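(* Let $k,n\ge 1$ be integers, let $A_1,A_2,\ldots,A_k$ be independent $n\times n$ random matrices with i.i.d. standard complex Gaussian entries, and let $\epsilon_1,\ldots,\epsilon_k\in\{+1,-1\}$. Then the eigenvalues of $A=A_1^{\epsilon_1}A_2^{\epsilon_2}\cdots A_k^{\epsilon_k}$ form a determinantal point process on $\mathbb{C}$. Equivalently, the vector of eigenvalues $(z_1,\ldots,z_n)$ of $A$ has density, with respect to Lebesgue measure on $\mathbb{C}^n$, proportional to $$\prod_{\ell=1}^{n}\omega(z_\ell)\prod_{1\le i<j\le n}|z_i-z_j|^2,$$ where the weight function $\omega:\mathbb{C}\to[0,\infty)$ is given by $$|dz|^2\,\omega(z)=\int_{x_1^{\epsilon_1}\cdots x_k^{\epsilon_k}=z}e^{-\sum_{j=1}^{k}|x_j|^2}\prod_{j=1}^{k}|x_j|^{(1-\epsilon_j)(n-1)}\prod_{j=1}^{k}|dx_j|^2 .$$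
   Context: A standard complex Gaussian variable has density $\pi^{-1}e^{-|z|^2}$ with respect to Lebesgue measure on $\mathbb{C}$. $|dz|^2$ denotes Lebesgue measure on $\mathbb{C}$ (up to an irrelevant constant). Notation for the weight: for functions $h$ and $g$ of $(x_1,\ldots,x_k)\in\mathbb{C}^k$, with $h$ complex-valued (defined almost everywhere) and $g\ge 0$, one writes $|dz|^2\omega(z)=\int_{h(x_1,\ldots,x_k)=z}g(x_1,\ldots,x_k)|dx_1|^2\cdots|dx_k|^2$ if $$\int_{\mathbb{C}} f(z)\,\omega(z)\,|dz|^2=\int_{\mathbb{C}^k} f(h(x_1,\ldots,x_k))\,g(x_1,\ldots,x_k)\,|dx_1|^2\cdots|dx_k|^2$$ for every integrable $f:\mathbb{C}\to\mathbb{C}$; that is, $\omega(z)|dz|^2$ is the push-forward under $h$ of the measure $g\,|dx_1|^2\cdots|dx_k|^2$. "The vector of eigenvalues has density $p$" for a symmetric $p$ means: the eigenvalues, counted with multiplicity and listed in uniformly random order, have joint density $p$ on $\mathbb{C}^n$; equivalently, $\mathbf{E}[f(z_1,\ldots,z_n)]=\int f p$ for every bounded continuous symmetric $f$ on $\mathbb{C}^n$. A point process on $\mathbb{C}$ is determinantal if there is a kernel $K(x,y)$ such that, for each $r$, its $r$-point correlation function with respect to Lebesgue measure is $\det(K(x_i,x_j))_{i,j=1}^r$. *)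

theory Defs
  imports
    "HOL-Probability.Probability"
    "HOL-Combinatorics.Multiset_Permutations"
    "HOL-Computational_Algebra.Computational_Algebra"
    "Jordan_Normal_Form.Gauss_Jordan_Elimination"
    "Jordan_Normal_Form.Char_Poly"
begin

(* Lebesgue measure on C^n; a point is an extensional function on {..<n}. *)
abbreviation lebesgue_pow :: "nat \<Rightarrow> (nat \<Rightarrow> complex) measure" where
  "lebesgue_pow n \<equiv> \<Pi>\<^sub>M i\<in>{..<n}. lborel"

definition std_complex_gaussian :: "'w measure \<Rightarrow> ('w \<Rightarrow> complex) \<Rightarrow> bool" where
  "std_complex_gaussian M X \<longleftrightarrow>
     distributed M lborel X (\<lambda>z. ennreal (exp (- (cmod z)\<^sup>2) / pi))"

(* "A 0, ..., A (k - 1) are independent and each has i.i.d. standard entries" is the same as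
   joint independence of all k * n * n entries. *)
definition independent_gaussian_matrices ::
    "'w measure \<Rightarrow> nat \<Rightarrow> nat \<Rightarrow> (nat \<Rightarrow> 'w \<Rightarrow> complex mat) \<Rightarrow> bool" where
  "independent_gaussian_matrices M n k A \<longleftrightarrow>
     prob_space M \<and>
     (\<forall>j<k. \<forall>w\<in>space M. A j w \<in> carrier_mat n n) \<and>
     prob_space.indep_vars M (\<lambda>_. borel) (\<lambda>(j, a, b) w. A j w $$ (a, b))
       ({..<k} \<times> {..<n} \<times> {..<n}) \<and>
     (\<forall>j<k. \<forall>a<n. \<forall>b<n. std_complex_gaussian M (\<lambda>w. A j w $$ (a, b)))"

(* The inverse is totalised by 0 on singular matrices, which occur with probability 0. *)
definition signed_mat :: "int \<Rightarrow> complex mat \<Rightarrow> complex mat" where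
  "signed_mat e X =
     (if e = 1 then X
      else case mat_inverse X of Some Y \<Rightarrow> Y | None \<Rightarrow> 0\<^sub>m (dim_row X) (dim_row X))"

definition signed_product :: "nat \<Rightarrow> nat \<Rightarrow> (nat \<Rightarrow> int) \<Rightarrow> (nat \<Rightarrow> complex mat) \<Rightarrow> complex mat" where
  "signed_product n k \<epsilon> X = foldr (\<lambda>j Y. signed_mat (\<epsilon> j) (X j) * Y) [0..<k] (1\<^sub>m n)"

definition eigenvalues :: "complex mat \<Rightarrow> complex multiset" where
  "eigenvalues X = proots (char_poly X)"

(* The law of the vector obtained by listing the points of S in uniformly random order.
   Every list with content S arises from the same number of permutations of the positions,
   so the uniform distribution on such lists is the right one, also for repeated points. *)
definition uniform_ordering :: "complex multiset \<Rightarrow> (nat \<Rightarrow> complex) pmf" where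
  "uniform_ordering S =
     map_pmf (\<lambda>xs. \<lambda>i\<in>{..<size S}. xs ! i) (pmf_of_set (permutations_of_multiset S))"

definition points_have_density ::
    "'w measure \<Rightarrow> nat \<Rightarrow> ('w \<Rightarrow> complex multiset) \<Rightarrow> ((nat \<Rightarrow> complex) \<Rightarrow> real) \<Rightarrow> bool" where
  "points_have_density M n Z p \<longleftrightarrow>
     (AE w in M. size (Z w) = n) \<and>
     p \<in> borel_measurable (lebesgue_pow n) \<and> (\<forall>x. 0 \<le> p x) \<and>
     (\<forall>B\<in>sets (lebesgue_pow n).
        (\<lambda>w. emeasure (uniform_ordering (Z w)) B) \<in> borel_measurable M \<and>
        (\<integral>\<^sup>+w. emeasure (uniform_ordering (Z w)) B \<partial>M) = (\<integral>\<^sup>+x\<in>B. ennreal (p x) \<partial>lebesgue_pow n))"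

(* The push-forward of g |dx_1|^2 ... |dx_k|^2 under h is \<omega>(z) |dz|^2. *)
definition pushforward_weight ::
    "nat \<Rightarrow> ((nat \<Rightarrow> complex) \<Rightarrow> complex) \<Rightarrow> ((nat \<Rightarrow> complex) \<Rightarrow> real) \<Rightarrow> (complex \<Rightarrow> real) \<Rightarrow> bool" where
  "pushforward_weight k h g \<omega> \<longleftrightarrow>
     \<omega> \<in> borel_measurable borel \<and> (\<forall>z. 0 \<le> \<omega> z) \<and>
     distr (density (lebesgue_pow k) (\<lambda>x. ennreal (g x))) borel h =
       density lborel (\<lambda>z. ennreal (\<omega> z))"

definition product_weight :: "nat \<Rightarrow> nat \<Rightarrow> (nat \<Rightarrow> int) \<Rightarrow> (complex \<Rightarrow> real) \<Rightarrow> bool" where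
  "product_weight n k \<epsilon> \<omega> \<longleftrightarrow>
     pushforward_weight k
       (\<lambda>x. \<Prod>j<k. x j powi \<epsilon> j)
       (\<lambda>x. exp (- (\<Sum>j<k. (cmod (x j))\<^sup>2)) *
            (\<Prod>j<k. cmod (x j) powi ((1 - \<epsilon> j) * (int n - 1))))
       \<omega>"

definition finite_point_process :: "'w measure \<Rightarrow> ('w \<Rightarrow> complex multiset) \<Rightarrow> bool" where
  "finite_point_process M Z \<longleftrightarrow>
     prob_space M \<and>
     (\<forall>D\<in>sets borel. (\<lambda>w. real (size (filter_mset (\<lambda>z. z \<in> D) (Z w)))) \<in> borel_measurable M)"

(* The number of r-tuples in B formed from r different points of S, where equal points are
   different if they are different occurrences; it does not depend on the enumeration chosen. *)
definition tuple_count :: "nat \<Rightarrow> complex multiset \<Rightarrow> (nat \<Rightarrow> complex) set \<Rightarrow> nat" where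
  "tuple_count r S B =
     (let xs = (SOME xs. mset xs = S)
      in card {t \<in> {..<r} \<rightarrow>\<^sub>E {..<size S}. inj_on t {..<r} \<and> (\<lambda>i\<in>{..<r}. xs ! t i) \<in> B})"

(* \<rho> is the density of the r-th factorial moment measure of Z. *)
definition correlation_function ::
    "'w measure \<Rightarrow> ('w \<Rightarrow> complex multiset) \<Rightarrow> nat \<Rightarrow> ((nat \<Rightarrow> complex) \<Rightarrow> real) \<Rightarrow> bool" where
  "correlation_function M Z r \<rho> \<longleftrightarrow>
     \<rho> \<in> borel_measurable (lebesgue_pow r) \<and> (\<forall>x\<in>space (lebesgue_pow r). 0 \<le> \<rho> x) \<and>
     (\<forall>B\<in>sets (lebesgue_pow r).
        (\<integral>\<^sup>+w. of_nat (tuple_count r (Z w) B) \<partial>M) = (\<integral>\<^sup>+x\<in>B. ennreal (\<rho> x) \<partial>lebesgue_pow r))"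

definition determinantal :: "'w measure \<Rightarrow> ('w \<Rightarrow> complex multiset) \<Rightarrow> bool" where
  "determinantal M Z \<longleftrightarrow>
     finite_point_process M Z \<and>
     (\<exists>K :: complex \<Rightarrow> complex \<Rightarrow> complex.
        case_prod K \<in> borel_measurable (borel \<Otimes>\<^sub>M borel) \<and>
        (\<forall>r\<ge>1. \<exists>\<rho>. correlation_function M Z r \<rho> \<and>
           (\<forall>x\<in>space (lebesgue_pow r).
              complex_of_real (\<rho> x) = Determinant.det (Matrix.mat r r (\<lambda>(i, j). K (x i) (x j))))))"

end

theory Submission
  imports Defs "HOL-Complex_Analysis.Complex_Analysis"
begin

text \<open>The matrices are integrated against weights that are invariant under multiplication by unitary
matrices on both sides. Such weights are closed under multiplicative convolution, and so is the property
that integrating over the first row of a block triangular matrix leaves a product of a function of the corner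
and a weight of the same kind on the remaining block: convolution acts separately on corner and block.
The inversion \<open>X \<mapsto> X\<inverse>\<close> preserves the Haar measure \<open>|det X|\<^sup>-\<^sup>2\<^sup>n dX\<close>, so the product
\<open>A\<^sub>1\<^sup>\<epsilon>\<^sup>1\<dots>A\<^sub>k\<^sup>\<epsilon>\<^sup>k\<close> has such a weight as its density. Splitting off one eigenvalue by a
change of variables (a unipotent conjugation, followed by a Householder reflection) reduces the density from
size \<open>n + 1\<close> to size \<open>n\<close> and produces the factor \<open>\<Prod>|z - z\<^sub>i|\<^sup>2\<close>. The determinantal structure
then follows by orthogonality of the monomials with respect to the rotation invariant weight.\<close>

text \<open>The obstacle is the passage to eigenvalues: a Schur or QR parametrisation would need
  volume forms on unitary groups and flag manifolds. Here, apart from inversion, the only nonlinear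
  substitution is in one complex variable. With the other blocks fixed, the characteristic
  polynomial is affine in the corner entry, P - a Q, so an eigenvalue z determines a = P(z)/Q(z);
  this rational map of degree n + 1 covers the plane n + 1 times, once per eigenvalue. All other
  substitutions are linear in one block. The unipotent matrix splits into a reflection, which
  invariance removes, and a block triangular factor, whose Jacobian depends on the eigenvector
  alone.

  Inverse factors force a family of weights: inversion costs |det X|^(-4n), and with m eigenvalues
  removed the exponent is 2m + 4n. The scalar weight split off depends on m + n only, so it is the
  same at every stage. Its exponent 2(m + n - 1) + 4 becomes (1 - \<epsilon>)(n - 1) for the full
  size n once a scalar inversion takes the 4 away.

  Integrals are extended nonnegative, so constants are carried along unknown and fixed by the total
  mass at the end.\<close>

lemmas measurable_idt = measurable_ident_sets[OF refl]
 and measurable_to_ennreal = measurable_compose[OF _ measurable_ennreal]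
 and measurable_cmod = measurable_compose[OF _ borel_measurable_norm]
 and measurable_to_complex = measurable_compose[OF _ borel_measurable_of_real]
 and measurable_times = borel_measurable_times_ennreal

abbreviation bmeas :: "'a measure => ('a => 'b :: topological_space) set" where
 "bmeas M \<equiv> borel_measurable M"

abbreviation lpow :: "nat => (nat => complex) measure" where
 "lpow \<equiv> lebesgue_pow"

alias det = Determinant.det
alias cmat = carrier_mat

abbreviation clborel :: "complex measure" where
 "clborel \<equiv> lborel"

lemma nn_integral_cong_nonzero:
 assumes "\<And>z. z \<in> space clborel ==> z ~= 0 ==> f z = g z"
 shows "integral\<^sup>N clborel f = integral\<^sup>N clborel g"
 by (rule nn_integral_cong_AE, rule AE_mp[OF AE_lborel_singleton[of 0] AE_I2]) (use assms in simp)

section \<open>The area formula for holomorphic functions\<close>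

text \<open>The change of variables theorem used for an injective piece,
  \<open>has_measure_differentiable_image\<close>, is stated for \<open>real ^ n\<close> with the
  determinant of a real matrix, so the complex plane is identified with
  \<open>real ^ 2\<close>.\<close>

definition complex_of_R2 :: "(real, 2) Finite_Cartesian_Product.vec => complex" where
 "complex_of_R2 v = Complex (Finite_Cartesian_Product.vec_nth v 1) (Finite_Cartesian_Product.vec_nth v 2)"

definition R2_of_complex :: "complex => (real, 2) Finite_Cartesian_Product.vec" where
 "R2_of_complex z = Finite_Cartesian_Product.vec_lambda (\<lambda>i. if i = 1 then Re z else Im z)"

lemma R2_complex_inverse [simp]:
 "complex_of_R2 (R2_of_complex z) = z" "R2_of_complex (complex_of_R2 v) = v"
 by (auto simp: complex_of_R2_def R2_of_complex_def Finite_Cartesian_Product.vec_eq_iff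
   complex_eq_iff forall_2)

lemma bounded_linear_complex_of_R2: "bounded_linear complex_of_R2"
 by (intro linear_conv_bounded_linear[THEN iffD1] linearI)
  (auto simp: complex_of_R2_def complex_eq_iff)

lemma bounded_linear_R2_of_complex: "bounded_linear R2_of_complex"
 by (intro linear_conv_bounded_linear[THEN iffD1] linearI)
  (auto simp: R2_of_complex_def Finite_Cartesian_Product.vec_eq_iff)

lemma borel_measurable_complex_of_R2 [measurable]: "complex_of_R2 \<in> bmeas borel"
 by (intro borel_measurable_continuous_onI linear_continuous_on bounded_linear_complex_of_R2)

lemma borel_measurable_R2_of_complex [measurable]: "R2_of_complex \<in> bmeas borel"
 by (intro borel_measurable_continuous_onI linear_continuous_on bounded_linear_R2_of_complex)

lemma complex_of_R2_vimage: "complex_of_R2 -` S = R2_of_complex ` S"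
proof (intro equalityI subsetI)
 fix v assume "v \<in> complex_of_R2 -` S"
 then show "v \<in> R2_of_complex ` S" by (intro image_eqI[of _ _ "complex_of_R2 v"]) auto
qed auto

lemma lborel_complex_R2: "clborel = distr lborel borel complex_of_R2"
proof (rule lborel_eqI)
 fix l u :: complex
 assume lu: "\<And>b. b \<in> Basis ==> inner l b \<le> inner u b"
 have le: "Re l \<le> Re u" "Im l \<le> Im u"
  using lu[of 1] lu[of \<i>] by (auto simp: Basis_complex_def)
 have B: "(Basis :: (real, 2) Finite_Cartesian_Product.vec set) = {axis 1 1, axis 2 1}"
  by (auto simp: Basis_vec_def UNIV_2)
 have ne: "axis 1 1 ~= (axis 2 1 :: (real, 2) Finite_Cartesian_Product.vec)"
  by (auto simp: axis_eq_axis)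
 have "complex_of_R2 -` box l u = box (R2_of_complex l) (R2_of_complex u)"
  by (auto simp: B box_def Basis_complex_def complex_of_R2_def R2_of_complex_def inner_axis)
 then have "emeasure (distr lborel borel complex_of_R2) (box l u)
   = emeasure lborel (box (R2_of_complex l) (R2_of_complex u))"
  by (subst emeasure_distr) auto
 also have "... = ennreal (prod (inner (R2_of_complex u - R2_of_complex l)) Basis)"
  using le by (subst emeasure_lborel_box) (auto simp: B R2_of_complex_def inner_axis)
 also have "prod (inner (R2_of_complex u - R2_of_complex l)) Basis = prod (inner (u - l)) Basis"
  unfolding B Basis_complex_def using ne
  by (simp add: inner_axis R2_of_complex_def)
 finally show "emeasure (distr lborel borel complex_of_R2) (box l u)
   = ennreal (prod (inner (u - l)) Basis)" .
qed simp

text \<open>Multiplication by a + ib acts on the plane as the real matrix with rows (a, -b) and (b,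
  a), of determinant a^2 + b^2. This makes |g'|^2 the real Jacobian of a holomorphic g.\<close>

lemma det_matrix_complex_mult:
 "Determinants.det (matrix (\<lambda>v. R2_of_complex (c * complex_of_R2 v))) = (cmod c)^2"
 by (simp add: det_2 matrix_def R2_of_complex_def complex_of_R2_def axis_def cmod_power2)
  (simp add: power2_eq_square)

text \<open>The real change of variables theorem for the injective map g. That theorem speaks of
  images of finite measure, hence the assumption \<open>fin\<close>.\<close>

lemma emeasure_holomorphic_image:
 assumes g: "g holomorphic_on U" and U: "open U" and inj: "inj_on g U"
  and S: "S \<in> sets borel" "S \<subseteq> U"
  and fin: "(\<integral>\<^sup>+z\<in>S. (cmod (deriv g z))^2 \<partial>lborel) < \<infinity>"
 shows "g ` S \<in> sets borel" "emeasure lborel (g ` S) = (\<integral>\<^sup>+z\<in>S. (cmod (deriv g z))^2 \<partial>lborel)"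
proof -
 have oU: "open (g ` U)" using open_mapping_thm3[OF g U inj] .
 obtain k where k: "k holomorphic_on (g ` U)" "\<And>z. z \<in> U ==> k (g z) = z"
  using holomorphic_has_inverse[OF g U inj] by metis
 have kc: "continuous_on (g ` U) k" using k(1) by (rule holomorphic_on_imp_continuous_on)
 \<comment> \<open>The holomorphic inverse turns the image into a preimage, which settles its Borel
   measurability.\<close>
 have "g ` S = k -` S \<inter> g ` U"
  using S(2) k(2) by (auto 4 3)
 also have "... \<in> sets borel"
  using measurable_sets[OF borel_measurable_continuous_on_restrict[OF kc] S(1)] oU
  by (simp add: space_restrict_space sets_restrict_space_iff)
 finally show gS: "g ` S \<in> sets borel" .
 have dg: "continuous_on U (\<lambda>z. (cmod (deriv g z))^2)"
  using holomorphic_deriv[OF g U, THEN holomorphic_on_imp_continuous_on]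
  by (intro continuous_intros)
 define h where "h = (\<lambda>z. indicator S z * (cmod (deriv g z))^2)"
 have hU: "h = (\<lambda>z. indicator S z * (indicator U z * (cmod (deriv g z))^2))"
  using S(2) by (auto simp: h_def indicator_def fun_eq_iff)
 have "(\<lambda>z. indicator U z *\<^sub>R (cmod (deriv g z))^2) \<in> bmeas borel"
  using U dg by (intro borel_measurable_continuous_on_indicator) auto
 then have hm [measurable]: "h \<in> bmeas borel"
  unfolding hU using S(1) by simp
 have h0: "0 \<le> h z" for z by (auto simp: h_def)
 define r where "r = enn2real (\<integral>\<^sup>+z. ennreal (h z) \<partial>lborel)"
 have hS: "(\<integral>\<^sup>+z. ennreal (h z) \<partial>lborel) = (\<integral>\<^sup>+z\<in>S. (cmod (deriv g z))^2 \<partial>lborel)"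
  by (intro nn_integral_cong) (auto simp: h_def indicator_def)
 then have r: "(\<integral>\<^sup>+z. ennreal (h z) \<partial>lborel) = ennreal r" "0 \<le> r"
  using fin by (auto simp: r_def)
 let ?S = "complex_of_R2 -` S"
 let ?f = "R2_of_complex \<circ> g \<circ> complex_of_R2"
 let ?f' = "\<lambda>x v. R2_of_complex (deriv g (complex_of_R2 x) * complex_of_R2 v)"
 have "(\<integral>\<^sup>+v. ennreal (h (complex_of_R2 v)) \<partial>lborel) = ennreal r"
  using r(1) by (subst (asm) lborel_complex_R2) (simp add: nn_integral_distr)
 then have "((\<lambda>v. h (complex_of_R2 v)) has_integral r) UNIV"
  using r(2) h0 by (intro nn_integral_has_integral) auto
 moreover have "(\<lambda>v. h (complex_of_R2 v)) =
   (\<lambda>v. if v \<in> ?S then \<bar>Determinants.det (matrix (?f' v))\<bar> else 0)"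
  by (auto simp: h_def det_matrix_complex_mult fun_eq_iff)
 ultimately have int: "((\<lambda>v. \<bar>Determinants.det (matrix (?f' v))\<bar>) has_integral r) ?S"
  by (simp only: has_integral_restrict_UNIV)
 have Sb: "?S \<in> sets borel"
  using measurable_sets[OF borel_measurable_complex_of_R2 S(1)] by simp
 have "?S \<in> sets lebesgue" using Sb by simp
 moreover have "(?f has_derivative ?f' x) (at x within ?S)" if "x \<in> ?S" for x
 proof -
  have "complex_of_R2 x \<in> U" using that S(2) by auto
  then have "(g has_field_derivative deriv g (complex_of_R2 x)) (at (complex_of_R2 x))"
   using g U holomorphic_derivI by blast
  then have "(g has_derivative (\<lambda>h. deriv g (complex_of_R2 x) * h)) (at (complex_of_R2 x))"
   by (simp add: has_field_derivative_def)
  from has_derivative_compose[OF bounded_linear_imp_has_derivative[OF bounded_linear_complex_of_R2] this]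
  have "((\<lambda>x. g (complex_of_R2 x)) has_derivative
    (\<lambda>v. deriv g (complex_of_R2 x) * complex_of_R2 v)) (at x)" .
  from bounded_linear.has_derivative[OF bounded_linear_R2_of_complex this]
  show ?thesis by (simp add: has_derivative_at_withinI o_def)
 qed
 moreover have "inj_on ?f ?S"
 proof (rule inj_onI)
  fix x y assume xy: "x \<in> ?S" "y \<in> ?S" "?f x = ?f y"
  then have "complex_of_R2 (?f x) = complex_of_R2 (?f y)" by simp
  then have "g (complex_of_R2 x) = g (complex_of_R2 y)" by simp
  then have "complex_of_R2 x = complex_of_R2 y" using xy inj S(2) by (auto dest: inj_onD)
  then have "R2_of_complex (complex_of_R2 x) = R2_of_complex (complex_of_R2 y)" by simp
  then show "x = y" by simp
 qed
 ultimately have "?f ` ?S \<in> lmeasurable \<and> measure lebesgue (?f ` ?S) = r \<longleftrightarrow>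
   ((\<lambda>v. \<bar>Determinants.det (matrix (?f' v))\<bar>) has_integral r) ?S"
  by (rule has_measure_differentiable_image)
 with int have im: "?f ` ?S \<in> lmeasurable \<and> measure lebesgue (?f ` ?S) = r"
  by (rule iffD2[rotated])
 have eq: "?f ` ?S = complex_of_R2 -` (g ` S)"
  unfolding complex_of_R2_vimage by (simp add: image_image)
 have gb: "complex_of_R2 -` (g ` S) \<in> sets borel"
  using measurable_sets[OF borel_measurable_complex_of_R2 gS] by simp
 have "emeasure lborel (g ` S) = emeasure (distr lborel borel complex_of_R2) (g ` S)"
  by (simp only: lborel_complex_R2[symmetric])
 also have "... = emeasure lborel (complex_of_R2 -` (g ` S))"
  using gS by (subst emeasure_distr) auto
 also have "... = emeasure lebesgue (?f ` ?S)" using gb eq by simp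
 also have "... = ennreal r" using im by (simp add: emeasure_eq_measure2)
 finally show "emeasure lborel (g ` S) = (\<integral>\<^sup>+z\<in>S. (cmod (deriv g z))^2 \<partial>lborel)"
  using r hS by simp
qed

text \<open>Since g' has no zeros on G, g is injective on small discs. Countably many of them cover
  G; made disjoint, they cut G into pieces to which \<open>emeasure_holomorphic_image\<close>
  applies, and the sum of the indicators of the images of the pieces counts the preimages of a
  point.\<close>

lemma holomorphic_area_formula:
 assumes G: "open G" and g: "g holomorphic_on G" "\<And>z. z \<in> G ==> deriv g z ~= 0"
  and gm [measurable]: "g \<in> bmeas borel"
  and N: "N \<in> null_sets lborel"
  and fib: "\<And>a. a \<notin> N ==> finite {z\<in>G. g z = a} \<and> card {z\<in>G. g z = a} = m"
  and F [measurable]: "F \<in> bmeas borel"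
 shows "of_nat m * (\<integral>\<^sup>+a. F a \<partial>lborel) = (\<integral>\<^sup>+z\<in>G. ennreal ((cmod (deriv g z))^2) * F (g z) \<partial>lborel)"
proof -
 define J where "J = (\<lambda>z. indicator G z * (cmod (deriv g z))^2)"
 have dg: "continuous_on G (\<lambda>z. (cmod (deriv g z))^2)"
  using holomorphic_deriv[OF g(1) G, THEN holomorphic_on_imp_continuous_on]
  by (intro continuous_intros)
 have [measurable]: "G \<in> sets borel" using G by simp
 have Jm [measurable]: "J \<in> bmeas borel"
  using borel_measurable_continuous_on_indicator[OF _ dg] G by (simp add: J_def)
 \<comment> \<open>Closed discs inside G keep |g'|^2 bounded on each disc, which provides the finite
   measure required of a piece.\<close>
 define Bs where "Bs = {ball w r | w r. r > 0 \<and> cball w r \<subseteq> G \<and> inj_on g (ball w r)}"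
 have UB: "\<Union>Bs = G"
 proof
  show "\<Union>Bs \<subseteq> G" by (auto simp: Bs_def)
  show "G \<subseteq> \<Union>Bs"
  proof
   fix z assume z: "z \<in> G"
   obtain r where r: "r > 0" "ball z r \<subseteq> G" "inj_on g (ball z r)"
    using has_complex_derivative_locally_injective[OF g(1) z G g(2)[OF z]] .
   have "ball z (r/2) \<in> Bs"
    unfolding Bs_def using r
    by (auto intro!: exI[of _ z] exI[of _ "r/2"] intro: inj_on_subset[OF r(3)] subsetD[OF r(2)])
   then show "z \<in> \<Union>Bs" using r(1) by (auto intro!: bexI[of _ "ball z (r/2)"])
  qed
 qed
 obtain C where C: "C \<subseteq> Bs" "countable C" "\<Union>C = \<Union>Bs"
  using Lindelof[of Bs] by (auto simp: Bs_def)
 show ?thesis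
 proof (cases "C = {}")
  \<comment> \<open>With G empty every fibre over a point outside N is empty, and N cannot be the
    whole plane, so m = 0.\<close>
  case True
  then have "G = {}" using C UB by auto
  then have m: "a \<notin> N ==> m = 0" for a using fib[of a] by auto
  have "\<exists>a. a \<notin> N"
  proof (rule ccontr)
   assume "\<not> ?thesis"
   then have "N = UNIV" by auto
   then have "emeasure lborel (UNIV :: complex set) = 0" using N by (simp add: null_sets_def)
   then show False by simp
  qed
  with m \<open>G = {}\<close> show ?thesis by auto
 next
  case False
  define B where "B = from_nat_into C"
  have BB: "B i \<in> Bs" for i using False C by (metis B_def from_nat_into subset_iff)
  define S where "S = disjointed B"
  have SB: "S i \<subseteq> B i" for i by (simp add: S_def disjointed_subset)
  have Bo: "open (B i)" for i using BB[of i] by (auto simp: Bs_def)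
  have Sm [measurable]: "S i \<in> sets borel" for i
  proof -
   have "range (disjointed B) \<subseteq> sets borel"
    using Bo by (intro sets.range_disjointed_sets) auto
   then show ?thesis by (auto simp: S_def)
  qed
  have US: "(\<Union>i. S i) = G"
  proof -
   have "(\<Union>i. S i) = (\<Union>i. B i)" by (simp add: S_def UN_disjointed_eq)
   also have "... = \<Union>C" using False C by (simp add: B_def)
   finally show ?thesis using C UB by simp
  qed
  have dS: "disjoint_family S" by (simp add: S_def disjoint_family_disjointed)
  have piece: "g ` (S i \<inter> g -` A) \<in> sets borel"
   "emeasure lborel (g ` (S i \<inter> g -` A)) = (\<integral>\<^sup>+z\<in>S i \<inter> g -` A. (cmod (deriv g z))^2 \<partial>lborel)"
   if A[measurable]: "A \<in> sets borel" for i A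
  proof -
   obtain w r where w: "B i = ball w r" "r > 0" "cball w r \<subseteq> G" "inj_on g (ball w r)"
    using BB[of i] by (auto simp: Bs_def)
   have "compact ((\<lambda>z. (cmod (deriv g z))^2) ` cball w r)"
    using w dg by (intro compact_continuous_image) (auto intro: continuous_on_subset)
   then obtain b where "\<forall>x\<in>(\<lambda>z. (cmod (deriv g z))^2) ` cball w r. \<bar>x\<bar> \<le> b"
    using compact_imp_bounded bounded_real by blast
   then have b: "(cmod (deriv g z))^2 \<le> b" if "z \<in> cball w r" for z
    using that by force
   have Ai: "S i \<inter> g -` A \<in> sets borel"
    using measurable_sets[OF gm A] by simp
   have sub: "S i \<inter> g -` A \<subseteq> ball w r" using SB[of i] w by auto
   have "(\<integral>\<^sup>+z\<in>S i \<inter> g -` A. (cmod (deriv g z))^2 \<partial>lborel) \<le> (\<integral>\<^sup>+z\<in>ball w r. ennreal b \<partial>lborel)"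
    using sub b by (intro nn_integral_mono) (auto simp: indicator_def intro!: ennreal_leI)
   also have "... = ennreal b * emeasure lborel (ball w r)"
    by (subst nn_integral_cmult_indicator) auto
   also have "... < \<infinity>"
    using emeasure_bounded_finite[OF bounded_ball[of w r]]
    by (simp add: ennreal_mult_less_top)
   finally have fin: "(\<integral>\<^sup>+z\<in>S i \<inter> g -` A. (cmod (deriv g z))^2 \<partial>lborel) < \<infinity>" .
   have hol: "g holomorphic_on ball w r"
    using g(1) w(3) by (meson ball_subset_cball holomorphic_on_subset)
   note * = emeasure_holomorphic_image[OF hol open_ball w(4) Ai sub fin]
   show "g ` (S i \<inter> g -` A) \<in> sets borel"
    "emeasure lborel (g ` (S i \<inter> g -` A)) = (\<integral>\<^sup>+z\<in>S i \<inter> g -` A. (cmod (deriv g z))^2 \<partial>lborel)"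
    using * by auto
  qed
  have gS [measurable]: "g ` S i \<in> sets borel" for i using piece(1)[of UNIV i] by simp
  have cnt: "(\<Sum>i. indicator (g ` S i) a) = (of_nat m :: ennreal)" if a: "a \<notin> N" for a
  proof -
   let ?I = "{i. a \<in> g ` S i}"
   let ?E = "{z\<in>G. g z = a}"
   have fE: "finite ?E" "card ?E = m" using fib[OF a] by auto
   \<comment> \<open>\<open>p\<close> sends a preimage to the index of its piece. On the fibre over
     a it is a bijection onto the indices of the pieces whose image contains a: the pieces are
     disjoint, and g is injective on each.\<close>
   define p where "p = (\<lambda>z. SOME i. z \<in> S i)"
   have p: "z \<in> S (p z)" if "z \<in> G" for z
    using that US unfolding p_def by (metis (mono_tags, lifting) UN_E someI_ex)
   have pu: "z \<in> S i ==> p z = i" for z i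
    using p[of z] dS US by (metis UN_I UNIV_I disjoint_family_onD disjoint_iff)
   have "bij_betw p ?E ?I"
   proof (rule bij_betwI')
    fix z z' assume zz: "z \<in> ?E" "z' \<in> ?E"
    show "(p z = p z') = (z = z')"
    proof
    assume e: "p z = p z'"
    obtain w r where w: "B (p z) = ball w r" "inj_on g (ball w r)"
    using BB[of "p z"] by (auto simp: Bs_def)
    have "z \<in> ball w r" "z' \<in> ball w r" 
    using p[of z] p[of z'] zz e SB[of "p z"] w(1) by (metis (lifting) mem_Collect_eq subsetD)+
    then show "z = z'" using w(2) zz by (auto dest: inj_onD)
    qed auto
   next
    fix z assume "z \<in> ?E" then show "p z \<in> ?I" using p[of z] by auto
   next
    fix i assume "i \<in> ?I"
    then obtain z where "z \<in> S i" "g z = a" by auto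
    then show "\<exists>z\<in>?E. i = p z" using pu US by (auto intro!: bexI[of _ z])
   qed
   then have fI: "finite ?I" "card ?I = m" 
    using fE bij_betw_finite[of p ?E ?I] bij_betw_same_card[of p ?E ?I] by auto
   have "(\<Sum>i. indicator (g ` S i) a) = (\<Sum>i\<in>?I. indicator (g ` S i) a :: ennreal)"
    using fI by (intro suminf_finite) auto
   also have "... = (\<Sum>i\<in>?I. 1)" by (intro sum.cong) auto
   finally show ?thesis using fI by simp
  qed
  have "distr (density lborel (\<lambda>z. ennreal (J z))) borel g = density lborel (\<lambda>_. of_nat m)"
  proof (rule measure_eqI)
   fix A assume "A \<in> sets (distr (density lborel (\<lambda>z. ennreal (J z))) borel g)"
   then have A[measurable]: "A \<in> sets borel" by simp
   have gA[measurable]: "g -` A \<in> sets borel" using measurable_sets[OF gm A] by simp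
   have "emeasure (distr (density lborel (\<lambda>z. ennreal (J z))) borel g) A
    = (\<integral>\<^sup>+z\<in>g -` A. ennreal (J z) \<partial>lborel)"
    by (simp add: emeasure_distr emeasure_density)
   also have "... = (\<integral>\<^sup>+z. (\<Sum>i. ennreal (J z) * indicator (g -` A) z * indicator (S i) z) \<partial>lborel)"
   proof (rule nn_integral_cong)
    fix z
    have "(\<Sum>i. indicator (S i) z) = (indicator G z :: ennreal)"
    using suminf_indicator[OF dS, of z] US by simp
    then show "ennreal (J z) * indicator (g -` A) z
    = (\<Sum>i. ennreal (J z) * indicator (g -` A) z * indicator (S i) z)"
    by (simp only: ennreal_suminf_cmult) (cases "z \<in> G"; simp add: J_def)
   qed
   also have "... = (\<Sum>i. \<integral>\<^sup>+z. ennreal (J z) * indicator (g -` A) z * indicator (S i) z \<partial>lborel)"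
    by (rule nn_integral_suminf) auto
   also have "... = (\<Sum>i. \<integral>\<^sup>+z\<in>S i \<inter> g -` A. (cmod (deriv g z))^2 \<partial>lborel)"
   proof (intro suminf_cong nn_integral_cong)
    fix i z
    have "z \<in> S i ==> z \<in> G" using US by auto
    then show "ennreal (J z) * indicator (g -` A) z * indicator (S i) z
    = ennreal ((cmod (deriv g z))^2) * indicator (S i \<inter> g -` A) z"
    by (cases "z \<in> S i"; cases "z \<in> g -` A") (simp_all add: J_def)
   qed
   also have "... = (\<Sum>i. emeasure lborel (g ` S i \<inter> A))"
   proof (rule suminf_cong)
    fix i have "g ` (S i \<inter> g -` A) = g ` S i \<inter> A" by auto
    then show "(\<integral>\<^sup>+z\<in>S i \<inter> g -` A. (cmod (deriv g z))^2 \<partial>lborel) = emeasure lborel (g ` S i \<inter> A)"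
    using piece(2)[OF A, of i] by simp
   qed
   also have "... = (\<Sum>i. \<integral>\<^sup>+a. indicator (g ` S i) a * indicator A a \<partial>lborel)"
   proof (rule suminf_cong)
    fix i
    have "(\<integral>\<^sup>+a. indicator (g ` S i \<inter> A) a \<partial>lborel) = emeasure lborel (g ` S i \<inter> A)"
    by (rule nn_integral_indicator) auto
    then show "emeasure lborel (g ` S i \<inter> A) = (\<integral>\<^sup>+a. indicator (g ` S i) a * indicator A a \<partial>lborel)"
    by (simp only: indicator_inter_arith)
   qed
   also have "... = (\<integral>\<^sup>+a. (\<Sum>i. indicator (g ` S i) a * indicator A a) \<partial>lborel)"
    by (rule nn_integral_suminf[symmetric]) auto
   also have "... = (\<integral>\<^sup>+a. of_nat m * indicator A a \<partial>lborel)"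
   proof (rule nn_integral_cong_AE)
    have "AE a in lborel. a \<notin> N" using N by (rule AE_not_in)
    then show "AE a in lborel. (\<Sum>i. indicator (g ` S i) a * indicator A a) = of_nat m * (indicator A a :: ennreal)"
    by eventually_elim (simp add: cnt)
   qed
   also have "... = emeasure (density lborel (\<lambda>_. of_nat m)) A"
    by (simp add: emeasure_density)
   finally show "emeasure (distr (density lborel (\<lambda>z. ennreal (J z))) borel g) A
    = emeasure (density lborel (\<lambda>_. of_nat m)) A" .
  qed simp
  then have eq: "integral\<^sup>N (distr (density lborel (\<lambda>z. ennreal (J z))) borel g) F
    = integral\<^sup>N (density lborel (\<lambda>_. of_nat m)) F" by (rule arg_cong)
  have 1: "(\<integral>\<^sup>+z\<in>G. ennreal ((cmod (deriv g z))^2) * F (g z) \<partial>lborel)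
    = (\<integral>\<^sup>+z. ennreal (J z) * F (g z) \<partial>lborel)"
  proof (rule nn_integral_cong)
   fix z show "ennreal ((cmod (deriv g z))^2) * F (g z) * indicator G z = ennreal (J z) * F (g z)"
    by (cases "z \<in> G") (simp_all add: J_def)
  qed
  have 2: "(\<integral>\<^sup>+z. F (g z) \<partial>density lborel (\<lambda>z. ennreal (J z)))
    = (\<integral>\<^sup>+z. ennreal (J z) * F (g z) \<partial>lborel)"
   by (rule nn_integral_density) auto
  have 3: "integral\<^sup>N (distr (density lborel (\<lambda>z. ennreal (J z))) borel g) F
    = (\<integral>\<^sup>+z. F (g z) \<partial>density lborel (\<lambda>z. ennreal (J z)))"
  proof (rule nn_integral_distr)
   show "g \<in> density lborel (\<lambda>z. ennreal (J z)) \<rightarrow>\<^sub>M borel" using gm by simp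
   show "F \<in> bmeas (distr (density lborel (\<lambda>z. ennreal (J z))) borel g)"
    using F by (simp only: measurable_distr_eq1)
  qed
  have 4: "integral\<^sup>N (density lborel (\<lambda>_. of_nat m)) F = (\<integral>\<^sup>+a. of_nat m * F a \<partial>lborel)"
   by (rule nn_integral_density) (simp_all only: borel_measurable_const F measurable_lborel2)
  have 5: "(\<integral>\<^sup>+a. of_nat m * F a \<partial>lborel) = of_nat m * (\<integral>\<^sup>+a. F a \<partial>lborel)"
   by (rule nn_integral_cmult) (simp only: F measurable_lborel2)
  show ?thesis by (simp only: 1 2[symmetric] 3[symmetric] eq 4 5)
 qed
qed

section \<open>Lebesgue measure on matrices\<close>

text \<open>The type of matrices contains all dimensions, so the sigma-algebra is pulled back along
  the entries and lives on \<open>carrier_mat m n\<close>. The measure is the product of the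
  Lebesgue measures of the entries.\<close>

definition lmat :: "nat => nat => complex mat measure" where
 "lmat m n = distr (\<Pi>\<^sub>M p\<in>{..<m} \<times> {..<n}. lborel)
   (vimage_algebra (cmat m n) (\<lambda>A. \<lambda>p\<in>{..<m} \<times> {..<n}. A $$ p) (\<Pi>\<^sub>M p\<in>{..<m} \<times> {..<n}. borel))
   (\<lambda>x. Matrix.mat m n x)"

syntax
 "_mat_integral" :: "pttrn => nat => nat => ennreal => ennreal" ("(\<integral>_:_,_./ _)" [0, 101, 101, 10] 10)
 "_complex_integral" :: "pttrn => ennreal => ennreal" ("(\<integral>_:\<C>./ _)" [0, 10] 10)
 "_complex_pow_integral" :: "pttrn => nat => ennreal => ennreal" ("(\<integral>_:\<C>^_./ _)" [0, 101, 10] 10)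
translations
 "\<integral>x:\<C>. F" == "CONST nn_integral (CONST lborel) (\<lambda>x. F)"
 "\<integral>x:\<C>^n. F" == "CONST nn_integral (CONST PiM {..<n} (\<lambda>_. CONST lborel)) (\<lambda>x. F)"
 "\<integral>x:m,n. F" == "CONST nn_integral (CONST lmat m n) (\<lambda>x. F)"

interpretation lborel_prod: product_sigma_finite "\<lambda>_. clborel"
 by standard

lemma space_lmat [simp]: "space (lmat m n) = cmat m n"
 by (simp add: lmat_def)

lemma nn_integral_cong_mat:
 "(\<And>X. X \<in> carrier_mat m n ==> F X = G X) ==> (\<integral>X:m,n. F X) = (\<integral>X:m,n. G X)"
 by (rule nn_integral_cong) simp

lemma carrier_mat_sets [simp]: "cmat m n \<in> sets (lmat m n)"
 by (metis sets.top space_lmat)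

lemma sets_lmat: "sets (lmat m n) =
  sets (vimage_algebra (cmat m n) (\<lambda>A. \<lambda>p\<in>{..<m} \<times> {..<n}. A $$ p) (\<Pi>\<^sub>M p\<in>{..<m} \<times> {..<n}. borel))"
 by (simp add: lmat_def)

lemma measurable_lmat:
 assumes "\<And>x. x \<in> space N ==> f x \<in> cmat m n"
  and "\<And>i j. i < m ==> j < n ==> (\<lambda>x. f x $$ (i, j)) \<in> bmeas N"
 shows "f \<in> N \<rightarrow>\<^sub>M lmat m n"
proof -
 have "(\<lambda>x. \<lambda>p\<in>{..<m} \<times> {..<n}. f x $$ p) \<in> N \<rightarrow>\<^sub>M (\<Pi>\<^sub>M p\<in>{..<m} \<times> {..<n}. borel)"
  by (intro measurable_restrict) (use assms(2) in auto)
 then have "f \<in> N \<rightarrow>\<^sub>M vimage_algebra (cmat m n) (\<lambda>A. \<lambda>p\<in>{..<m} \<times> {..<n}. A $$ p) (\<Pi>\<^sub>M p\<in>{..<m} \<times> {..<n}. borel)"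
  using assms(1) by (intro measurable_vimage_algebra2) auto
 then show ?thesis using measurable_cong_sets[OF refl sets_lmat] by blast
qed

lemma measurable_mat_entries:
 "(\<lambda>A. \<lambda>p\<in>{..<m} \<times> {..<n}. A $$ p) \<in> lmat m n \<rightarrow>\<^sub>M (\<Pi>\<^sub>M p\<in>{..<m} \<times> {..<n}. lborel)"
proof -
 have "(\<lambda>A. \<lambda>p\<in>{..<m} \<times> {..<n}. A $$ p) \<in> cmat m n \<rightarrow> space (\<Pi>\<^sub>M p\<in>{..<m} \<times> {..<n}. borel)"
  by (auto simp: space_PiM)
 from measurable_vimage_algebra1[OF this]
 have "(\<lambda>A. \<lambda>p\<in>{..<m} \<times> {..<n}. A $$ p) \<in> lmat m n \<rightarrow>\<^sub>M (\<Pi>\<^sub>M p\<in>{..<m} \<times> {..<n}. borel)"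
  using measurable_cong_sets[OF sets_lmat refl] by blast
 moreover have "sets (\<Pi>\<^sub>M p\<in>{..<m} \<times> {..<n}. borel :: complex measure) = sets (\<Pi>\<^sub>M p\<in>{..<m} \<times> {..<n}. lborel)"
  by (intro sets_PiM_cong) auto
 ultimately show ?thesis using measurable_cong_sets[OF refl] by blast
qed

lemma meas_entry:
 assumes "i < m" "j < n" "f \<in> N \<rightarrow>\<^sub>M lmat m n"
 shows "(\<lambda>x. f x $$ (i, j)) \<in> bmeas N"
proof -
 have "(\<lambda>A. (\<lambda>p\<in>{..<m} \<times> {..<n}. A $$ p) (i, j)) \<in> lmat m n \<rightarrow>\<^sub>M lborel"
  by (rule measurable_compose[OF measurable_mat_entries measurable_component_singleton])
   (use assms in auto)
 then have "(\<lambda>A. A $$ (i, j)) \<in> bmeas (lmat m n)" using assms by simp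
 from measurable_compose[OF assms(3) this] show ?thesis .
qed

lemma measurable_carrier:
 "f \<in> N \<rightarrow>\<^sub>M lmat m n ==> x \<in> space N ==> f x \<in> cmat m n"
 by (metis measurable_space space_lmat)

lemma measurable_mat_of_fun:
 "Matrix.mat m n \<in> (\<Pi>\<^sub>M p\<in>{..<m} \<times> {..<n}. lborel) \<rightarrow>\<^sub>M lmat m n"
 by (rule measurable_lmat) auto

lemma lmat_alt:
 "lmat m n = distr (\<Pi>\<^sub>M p\<in>{..<m} \<times> {..<n}. lborel) (lmat m n) (Matrix.mat m n)"
 by (subst lmat_def) (auto intro!: distr_cong simp: sets_lmat)

lemma nn_integral_lmat:
 "F \<in> bmeas (lmat m n) ==>
  integral\<^sup>N (lmat m n) F = (\<integral>\<^sup>+x. F (Matrix.mat m n x) \<partial>(\<Pi>\<^sub>M p\<in>{..<m} \<times> {..<n}. lborel))"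
 by (subst lmat_alt) (simp add: nn_integral_distr measurable_mat_of_fun)

definition mat_box :: "nat => nat => (nat \<times> nat => complex set) => complex mat set" where
 "mat_box m n E = {A \<in> cmat m n. \<forall>i<m. \<forall>j<n. A $$ (i, j) \<in> E (i, j)}"

lemma mat_box_vimage:
 "mat_box m n E = (\<lambda>A. \<lambda>p\<in>{..<m} \<times> {..<n}. A $$ p) -` (\<Pi>\<^sub>E p\<in>{..<m} \<times> {..<n}. E p) \<inter> cmat m n"
 by (auto simp: mat_box_def PiE_iff)

lemma sets_mat_box:
 assumes "\<And>p. p \<in> {..<m} \<times> {..<n} ==> E p \<in> sets borel"
 shows "mat_box m n E \<in> sets (lmat m n)"
proof -
 have "(\<Pi>\<^sub>E p\<in>{..<m} \<times> {..<n}. E p) \<in> sets (\<Pi>\<^sub>M p\<in>{..<m} \<times> {..<n}. lborel)"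
  using assms by (intro sets_PiM_I_finite) auto
 from measurable_sets[OF measurable_mat_entries this] show ?thesis
  by (simp add: mat_box_vimage)
qed

lemma mat_box_cong:
 "(\<And>p. p \<in> {..<m} \<times> {..<n} ==> E p = E' p) ==> mat_box m n E = mat_box m n E'"
 by (auto simp: mat_box_def)

text \<open>Uniqueness of product measures, transported to matrices. Affine maps, transposition and
  the block decompositions are each reduced by it to a computation on boxes.\<close>

lemma lmat_eqI:
 assumes sets: "sets M = sets (lmat m n)"
  and box: "\<And>E. (\<And>p. E p \<in> sets borel) ==>
   emeasure M (mat_box m n E) = (\<Prod>p\<in>{..<m} \<times> {..<n}. emeasure lborel (E p))"
 shows "M = lmat m n"
proof -
 let ?I = "{..<m} \<times> {..<n}"
 let ?e = "\<lambda>A. \<lambda>p\<in>?I. A $$ p"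
 have sp: "space M = cmat m n"
  using sets_eq_imp_space_eq[OF sets] by simp
 have em: "?e \<in> M \<rightarrow>\<^sub>M (\<Pi>\<^sub>M p\<in>?I. lborel)"
  using measurable_mat_entries[of m n] measurable_cong_sets[OF sets refl] by blast
 have "distr M (\<Pi>\<^sub>M p\<in>?I. lborel) ?e = (\<Pi>\<^sub>M p\<in>?I. lborel)"
 proof (rule lborel_prod.PiM_eqI)
  fix E :: "nat \<times> nat => complex set"
  assume E: "\<And>p. p \<in> ?I ==> E p \<in> sets lborel"
  define E' where "E' = (\<lambda>p. if p \<in> ?I then E p else {})"
  have "emeasure (distr M (\<Pi>\<^sub>M p\<in>?I. lborel) ?e) (\<Pi>\<^sub>E p\<in>?I. E p) = emeasure M (mat_box m n E)"
   using E em by (subst emeasure_distr) (auto intro!: sets_PiM_I_finite simp: mat_box_vimage sp)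
  also have "mat_box m n E = mat_box m n E'"
   by (rule mat_box_cong) (simp add: E'_def)
  also have "emeasure M (mat_box m n E') = (\<Prod>p\<in>?I. emeasure lborel (E' p))"
   using E by (intro box) (auto simp: E'_def)
  also have "... = (\<Prod>p\<in>?I. emeasure lborel (E p))"
   by (intro prod.cong) (auto simp: E'_def)
  finally show "emeasure (distr M (\<Pi>\<^sub>M p\<in>?I. lborel) ?e) (\<Pi>\<^sub>E p\<in>?I. E p)
    = (\<Prod>p\<in>?I. emeasure lborel (E p))" .
 qed simp_all
 then have "lmat m n = distr (distr M (\<Pi>\<^sub>M p\<in>?I. lborel) ?e) (lmat m n) (Matrix.mat m n)"
  using lmat_alt[of m n] by simp
 also have "... = distr M (lmat m n) (Matrix.mat m n \<circ> ?e)"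
  by (rule distr_distr[OF measurable_mat_of_fun em])
 also have "... = distr M M (\<lambda>x. x)"
  by (rule distr_cong) (auto simp: sets sp intro!: eq_matI)
 finally show ?thesis by (simp add: distr_id)
qed

lemma emeasure_mat_box:
 assumes "\<And>p. p \<in> {..<m} \<times> {..<n} ==> E p \<in> sets borel"
 shows "emeasure (lmat m n) (mat_box m n E) = (\<Prod>p\<in>{..<m} \<times> {..<n}. emeasure lborel (E p))"
proof -
 let ?I = "{..<m} \<times> {..<n}"
 have "Matrix.mat m n -` mat_box m n E \<inter> space (\<Pi>\<^sub>M p\<in>?I. lborel) = (\<Pi>\<^sub>E p\<in>?I. E p)"
  by (auto simp: mat_box_def space_PiM PiE_iff)
 then show ?thesis
  using assms
  by (subst lmat_alt, subst emeasure_distr[OF measurable_mat_of_fun sets_mat_box])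
   (auto intro!: lborel_prod.emeasure_PiM)
qed

lemma sigma_finite_lmat: "sigma_finite_measure (lmat m n)"
proof -
 let ?I = "{..<m} \<times> {..<n}"
 let ?e = "\<lambda>A. \<lambda>p\<in>?I. A $$ p"
 have "distr (lmat m n) (\<Pi>\<^sub>M p\<in>?I. lborel) ?e
   = distr (\<Pi>\<^sub>M p\<in>?I. lborel) (\<Pi>\<^sub>M p\<in>?I. lborel) (?e \<circ> Matrix.mat m n)"
  by (subst (1) lmat_alt, rule distr_distr[OF measurable_mat_entries measurable_mat_of_fun])
 also have "... = distr (\<Pi>\<^sub>M p\<in>?I. lborel) (\<Pi>\<^sub>M p\<in>?I. lborel) (\<lambda>x. x)"
  by (rule distr_cong) (auto simp: space_PiM PiE_iff extensional_def restrict_def fun_eq_iff)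
 also have "... = (\<Pi>\<^sub>M p\<in>?I. lborel)" by (simp add: distr_id)
 finally have "sigma_finite_measure (distr (lmat m n) (\<Pi>\<^sub>M p\<in>?I. lborel) ?e)"
  by (simp add: lborel_prod.sigma_finite)
 then show ?thesis by (rule sigma_finite_measure_distr[OF _ measurable_mat_entries])
qed

interpretation lmat: sigma_finite_measure "lmat m n" for m n
 by (rule sigma_finite_lmat)

lemma nn_integral_lmat_swap:
 assumes [measurable]: "case_prod f \<in> bmeas (lmat a b \<Otimes>\<^sub>M lmat c d)"
 shows "(\<integral>X:a,b. \<integral>Y:c,d. f X Y) = (\<integral>Y:c,d. \<integral>X:a,b. f X Y)"
proof -
 interpret pair_sigma_finite "lmat a b" "lmat c d" ..
 show ?thesis using Fubini'[of f] assms by simp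
qed

lemma nn_integral_lborel_lmat_swap:
 assumes [measurable]: "case_prod f \<in> bmeas (lborel \<Otimes>\<^sub>M lmat c d)"
 shows "(\<integral>x:\<C>. \<integral>Y:c,d. f x Y) = (\<integral>Y:c,d. \<integral>x:\<C>. f x Y)"
proof -
 interpret pair_sigma_finite "lborel :: 'a measure" "lmat c d" ..
 show ?thesis using Fubini'[of f] assms by simp
qed

lemma measurable_eqI:
 "(\<And>x. x \<in> space N ==> f x = g x) ==> g \<in> N \<rightarrow>\<^sub>M M ==> f \<in> N \<rightarrow>\<^sub>M M"
 by (subst measurable_cong[of N f g])

lemma meas_mult [measurable (raw)]:
 assumes f: "f \<in> N \<rightarrow>\<^sub>M lmat a b" and g: "g \<in> N \<rightarrow>\<^sub>M lmat b c"
 shows "(\<lambda>x. f x * g x) \<in> N \<rightarrow>\<^sub>M lmat a c"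
proof (rule measurable_lmat)
 fix x assume "x \<in> space N"
 then show "f x * g x \<in> cmat a c"
  using measurable_carrier[OF f] measurable_carrier[OF g] by (auto intro: mult_carrier_mat)
next
 fix i j assume ij: "i < a" "j < c"
 have "(f x * g x) $$ (i, j) = (\<Sum>k<b. f x $$ (i, k) * g x $$ (k, j))" if "x \<in> space N" for x
  using measurable_carrier[OF f that] measurable_carrier[OF g that] ij
  by (auto simp: scalar_prod_def lessThan_atLeast0 intro!: sum.cong)
 moreover have "(\<lambda>x. \<Sum>k<b. f x $$ (i, k) * g x $$ (k, j)) \<in> bmeas N"
  using ij by (intro borel_measurable_sum borel_measurable_times meas_entry[OF _ _ f]
    meas_entry[OF _ _ g]) auto
 ultimately show "(\<lambda>x. (f x * g x) $$ (i, j)) \<in> bmeas N"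
  by (rule measurable_eqI)
qed

lemma meas_add [measurable (raw)]:
 assumes f: "f \<in> N \<rightarrow>\<^sub>M lmat a b" and g: "g \<in> N \<rightarrow>\<^sub>M lmat a b"
 shows "(\<lambda>x. f x + g x) \<in> N \<rightarrow>\<^sub>M lmat a b"
proof (rule measurable_lmat)
 fix x assume "x \<in> space N"
 then show "f x + g x \<in> cmat a b"
  using measurable_carrier[OF f] measurable_carrier[OF g] by auto
next
 fix i j assume ij: "i < a" "j < b"
 have "(f x + g x) $$ (i, j) = f x $$ (i, j) + g x $$ (i, j)" if "x \<in> space N" for x
  using measurable_carrier[OF f that] measurable_carrier[OF g that] ij by auto
 moreover have "(\<lambda>x. f x $$ (i, j) + g x $$ (i, j)) \<in> bmeas N"
  using ij meas_entry[OF _ _ f] meas_entry[OF _ _ g] by auto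
 ultimately show "(\<lambda>x. (f x + g x) $$ (i, j)) \<in> bmeas N"
  by (rule measurable_eqI)
qed

lemma meas_smult [measurable (raw)]:
 assumes c: "c \<in> bmeas N" and f: "f \<in> N \<rightarrow>\<^sub>M lmat a b"
 shows "(\<lambda>x. c x \<cdot>\<^sub>m f x) \<in> N \<rightarrow>\<^sub>M lmat a b"
proof (rule measurable_lmat)
 fix x assume "x \<in> space N"
 then show "c x \<cdot>\<^sub>m f x \<in> cmat a b"
  using measurable_carrier[OF f] by auto
next
 fix i j assume ij: "i < a" "j < b"
 have "(c x \<cdot>\<^sub>m f x) $$ (i, j) = c x * f x $$ (i, j)" if "x \<in> space N" for x
  using measurable_carrier[OF f that] ij by auto
 moreover have "(\<lambda>x. c x * f x $$ (i, j)) \<in> bmeas N"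
  using ij c meas_entry[OF _ _ f] by auto
 ultimately show "(\<lambda>x. (c x \<cdot>\<^sub>m f x) $$ (i, j)) \<in> bmeas N"
  by (rule measurable_eqI)
qed

lemma measurable_mat_transpose [measurable (raw)]:
 assumes f: "f \<in> N \<rightarrow>\<^sub>M lmat a b"
 shows "(\<lambda>x. Matrix.transpose_mat (f x)) \<in> N \<rightarrow>\<^sub>M lmat b a"
proof (rule measurable_lmat)
 fix x assume "x \<in> space N"
 then show "Matrix.transpose_mat (f x) \<in> cmat b a"
  using measurable_carrier[OF f] by auto
next
 fix i j assume ij: "i < b" "j < a"
 have "Matrix.transpose_mat (f x) $$ (i, j) = f x $$ (j, i)" if "x \<in> space N" for x
  using measurable_carrier[OF f that] ij by auto
 moreover have "(\<lambda>x. f x $$ (j, i)) \<in> bmeas N"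
  using ij meas_entry[OF _ _ f] by auto
 ultimately show "(\<lambda>x. Matrix.transpose_mat (f x) $$ (i, j)) \<in> bmeas N"
  by (rule measurable_eqI)
qed

lemma measurable_four_block_mat [measurable (raw)]:
 assumes A: "A \<in> N \<rightarrow>\<^sub>M lmat a c" and B: "B \<in> N \<rightarrow>\<^sub>M lmat a d"
  and C: "C \<in> N \<rightarrow>\<^sub>M lmat b c" and D: "D \<in> N \<rightarrow>\<^sub>M lmat b d"
 shows "(\<lambda>x. four_block_mat (A x) (B x) (C x) (D x)) \<in> N \<rightarrow>\<^sub>M lmat (a + b) (c + d)"
proof (rule measurable_lmat)
 fix x assume "x \<in> space N"
 then show "four_block_mat (A x) (B x) (C x) (D x) \<in> cmat (a + b) (c + d)"
  using measurable_carrier[OF A] measurable_carrier[OF D] by auto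
next
 fix i j assume ij: "i < a + b" "j < c + d"
 let ?g = "\<lambda>x. if i < a then if j < c then A x $$ (i, j) else B x $$ (i, j - c)
   else if j < c then C x $$ (i - a, j) else D x $$ (i - a, j - c)"
 have "four_block_mat (A x) (B x) (C x) (D x) $$ (i, j) = ?g x" if "x \<in> space N" for x
  using measurable_carrier[OF A that] measurable_carrier[OF D that] ij by auto
 moreover have "?g \<in> bmeas N"
  using ij meas_entry[OF _ _ A, of i j] meas_entry[OF _ _ B, of i "j - c"]
   meas_entry[OF _ _ C, of "i - a" j] meas_entry[OF _ _ D, of "i - a" "j - c"]
  by (cases "i < a"; cases "j < c"; simp)
 ultimately show "(\<lambda>x. four_block_mat (A x) (B x) (C x) (D x) $$ (i, j)) \<in> bmeas N"
  by (rule measurable_eqI)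
qed

lemma meas_det [measurable (raw)]:
 assumes f: "f \<in> N \<rightarrow>\<^sub>M lmat n n"
 shows "(\<lambda>x. det (f x)) \<in> bmeas N"
proof -
 let ?g = "\<lambda>x. \<Sum>p\<in>{p. p permutes {0..<n}}. signof p * (\<Prod>i = 0..<n. f x $$ (i, p i))"
 have "det (f x) = ?g x" if "x \<in> space N" for x
  using det_def'[OF measurable_carrier[OF f that]] .
 moreover have "?g \<in> bmeas N"
 proof (intro borel_measurable_sum borel_measurable_times borel_measurable_const borel_measurable_prod)
  fix p i assume "p \<in> {p. p permutes {0..<n}}" "i \<in> {0..<n}"
  then have "i < n" "p i < n" using permutes_in_image[of p "{0..<n}" i] by auto
  then show "(\<lambda>x. f x $$ (i, p i)) \<in> bmeas N"
   using meas_entry[OF _ _ f] by blast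
 qed
 ultimately show ?thesis by (rule measurable_eqI)
qed

lemma meas_const: "C \<in> cmat a b ==> (\<lambda>x. C) \<in> N \<rightarrow>\<^sub>M lmat a b"
 by simp

lemma meas_one [measurable]: "(\<lambda>x. 1\<^sub>m n) \<in> N \<rightarrow>\<^sub>M lmat n n"
 and meas_zero [measurable]: "(\<lambda>x. 0\<^sub>m a b) \<in> N \<rightarrow>\<^sub>M lmat a b"
 by simp_all

lemma measurable_mat_11 [measurable (raw)]:
 "f \<in> bmeas N ==> (\<lambda>x. Matrix.mat 1 1 (\<lambda>_. f x)) \<in> N \<rightarrow>\<^sub>M lmat 1 1"
 by (rule measurable_lmat) auto

lemma emeasure_lborel_complex_affine:
 assumes d: "d ~= 0" and E [measurable]: "E \<in> sets borel"
 shows "ennreal ((cmod d)^2) * emeasure lborel {z. d * z + c \<in> E} = emeasure lborel E"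
proof -
 let ?g = "\<lambda>z. d * z + c"
 have dv: "deriv ?g z = d" for z
  by (rule DERIV_imp_deriv) (auto intro!: derivative_eq_intros)
 have fib: "{z \<in> UNIV. ?g z = a} = {(a - c) / d}" for a
  using d by (auto simp: field_simps)
 have m: "{z. d * z + c \<in> E} \<in> sets borel" by measurable
 have "of_nat 1 * (\<integral>a:\<C>. indicator E a)
   = (\<integral>\<^sup>+z\<in>UNIV. ennreal ((cmod (deriv ?g z))^2) * indicator E (?g z) \<partial>lborel)"
 proof (rule holomorphic_area_formula)
  show "?g holomorphic_on UNIV" by (intro holomorphic_intros)
  show "deriv ?g z ~= 0" for z using d by (simp only: dv) simp
  show "finite {z \<in> UNIV. ?g z = a} \<and> card {z \<in> UNIV. ?g z = a} = 1" for a
   by (simp only: fib) simp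
 qed auto
 also have "... = (\<integral>z:\<C>. ennreal ((cmod d)^2) * indicator {z. d * z + c \<in> E} z)"
  by (intro nn_integral_cong) (simp only: dv, simp add: indicator_def)
 also have "... = ennreal ((cmod d)^2) * emeasure lborel {z. d * z + c \<in> E}"
  using m by (simp add: nn_integral_cmult)
 finally show ?thesis by simp
qed

text \<open>Each of the m n complex entries is scaled by d and contributes |d|^2; the shift by C
  contributes nothing.\<close>

lemma nn_integral_lmat_affine:
 assumes d: "d ~= 0" and C: "C \<in> cmat m n"
  and F [measurable]: "F \<in> bmeas (lmat m n)"
 shows "ennreal (cmod d ^ (2 * (m * n))) * (\<integral>X:m,n. F (d \<cdot>\<^sub>m X + C)) = integral\<^sup>N (lmat m n) F"
proof -
 let ?k = "ennreal (cmod d ^ (2 * (m * n)))"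
 let ?g = "\<lambda>X. d \<cdot>\<^sub>m X + C"
 have [measurable]: "(\<lambda>_. C) \<in> lmat m n \<rightarrow>\<^sub>M lmat m n" using C by simp
 have g: "?g \<in> lmat m n \<rightarrow>\<^sub>M lmat m n" by measurable
 have "?k = ennreal (((cmod d)^2) ^ (m * n))" by (simp only: power_mult)
 also have "... = (\<Prod>p\<in>{..<m} \<times> {..<n}. ennreal ((cmod d)^2))"
  by (simp add: ennreal_power)
 finally have k: "?k = (\<Prod>p\<in>{..<m} \<times> {..<n}. ennreal ((cmod d)^2))" .
 have "density (distr (lmat m n) (lmat m n) ?g) (\<lambda>_. ?k) = lmat m n"
 proof (rule lmat_eqI)
  fix E :: "nat \<times> nat => complex set" assume E: "\<And>p. E p \<in> sets borel"
  let ?E = "\<lambda>p. {z. d * z + C $$ p \<in> E p}"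
  have E': "?E p \<in> sets borel" for p using E[of p] by measurable
  have b: "mat_box m n E \<in> sets (lmat m n)" using E by (intro sets_mat_box)
  have pre: "?g -` mat_box m n E \<inter> space (lmat m n) = mat_box m n ?E"
   using C by (auto simp: mat_box_def)
  have "emeasure (density (distr (lmat m n) (lmat m n) ?g) (\<lambda>_. ?k)) (mat_box m n E)
    = ?k * emeasure (distr (lmat m n) (lmat m n) ?g) (mat_box m n E)"
   using b by (subst emeasure_density_const) auto
  also have "... = ?k * emeasure (lmat m n) (mat_box m n ?E)"
   by (simp only: emeasure_distr[OF g b] pre)
  also have "... = ?k * (\<Prod>p\<in>{..<m} \<times> {..<n}. emeasure lborel (?E p))"
   using E' by (simp only: emeasure_mat_box)
  also have "... = (\<Prod>p\<in>{..<m} \<times> {..<n}. ennreal ((cmod d)^2) * emeasure lborel (?E p))"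
   by (simp only: k prod.distrib)
  also have "... = (\<Prod>p\<in>{..<m} \<times> {..<n}. emeasure lborel (E p))"
   using d E by (intro prod.cong refl emeasure_lborel_complex_affine)
  finally show "emeasure (density (distr (lmat m n) (lmat m n) ?g) (\<lambda>_. ?k)) (mat_box m n E)
    = (\<Prod>p\<in>{..<m} \<times> {..<n}. emeasure lborel (E p))" .
 qed simp
 then have "integral\<^sup>N (lmat m n) F = integral\<^sup>N (density (distr (lmat m n) (lmat m n) ?g) (\<lambda>_. ?k)) F"
  by simp
 also have "... = (\<integral>\<^sup>+X. ?k * F X \<partial>distr (lmat m n) (lmat m n) ?g)"
  using F by (intro nn_integral_density) auto
 also have "... = (\<integral>X:m,n. ?k * F (?g X))"
  using F g by (intro nn_integral_distr) auto
 also have "... = ?k * (\<integral>X:m,n. F (?g X))"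
  by (intro nn_integral_cmult) measurable
 finally show ?thesis by (rule sym)
qed

lemma nn_integral_lmat_translate:
 assumes C: "C \<in> cmat m n" and F: "F \<in> bmeas (lmat m n)"
 shows "(\<integral>X:m,n. F (X + C)) = integral\<^sup>N (lmat m n) F"
proof -
 have "(\<integral>X:m,n. F (X + C)) = (\<integral>X:m,n. F (1 \<cdot>\<^sub>m X + C))"
  by (intro nn_integral_cong) (auto intro!: arg_cong[where f = F] arg_cong[where f = "\<lambda>x. x + C"] eq_matI)
 then show ?thesis using nn_integral_lmat_affine[OF _ C F, of 1] by simp
qed

lemma nn_integral_lmat_transpose:
 assumes F: "F \<in> bmeas (lmat m n)"
 shows "(\<integral>X:n,m. F (Matrix.transpose_mat X)) = integral\<^sup>N (lmat m n) F"
proof -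
 let ?g = "Matrix.transpose_mat :: complex mat => complex mat"
 have g: "?g \<in> lmat n m \<rightarrow>\<^sub>M lmat m n" by measurable
 have "distr (lmat n m) (lmat m n) ?g = lmat m n"
 proof (rule lmat_eqI)
  fix E :: "nat \<times> nat => complex set" assume E: "\<And>p. E p \<in> sets borel"
  let ?E = "\<lambda>p. E (prod.swap p)"
  have b: "mat_box m n E \<in> sets (lmat m n)" using E by (intro sets_mat_box)
  have pre: "?g -` mat_box m n E \<inter> space (lmat n m) = mat_box n m ?E"
   by (auto simp: mat_box_def)
  have "emeasure (distr (lmat n m) (lmat m n) ?g) (mat_box m n E)
    = (\<Prod>p\<in>{..<n} \<times> {..<m}. emeasure lborel (?E p))"
   using E by (simp only: emeasure_distr[OF g b] pre emeasure_mat_box)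
  also have "... = (\<Prod>p\<in>{..<m} \<times> {..<n}. emeasure lborel (E p))"
   by (rule prod.reindex_bij_witness[of _ prod.swap prod.swap]) auto
  finally show "emeasure (distr (lmat n m) (lmat m n) ?g) (mat_box m n E)
    = (\<Prod>p\<in>{..<m} \<times> {..<n}. emeasure lborel (E p))" .
 qed simp
 then show ?thesis using nn_integral_distr[OF g, of F] F by simp
qed

lemma prod_lessThan_add:
 "(\<Prod>i<a + b :: nat. h i) = (\<Prod>i<a. h i) * (\<Prod>i<b. h (i + a) :: 'a :: comm_monoid_mult)"
 by (induction b) (simp_all add: ac_simps)

lemma prod_Times: "(\<Prod>p\<in>A \<times> B. h p) = (\<Prod>i\<in>A. \<Prod>j\<in>B. h (i, j))"
 by (simp add: prod.cartesian_product)

text \<open>A block matrix lies in a box exactly when its blocks lie in the four corresponding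
  boxes, so the two measures agree on boxes.\<close>

lemma nn_integral_four_block_mat:
 assumes F: "F \<in> bmeas (lmat (a + b) (c + d))"
 shows "integral\<^sup>N (lmat (a + b) (c + d)) F =
  (\<integral>A:a,c. \<integral>B:a,d. \<integral>C:b,c. \<integral>D:b,d. F (four_block_mat A B C D))"
proof -
 let ?M = "lmat a c \<Otimes>\<^sub>M (lmat a d \<Otimes>\<^sub>M (lmat b c \<Otimes>\<^sub>M lmat b d))"
 let ?g = "\<lambda>(A, B, C, D). four_block_mat A B C D :: complex mat"
 interpret p1: pair_sigma_finite "lmat b c" "lmat b d" ..
 have s1: "sigma_finite_measure (lmat b c \<Otimes>\<^sub>M lmat b d)" by unfold_locales
 interpret p2: pair_sigma_finite "lmat a d" "lmat b c \<Otimes>\<^sub>M lmat b d"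
  by (intro pair_sigma_finite.intro s1 sigma_finite_lmat)
 have s2: "sigma_finite_measure (lmat a d \<Otimes>\<^sub>M (lmat b c \<Otimes>\<^sub>M lmat b d))"
  by unfold_locales
 have g: "?g \<in> ?M \<rightarrow>\<^sub>M lmat (a + b) (c + d)" by measurable
 have "distr ?M (lmat (a + b) (c + d)) ?g = lmat (a + b) (c + d)"
 proof (rule lmat_eqI)
  fix E :: "nat \<times> nat => complex set" assume E: "\<And>p. E p \<in> sets borel"
  let ?E2 = "\<lambda>(i, j). E (i, j + c)" and ?E3 = "\<lambda>(i, j). E (i + a, j)"
   and ?E4 = "\<lambda>(i, j). E (i + a, j + c)"
  have bx: "mat_box (a + b) (c + d) E \<in> sets (lmat (a + b) (c + d))"
   using E by (intro sets_mat_box)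
  have Es: "\<And>p. ?E2 p \<in> sets borel" "\<And>p. ?E3 p \<in> sets borel" "\<And>p. ?E4 p \<in> sets borel"
   using E by auto
  have iff: "four_block_mat A B C D \<in> mat_box (a + b) (c + d) E \<longleftrightarrow>
    A \<in> mat_box a c E \<and> B \<in> mat_box a d ?E2 \<and> C \<in> mat_box b c ?E3 \<and> D \<in> mat_box b d ?E4"
   if car: "A \<in> cmat a c" "B \<in> cmat a d" "C \<in> cmat b c" "D \<in> cmat b d"
   for A B C D
  proof -
   have "(\<forall>i<a + b. \<forall>j<c + d. four_block_mat A B C D $$ (i, j) \<in> E (i, j)) \<longleftrightarrow>
    (\<forall>i<a. \<forall>j<c. A $$ (i, j) \<in> E (i, j)) \<and> (\<forall>i<a. \<forall>j<d. B $$ (i, j) \<in> E (i, j + c)) \<and>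
    (\<forall>i<b. \<forall>j<c. C $$ (i, j) \<in> E (i + a, j)) \<and> (\<forall>i<b. \<forall>j<d. D $$ (i, j) \<in> E (i + a, j + c))"
    (is "?L \<longleftrightarrow> ?R")
   proof
    assume L: ?L
    have "A $$ (i, j) \<in> E (i, j)" if "i < a" "j < c" for i j
    using L[rule_format, of i j] that car by auto
    moreover have "B $$ (i, j) \<in> E (i, j + c)" if "i < a" "j < d" for i j
    using L[rule_format, of i "j + c"] that car by auto
    moreover have "C $$ (i, j) \<in> E (i + a, j)" if "i < b" "j < c" for i j
    using L[rule_format, of "i + a" j] that car by auto
    moreover have "D $$ (i, j) \<in> E (i + a, j + c)" if "i < b" "j < d" for i j
    using L[rule_format, of "i + a" "j + c"] that car by auto
    ultimately show ?R by blast
   next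
    assume R: ?R
    show ?L
    proof (intro allI impI)
    fix i j assume ij: "i < a + b" "j < c + d"
    show "four_block_mat A B C D $$ (i, j) \<in> E (i, j)"
    proof (cases "i < a")
    case True
    show ?thesis
    proof (cases "j < c")
    case True
    then show ?thesis using R ij car \<open>i < a\<close> by auto
    next
    case False
    then obtain j' where "j = j' + c" "j' < d" using ij by (metis add.commute le_add_diff_inverse2 less_diff_conv2 not_le)
    then show ?thesis using R ij car \<open>i < a\<close> by auto
    qed
    next
    case False
    then obtain i' where i': "i = i' + a" "i' < b" using ij by (metis add.commute le_add_diff_inverse2 less_diff_conv2 not_le)
    show ?thesis
    proof (cases "j < c")
    case True
    then show ?thesis using R ij car i' by auto
    next
    case False
    then obtain j' where "j = j' + c" "j' < d" using ij by (metis add.commute le_add_diff_inverse2 less_diff_conv2 not_le)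
    then show ?thesis using R ij car i' by auto
    qed
    qed
    qed
   qed
   then show ?thesis using car by (simp add: mat_box_def)
  qed
  have pre: "?g -` mat_box (a + b) (c + d) E \<inter> space ?M =
    mat_box a c E \<times> (mat_box a d ?E2 \<times> (mat_box b c ?E3 \<times> mat_box b d ?E4))"
  proof (intro equalityI subsetI)
   fix p assume p: "p \<in> ?g -` mat_box (a + b) (c + d) E \<inter> space ?M"
   then show "p \<in> mat_box a c E \<times> (mat_box a d ?E2 \<times> (mat_box b c ?E3 \<times> mat_box b d ?E4))"
   proof -
    obtain A B C D where "p = (A, B, C, D)" by (cases p)
    then show ?thesis
    using p iff[of A B C D] by (auto simp: space_pair_measure)
   qed
  next
   fix p assume p: "p \<in> mat_box a c E \<times> (mat_box a d ?E2 \<times> (mat_box b c ?E3 \<times> mat_box b d ?E4))"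
   moreover have "mat_box m n E \<subseteq> cmat m n" for m n E by (auto simp: mat_box_def)
   ultimately have "p \<in> space ?M" by (auto simp: space_pair_measure)
   then show "p \<in> ?g -` mat_box (a + b) (c + d) E \<inter> space ?M"
    using p by (cases p) (simp add: space_pair_measure iff)
  qed
  have m: "mat_box a c E \<in> sets (lmat a c)" "mat_box a d ?E2 \<in> sets (lmat a d)"
   "mat_box b c ?E3 \<in> sets (lmat b c)" "mat_box b d ?E4 \<in> sets (lmat b d)"
   using E Es by (auto intro!: sets_mat_box split: prod.splits)
  have "emeasure (distr ?M (lmat (a + b) (c + d)) ?g) (mat_box (a + b) (c + d) E) =
    emeasure (lmat a c) (mat_box a c E) * (emeasure (lmat a d) (mat_box a d ?E2) *
    (emeasure (lmat b c) (mat_box b c ?E3) * emeasure (lmat b d) (mat_box b d ?E4)))"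
   using m by (simp only: emeasure_distr[OF g bx] pre
    sigma_finite_measure.emeasure_pair_measure_Times[OF s2]
    sigma_finite_measure.emeasure_pair_measure_Times[OF s1]
    lmat.emeasure_pair_measure_Times pair_measureI)
  also have "... = (\<Prod>p\<in>{..<a + b} \<times> {..<c + d}. emeasure lborel (E p))"
   using E Es
   by (simp add: emeasure_mat_box prod_Times prod_lessThan_add prod.distrib ac_simps)
  finally show "emeasure (distr ?M (lmat (a + b) (c + d)) ?g) (mat_box (a + b) (c + d) E)
    = (\<Prod>p\<in>{..<a + b} \<times> {..<c + d}. emeasure lborel (E p))" .
 qed simp
 then have "integral\<^sup>N (lmat (a + b) (c + d)) F = (\<integral>\<^sup>+p. F (?g p) \<partial>?M)"
  using nn_integral_distr[OF g, of F] F by simp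
 also have "... = (\<integral>A:a,c. \<integral>\<^sup>+p. F (?g (A, p)) \<partial>(lmat a d \<Otimes>\<^sub>M (lmat b c \<Otimes>\<^sub>M lmat b d)))"
  using g F by (intro sigma_finite_measure.nn_integral_fst[OF s2, symmetric] measurable_compose[OF g])
 also have "... = (\<integral>A:a,c. \<integral>B:a,d. \<integral>\<^sup>+p. F (?g (A, B, p)) \<partial>(lmat b c \<Otimes>\<^sub>M lmat b d))"
  using F by (intro nn_integral_cong sigma_finite_measure.nn_integral_fst[OF s1, symmetric]
    measurable_compose[OF measurable_compose[OF measurable_Pair1' g]]) auto
 also have "... = (\<integral>A:a,c. \<integral>B:a,d. \<integral>C:b,c. \<integral>D:b,d. F (?g (A, B, C, D)))"
  using F by (intro nn_integral_cong lmat.nn_integral_fst[symmetric]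
    measurable_compose[OF measurable_compose[OF measurable_Pair1' measurable_compose[OF measurable_Pair1' g]]])
   (auto simp: space_pair_measure)
 finally show ?thesis by simp
qed

declare One_nat_def [simp del]

lemma one_plus_eq_Suc [simp]: "1 + n = Suc n"
 by simp

text \<open>Without entries the measure is the unit mass at the empty matrix. This starts the
  induction over the size in \<open>nn_integral_eigenvalues\<close>.\<close>

lemma nn_integral_lmat_0:
 assumes F: "F \<in> bmeas (lmat a b)" and "a = 0 \<or> b = 0"
 shows "integral\<^sup>N (lmat a b) F = F (0\<^sub>m a b)"
proof -
 have e: "{..<a} \<times> {..<b} = {}" using assms(2) by auto
 have z: "Matrix.mat a b x = 0\<^sub>m a b" for x :: "nat \<times> nat => complex"
  using assms(2) by (intro eq_matI) auto
 have "integral\<^sup>N (lmat a b) F = (\<integral>\<^sup>+x. F (0\<^sub>m a b) \<partial>(\<Pi>\<^sub>M p\<in>({} :: (nat \<times> nat) set). clborel))"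
  unfolding nn_integral_lmat[OF F] by (simp only: e z)
 also have "... = F (0\<^sub>m a b)" by (rule lborel_prod.nn_integral_empty) simp
 finally show ?thesis .
qed

lemma nn_integral_lmat_11:
 assumes F: "F \<in> bmeas (lmat 1 1)"
 shows "integral\<^sup>N (lmat 1 1) F = (\<integral>x:\<C>. F (Matrix.mat 1 1 (\<lambda>_. x)))"
proof -
 have e: "{..<1} \<times> {..<1} = {(0, 0) :: nat \<times> nat}" by auto
 have eq: "Matrix.mat 1 1 x = Matrix.mat 1 1 (\<lambda>_. x (0, 0))" for x :: "nat \<times> nat => complex"
  by (intro eq_matI) auto
 have "integral\<^sup>N (lmat 1 1) F
   = (\<integral>\<^sup>+x. F (Matrix.mat 1 1 (\<lambda>_. x (0, 0))) \<partial>(\<Pi>\<^sub>M p\<in>{(0 :: nat, 0 :: nat)}. lborel))"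
  unfolding nn_integral_lmat[OF F] e using eq by (intro nn_integral_cong) (rule arg_cong[where f = F])
 also have "... = (\<integral>x:\<C>. F (Matrix.mat 1 1 (\<lambda>_. x)))"
  using F by (intro lborel_prod.product_nn_integral_singleton measurable_compose[OF measurable_mat_11 F]) simp
 finally show ?thesis .
qed

section \<open>Matrices with a scalar corner\<close>

definition bmat :: "complex => complex mat => complex mat => complex mat => complex mat" where
 "bmat x b c D = four_block_mat (Matrix.mat 1 1 (\<lambda>_. x)) b c D"

lemma bmat_carrier [simp]: "D \<in> cmat n n ==> bmat x b c D \<in> cmat (Suc n) (Suc n)"
 using four_block_carrier_mat[of "Matrix.mat 1 1 (\<lambda>_. x)" 1 1 D n n] by (simp add: bmat_def)

lemma dim_bmat [simp]: "dim_row (bmat x b c D) = Suc (dim_row D)" "dim_col (bmat x b c D) = Suc (dim_col D)"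
 by (simp_all add: bmat_def)

lemma measurable_bmat [measurable (raw)]:
 assumes "x \<in> bmeas N" "b \<in> N \<rightarrow>\<^sub>M lmat 1 n" "c \<in> N \<rightarrow>\<^sub>M lmat n 1" "D \<in> N \<rightarrow>\<^sub>M lmat n n"
 shows "(\<lambda>w. bmat (x w) (b w) (c w) (D w)) \<in> N \<rightarrow>\<^sub>M lmat (Suc n) (Suc n)"
 using measurable_four_block_mat[OF measurable_mat_11[OF assms(1)] assms(2-4)]
 by (simp add: bmat_def)

lemma bmat_cases:
 assumes "M \<in> cmat (Suc n) (Suc n)"
 obtains x b c D where "b \<in> cmat 1 n" "c \<in> cmat n 1" "D \<in> cmat n n" "M = bmat x b c D"
proof -
 obtain A1 A2 A3 A4 where s: "split_block M 1 1 = (A1, A2, A3, A4)" by (cases "split_block M 1 1")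
 have M: "dim_row M = 1 + n" "dim_col M = 1 + n" using assms by auto
 note b = split_block[OF s M]
 have "A1 = Matrix.mat 1 1 (\<lambda>_. A1 $$ (0, 0))" using b(1) by (intro eq_matI) auto
 then have "M = bmat (A1 $$ (0, 0)) A2 A3 A4" using b(5) by (simp add: bmat_def)
 then show ?thesis using that b by blast
qed

lemma nn_integral_bmat:
 assumes F: "F \<in> bmeas (lmat (Suc n) (Suc n))"
 shows "integral\<^sup>N (lmat (Suc n) (Suc n)) F =
  (\<integral>x:\<C>. \<integral>b:1,n. \<integral>c:n,1. \<integral>D:n,n. F (bmat x b c D))"
proof -
 have F': "F \<in> bmeas (lmat (1 + n) (1 + n))" using F by simp
 have m: "(\<lambda>A. \<integral>b:1,n. \<integral>c:n,1. \<integral>D:n,n. F (four_block_mat A b c D))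
   \<in> bmeas (lmat 1 1)"
  using F' by measurable
 show ?thesis
  using nn_integral_four_block_mat[OF F'] nn_integral_lmat_11[OF m] by (simp add: bmat_def)
qed

lemma mat_11_mult: "b \<in> cmat 1 n ==> Matrix.mat 1 1 (\<lambda>_. x) * b = x \<cdot>\<^sub>m b"
 for b :: "complex mat"
 by (intro eq_matI) (auto simp: scalar_prod_def One_nat_def)

lemma mat_mult_11: "c \<in> cmat n 1 ==> c * Matrix.mat 1 1 (\<lambda>_. x) = x \<cdot>\<^sub>m c"
 for c :: "complex mat"
 by (intro eq_matI) (auto simp: scalar_prod_def One_nat_def)

lemma bmat_mult:
 assumes "b \<in> cmat 1 n" "c \<in> cmat n 1" "D \<in> cmat n n"
  "b' \<in> cmat 1 n" "c' \<in> cmat n 1" "D' \<in> cmat n n"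
 shows "bmat x b c D * bmat x' b' c' D' =
  bmat (x * x' + (b * c') $$ (0, 0)) (x \<cdot>\<^sub>m b' + b * D') (x' \<cdot>\<^sub>m c + D * c') (c * b' + D * D')"
proof -
 have 1: "Matrix.mat 1 1 (\<lambda>_. x) * Matrix.mat 1 1 (\<lambda>_. x') + b * c'
   = Matrix.mat 1 1 (\<lambda>_. x * x' + (b * c') $$ (0, 0))"
  using assms by (intro eq_matI) (auto simp: scalar_prod_def)
 show ?thesis
  unfolding bmat_def
  using assms by (subst mult_four_block_mat[of _ 1 1 _ n _ n _ _ 1 _ n])
   (simp_all add: 1 mat_11_mult mat_mult_11)
qed

lemma det_bmat_lower_zero:
 assumes "b \<in> cmat 1 n" "D \<in> cmat n n"
 shows "det (bmat x b (0\<^sub>m n 1) D) = x * det D"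
 unfolding bmat_def using assms
 by (subst det_four_block_mat_lower_left_zero[of _ 1 _ n]) (auto simp: det_single)

lemma det_bmat_upper_zero:
 assumes "c \<in> cmat n 1" "D \<in> cmat n n"
 shows "det (bmat x (0\<^sub>m 1 n) c D) = x * det D"
 unfolding bmat_def using assms
 by (subst det_four_block_mat_upper_right_zero[of _ 1 _ n]) (auto simp: det_single)

text \<open>Stacking is encoded as a four block matrix with two blocks of width zero, so that the
  multiplication rule for block matrices applies to it.\<close>

definition row_stack :: "complex mat => complex mat => complex mat" where
 "row_stack x Y = four_block_mat x (0\<^sub>m (dim_row x) 0) Y (0\<^sub>m (dim_row Y) 0)"

lemma measurable_row_stack [measurable (raw)]:
 assumes f: "f \<in> N \<rightarrow>\<^sub>M lmat a k" and g: "g \<in> N \<rightarrow>\<^sub>M lmat b k"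
 shows "(\<lambda>w. row_stack (f w) (g w)) \<in> N \<rightarrow>\<^sub>M lmat (a + b) k"
proof (rule measurable_eqI)
 fix w assume "w \<in> space N"
 then show "row_stack (f w) (g w) = four_block_mat (f w) (0\<^sub>m a 0) (g w) (0\<^sub>m b 0)"
  using measurable_carrier[OF f, of w] measurable_carrier[OF g, of w] by (simp add: row_stack_def)
next
 show "(\<lambda>w. four_block_mat (f w) (0\<^sub>m a 0) (g w) (0\<^sub>m b 0)) \<in> N \<rightarrow>\<^sub>M lmat (a + b) k"
  using measurable_four_block_mat[OF f _ g, of "\<lambda>_. 0\<^sub>m a 0" 0 "\<lambda>_. 0\<^sub>m b 0"] by simp
qed

lemma row_stack_mat_box:
 assumes "x \<in> cmat a k" "Y \<in> cmat b k"
 shows "row_stack x Y \<in> mat_box (a + b) k E \<longleftrightarrow> x \<in> mat_box a k E \<and> Y \<in> mat_box b k (\<lambda>(i, j). E (i + a, j))"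
proof -
 have "(\<forall>i<a + b. \<forall>j<k. row_stack x Y $$ (i, j) \<in> E (i, j)) \<longleftrightarrow>
   (\<forall>i<a. \<forall>j<k. x $$ (i, j) \<in> E (i, j)) \<and> (\<forall>i<b. \<forall>j<k. Y $$ (i, j) \<in> E (i + a, j))" (is "?L \<longleftrightarrow> ?R")
 proof
  assume L: ?L
  have "x $$ (i, j) \<in> E (i, j)" if "i < a" "j < k" for i j
   using L[rule_format, of i j] that assms by (auto simp: row_stack_def)
  moreover have "Y $$ (i, j) \<in> E (i + a, j)" if "i < b" "j < k" for i j
   using L[rule_format, of "i + a" j] that assms by (auto simp: row_stack_def)
  ultimately show ?R by blast
 next
  assume R: ?R
  show ?L
  proof (intro allI impI)
   fix i j assume ij: "i < a + b" "j < k"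
   show "row_stack x Y $$ (i, j) \<in> E (i, j)"
   proof (cases "i < a")
    case True
    then show ?thesis using R ij assms by (auto simp: row_stack_def)
   next
    case False
    then obtain i' where "i = i' + a" "i' < b"
    using ij by (metis add.commute le_add_diff_inverse2 less_diff_conv2 not_le)
    then show ?thesis using R ij assms by (auto simp: row_stack_def)
   qed
  qed
 qed
 then show ?thesis using assms by (auto simp: mat_box_def row_stack_def)
qed

lemma nn_integral_row_stack:
 assumes F: "F \<in> bmeas (lmat (a + b) k)"
 shows "integral\<^sup>N (lmat (a + b) k) F =
  (\<integral>x:a,k. \<integral>Y:b,k. F (row_stack x Y))"
proof -
 let ?M = "lmat a k \<Otimes>\<^sub>M lmat b k"
 let ?g = "\<lambda>(x, Y). row_stack x Y"
 have g: "?g \<in> ?M \<rightarrow>\<^sub>M lmat (a + b) k" by measurable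
 have "distr ?M (lmat (a + b) k) ?g = lmat (a + b) k"
 proof (rule lmat_eqI)
  fix E :: "nat \<times> nat => complex set" assume E: "\<And>p. E p \<in> sets borel"
  let ?E = "\<lambda>(i, j). E (i + a, j)"
  have bx: "mat_box (a + b) k E \<in> sets (lmat (a + b) k)"
   using E by (intro sets_mat_box)
  have E': "?E p \<in> sets borel" for p using E by (cases p) auto
  have sub: "mat_box m n E \<subseteq> cmat m n" for m n E by (auto simp: mat_box_def)
  have pre: "?g -` mat_box (a + b) k E \<inter> space ?M = mat_box a k E \<times> mat_box b k ?E"
  proof (intro equalityI subsetI)
   fix p assume "p \<in> ?g -` mat_box (a + b) k E \<inter> space ?M"
   then show "p \<in> mat_box a k E \<times> mat_box b k ?E"
    by (cases p) (auto simp: space_pair_measure row_stack_mat_box)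
  next
   fix p assume p: "p \<in> mat_box a k E \<times> mat_box b k ?E"
   then have "p \<in> space ?M"
    using sub[of a k E] sub[of b k ?E] by (auto simp: space_pair_measure)
   then show "p \<in> ?g -` mat_box (a + b) k E \<inter> space ?M"
    using p row_stack_mat_box[of "fst p" a k "snd p" b E]
    by (cases p) (auto simp: space_pair_measure)
  qed
  have m: "mat_box a k E \<in> sets (lmat a k)" "mat_box b k ?E \<in> sets (lmat b k)"
   using E E' by (auto intro!: sets_mat_box split: prod.splits)
  have "emeasure (distr ?M (lmat (a + b) k) ?g) (mat_box (a + b) k E) =
    emeasure (lmat a k) (mat_box a k E) * emeasure (lmat b k) (mat_box b k ?E)"
   using m by (simp only: emeasure_distr[OF g bx] pre lmat.emeasure_pair_measure_Times)
  also have "... = (\<Prod>p\<in>{..<a + b} \<times> {..<k}. emeasure lborel (E p))"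
   using E E' by (simp add: emeasure_mat_box prod_Times prod_lessThan_add)
  finally show "emeasure (distr ?M (lmat (a + b) k) ?g) (mat_box (a + b) k E)
    = (\<Prod>p\<in>{..<a + b} \<times> {..<k}. emeasure lborel (E p))" .
 qed simp
 then have "integral\<^sup>N (lmat (a + b) k) F = (\<integral>\<^sup>+p. F (?g p) \<partial>?M)"
  using nn_integral_distr[OF g, of F] F by simp
 also have "... = (\<integral>x:a,k. \<integral>Y:b,k. F (?g (x, Y)))"
  using g F by (intro lmat.nn_integral_fst[symmetric] measurable_compose[OF g])
 finally show ?thesis by simp
qed

lemma measurable_row_stack_1 [measurable (raw)]:
 assumes "f \<in> N \<rightarrow>\<^sub>M lmat 1 k" "g \<in> N \<rightarrow>\<^sub>M lmat b k"
 shows "(\<lambda>w. row_stack (f w) (g w)) \<in> N \<rightarrow>\<^sub>M lmat (Suc b) k"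
 using measurable_row_stack[OF assms] by simp

lemma nn_integral_row_stack_1:
 assumes "F \<in> bmeas (lmat (Suc b) k)"
 shows "integral\<^sup>N (lmat (Suc b) k) F =
  (\<integral>x:1,k. \<integral>Y:b,k. F (row_stack x Y))"
 using nn_integral_row_stack[of F 1 b k] assms by simp

section \<open>Jacobian of multiplication by an invertible matrix\<close>

lemma bmat_mult_row_stack:
 assumes "b \<in> cmat 1 n" "c \<in> cmat n 1" "D \<in> cmat n n"
  "x \<in> cmat 1 k" "Y \<in> cmat n k"
 shows "bmat a b c D * row_stack x Y = row_stack (a \<cdot>\<^sub>m x + b * Y) (c * x + D * Y)"
proof -
 have *: "b * 0\<^sub>m n 0 = 0\<^sub>m 1 0" "D * 0\<^sub>m n 0 = 0\<^sub>m n 0" "c * 0\<^sub>m 1 0 = 0\<^sub>m n 0"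
  "Matrix.mat 1 1 (\<lambda>_. a) * 0\<^sub>m 1 0 = 0\<^sub>m 1 0"
  using assms by (auto intro!: eq_matI)
 have d: "dim_row x = 1" "dim_row Y = n" "dim_row (a \<cdot>\<^sub>m x + b * Y) = 1" "dim_row (c * x + D * Y) = n"
  using assms by auto
 have "bmat a b c D * row_stack x Y = four_block_mat (Matrix.mat 1 1 (\<lambda>_. a)) b c D * four_block_mat x (0\<^sub>m 1 0) Y (0\<^sub>m n 0)"
  by (simp add: bmat_def row_stack_def d)
 also have "... = four_block_mat (Matrix.mat 1 1 (\<lambda>_. a) * x + b * Y) (Matrix.mat 1 1 (\<lambda>_. a) * 0\<^sub>m 1 0 + b * 0\<^sub>m n 0)
    (c * x + D * Y) (c * 0\<^sub>m 1 0 + D * 0\<^sub>m n 0)"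
  using assms by (intro mult_four_block_mat[of _ 1 1 _ n _ n _ _ k _ 0]) auto
 also have "... = row_stack (a \<cdot>\<^sub>m x + b * Y) (c * x + D * Y)"
  using assms by (simp add: row_stack_def * d mat_11_mult)
 finally show ?thesis .
qed

text \<open>M acts on each of the k columns separately and scales the volume there by |det M|^2,
  hence the exponent 2k. As a predicate on M the formula is closed under products, so elementary
  factors suffice.\<close>

definition left_mult_jacobian :: "nat => nat => complex mat => bool" where
 "left_mult_jacobian m k M \<longleftrightarrow> M \<in> cmat m m \<and>
  (\<forall>F\<in>bmeas (lmat m k).
   ennreal (cmod (det M) ^ (2 * k)) * (\<integral>X:m,k. F (M * X)) = integral\<^sup>N (lmat m k) F)"

lemma left_mult_jacobianD:
 "left_mult_jacobian m k M ==> F \<in> bmeas (lmat m k) ==>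
  ennreal (cmod (det M) ^ (2 * k)) * (\<integral>X:m,k. F (M * X)) = integral\<^sup>N (lmat m k) F"
 by (simp add: left_mult_jacobian_def)

lemma left_mult_jacobian_mult:
 assumes "left_mult_jacobian m k M" "left_mult_jacobian m k N"
 shows "left_mult_jacobian m k (M * N)"
 unfolding left_mult_jacobian_def
proof (intro conjI ballI)
 have car: "M \<in> cmat m m" "N \<in> cmat m m"
  using assms by (auto simp: left_mult_jacobian_def)
 then show "M * N \<in> cmat m m" by auto
 fix F :: "complex mat => ennreal" assume F: "F \<in> bmeas (lmat m k)"
 have "(\<lambda>w. M) \<in> lmat m k \<rightarrow>\<^sub>M lmat m m" using car by simp
 then have F': "(\<lambda>X. F (M * X)) \<in> bmeas (lmat m k)"
  using F by measurable
 have "ennreal (cmod (det (M * N)) ^ (2 * k)) * (\<integral>X:m,k. F (M * N * X)) =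
   ennreal (cmod (det M) ^ (2 * k)) * (ennreal (cmod (det N) ^ (2 * k)) *
    (\<integral>X:m,k. F (M * (N * X))))"
 proof -
  have "(\<integral>X:m,k. F (M * N * X)) = (\<integral>X:m,k. F (M * (N * X)))"
   using car by (intro nn_integral_cong) (simp add: assoc_mult_mat[of M m m N m])
  then show ?thesis
   using car by (simp add: det_mult norm_mult power_mult_distrib ennreal_mult mult.assoc)
 qed
 also have "... = integral\<^sup>N (lmat m k) F"
  by (simp only: left_mult_jacobianD[OF assms(2) F'] left_mult_jacobianD[OF assms(1) F])
 finally show "ennreal (cmod (det (M * N)) ^ (2 * k)) * (\<integral>X:m,k. F (M * N * X))
   = integral\<^sup>N (lmat m k) F" .
qed

text \<open>For a fixed first row x the map translates the remaining rows by c x, and the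
  determinant is one.\<close>

lemma left_mult_jacobian_lower:
 assumes c: "c \<in> cmat n 1"
 shows "left_mult_jacobian (Suc n) k (bmat 1 (0\<^sub>m 1 n) c (1\<^sub>m n))"
 unfolding left_mult_jacobian_def
proof (intro conjI ballI)
 fix F :: "complex mat => ennreal" assume F: "F \<in> bmeas (lmat (Suc n) k)"
 let ?L = "bmat 1 (0\<^sub>m 1 n) c (1\<^sub>m n)"
 note F' [measurable] = F
 have [measurable]: "(\<lambda>w. ?L) \<in> N \<rightarrow>\<^sub>M lmat (Suc n) (Suc n)" "(\<lambda>w. c) \<in> N \<rightarrow>\<^sub>M lmat n 1"
  for N :: "'x measure" using c by simp_all
 have "(\<integral>X:(Suc n),k. F (?L * X)) =
   (\<integral>x:1,k. \<integral>Y:n,k. F (?L * row_stack x Y))"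
  by (rule nn_integral_row_stack_1) measurable
 also have "... = (\<integral>x:1,k. \<integral>Y:n,k. F (row_stack x Y))"
 proof (rule nn_integral_cong)
  fix x assume x: "x \<in> space (lmat 1 k)"
  then have [measurable]: "(\<lambda>w. x) \<in> N \<rightarrow>\<^sub>M lmat 1 k" for N :: "'x measure" by simp
  have "(\<integral>Y:n,k. F (?L * row_stack x Y)) = (\<integral>Y:n,k. F (row_stack x (Y + c * x)))"
  proof (rule nn_integral_cong)
   fix Y assume Y: "Y \<in> space (lmat n k)"
   have "1 \<cdot>\<^sub>m x + 0\<^sub>m 1 n * Y = x" using x Y by (intro eq_matI) auto
   moreover have "c * x + 1\<^sub>m n * Y = Y + c * x"
    using x Y c by (simp add: comm_add_mat[of "c * x" n k Y])
   ultimately show "F (?L * row_stack x Y) = F (row_stack x (Y + c * x))"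
    using bmat_mult_row_stack[of "0\<^sub>m 1 n" n c "1\<^sub>m n" x k Y 1] c x Y by simp
  qed
  also have "... = (\<integral>Y:n,k. F (row_stack x Y))"
   using x c F' by (intro nn_integral_lmat_translate) (auto, measurable)
  finally show "(\<integral>Y:n,k. F (?L * row_stack x Y)) = (\<integral>Y:n,k. F (row_stack x Y))" .
 qed
 also have "... = integral\<^sup>N (lmat (Suc n) k) F"
  by (rule nn_integral_row_stack_1[OF F', symmetric])
 finally show "ennreal (cmod (det ?L) ^ (2 * k)) * (\<integral>X:(Suc n),k. F (?L * X))
   = integral\<^sup>N (lmat (Suc n) k) F"
  using c by (simp add: det_bmat_upper_zero)
qed simp

text \<open>For fixed lower rows the first row undergoes an affine map with factor a; the lower rows
  are then transformed by D, for which the formula is assumed.\<close>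

lemma left_mult_jacobian_upper:
 assumes a: "a ~= 0" and b: "b \<in> cmat 1 n" and D: "left_mult_jacobian n k D"
 shows "left_mult_jacobian (Suc n) k (bmat a b (0\<^sub>m n 1) D)"
 unfolding left_mult_jacobian_def
proof (intro conjI ballI)
 have Dc: "D \<in> cmat n n" using D by (simp add: left_mult_jacobian_def)
 then show "bmat a b (0\<^sub>m n 1) D \<in> cmat (Suc n) (Suc n)" by simp
 fix F :: "complex mat => ennreal" assume F: "F \<in> bmeas (lmat (Suc n) k)"
 let ?L = "bmat a b (0\<^sub>m n 1) D"
 note F' [measurable] = F
 have [measurable]: "(\<lambda>w. ?L) \<in> N \<rightarrow>\<^sub>M lmat (Suc n) (Suc n)" "(\<lambda>w. b) \<in> N \<rightarrow>\<^sub>M lmat 1 n"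
   "(\<lambda>w. D) \<in> N \<rightarrow>\<^sub>M lmat n n" for N :: "'x measure" using Dc b by simp_all
 let ?ka = "ennreal (cmod a ^ (2 * (1 * k)))" and ?kd = "ennreal (cmod (det D) ^ (2 * k))"
 let ?I = "\<integral>X:(Suc n),k. F (?L * X)"
 have "?I = (\<integral>x:1,k. \<integral>Y:n,k. F (?L * row_stack x Y))"
  by (rule nn_integral_row_stack_1) measurable
 also have "... = (\<integral>x:1,k. \<integral>Y:n,k. F (row_stack (a \<cdot>\<^sub>m x + b * Y) (D * Y)))"
 proof (intro nn_integral_cong)
  fix x Y assume xY: "x \<in> space (lmat 1 k)" "Y \<in> space (lmat n k)"
  have "0\<^sub>m n 1 * x + D * Y = D * Y" using xY Dc by simp
  then show "F (?L * row_stack x Y) = F (row_stack (a \<cdot>\<^sub>m x + b * Y) (D * Y))"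
   using bmat_mult_row_stack[of b n "0\<^sub>m n 1" D x k Y a] b Dc xY by simp
 qed
 also have "... = (\<integral>Y:n,k. \<integral>x:1,k. F (row_stack (a \<cdot>\<^sub>m x + b * Y) (D * Y)))"
  by (rule nn_integral_lmat_swap) measurable
 finally have 1: "?I = ..." .
 have "?ka * ?I = (\<integral>Y:n,k. ?ka * (\<integral>x:1,k. F (row_stack (a \<cdot>\<^sub>m x + b * Y) (D * Y))))"
  unfolding 1 by (rule nn_integral_cmult[symmetric]) measurable
 also have "... = (\<integral>Y:n,k. \<integral>x:1,k. F (row_stack x (D * Y)))"
 proof (rule nn_integral_cong)
  fix Y assume Y: "Y \<in> space (lmat n k)"
  then have [measurable]: "(\<lambda>w. Y) \<in> N \<rightarrow>\<^sub>M lmat n k" for N :: "'x measure" by simp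
  have "b * Y \<in> cmat 1 k" using Y b by auto
  moreover have "(\<lambda>x. F (row_stack x (D * Y))) \<in> bmeas (lmat 1 k)" by measurable
  ultimately show "?ka * (\<integral>x:1,k. F (row_stack (a \<cdot>\<^sub>m x + b * Y) (D * Y)))
    = (\<integral>x:1,k. F (row_stack x (D * Y)))"
   by (rule nn_integral_lmat_affine[OF a])
 qed
 finally have 2: "?ka * ?I = ..." .
 have "?kd * (?ka * ?I) = (\<integral>Y:n,k. \<integral>x:1,k. F (row_stack x Y))"
  unfolding 2 by (rule left_mult_jacobianD[OF D]) measurable
 also have "... = (\<integral>x:1,k. \<integral>Y:n,k. F (row_stack x Y))"
  by (rule nn_integral_lmat_swap) measurable
 also have "... = integral\<^sup>N (lmat (Suc n) k) F"
  by (rule nn_integral_row_stack_1[OF F', symmetric])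
 finally have 3: "?kd * (?ka * ?I) = integral\<^sup>N (lmat (Suc n) k) F" .
 have "ennreal (cmod (det ?L) ^ (2 * k)) = ?kd * ?ka"
  using b Dc by (simp add: det_bmat_lower_zero norm_mult power_mult_distrib ennreal_mult mult.commute)
 then show "ennreal (cmod (det ?L) ^ (2 * k)) * ?I = integral\<^sup>N (lmat (Suc n) k) F"
  using 3 by (simp only: mult.assoc)
qed

text \<open>LU elimination by induction over the size: a nonzero pivot splits M into a lower
  unipotent and an upper block triangular factor. A zero pivot is repaired by adding another row to
  the first.\<close>

lemma left_mult_jacobian_invertible:
 assumes "M \<in> cmat n n" "det M ~= 0"
 shows "left_mult_jacobian n k M"
 using assms
proof (induction n arbitrary: M)
 case 0
 then have "M * X = X" if "X \<in> cmat 0 k" for X using that by (intro eq_matI) auto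
 then have "(\<integral>X:0,k. F (M * X)) = integral\<^sup>N (lmat 0 k) F" for F
  by (intro nn_integral_cong) auto
 then show ?case using 0 by (simp add: left_mult_jacobian_def)
next
 case (Suc n)
 have pivot: "left_mult_jacobian (Suc n) k M"
  if M: "M = bmat a b c D" "a ~= 0" "b \<in> cmat 1 n" "c \<in> cmat n 1" "D \<in> cmat n n"
   and d: "det M ~= 0" for M a b c D
 proof -
  let ?c = "(1 / a) \<cdot>\<^sub>m c"
  \<comment> \<open>The Schur complement of the pivot; it is invertible because det M = a det
    \<open>?D\<close>.\<close>
  let ?D = "D + (- 1) \<cdot>\<^sub>m (?c * b)"
  let ?L = "bmat 1 (0\<^sub>m 1 n) ?c (1\<^sub>m n)" and ?U = "bmat a b (0\<^sub>m n 1) ?D"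
  have c: "?c * b \<in> cmat n n" "?c \<in> cmat n 1" "?D \<in> cmat n n" using M by auto
  have 1: "a \<cdot>\<^sub>m ?c = c" using M by (intro eq_matI) auto
  have 2: "?c * b + ?D = D" using M c by (intro eq_matI) auto
  have 3: "1 \<cdot>\<^sub>m b = b" using M by (intro eq_matI) auto
  have "?L * ?U = bmat (1 * a + (0\<^sub>m 1 n * 0\<^sub>m n 1) $$ (0, 0)) (1 \<cdot>\<^sub>m b + 0\<^sub>m 1 n * ?D)
    (a \<cdot>\<^sub>m ?c + 1\<^sub>m n * 0\<^sub>m n 1) (?c * b + 1\<^sub>m n * ?D)"
   by (rule bmat_mult) (use M c in auto)
  also have "... = bmat a b c D"
   unfolding 1 3 left_mult_zero_mat[OF c(3)] left_mult_one_mat[OF c(3)] 2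
   using M by simp
  finally have "?L * ?U = M" using M by simp
  moreover have "left_mult_jacobian (Suc n) k (?L * ?U)"
  proof (rule left_mult_jacobian_mult)
   show "left_mult_jacobian (Suc n) k ?L" using c by (intro left_mult_jacobian_lower)
   have "det (?L * ?U) = a * det ?D"
    using M c by (subst det_mult[of _ "Suc n"]) (simp_all add: det_bmat_upper_zero det_bmat_lower_zero)
   then have "det ?D ~= 0" using d \<open>?L * ?U = M\<close> by auto
   then show "left_mult_jacobian (Suc n) k ?U"
    using Suc.IH[OF c(3)] M by (intro left_mult_jacobian_upper)
  qed
  ultimately show ?thesis by simp
 qed
 obtain a b c D where M: "b \<in> cmat 1 n" "c \<in> cmat n 1" "D \<in> cmat n n" "M = bmat a b c D"
  using bmat_cases[OF Suc.prems(1)] by metis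
 show ?case
 proof (cases "a = 0")
  case False
  then show ?thesis using pivot M Suc.prems by blast
 next
  case True
  have "c ~= 0\<^sub>m n 1" using Suc.prems(2) M True by (auto simp: det_bmat_lower_zero)
  then obtain i where i: "i < n" "c $$ (i, 0) ~= 0"
   using M(2) by (auto simp: mat_eq_iff One_nat_def)
  \<comment> \<open>Adding the row of \<open>(c, D)\<close> with index i, whose first entry is
    nonzero, to the first row of M makes the corner nonzero. \<open>?e'\<close> undoes the
    addition.\<close>
  let ?e = "Matrix.mat 1 n (\<lambda>(_, j). if j = i then 1 else 0 :: complex)"
  let ?e' = "(- 1) \<cdot>\<^sub>m ?e"
  let ?E = "bmat 1 ?e (0\<^sub>m n 1) (1\<^sub>m n)" and ?E' = "bmat 1 ?e' (0\<^sub>m n 1) (1\<^sub>m n)"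
  have e: "?e \<in> cmat 1 n" "?e' \<in> cmat 1 n" by auto
  have one: "left_mult_jacobian n k (1\<^sub>m n)"
  proof -
   have "(\<integral>X:n,k. F (1\<^sub>m n * X)) = integral\<^sup>N (lmat n k) F" for F
    by (intro nn_integral_cong) auto
   then show ?thesis by (simp add: left_mult_jacobian_def)
  qed
  have "(?e * c) $$ (0, 0) = (\<Sum>j = 0..<n. (if j = i then 1 else 0) * c $$ (j, 0))"
   using M(2) by (auto simp: scalar_prod_def One_nat_def intro!: sum.cong)
  also have "... = c $$ (i, 0)" using i by (simp add: if_distrib[of "\<lambda>x. x * _"] cong: if_cong)
  finally have ec: "(?e * c) $$ (0, 0) ~= 0" using i by simp
  have EM: "?E * M = bmat ((?e * c) $$ (0, 0)) (1 \<cdot>\<^sub>m b + ?e * D) (a \<cdot>\<^sub>m 0\<^sub>m n 1 + 1\<^sub>m n * c) (0\<^sub>m n 1 * b + 1\<^sub>m n * D)"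
   unfolding M(4) using bmat_mult[of ?e n "0\<^sub>m n 1" "1\<^sub>m n" b c D 1 a] M e True by simp
  have dE: "det ?E = 1" using e by (simp add: det_bmat_lower_zero)
  have "left_mult_jacobian (Suc n) k (?E * M)"
  proof (rule pivot[OF EM ec])
   show "det (?E * M) ~= 0"
    using Suc.prems dE by (subst det_mult[of _ "Suc n"]) auto
  qed (use M e in auto)
  moreover have "left_mult_jacobian (Suc n) k ?E'"
   using e one by (intro left_mult_jacobian_upper) auto
  ultimately have "left_mult_jacobian (Suc n) k (?E' * (?E * M))"
   by (rule left_mult_jacobian_mult[rotated])
  moreover have "?E' * (?E * M) = M"
  proof -
   have "?e' * 1\<^sub>m n = ?e'" using e(2) by (rule right_mult_one_mat)
   then have z: "1 \<cdot>\<^sub>m ?e + ?e' * 1\<^sub>m n = 0\<^sub>m 1 n"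
    by (simp only:) (intro eq_matI; auto)
   have "?E' * ?E = bmat (1 * 1 + (?e' * 0\<^sub>m n 1) $$ (0, 0)) (1 \<cdot>\<^sub>m ?e + ?e' * 1\<^sub>m n)
    (1 \<cdot>\<^sub>m 0\<^sub>m n 1 + 1\<^sub>m n * 0\<^sub>m n 1) (0\<^sub>m n 1 * ?e + 1\<^sub>m n * 1\<^sub>m n)"
    by (rule bmat_mult) (use e in auto)
   also have "... = bmat 1 (0\<^sub>m 1 n) (0\<^sub>m n 1) (1\<^sub>m n)"
    unfolding z using e by simp
   also have "... = 1\<^sub>m (Suc n)" by (intro eq_matI) (auto simp: bmat_def One_nat_def)
   finally have "?E' * ?E = 1\<^sub>m (Suc n)" .
   moreover have "?E' * (?E * M) = ?E' * ?E * M"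
    using Suc.prems(1) by (intro assoc_mult_mat[symmetric, of _ "Suc n" "Suc n" _ "Suc n" _ "Suc n"]) auto
   ultimately show ?thesis using Suc.prems(1) by simp
  qed
  ultimately show ?thesis by simp
 qed
qed

lemma nn_integral_left_mult:
 assumes "M \<in> cmat m m" "det M ~= 0" "F \<in> bmeas (lmat m k)"
 shows "ennreal (cmod (det M) ^ (2 * k)) * (\<integral>X:m,k. F (M * X)) = integral\<^sup>N (lmat m k) F"
 using left_mult_jacobianD[OF left_mult_jacobian_invertible[OF assms(1,2)] assms(3)] .

lemma nn_integral_right_mult:
 assumes M: "M \<in> cmat m m" "det M ~= 0" and F: "F \<in> bmeas (lmat k m)"
 shows "ennreal (cmod (det M) ^ (2 * k)) * (\<integral>X:k,m. F (X * M)) = integral\<^sup>N (lmat k m) F"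
proof -
 let ?T = "Matrix.transpose_mat :: complex mat => complex mat"
 have MT: "?T M \<in> cmat m m" "det (?T M) ~= 0"
  using M by (simp_all add: det_transpose)
 have [measurable]: "(\<lambda>w. M) \<in> N \<rightarrow>\<^sub>M lmat m m" for N :: "'x measure" using M by simp
 have 1: "(\<lambda>X. F (?T X)) \<in> bmeas (lmat m k)"
  using F by measurable
 have 2: "(\<lambda>X. F (X * M)) \<in> bmeas (lmat k m)"
  using F by measurable
 have "(\<integral>X:k,m. F (X * M)) = (\<integral>X:m,k. F (?T X * M))"
  using nn_integral_lmat_transpose[OF 2] by simp
 also have "... = (\<integral>X:m,k. F (?T (?T M * X)))"
  using M by (intro nn_integral_cong arg_cong[where f = F]) (simp add: transpose_mult[of _ m m _ k])
 finally have "ennreal (cmod (det M) ^ (2 * k)) * (\<integral>X:k,m. F (X * M))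
   = (\<integral>X:m,k. F (?T X))"
  using nn_integral_left_mult[OF MT 1] M by (simp add: det_transpose)
 also have "... = integral\<^sup>N (lmat k m) F"
  by (rule nn_integral_lmat_transpose[OF F])
 finally show ?thesis .
qed

section \<open>Measurable enumeration of eigenvalues\<close>

text \<open>An existential quantifier over an uncountable set is made countable. On a compact set a
  nonnegative continuous function has a zero exactly when its values on a countable dense subset
  come arbitrarily close to zero; the closed set K is exhausted by its intersections with
  balls.\<close>

lemma sets_exists_zero:
 fixes G :: "'a => complex => real"
 assumes K: "closed K"
  and cont: "\<And>s. s \<in> space N ==> continuous_on UNIV (G s)"
  and nonneg: "\<And>s z. s \<in> space N ==> 0 \<le> G s z"
  and meas: "\<And>z. (\<lambda>s. G s z) \<in> bmeas N"
 shows "{s \<in> space N. \<exists>z\<in>K. G s z = 0} \<in> sets N"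
proof -
 have cpt: "{s \<in> space N. \<exists>z\<in>L. G s z = 0} \<in> sets N" if L: "compact L" for L
 proof -
  obtain T where T: "countable T" "T \<subseteq> L" "L \<subseteq> closure T" using separable[of L] by metis
  have "{s \<in> space N. \<exists>z\<in>L. G s z = 0}
    = {s \<in> space N. \<forall>m::nat. \<exists>d\<in>T. G s d < 1 / real (Suc m)}"
  proof (intro equalityI subsetI)
   fix s assume "s \<in> {s \<in> space N. \<exists>z\<in>L. G s z = 0}"
   then obtain z where s: "s \<in> space N" "z \<in> L" "G s z = 0" by auto
   have "\<exists>d\<in>T. G s d < 1 / real (Suc m)" for m
   proof -
    have "open (G s -` {..<1 / real (Suc m)})"
    using cont[OF s(1)] by (intro open_vimage) auto
    moreover have "z \<in> G s -` {..<1 / real (Suc m)}" using s by auto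
    moreover have "z \<in> closure T" using s T by auto
    ultimately have "T \<inter> G s -` {..<1 / real (Suc m)} ~= {}"
    by (metis closure_iff_nhds_not_empty inf.commute order_refl)
    then show ?thesis by auto
   qed
   then show "s \<in> {s \<in> space N. \<forall>m::nat. \<exists>d\<in>T. G s d < 1 / real (Suc m)}" using s by auto
  next
   fix s assume "s \<in> {s \<in> space N. \<forall>m::nat. \<exists>d\<in>T. G s d < 1 / real (Suc m)}"
   then have s: "s \<in> space N" "\<And>m::nat. \<exists>d\<in>T. G s d < 1 / real (Suc m)" by auto
   have "L ~= {}" using s(2)[of 0] T by auto
   then obtain z where z: "z \<in> L" "\<And>y. y \<in> L ==> G s z \<le> G s y"
    using continuous_attains_inf[OF L, of "G s"] continuous_on_subset[OF cont[OF s(1)]] by auto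
   have "G s z < 1 / real (Suc m)" for m
    using s(2)[of m] T z(2) by (meson le_less_trans subsetD)
   then have "\<not> 0 < G s z"
    using reals_Archimedean[of "G s z"] by (metis inverse_eq_divide less_asym')
   then have "G s z = 0" using nonneg[OF s(1), of z] by simp
   then show "s \<in> {s \<in> space N. \<exists>z\<in>L. G s z = 0}" using s z by auto
  qed
  also have "... \<in> sets N"
  proof (intro sets.sets_Collect_countable_All sets.sets_Collect_countable_Ex' T(1))
   fix m :: nat and d
   show "{s \<in> space N. G s d < 1 / real (Suc m)} \<in> sets N"
    using meas[of d] by measurable
  qed
  finally show ?thesis .
 qed
 have "{s \<in> space N. \<exists>z\<in>K. G s z = 0} = (\<Union>k::nat. {s \<in> space N. \<exists>z\<in>K \<inter> cball 0 (real k). G s z = 0})"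
 proof (intro equalityI subsetI)
  fix s assume "s \<in> {s \<in> space N. \<exists>z\<in>K. G s z = 0}"
  then obtain z where s: "s \<in> space N" "z \<in> K" "G s z = 0" by auto
  obtain k :: nat where "cmod z \<le> real k" using real_arch_simple by blast
  then show "s \<in> (\<Union>k::nat. {s \<in> space N. \<exists>z\<in>K \<inter> cball 0 (real k). G s z = 0})"
   using s by (auto intro!: exI[of _ k] bexI[of _ z])
 qed auto
 also have "... \<in> sets N"
  using K by (intro sets.countable_UN image_subsetI cpt closed_Int_compact) auto
 finally show ?thesis .
qed

section \<open>Measurable choice of roots\<close>

definition measurable_poly :: "'a measure => ('a => complex poly) => bool" where
 "measurable_poly N p \<longleftrightarrow> (\<forall>i. (\<lambda>s. coeff (p s) i) \<in> bmeas N)"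

lemma measurable_poly_eval:
 assumes p: "measurable_poly N p" and deg: "\<And>s. s \<in> space N ==> degree (p s) = n"
  and z: "z \<in> bmeas N"
 shows "(\<lambda>s. poly (p s) (z s)) \<in> bmeas N"
proof (rule measurable_eqI)
 show "poly (p s) (z s) = (\<Sum>i\<le>n. coeff (p s) i * z s ^ i)" if "s \<in> space N" for s
  using deg[OF that] by (simp add: poly_altdef)
 show "(\<lambda>s. \<Sum>i\<le>n. coeff (p s) i * z s ^ i) \<in> bmeas N"
  using p by (intro borel_measurable_sum borel_measurable_times borel_measurable_power z)
   (simp add: measurable_poly_def)
qed

text \<open>The lexicographically least root, real part first. The choice is measurable because a
  bound on its real part says that some root lies in a closed half-plane, and a bound on its
  imaginary part says the same of the roots with least real part.\<close>

definition min_root :: "complex poly => complex" where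
 "min_root p = (let r = Min (Re ` {z. poly p z = 0})
   in Complex r (Min (Im ` {z. poly p z = 0 \<and> Re z = r})))"

lemma min_root:
 assumes "degree p > 0"
 shows Re_min_root_le: "Re (min_root p) \<le> a \<longleftrightarrow> (\<exists>z. poly p z = 0 \<and> Re z \<le> a)"
  and Im_min_root_le: "Im (min_root p) \<le> b \<longleftrightarrow> (\<exists>z. poly p z = 0 \<and> Re z = Re (min_root p) \<and> Im z \<le> b)"
  and poly_min_root: "poly p (min_root p) = 0"
proof -
 let ?Z = "{z. poly p z = 0}"
 define r where "r = Min (Re ` ?Z)"
 let ?Y = "{z. poly p z = 0 \<and> Re z = r}"
 have p0: "p ~= 0" using assms by auto
 have fZ: "finite ?Z" using p0 by (rule poly_roots_finite)
 have "\<not> constant (poly p)" using assms by (simp add: constant_degree)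
 then have nZ: "?Z ~= {}" using Fundamental_Theorem_Algebra.fundamental_theorem_of_algebra by auto
 have fY: "finite ?Y" using fZ by (rule rev_finite_subset) auto
 have "r \<in> Re ` ?Z" using fZ nZ unfolding r_def by (intro Min_in) auto
 then have nY: "?Y ~= {}" by auto
 have mr: "Re (min_root p) = r" "Im (min_root p) = Min (Im ` ?Y)"
  by (simp_all add: min_root_def r_def Let_def)
 show "Re (min_root p) \<le> a \<longleftrightarrow> (\<exists>z. poly p z = 0 \<and> Re z \<le> a)"
  unfolding mr r_def using fZ nZ by (subst Min_le_iff) auto
 show "Im (min_root p) \<le> b \<longleftrightarrow> (\<exists>z. poly p z = 0 \<and> Re z = Re (min_root p) \<and> Im z \<le> b)"
  unfolding mr using fY nY by (subst Min_le_iff) auto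
 have "Min (Im ` ?Y) \<in> Im ` ?Y" using fY nY by (intro Min_in) auto
 then obtain z where z: "poly p z = 0" "Re z = r" "Im z = Min (Im ` ?Y)" by auto
 then have "min_root p = z" using mr by (simp add: complex_eq_iff)
 then show "poly p (min_root p) = 0" using z by simp
qed

lemma measurable_min_root:
 assumes p: "measurable_poly N p" and deg: "\<And>s. s \<in> space N ==> degree (p s) = Suc n"
 shows "(\<lambda>s. min_root (p s)) \<in> bmeas N"
proof -
 have pe: "(\<lambda>s. poly (p s) z) \<in> bmeas N" for z
  using measurable_poly_eval[OF p deg, of "\<lambda>_. z"] by auto
 have re: "(\<lambda>s. Re (min_root (p s))) \<in> bmeas N"
 proof (rule borel_measurableI_le)
  fix a
  have "{s \<in> space N. Re (min_root (p s)) \<le> a} = {s \<in> space N. \<exists>z\<in>{z. Re z \<le> a}. cmod (poly (p s) z) = 0}"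
   using deg by (auto simp: Re_min_root_le)
  also have "... \<in> sets N"
   using pe by (intro sets_exists_zero closed_halfspace_Re_le continuous_intros) auto
  finally show "{s \<in> space N. Re (min_root (p s)) \<le> a} \<in> sets N" .
 qed
 have im: "(\<lambda>s. Im (min_root (p s))) \<in> bmeas N"
 proof (rule borel_measurableI_le)
  fix b
  \<comment> \<open>Being a root and having the least real part are merged into the vanishing of one
    nonnegative continuous function of z.\<close>
  have "{s \<in> space N. Im (min_root (p s)) \<le> b} =
    {s \<in> space N. \<exists>z\<in>{z. Im z \<le> b}. cmod (poly (p s) z) + \<bar>Re z - Re (min_root (p s))\<bar> = 0}"
   using deg by (auto simp: Im_min_root_le add_nonneg_eq_0_iff)
  also have "... \<in> sets N"
   using pe re by (intro sets_exists_zero closed_halfspace_Im_le continuous_intros) auto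
  finally show "{s \<in> space N. Im (min_root (p s)) \<le> b} \<in> sets N" .
 qed
 have "(\<lambda>s. Complex (Re (min_root (p s))) (Im (min_root (p s)))) \<in> bmeas N"
  unfolding Complex_eq using re im by measurable
 then show ?thesis by simp
qed

lemma coeff_synthetic_div:
 fixes p :: "complex poly"
 shows "coeff (synthetic_div p c) i = coeff p (Suc i) + c * coeff (synthetic_div p c) (Suc i)"
proof -
 have "coeff p (Suc i) = coeff ([:- c, 1:] * synthetic_div p c + [:poly p c:]) (Suc i)"
  by (simp only: synthetic_div_correct')
 then show ?thesis by (simp add: algebra_simps)
qed

text \<open>By Horner's recursion each coefficient of the quotient comes from the next higher one,
  so the induction runs downwards from index n, where the coefficients of the quotient
  vanish.\<close>

lemma measurable_synthetic_div:
 assumes p: "measurable_poly N p" and deg: "\<And>s. s \<in> space N ==> degree (p s) = n"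
  and z: "z \<in> bmeas N"
 shows "measurable_poly N (\<lambda>s. synthetic_div (p s) (z s))"
 unfolding measurable_poly_def
proof
 fix i
 show "(\<lambda>s. coeff (synthetic_div (p s) (z s)) i) \<in> bmeas N"
 proof (induction "n - i" arbitrary: i)
  case 0
  have "coeff (synthetic_div (p s) (z s)) i = 0" if "s \<in> space N" for s
  proof (cases "synthetic_div (p s) (z s) = 0")
   case False
   then have "degree (p s) ~= 0" by (simp add: synthetic_div_eq_0_iff)
   then show ?thesis using 0 deg[OF that] by (intro coeff_eq_0) (simp add: degree_synthetic_div)
  qed simp
  then show ?case by (rule measurable_eqI[where g = "\<lambda>_. 0"]) simp_all
 next
  case (Suc k)
  then have "(\<lambda>s. coeff (synthetic_div (p s) (z s)) (Suc i)) \<in> bmeas N" by simp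
  moreover have "(\<lambda>s. coeff (p s) (Suc i)) \<in> bmeas N"
   using p by (simp add: measurable_poly_def)
  ultimately have "(\<lambda>s. coeff (p s) (Suc i) + z s * coeff (synthetic_div (p s) (z s)) (Suc i)) \<in> bmeas N"
   by (intro borel_measurable_add borel_measurable_times z)
  then show ?case by (simp only: coeff_synthetic_div[of _ _ i])
 qed
qed

text \<open>Repeated deflation: the least root is listed and its linear factor divided out. The
  explicit length makes this a recursion over natural numbers.\<close>

fun root_list :: "nat => complex poly => complex list" where
 "root_list 0 p = []"
| "root_list (Suc n) p = min_root p # root_list n (synthetic_div p (min_root p))"

lemma length_root_list [simp]: "length (root_list n p) = n"
 by (induction n arbitrary: p) auto

lemma mset_root_list: "p ~= 0 ==> degree p = n ==> mset (root_list n p) = proots p"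
proof (induction n arbitrary: p)
 case 0
 then obtain c where "p = [:c:]" by (metis degree_eq_zeroE)
 then show ?case by simp
next
 case (Suc n)
 let ?z = "min_root p"
 let ?q = "synthetic_div p ?z"
 have "poly p ?z = 0" using Suc.prems by (intro poly_min_root) simp
 then have p: "p = [:- ?z, 1:] * ?q" using synthetic_div_correct'[of ?z p] by simp
 have q: "?q ~= 0" using Suc.prems by (simp add: synthetic_div_eq_0_iff)
 have "degree ?q = n" using Suc.prems(2) by (simp add: degree_synthetic_div)
 then have "mset (root_list n ?q) = proots ?q" using Suc.IH q by blast
 moreover have "proots ([:- ?z, 1:] * ?q) = add_mset ?z (proots ?q)"
  using q by (subst proots_mult) auto
 then have "proots p = add_mset ?z (proots ?q)" by (simp only: p[symmetric])
 ultimately show ?case by simp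
qed

lemma measurable_root_list:
 assumes "measurable_poly N p" "\<And>s. s \<in> space N ==> degree (p s) = n" "i < n"
 shows "(\<lambda>s. root_list n (p s) ! i) \<in> bmeas N"
 using assms
proof (induction n arbitrary: p i)
 case (Suc n)
 have mr: "(\<lambda>s. min_root (p s)) \<in> bmeas N"
  using Suc.prems by (intro measurable_min_root) auto
 show ?case
 proof (cases i)
  case 0
  then show ?thesis using mr by simp
 next
  case (Suc j)
  have "measurable_poly N (\<lambda>s. synthetic_div (p s) (min_root (p s)))"
   using Suc.prems mr by (intro measurable_synthetic_div) auto
  then have "(\<lambda>s. root_list n (synthetic_div (p s) (min_root (p s))) ! j) \<in> bmeas N"
   using Suc.prems Suc by (intro Suc.IH) (auto simp: degree_synthetic_div)
  then show ?thesis using Suc by simp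
 qed
qed simp

lemma measurable_poly_mult:
 assumes "measurable_poly N p" "measurable_poly N q"
 shows "measurable_poly N (\<lambda>s. p s * q s)"
 using assms unfolding measurable_poly_def coeff_mult
 by (auto intro!: borel_measurable_sum borel_measurable_times)

lemma measurable_poly_const: "measurable_poly N (\<lambda>_. p)"
 by (simp add: measurable_poly_def)

lemma measurable_poly_sum:
 "(\<And>i. i \<in> I ==> measurable_poly N (p i)) ==> measurable_poly N (\<lambda>s. \<Sum>i\<in>I. p i s)"
 unfolding measurable_poly_def coeff_sum by (auto intro!: borel_measurable_sum)

lemma measurable_poly_prod:
 "(\<And>i. i \<in> I ==> measurable_poly N (p i)) ==> measurable_poly N (\<lambda>s. \<Prod>i\<in>I. p i s)"
 by (induction I rule: infinite_finite_induct) (auto intro!: measurable_poly_mult simp: measurable_poly_const)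

lemma measurable_char_poly: "measurable_poly (lmat n n) char_poly"
proof -
 let ?g = "\<lambda>A. \<Sum>p\<in>{p. p permutes {0..<n}}. signof p * (\<Prod>i = 0..<n. [:- (A $$ (i, p i)), if i = p i then 1 else 0:])"
 have eq: "char_poly A = ?g A" if A: "A \<in> cmat n n" for A :: "complex mat"
 proof -
  have "char_poly A = (\<Sum>p\<in>{p. p permutes {0..<n}}. signof p * (\<Prod>i = 0..<n. char_poly_matrix A $$ (i, p i)))"
   unfolding char_poly_def using A by (intro det_def') simp
  also have "... = ?g A"
  proof (intro sum.cong prod.cong refl arg_cong2[where f = "(*)"])
   fix p i assume "p \<in> {p. p permutes {0..<n}}" "i \<in> {0..<n}"
   then have "i < n" "p i < n" using permutes_in_image[of p "{0..<n}" i] by auto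
   then show "char_poly_matrix A $$ (i, p i) = [:- (A $$ (i, p i)), if i = p i then 1 else 0:]"
    using A by (auto simp: char_poly_matrix_def)
  qed
  finally show ?thesis .
 qed
 have "measurable_poly (lmat n n) ?g"
 proof (intro measurable_poly_sum measurable_poly_mult measurable_poly_const measurable_poly_prod)
  fix p i assume "p \<in> {p. p permutes {0..<n}}" "i \<in> {0..<n}"
  then have "i < n" "p i < n" using permutes_in_image[of p "{0..<n}" i] by auto
  then have "(\<lambda>A. A $$ (i, p i)) \<in> bmeas (lmat n n)"
   by (intro meas_entry[where f = "\<lambda>A. A"]) auto
  then show "measurable_poly (lmat n n) (\<lambda>A. [:- (A $$ (i, p i)), if i = p i then 1 else 0:])"
   unfolding measurable_poly_def by (auto simp: coeff_pCons split: nat.splits)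
 qed
 then show ?thesis
  unfolding measurable_poly_def
 proof (intro allI)
  fix i assume m: "\<forall>i. (\<lambda>s. coeff (?g s) i) \<in> bmeas (lmat n n)"
  show "(\<lambda>s. coeff (char_poly s) i) \<in> bmeas (lmat n n)"
  proof (rule measurable_eqI)
   show "(\<lambda>s. coeff (?g s) i) \<in> bmeas (lmat n n)" using m by (rule spec)
  qed (simp only: eq space_lmat)
 qed
qed

definition eigenvalue_vector :: "nat => complex mat => nat => complex" where
 "eigenvalue_vector n A = (\<lambda>i\<in>{..<n}. root_list n (char_poly A) ! i)"

lemma char_poly_nonzero: "A \<in> cmat n n ==> char_poly A ~= 0" for A :: "complex mat"
 using degree_monic_char_poly[of A n] by auto

lemma measurable_eigenvalue_vector [measurable (raw)]:
 assumes "f \<in> N \<rightarrow>\<^sub>M lmat n n"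
 shows "(\<lambda>w. eigenvalue_vector n (f w)) \<in> N \<rightarrow>\<^sub>M lpow n"
proof -
 have "(\<lambda>A. root_list n (char_poly A) ! i) \<in> bmeas (lmat n n)" if "i < n" for i
  using measurable_char_poly that degree_monic_char_poly[of _ n] by (intro measurable_root_list) auto
 then have "eigenvalue_vector n \<in> lmat n n \<rightarrow>\<^sub>M lpow n"
  unfolding eigenvalue_vector_def by (intro measurable_restrict) auto
 from measurable_compose[OF assms this] show ?thesis .
qed

lemma eigenvalue_vector:
 assumes "A \<in> cmat n n"
 shows "eigenvalues A = mset (map (eigenvalue_vector n A) [0..<n])"
proof -
 have "map (eigenvalue_vector n A) [0..<n] = root_list n (char_poly A)"
  by (intro nth_equalityI) (auto simp: eigenvalue_vector_def)
 then show ?thesis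
  using mset_root_list[of "char_poly A" n] degree_monic_char_poly[of A n] assms char_poly_nonzero[OF assms]
  by (simp add: eigenvalues_def)
qed

text \<open>No sigma-algebra is put on multisets; a functional counts as measurable when it is so on
  vectors of every length. Such functionals are symmetric in the vector, so the order in which
  \<open>eigenvalue_vector\<close> lists the spectrum does not matter to them.\<close>

definition measurable_mset :: "(complex multiset => ennreal) => bool" where
 "measurable_mset f \<longleftrightarrow> (\<forall>n. (\<lambda>x. f (mset (map x [0..<n]))) \<in> bmeas (lpow n))"

lemma measurable_mset_eigenvalues:
 assumes f: "measurable_mset f" and g: "g \<in> N \<rightarrow>\<^sub>M lmat n n"
 shows "(\<lambda>w. f (eigenvalues (g w))) \<in> bmeas N"
proof (rule measurable_eqI)
 show "f (eigenvalues (g w)) = f (mset (map (eigenvalue_vector n (g w)) [0..<n]))" if "w \<in> space N" for w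
  using measurable_carrier[OF g that] by (simp add: eigenvalue_vector)
 show "(\<lambda>w. f (mset (map (eigenvalue_vector n (g w)) [0..<n]))) \<in> bmeas N"
  using f by (intro measurable_compose[OF measurable_eigenvalue_vector[OF g]] measurable_mset_def[THEN iffD1, rule_format])
qed

section \<open>Simple spectrum almost everywhere\<close>

text \<open>Tonelli, in the order that makes the scalar variable innermost: the other blocks are
  then fixed while the corner is exchanged for an eigenvalue.\<close>

lemma nn_integral_reorder_lmat:
 assumes f: "(\<lambda>(a, b, c, D). f a b c D) \<in> bmeas
   (clborel \<Otimes>\<^sub>M (lmat p q \<Otimes>\<^sub>M (lmat r s \<Otimes>\<^sub>M lmat t u)))"
 shows "(\<integral>a:\<C>. \<integral>b:p,q. \<integral>c:r,s. \<integral>D:t,u. f a b c D) =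
  (\<integral>D:t,u. \<integral>c:r,s. \<integral>b:p,q. \<integral>a:\<C>. f a b c D)"
proof -
 have [measurable (raw)]: "(\<lambda>w. f (A w) (B w) (C w) (D w)) \<in> bmeas N"
  if "A \<in> bmeas N" "B \<in> N \<rightarrow>\<^sub>M lmat p q" "C \<in> N \<rightarrow>\<^sub>M lmat r s" "D \<in> N \<rightarrow>\<^sub>M lmat t u"
  for N :: "'x measure" and A B C D
 proof -
  have "(\<lambda>w. (A w, B w, C w, D w)) \<in> N \<rightarrow>\<^sub>M lborel \<Otimes>\<^sub>M (lmat p q \<Otimes>\<^sub>M (lmat r s \<Otimes>\<^sub>M lmat t u))"
   using that by (intro measurable_Pair) auto
  from measurable_compose[OF this f] show ?thesis by simp
 qed
 have "(\<integral>a:\<C>. \<integral>b:p,q. \<integral>c:r,s. \<integral>D:t,u. f a b c D) =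
  (\<integral>b:p,q. \<integral>a:\<C>. \<integral>c:r,s. \<integral>D:t,u. f a b c D)"
  by (rule nn_integral_lborel_lmat_swap) measurable
 also have "... = (\<integral>b:p,q. \<integral>c:r,s. \<integral>a:\<C>. \<integral>D:t,u. f a b c D)"
  by (intro nn_integral_cong nn_integral_lborel_lmat_swap) measurable
 also have "... = (\<integral>c:r,s. \<integral>b:p,q. \<integral>a:\<C>. \<integral>D:t,u. f a b c D)"
  by (rule nn_integral_lmat_swap) measurable
 also have "... = (\<integral>c:r,s. \<integral>b:p,q. \<integral>D:t,u. \<integral>a:\<C>. f a b c D)"
  by (intro nn_integral_cong nn_integral_lborel_lmat_swap) measurable
 also have "... = (\<integral>c:r,s. \<integral>D:t,u. \<integral>b:p,q. \<integral>a:\<C>. f a b c D)"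
  by (intro nn_integral_cong nn_integral_lmat_swap) measurable
 also have "... = (\<integral>D:t,u. \<integral>c:r,s. \<integral>b:p,q. \<integral>a:\<C>. f a b c D)"
  by (rule nn_integral_lmat_swap) measurable
 finally show ?thesis .
qed

text \<open>Tonelli along lines parallel to E. Translation by t E preserves the measure, so the
  exceptional set has the measure of each of its translates. Averaging over t in the unit disc and
  integrating over t first gives zero, since countable sets are null and the disc is not.\<close>

lemma AE_lmat_line:
 assumes E: "E \<in> cmat m n"
  and S: "{X \<in> cmat m n. P X} \<in> sets (lmat m n)"
  and line: "\<And>X. X \<in> cmat m n ==> countable {t. P (X + t \<cdot>\<^sub>m E)}"
 shows "AE X in lmat m n. \<not> P X"
proof -
 define S where "S = {X \<in> cmat m n. P X}"
 let ?B = "ball 0 1 :: complex set"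
 have Sm [measurable]: "S \<in> sets (lmat m n)" unfolding S_def by (rule S)
 have [measurable]: "(\<lambda>w. E) \<in> N \<rightarrow>\<^sub>M lmat m n" for N :: "'x measure" using E by simp
 have tr: "(\<integral>X:m,n. indicator S (X + t \<cdot>\<^sub>m E)) = emeasure (lmat m n) S" for t
  using nn_integral_lmat_translate[of "t \<cdot>\<^sub>m E" m n "indicator S"] E Sm by simp
 have "fst \<in> bmeas (clborel \<Otimes>\<^sub>M lmat m n)" by simp
 then have "(\<lambda>p. snd p + fst p \<cdot>\<^sub>m E) \<in> clborel \<Otimes>\<^sub>M lmat m n \<rightarrow>\<^sub>M lmat m n"
  by (intro meas_add measurable_snd meas_smult meas_const E)
 then have 1: "(\<lambda>p. indicator S (snd p + fst p \<cdot>\<^sub>m E) :: ennreal) \<in> bmeas (clborel \<Otimes>\<^sub>M lmat m n)"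
  by (rule measurable_compose) (rule borel_measurable_indicator[OF Sm])
 have 2: "(\<lambda>p. indicator ?B (fst p) :: ennreal) \<in> bmeas (lborel \<Otimes>\<^sub>M lmat m n)"
  by (rule measurable_compose[OF measurable_fst]) (rule borel_measurable_indicator, simp)
 have m2: "(\<lambda>(t, X). indicator S (X + t \<cdot>\<^sub>m E) * indicator ?B t :: ennreal)
   \<in> bmeas (lborel \<Otimes>\<^sub>M lmat m n)"
  using measurable_times[OF 1 2] by (simp only: case_prod_unfold)
 have "emeasure (lmat m n) S * emeasure lborel ?B
   = (\<integral>t:\<C>. (\<integral>X:m,n. indicator S (X + t \<cdot>\<^sub>m E)) * indicator ?B t)"
  unfolding tr by (subst nn_integral_cmult_indicator) simp_all
 also have "... = (\<integral>t:\<C>. \<integral>X:m,n. indicator S (X + t \<cdot>\<^sub>m E) * indicator ?B t)"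
  by (intro nn_integral_cong nn_integral_multc[symmetric]) measurable
 also have "... = (\<integral>X:m,n. \<integral>t:\<C>. indicator S (X + t \<cdot>\<^sub>m E) * indicator ?B t)"
  using m2 by (rule nn_integral_lborel_lmat_swap)
 also have "... = (\<integral>X:m,n. 0)"
 proof (rule nn_integral_cong_mat)
  fix X :: "complex mat" assume X: "X \<in> cmat m n"
  have "AE t in lborel. t \<notin> {t. P (X + t \<cdot>\<^sub>m E)}"
   by (intro AE_not_in countable_imp_null_set_lborel line X)
  then have "AE t in lborel. indicator S (X + t \<cdot>\<^sub>m E) * indicator ?B t = (0 :: ennreal)"
   by eventually_elim (auto simp: S_def)
  from nn_integral_cong_AE[OF this]
  show "(\<integral>t:\<C>. indicator S (X + t \<cdot>\<^sub>m E) * indicator ?B t) = 0" by simp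
 qed
 finally have "emeasure (lmat m n) S * emeasure lborel ?B = 0" by simp
 moreover have "emeasure lborel ?B ~= 0"
 proof
  assume "emeasure lborel ?B = 0"
  then have "?B \<in> null_sets lborel" by auto
  then show False using open_not_negligible[of ?B]
   by (auto simp: negligible_iff_null_sets null_sets_completionI)
 qed
 ultimately have "S \<in> null_sets (lmat m n)" by auto
 from AE_not_in[OF this] show ?thesis
  by (rule AE_mp) (intro AE_I2, auto simp: S_def)
qed

lemma poly_char_poly:
 fixes A :: "complex mat"
 assumes "A \<in> cmat n n"
 shows "poly (char_poly A) z = det (z \<cdot>\<^sub>m 1\<^sub>m n + (- 1) \<cdot>\<^sub>m A)"
proof -
 have "- char_matrix A z = z \<cdot>\<^sub>m 1\<^sub>m n + (- 1) \<cdot>\<^sub>m A"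
  using assms by (intro eq_matI) (auto simp: char_matrix_def)
 then show ?thesis by (simp add: char_poly_matrix[OF assms])
qed

text \<open>On a line in the direction of the identity the determinant vanishes only at the
  eigenvalues of -X.\<close>

lemma AE_det_nonzero: "AE X in lmat n n. det X ~= 0"
proof (rule AE_lmat_line)
 have "(\<lambda>X. X) \<in> lmat n n \<rightarrow>\<^sub>M lmat n n" by simp
 then have "{X \<in> space (lmat n n). det X = 0} \<in> sets (lmat n n)"
  by measurable
 then show "{X \<in> cmat n n. det X = 0} \<in> sets (lmat n n)" by simp
 fix X :: "complex mat" assume X: "X \<in> cmat n n"
 have "X + t \<cdot>\<^sub>m 1\<^sub>m n = t \<cdot>\<^sub>m 1\<^sub>m n + (- 1) \<cdot>\<^sub>m ((- 1) \<cdot>\<^sub>m X)" for t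
  using X by (intro eq_matI) auto
 then have "{t. det (X + t \<cdot>\<^sub>m 1\<^sub>m n) = 0} = {t. poly (char_poly ((- 1) \<cdot>\<^sub>m X)) t = 0}"
  using X by (simp add: poly_char_poly[of _ n])
 moreover have "finite {t. poly (char_poly ((- 1) \<cdot>\<^sub>m X)) t = 0}"
  using X by (intro poly_roots_finite char_poly_nonzero[of _ n]) auto
 ultimately show "countable {t. det (X + t \<cdot>\<^sub>m 1\<^sub>m n) = 0}" by (simp add: countable_finite)
qed simp

lemma nn_integral_cong_det:
 assumes "\<And>X. X \<in> carrier_mat n n ==> det X ~= 0 ==> F X = G X"
 shows "(\<integral>X:n,n. F X) = (\<integral>X:n,n. G X)"
 by (rule nn_integral_cong_AE, rule AE_mp[OF AE_det_nonzero AE_I2]) (use assms in simp)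

definition unit_mat :: "nat => nat => nat => nat => complex mat" where
 "unit_mat m n i j = Matrix.mat m n (\<lambda>p. if p = (i, j) then 1 else 0)"

lemma unit_mat_carrier [simp]: "unit_mat m n i j \<in> cmat m n"
 by (simp add: unit_mat_def)

text \<open>In the expansion along row i a single entry changes, and the cofactors of a row do not
  involve that row.\<close>

lemma det_add_unit_mat:
 assumes A: "A \<in> cmat n n" and ij: "i < n" "j < n"
 shows "det (A + t \<cdot>\<^sub>m unit_mat n n i j) = det A + t * cofactor A i j"
proof -
 let ?B = "A + t \<cdot>\<^sub>m unit_mat n n i j"
 have B: "?B \<in> cmat n n" using A by simp
 have "mat_delete ?B i k = mat_delete A i k" for k
  using A ij by (intro eq_matI) (auto simp: mat_delete_def unit_mat_def)
 then have cof: "cofactor ?B i k = cofactor A i k" for k by (simp add: cofactor_def)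
 have "det ?B = (\<Sum>k<n. A $$ (i, k) * cofactor A i k + (if k = j then t * cofactor A i k else 0))"
  unfolding laplace_expansion_row[OF B ij(1)] cof
  using A ij by (intro sum.cong) (auto simp: unit_mat_def algebra_simps)
 also have "... = det A + t * cofactor A i j"
  using ij by (simp add: sum.distrib laplace_expansion_row[OF A ij(1)])
 finally show ?thesis .
qed

lemma char_matrix_bmat:
 assumes "b \<in> cmat 1 n" "c \<in> cmat n 1" "D \<in> cmat n n"
 shows "z \<cdot>\<^sub>m 1\<^sub>m (Suc n) + (- 1) \<cdot>\<^sub>m bmat a b c D
  = bmat (z - a) ((- 1) \<cdot>\<^sub>m b) ((- 1) \<cdot>\<^sub>m c) (z \<cdot>\<^sub>m 1\<^sub>m n + (- 1) \<cdot>\<^sub>m D)"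
 using assms by (intro eq_matI) (auto simp: bmat_def One_nat_def)

lemma det_bmat_affine:
 assumes "b \<in> cmat 1 n" "c \<in> cmat n 1" "D \<in> cmat n n"
 shows "det (bmat (x + t) b c D) = det (bmat x b c D) + t * det D"
proof -
 have "bmat (x + t) b c D = bmat x b c D + t \<cdot>\<^sub>m unit_mat (Suc n) (Suc n) 0 0"
  using assms by (intro eq_matI) (auto simp: bmat_def unit_mat_def One_nat_def)
 moreover have "mat_delete (bmat x b c D) 0 0 = D"
  using assms by (intro eq_matI) (auto simp: mat_delete_def bmat_def One_nat_def)
 ultimately show ?thesis
  using assms by (simp add: det_add_unit_mat cofactor_def)
qed

text \<open>The corner occurs in one entry of zI - M only. Hence, for fixed remaining blocks and z
  not an eigenvalue of D, exactly one value of the corner makes z an eigenvalue; this is the basis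
  of the substitution of an eigenvalue for the corner.\<close>

lemma char_poly_bmat_affine:
 assumes "b \<in> cmat 1 n" "c \<in> cmat n 1" "D \<in> cmat n n"
 shows "char_poly (bmat a b c D) = char_poly (bmat 0 b c D) - Polynomial.smult a (char_poly D)"
proof -
 have "poly (char_poly (bmat a b c D)) z = poly (char_poly (bmat 0 b c D) - Polynomial.smult a (char_poly D)) z" for z
  using assms det_bmat_affine[of "(- 1) \<cdot>\<^sub>m b" n "(- 1) \<cdot>\<^sub>m c" "z \<cdot>\<^sub>m 1\<^sub>m n + (- 1) \<cdot>\<^sub>m D" z "- a"]
  by (simp add: poly_char_poly[of _ n] poly_char_poly[of _ "Suc n"] char_matrix_bmat)
 then show ?thesis by (simp add: poly_eq_poly_eq_iff[symmetric] fun_eq_iff)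
qed

lemma sets_zero_complex: "g \<in> bmeas N ==> {x \<in> space N. g x = (0 :: complex)} \<in> sets N"
 by measurable

text \<open>With zero corner the determinant is bilinear in b and c, and the product of their
  entries with index i has the given principal minor as coefficient, up to sign. Varying that entry
  of c makes the coefficient \<open>?g\<close> of the entry of b nonzero; varying the entry of b
  then makes the determinant nonzero.\<close>

lemma AE_det_bmat_nonzero:
 assumes Z: "Z \<in> cmat n n" and i: "i < n" and minor: "det (mat_delete Z i i) ~= 0"
 shows "AE c in lmat n 1. AE b in lmat 1 n. det (bmat 0 b c Z) ~= 0"
proof -
 let ?f = "\<lambda>b c. det (bmat 0 b c Z)"
 let ?g = "\<lambda>c. cofactor (bmat 0 (0\<^sub>m 1 n) c Z) 0 (Suc i)"
 have [measurable]: "(\<lambda>w. Z) \<in> N \<rightarrow>\<^sub>M lmat n n" "(\<lambda>w. unit_mat 1 n 0 i) \<in> N \<rightarrow>\<^sub>M lmat 1 n"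
  for N :: "'x measure" using Z by simp_all
 have fb: "?f (b + t \<cdot>\<^sub>m unit_mat 1 n 0 i) c = ?f b c + t * ?g c"
  if b: "b \<in> cmat 1 n" and c: "c \<in> cmat n 1" for b c t
 proof -
  have "bmat 0 (b + t \<cdot>\<^sub>m unit_mat 1 n 0 i) c Z = bmat 0 b c Z + t \<cdot>\<^sub>m unit_mat (Suc n) (Suc n) 0 (Suc i)"
   using b c Z i by (intro eq_matI) (auto simp: bmat_def unit_mat_def One_nat_def)
  moreover have "mat_delete (bmat 0 b c Z) 0 (Suc i) = mat_delete (bmat 0 (0\<^sub>m 1 n) c Z) 0 (Suc i)"
   using b c Z i by (intro eq_matI) (auto simp: mat_delete_def bmat_def One_nat_def)
  ultimately show ?thesis
   using b c Z i by (simp add: det_add_unit_mat cofactor_def)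
 qed
 have gdiff: "?g c = ?f (0\<^sub>m 1 n + 1 \<cdot>\<^sub>m unit_mat 1 n 0 i) c - ?f (0\<^sub>m 1 n) c" if "c \<in> cmat n 1" for c
  using fb[of "0\<^sub>m 1 n" c 1] that by simp
 have gm: "?g \<in> bmeas (lmat n 1)"
 proof (rule measurable_eqI)
  show "?g c = ?f (0\<^sub>m 1 n + 1 \<cdot>\<^sub>m unit_mat 1 n 0 i) c - ?f (0\<^sub>m 1 n) c" if "c \<in> space (lmat n 1)" for c
   using that by (intro gdiff) simp
  show "(\<lambda>c. ?f (0\<^sub>m 1 n + 1 \<cdot>\<^sub>m unit_mat 1 n 0 i) c - ?f (0\<^sub>m 1 n) c) \<in> bmeas (lmat n 1)"
   using Z by (intro borel_measurable_diff meas_det[where n = "Suc n"] measurable_bmat measurable_idt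
    meas_const borel_measurable_const) simp_all
 qed
 have gc: "?g (c + s \<cdot>\<^sub>m unit_mat n 1 i 0) = ?g c + s * ((- 1) ^ (Suc i) * cofactor (mat_delete (bmat 0 (0\<^sub>m 1 n) c Z) 0 (Suc i)) i 0)"
  and hc: "cofactor (mat_delete (bmat 0 (0\<^sub>m 1 n) c Z) 0 (Suc i)) i 0 = (- 1) ^ i * det (mat_delete Z i i)"
  if c: "c \<in> cmat n 1" for c s
 proof -
  let ?A = "mat_delete (bmat 0 (0\<^sub>m 1 n) c Z) 0 (Suc i)"
  have A: "?A \<in> cmat n n"
   using c Z i mat_delete_carrier[of "bmat 0 (0\<^sub>m 1 n) c Z" "Suc n" "Suc n" 0 "Suc i"] by simp
  have "mat_delete (bmat 0 (0\<^sub>m 1 n) (c + s \<cdot>\<^sub>m unit_mat n 1 i 0) Z) 0 (Suc i) = ?A + s \<cdot>\<^sub>m unit_mat n n i 0"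
   using c Z i by (intro eq_matI) (auto simp: mat_delete_def bmat_def unit_mat_def One_nat_def)
  then show "?g (c + s \<cdot>\<^sub>m unit_mat n 1 i 0) = ?g c + s * ((- 1) ^ (Suc i) * cofactor ?A i 0)"
   using A i by (simp add: cofactor_def det_add_unit_mat algebra_simps)
  have "mat_delete ?A i 0 = mat_delete Z i i"
   using c Z i by (intro eq_matI) (auto simp: mat_delete_def bmat_def One_nat_def)
  then show "cofactor ?A i 0 = (- 1) ^ i * det (mat_delete Z i i)"
   by (simp add: cofactor_def)
 qed
 have single: "countable {t. x + t * y = 0}" if "y ~= 0" for x y :: complex
 proof -
  have "{t. x + t * y = 0} \<subseteq> {- x / y}" using that by (auto simp: field_simps add_eq_0_iff)
  then show ?thesis by (rule countable_subset) simp
 qed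
 have "AE c in lmat n 1. \<not> ?g c = 0"
 proof (rule AE_lmat_line[of "unit_mat n 1 i 0"])
  have "{c \<in> space (lmat n 1). ?g c = 0} \<in> sets (lmat n 1)"
    using gm by (rule sets_zero_complex)
  then show "{c \<in> cmat n 1. ?g c = 0} \<in> sets (lmat n 1)" by (simp only: space_lmat)
  show "countable {t. ?g (c + t \<cdot>\<^sub>m unit_mat n 1 i 0) = 0}" if "c \<in> cmat n 1" for c
   unfolding gc[OF that] hc[OF that] using minor by (intro single) simp
 qed simp
 then show ?thesis
 proof (rule AE_mp[OF _ AE_I2[OF impI]])
  fix c assume c: "c \<in> space (lmat n 1)" "\<not> ?g c = 0"
  then have [measurable]: "(\<lambda>w. c) \<in> N \<rightarrow>\<^sub>M lmat n 1" for N :: "'x measure" by simp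
  show "AE b in lmat 1 n. \<not> ?f b c = 0"
  proof (rule AE_lmat_line[of "unit_mat 1 n 0 i"])
   have "(\<lambda>b. ?f b c) \<in> bmeas (lmat 1 n)"
    using c Z by (intro meas_det[where n = "Suc n"] measurable_bmat measurable_idt
    meas_const borel_measurable_const) simp_all
   then have "{b \<in> space (lmat 1 n). ?f b c = 0} \<in> sets (lmat 1 n)"
    by (rule sets_zero_complex)
   then show "{b \<in> cmat 1 n. ?f b c = 0} \<in> sets (lmat 1 n)" by (simp only: space_lmat)
   show "countable {t. ?f (b + t \<cdot>\<^sub>m unit_mat 1 n 0 i) c = 0}" if "b \<in> cmat 1 n" for b
   proof -
    have "c \<in> cmat n 1" using c by simp
    note e = fb[OF that this]
    show ?thesis unfolding e using c(2) by (intro single)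
   qed
  qed simp
 qed
qed

text \<open>At an eigenvalue z of D the corner drops out of the bordered determinant, so the
  condition concerns b and c alone. Since z is a simple root, some principal minor of zI - D is
  nonzero, and only finitely many z have to be treated.\<close>

lemma AE_bmat_no_common_root:
 assumes D: "D \<in> cmat n n" "rsquarefree (char_poly D)"
 shows "AE c in lmat n 1. AE b in lmat 1 n. \<forall>a z. poly (char_poly D) z = 0 \<longrightarrow> poly (char_poly (bmat a b c D)) z ~= 0"
proof -
 let ?R = "{z. poly (char_poly D) z = 0}"
 have fR: "finite ?R" using D by (intro poly_roots_finite char_poly_nonzero[of _ n])
 have root: "AE c in lmat n 1. AE b in lmat 1 n. det (bmat 0 b c (z \<cdot>\<^sub>m 1\<^sub>m n + (- 1) \<cdot>\<^sub>m D)) ~= 0"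
  if z: "z \<in> ?R" for z
 proof -
  let ?Z = "z \<cdot>\<^sub>m 1\<^sub>m n + (- 1) \<cdot>\<^sub>m D"
  have Z: "?Z \<in> cmat n n" using D by simp
  \<comment> \<open>The derivative of a characteristic polynomial is the sum of the characteristic
    polynomials of the principal submatrices, so at a simple root one summand is nonzero.\<close>
  have "poly (pderiv (char_poly D)) z ~= 0" using D(2) z by (auto simp: rsquarefree_roots)
  then have "(\<Sum>i<n. poly (char_poly (mat_delete D i i)) z) ~= 0"
   by (simp add: pderiv_char_poly[OF D(1)] poly_sum)
  then obtain i where i: "i < n" "poly (char_poly (mat_delete D i i)) z ~= 0"
   by (metis (no_types, lifting) lessThan_iff sum.not_neutral_contains_not_neutral)
  have del: "mat_delete D i i \<in> cmat (n - 1) (n - 1)" using D i by (intro mat_delete_carrier)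
  have "z \<cdot>\<^sub>m 1\<^sub>m (n - 1) + (- 1) \<cdot>\<^sub>m mat_delete D i i = mat_delete ?Z i i"
   using D i by (intro eq_matI) (auto simp: mat_delete_def)
  then have minor: "det (mat_delete ?Z i i) ~= 0"
   using i(2) by (simp add: poly_char_poly[OF del])
  show ?thesis using AE_det_bmat_nonzero[OF Z i(1) minor] .
 qed
 have "AE c in lmat n 1. \<forall>z\<in>?R. AE b in lmat 1 n. det (bmat 0 b c (z \<cdot>\<^sub>m 1\<^sub>m n + (- 1) \<cdot>\<^sub>m D)) ~= 0"
  by (rule AE_finite_all[OF fR, THEN iffD2]) (intro ballI root)
 then show ?thesis
 proof (rule AE_mp[OF _ AE_I2[OF impI]])
  fix c assume c: "c \<in> space (lmat n 1)"
   "\<forall>z\<in>?R. AE b in lmat 1 n. det (bmat 0 b c (z \<cdot>\<^sub>m 1\<^sub>m n + (- 1) \<cdot>\<^sub>m D)) ~= 0"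
  have "AE b in lmat 1 n. \<forall>z\<in>?R. det (bmat 0 b c (z \<cdot>\<^sub>m 1\<^sub>m n + (- 1) \<cdot>\<^sub>m D)) ~= 0"
   by (rule AE_finite_all[OF fR, THEN iffD2]) (rule c(2))
  then show "AE b in lmat 1 n. \<forall>a z. poly (char_poly D) z = 0 \<longrightarrow> poly (char_poly (bmat a b c D)) z ~= 0"
  proof (rule AE_mp, intro AE_I2 impI allI)
   fix b a z
   assume b: "b \<in> space (lmat 1 n)"
    "\<forall>z\<in>?R. det (bmat 0 b c (z \<cdot>\<^sub>m 1\<^sub>m n + (- 1) \<cdot>\<^sub>m D)) ~= 0"
    and z: "poly (char_poly D) z = 0"
   let ?Z = "z \<cdot>\<^sub>m 1\<^sub>m n + (- 1) \<cdot>\<^sub>m D"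
   have car: "b \<in> cmat 1 n" "c \<in> cmat n 1" "?Z \<in> cmat n n" using b c D by auto
   have Z0: "det ?Z = 0" using z D by (simp add: poly_char_poly)
   \<comment> \<open>Conjugation by this diagonal sign matrix flips the signs of b and c, which zI -
     M carries and the statement on almost all b and c does not.\<close>
   let ?S = "bmat (- 1) (0\<^sub>m 1 n) (0\<^sub>m n 1) (1\<^sub>m n)"
   have sc: "((- 1) \<cdot>\<^sub>m c) * 0\<^sub>m 1 n = 0\<^sub>m n n" "(- 1) \<cdot>\<^sub>m ((- 1) \<cdot>\<^sub>m c) = c" "(-1) \<cdot>\<^sub>m ((-1) \<cdot>\<^sub>m b) = b"
    using car by (auto intro!: eq_matI)
   have "poly (char_poly (bmat a b c D)) z = det (bmat (z - a) ((- 1) \<cdot>\<^sub>m b) ((- 1) \<cdot>\<^sub>m c) ?Z)"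
    using car D by (simp add: poly_char_poly[of _ "Suc n"] char_matrix_bmat)
   also have "... = det (bmat 0 ((- 1) \<cdot>\<^sub>m b) ((- 1) \<cdot>\<^sub>m c) ?Z)"
    using det_bmat_affine[of "(- 1) \<cdot>\<^sub>m b" n "(- 1) \<cdot>\<^sub>m c" ?Z 0 "z - a"] car D Z0 by simp
   also have "bmat 0 ((- 1) \<cdot>\<^sub>m b) ((- 1) \<cdot>\<^sub>m c) ?Z = ?S * bmat 0 b c ?Z * ?S"
   proof -
    have 1: "?S * bmat 0 b c ?Z = bmat 0 ((- 1) \<cdot>\<^sub>m b) c ?Z"
    using bmat_mult[of "0\<^sub>m 1 n" n "0\<^sub>m n 1" "1\<^sub>m n" b c ?Z "- 1" 0] car D by simp
    have 2: "bmat 0 ((- 1) \<cdot>\<^sub>m b) c ?Z * ?S = bmat 0 ((- 1) \<cdot>\<^sub>m b) ((- 1) \<cdot>\<^sub>m c) ?Z"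
    using bmat_mult[of "(- 1) \<cdot>\<^sub>m b" n c ?Z "0\<^sub>m 1 n" "0\<^sub>m n 1" "1\<^sub>m n" 0 "- 1"] car D by simp
    show ?thesis by (simp only: 1 2)
   qed
   finally have eq: "poly (char_poly (bmat a b c D)) z = det (?S * bmat 0 b c ?Z * ?S)" .
   have "det (?S * bmat 0 b c ?Z * ?S) ~= 0"
   proof -
    have "?S \<in> cmat (Suc n) (Suc n)" "bmat 0 b c ?Z \<in> cmat (Suc n) (Suc n)" using car D by auto
    moreover have "det ?S ~= 0" by (simp add: det_bmat_lower_zero)
    moreover have "det (bmat 0 b c ?Z) ~= 0" using b z by auto
    ultimately show ?thesis by (simp add: det_mult[of _ "Suc n"] mult_carrier_mat[of _ "Suc n" "Suc n" _ "Suc n"])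
   qed
   then show "poly (char_poly (bmat a b c D)) z ~= 0" using eq by simp
  qed
 qed
qed

lemma not_distinct_iff_count: "\<not> distinct xs \<longleftrightarrow> (\<exists>a. 1 < count (mset xs) a)"
proof
 assume "\<not> distinct xs"
 then obtain a where a: "count (mset xs) a ~= (if a \<in> set xs then 1 else 0)"
  by (auto simp: distinct_count_atmost_1)
 then have "a \<in> set xs" by (auto simp: count_eq_zero_iff split: if_splits)
 then have "count (mset xs) a ~= 0" by (simp add: count_eq_zero_iff)
 moreover have "count (mset xs) a ~= 1" using a \<open>a \<in> set xs\<close> by simp
 ultimately have "1 < count (mset xs) a" by linarith
 then show "\<exists>a. 1 < count (mset xs) a" ..
next
 assume "\<exists>a. 1 < count (mset xs) a"
 then obtain a where a: "1 < count (mset xs) a" ..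
 show "\<not> distinct xs"
 proof
  assume "distinct xs"
  then have "count (mset xs) a = (if a \<in> set xs then 1 else 0)"
   by (simp only: distinct_count_atmost_1)
  then show False using a by (simp split: if_splits)
 qed
qed

text \<open>A characteristic polynomial fails to be squarefree when two entries of the measurable
  enumeration of its roots coincide.\<close>

lemma sets_not_rsquarefree:
 "{M \<in> cmat n n. \<not> rsquarefree (char_poly M)} \<in> sets (lmat n n)"
proof -
 define f :: "complex multiset => ennreal" where "f S = (if \<exists>a. 1 < count S a then 1 else 0)" for S
 have "measurable_mset f"
  unfolding measurable_mset_def
 proof
  fix n
  let ?B = "{x \<in> space (lpow n). \<exists>i\<in>{..<n}. \<exists>j\<in>{j. j < n \<and> i ~= j}. x i - x j = 0}"
  have "?B \<in> sets (lpow n)"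
  proof (intro sets.sets_Collect_countable_Ex')
   fix i j assume "i \<in> {..<n}" "j \<in> {j. j < n \<and> i ~= j}"
   then have "(\<lambda>x. x i) \<in> lpow n \<rightarrow>\<^sub>M lborel" "(\<lambda>x. x j) \<in> lpow n \<rightarrow>\<^sub>M lborel"
    by (auto intro: measurable_component_singleton)
   then have "(\<lambda>x. x i - x j) \<in> bmeas (lpow n)"
    by (intro borel_measurable_diff) simp_all
   then show "{x \<in> space (lpow n). x i - x j = 0} \<in> sets (lpow n)"
    by (rule sets_zero_complex)
  qed auto
  moreover have "f (mset (map x [0..<n])) = indicator ?B x" if "x \<in> space (lpow n)" for x
  proof -
   have "(\<exists>a. 1 < count (mset (map x [0..<n])) a) \<longleftrightarrow> \<not> inj_on x {0..<n}"
    unfolding not_distinct_iff_count[symmetric] by (simp add: distinct_map)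
   also have "... \<longleftrightarrow> x \<in> ?B"
   proof
    assume "\<not> inj_on x {0..<n}"
    then obtain i j where "i < n" "j < n" "x i = x j" "i ~= j" by (auto simp: inj_on_def)
    then show "x \<in> ?B" using that by (auto intro!: bexI[of _ i] exI[of _ j])
   next
    assume "x \<in> ?B"
    then obtain i j where "i < n" "j < n" "x i = x j" "i ~= j" by auto
    then show "\<not> inj_on x {0..<n}" by (auto dest: inj_onD[of x "{0..<n}" i j])
   qed
   finally show ?thesis by (simp only: f_def indicator_def of_bool_def)
  qed
  ultimately show "(\<lambda>x. f (mset (map x [0..<n]))) \<in> bmeas (lpow n)"
   by (intro measurable_eqI[OF _ borel_measurable_indicator])
 qed
 then have "(\<lambda>M. f (eigenvalues M)) \<in> bmeas (lmat n n)"
  by (rule measurable_mset_eigenvalues) (rule measurable_idt)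
 from measurable_sets[OF this, of "{1}"]
 have "(\<lambda>M. f (eigenvalues M)) -` {1} \<inter> cmat n n \<in> sets (lmat n n)"
  by (simp only: space_lmat) simp
 moreover have "(\<lambda>M. f (eigenvalues M)) -` {1} \<inter> cmat n n = {M \<in> cmat n n. \<not> rsquarefree (char_poly M)}"
 proof (intro equalityI subsetI)
  fix M assume "M \<in> (\<lambda>M. f (eigenvalues M)) -` {1} \<inter> cmat n n"
  then have M: "M \<in> cmat n n" "f (eigenvalues M) = 1" by auto
  then obtain a where "1 < count (eigenvalues M) a" by (auto simp: f_def split: if_splits)
  then have "1 < order a (char_poly M)"
   using char_poly_nonzero[OF M(1)] by (simp add: eigenvalues_def)
  then show "M \<in> {M \<in> cmat n n. \<not> rsquarefree (char_poly M)}"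
   using M by (auto simp: rsquarefree_def dest!: spec[of _ a])
 next
  fix M :: "complex mat" assume "M \<in> {M \<in> cmat n n. \<not> rsquarefree (char_poly M)}"
  then have M: "M \<in> cmat n n" "\<not> rsquarefree (char_poly M)" by auto
  then obtain a where "order a (char_poly M) ~= 0" "order a (char_poly M) ~= 1"
   using char_poly_nonzero[OF M(1)] by (auto simp: rsquarefree_def)
  then have "1 < count (eigenvalues M) a"
   using char_poly_nonzero[OF M(1)] by (simp add: eigenvalues_def)
  then show "M \<in> (\<lambda>M. f (eigenvalues M)) -` {1} \<inter> cmat n n"
   using M by (auto simp: f_def)
 qed
 ultimately show ?thesis by simp
qed

lemma card_roots_rsquarefree:
 fixes p :: "complex poly"
 assumes "rsquarefree p"
 shows "card {z. poly p z = 0} = degree p"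
proof -
 have p: "p ~= 0" using assms by (simp add: rsquarefree_def)
 have "degree p = size (proots p)" by (simp add: size_proots_complex)
 also have "... = (\<Sum>z\<in>set_mset (proots p). count (proots p) z)"
  by (rule size_multiset_overloaded_eq)
 also have "... = (\<Sum>z\<in>{z. poly p z = 0}. 1)"
 proof (rule sum.cong)
  show "set_mset (proots p) = {z. poly p z = 0}" using p by simp
  show "count (proots p) z = 1" if "z \<in> {z. poly p z = 0}" for z
   using assms that p by (auto simp: rsquarefree_def order_root dest!: spec[of _ z])
 qed
 finally show ?thesis by simp
qed

text \<open>At a root of P, where Q does not vanish, P' has order one less than P. Hence P'Q
  vanishes there to smaller order than PQ', and the two cannot be equal.\<close>

lemma wronskian_nonzero:
 fixes P Q :: "complex poly"
 assumes deg: "degree P = Suc n" and Q: "Q ~= 0" and cop: "\<And>z. poly Q z = 0 ==> poly P z ~= 0"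
 shows "pderiv P * Q - P * pderiv Q ~= 0"
proof
 assume "pderiv P * Q - P * pderiv Q = 0"
 then have eq: "pderiv P * Q = P * pderiv Q" by simp
 have P0: "P ~= 0" "pderiv P ~= 0" using deg by (auto simp: pderiv_eq_0_iff)
 have "\<not> constant (poly P)" using deg by (simp add: constant_degree)
 then obtain z where z: "poly P z = 0"
  using Fundamental_Theorem_Algebra.fundamental_theorem_of_algebra by blast
 then have Qz: "poly Q z ~= 0" using cop by blast
 have nz: "pderiv P * Q ~= 0" using P0 Q by simp
 have "order z (pderiv P) = order z (pderiv P * Q)"
  using nz Qz by (simp add: order_mult order_root)
 also have "... = order z P + order z (pderiv Q)"
  using nz unfolding eq by (rule order_mult)
 finally show False using order_pderiv[OF P0(1) z] by simp
qed

text \<open>P/Q has degree n + 1: its fibre over a consists of the roots of P - aQ, which are n + 1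
  simple roots for all but finitely many a. The area formula is applied away from poles and critical
  points, and the factor in the integrand is the squared modulus of the derivative of P/Q.\<close>

lemma nn_integral_rational_substitution:
 fixes P Q :: "complex poly" and F :: "complex => ennreal"
 assumes deg: "degree P = Suc n" "degree Q = n" and Q: "Q ~= 0"
  and cop: "\<And>z. poly Q z = 0 ==> poly P z ~= 0"
  and F: "F \<in> bmeas borel"
 shows "of_nat (Suc n) * (\<integral>a:\<C>. F a) =
  (\<integral>z:\<C>. ennreal ((cmod (poly (pderiv P * Q - P * pderiv Q) z / (poly Q z)^2))^2) * F (poly P z / poly Q z))"
proof -
 let ?W = "pderiv P * Q - P * pderiv Q"
 define g where "g = (\<lambda>z. poly P z / poly Q z)"
 have W: "?W ~= 0" by (rule wronskian_nonzero[OF deg(1) Q cop])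
 define G where "G = {z. poly (Q * ?W) z ~= 0}"
 have finC: "finite (- G)"
 proof -
  have "- G = {z. poly (Q * ?W) z = 0}" by (auto simp: G_def)
  then show ?thesis using Q W poly_roots_finite[of "Q * ?W"] by simp
 qed
 have G: "open G"
 proof -
  have "closed (- G)" using finC by (rule finite_imp_closed)
  then show ?thesis by (simp add: open_closed)
 qed
 have dg: "(g has_field_derivative poly ?W z / (poly Q z)^2) (at z)" if "z \<in> G" for z
 proof -
  have "poly Q z ~= 0" using that by (simp add: G_def)
  then show ?thesis unfolding g_def
   by (auto intro!: derivative_eq_intros poly_DERIV simp: power2_eq_square field_simps)
 qed
 \<comment> \<open>The critical values. A double root of P - aQ is a zero of the Wronskian
   \<open>?W\<close>, so over points outside N all roots are simple.\<close>
 define N where "N = g ` {z. poly ?W z = 0}"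
 have N: "N \<in> null_sets lborel"
  unfolding N_def using W by (intro finite_imp_null_set_lborel finite_imageI poly_roots_finite)
 have "of_nat (Suc n) * (\<integral>a:\<C>. F a) = (\<integral>\<^sup>+z\<in>G. ennreal ((cmod (deriv g z))^2) * F (g z) \<partial>lborel)"
 proof (rule holomorphic_area_formula[OF G _ _ _ N _ F])
  show "g holomorphic_on G" using dg G by (auto simp: holomorphic_on_open)
  show "deriv g z ~= 0" if "z \<in> G" for z
   using dg[OF that] that by (simp add: DERIV_imp_deriv G_def)
  have "(\<lambda>z. poly p z) \<in> bmeas borel" for p :: "complex poly"
   by (intro borel_measurable_continuous_onI continuous_intros)
  then show "g \<in> bmeas borel" unfolding g_def by (intro borel_measurable_divide)
  fix a assume a: "a \<notin> N"
  let ?p = "P - Polynomial.smult a Q"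
  have "degree (Polynomial.smult (- a) Q) < degree P"
   using degree_smult_le[of "- a" Q] deg by simp
  then have "degree (P + Polynomial.smult (- a) Q) = degree P" by (rule degree_add_eq_left)
  then have dp: "degree ?p = Suc n" using deg by simp
  have roots: "{z \<in> G. g z = a} = {z. poly ?p z = 0}"
  proof (intro equalityI subsetI)
   fix z assume "z \<in> {z \<in> G. g z = a}"
   then show "z \<in> {z. poly ?p z = 0}" by (auto simp: G_def g_def field_simps)
  next
   fix z assume "z \<in> {z. poly ?p z = 0}"
   then have z: "poly P z = a * poly Q z" by simp
   have q: "poly Q z ~= 0" using z cop[of z] by auto
   then have "g z = a" using z by (simp add: g_def)
   moreover have "poly ?W z ~= 0" using a \<open>g z = a\<close> by (auto simp: N_def)
   ultimately show "z \<in> {z \<in> G. g z = a}" using q by (simp add: G_def)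
  qed
  have "rsquarefree ?p"
   unfolding rsquarefree_roots
  proof (intro allI notI)
   fix z assume z: "poly ?p z = 0 \<and> poly (pderiv ?p) z = 0"
   then have "z \<in> G" "g z = a" using roots by auto
   have "poly P z = a * poly Q z" "poly (pderiv P) z = a * poly (pderiv Q) z"
    using z by (simp_all add: pderiv_diff pderiv_smult)
   then have "poly ?W z = 0" by simp
   then show False using \<open>z \<in> G\<close> by (simp add: G_def)
  qed
  then have "card {z. poly ?p z = 0} = Suc n" by (simp only: card_roots_rsquarefree dp)
  moreover have "finite {z. poly ?p z = 0}" using dp by (intro poly_roots_finite) auto
  ultimately show "finite {z \<in> G. g z = a} \<and> card {z \<in> G. g z = a} = Suc n"
   by (simp only: roots)
 qed
 also have "... = (\<integral>z:\<C>. ennreal ((cmod (poly ?W z / (poly Q z)^2))^2) * F (g z))"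
 proof (rule nn_integral_cong_AE)
  have "AE z in lborel. z \<notin> - G" using finC by (intro AE_not_in finite_imp_null_set_lborel)
  then show "AE z in lborel. ennreal ((cmod (deriv g z))^2) * F (g z) * indicator G z
    = ennreal ((cmod (poly ?W z / (poly Q z)^2))^2) * F (g z)"
  proof (rule AE_mp[OF _ AE_I2[OF impI]])
   fix z assume "z \<notin> - G"
   then have z: "z \<in> G" by simp
   show "ennreal ((cmod (deriv g z))^2) * F (g z) * indicator G z
    = ennreal ((cmod (poly ?W z / (poly Q z)^2))^2) * F (g z)"
    using z by (simp only: DERIV_imp_deriv[OF dg[OF z]] indicator_simps mult_1_right)
  qed
 qed
 finally show ?thesis by (simp only: g_def)
qed

lemma measurable_char_poly_compose:
 assumes f: "f \<in> N \<rightarrow>\<^sub>M lmat n n"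
 shows "measurable_poly N (\<lambda>w. char_poly (f w))"
 unfolding measurable_poly_def
 using measurable_char_poly[of n] by (auto simp: measurable_poly_def intro: measurable_compose[OF f])

lemma measurable_char_poly_eval [measurable (raw)]:
 assumes f: "f \<in> N \<rightarrow>\<^sub>M lmat n n" and z: "z \<in> bmeas N"
 shows "(\<lambda>w. poly (char_poly (f w)) (z w)) \<in> bmeas N"
 using measurable_poly_eval[OF measurable_char_poly_compose[OF f] _ z, of n] measurable_carrier[OF f]
  degree_monic_char_poly by blast

lemma measurable_pderiv_char_poly_eval [measurable (raw)]:
 assumes f: "f \<in> N \<rightarrow>\<^sub>M lmat n n" and z: "z \<in> bmeas N"
 shows "(\<lambda>w. poly (pderiv (char_poly (f w))) (z w)) \<in> bmeas N"
proof (rule measurable_poly_eval[OF _ _ z])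
 have "(\<lambda>w. of_nat (Suc i) * coeff (char_poly (f w)) (Suc i)) \<in> bmeas N" for i
  using measurable_char_poly_compose[OF f]
  by (intro borel_measurable_times borel_measurable_const) (simp add: measurable_poly_def)
 then show "measurable_poly N (\<lambda>w. pderiv (char_poly (f w)))"
  unfolding measurable_poly_def coeff_pderiv by blast
 show "degree (pderiv (char_poly (f w))) = n - 1" if "w \<in> space N" for w
  using degree_monic_char_poly[OF measurable_carrier[OF f that]] by (simp add: degree_pderiv)
qed

lemma measurable_4_compose:
 assumes f: "(\<lambda>(a, b, c, D). f a b c D) \<in> bmeas
   (clborel \<Otimes>\<^sub>M (lmat p q \<Otimes>\<^sub>M (lmat r s \<Otimes>\<^sub>M lmat t u)))"
  and "A \<in> bmeas N" "B \<in> N \<rightarrow>\<^sub>M lmat p q" "C \<in> N \<rightarrow>\<^sub>M lmat r s" "D \<in> N \<rightarrow>\<^sub>M lmat t u"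
 shows "(\<lambda>w. f (A w) (B w) (C w) (D w)) \<in> bmeas N"
proof -
 have "(\<lambda>w. (A w, B w, C w, D w)) \<in> N \<rightarrow>\<^sub>M lborel \<Otimes>\<^sub>M (lmat p q \<Otimes>\<^sub>M (lmat r s \<Otimes>\<^sub>M lmat t u))"
  using assms by (intro measurable_Pair) auto
 from measurable_compose[OF this f] show ?thesis by simp
qed

lemma nn_integral_bmat_reorder:
 assumes F: "F \<in> bmeas (lmat (Suc n) (Suc n))"
 shows "integral\<^sup>N (lmat (Suc n) (Suc n)) F =
  (\<integral>D:n,n. \<integral>c:n,1. \<integral>b:1,n. \<integral>a:\<C>. F (bmat a b c D))"
proof -
 have "(\<lambda>(a, b, c, D). F (bmat a b c D)) \<in> bmeas
   (clborel \<Otimes>\<^sub>M (lmat 1 n \<Otimes>\<^sub>M (lmat n 1 \<Otimes>\<^sub>M lmat n n)))"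
  using F by measurable
 from nn_integral_reorder_lmat[OF this] nn_integral_bmat[OF F] show ?thesis by simp
qed

text \<open>Induction over the size with the corner as the last variable: a multiple root of P - aQ
  is a zero of the Wronskian of P and Q, which excludes only finitely many values of a.\<close>

lemma AE_rsquarefree_char_poly: "AE M in lmat n n. rsquarefree (char_poly M)"
proof (induction n)
 case 0
 have "char_poly M = 1" if "M \<in> cmat 0 0" for M :: "complex mat"
  using degree_monic_char_poly[OF that] by (metis degree_0_id monic_degree_0)
 then show ?case by (intro AE_I2) (simp add: rsquarefree_def order_0I)
next
 case (Suc n)
 define S :: "complex mat set" where "S = {M \<in> cmat (Suc n) (Suc n). \<not> rsquarefree (char_poly M)}"
 have S: "S \<in> sets (lmat (Suc n) (Suc n))" unfolding S_def by (rule sets_not_rsquarefree)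
 have "emeasure (lmat (Suc n) (Suc n)) S = (\<integral>M:(Suc n),(Suc n). indicator S M)"
  using S by simp
 also have "... = (\<integral>D:n,n. \<integral>c:n,1. \<integral>b:1,n. \<integral>a:\<C>. indicator S (bmat a b c D))"
  by (rule nn_integral_bmat_reorder[OF borel_measurable_indicator[OF S]])
 also have "... = (\<integral>D:n,n. 0)"
 proof (rule nn_integral_cong_AE, rule AE_mp[OF Suc AE_I2[OF impI]])
  fix D assume "D \<in> space (lmat n n)" and rs: "rsquarefree (char_poly D)"
  then have D: "D \<in> cmat n n" by simp
  have "(\<integral>c:n,1. \<integral>b:1,n. \<integral>a:\<C>. indicator S (bmat a b c D)) = (\<integral>c:n,1. 0)"
  proof (rule nn_integral_cong_AE, rule AE_mp[OF AE_bmat_no_common_root[OF D rs] AE_I2[OF impI]])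
   fix c assume "c \<in> space (lmat n 1)"
    and ae: "AE b in lmat 1 n. \<forall>a z. poly (char_poly D) z = 0 \<longrightarrow> poly (char_poly (bmat a b c D)) z ~= 0"
   then have c: "c \<in> cmat n 1" by simp
   have "(\<integral>b:1,n. \<integral>a:\<C>. indicator S (bmat a b c D)) = (\<integral>b:1,n. 0)"
   proof (rule nn_integral_cong_AE, rule AE_mp[OF ae AE_I2[OF impI]])
    fix b assume "b \<in> space (lmat 1 n)"
    and nc: "\<forall>a z. poly (char_poly D) z = 0 \<longrightarrow> poly (char_poly (bmat a b c D)) z ~= 0"
    then have b: "b \<in> cmat 1 n" by simp
    define P Q where "P = char_poly (bmat 0 b c D)" and "Q = char_poly D"
    have PQ: "degree P = Suc n" "degree Q = n" "Q ~= 0"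
    using degree_monic_char_poly[of "bmat 0 b c D" "Suc n"] degree_monic_char_poly[of D n] D char_poly_nonzero[OF D]
    by (auto simp: P_def Q_def)
    have cop: "\<And>z. poly Q z = 0 ==> poly P z ~= 0" using nc by (auto simp: P_def Q_def)
    let ?W = "pderiv P * Q - P * pderiv Q"
    have W: "?W ~= 0" by (rule wronskian_nonzero[OF PQ(1,3) cop])
    let ?N = "(\<lambda>z. poly P z / poly Q z) ` {z. poly ?W z = 0}"
    have "AE a in lborel. a \<notin> ?N"
    using W by (intro AE_not_in finite_imp_null_set_lborel finite_imageI poly_roots_finite)
    then have "AE a in lborel. indicator S (bmat a b c D) = (0 :: ennreal)"
    proof (rule AE_mp[OF _ AE_I2[OF impI]])
    fix a assume a: "a \<notin> ?N"
    have ch: "char_poly (bmat a b c D) = P - Polynomial.smult a Q"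
    using char_poly_bmat_affine[OF b c D, of a] by (simp add: P_def Q_def)
    have "rsquarefree (char_poly (bmat a b c D))"
    unfolding rsquarefree_roots
    proof (intro allI notI)
    fix z assume "poly (char_poly (bmat a b c D)) z = 0 \<and> poly (pderiv (char_poly (bmat a b c D))) z = 0"
    then have z: "poly P z = a * poly Q z" "poly (pderiv P) z = a * poly (pderiv Q) z"
    unfolding ch by (simp_all add: pderiv_diff pderiv_smult)
    have "poly Q z ~= 0" using z cop[of z] by auto
    then have "a = poly P z / poly Q z" using z by simp
    moreover have "poly ?W z = 0" using z by simp
    ultimately show False using a by blast
    qed
    then show "indicator S (bmat a b c D) = (0 :: ennreal)" by (simp add: S_def)
    qed
    from nn_integral_cong_AE[OF this]
    show "(\<integral>a:\<C>. indicator S (bmat a b c D)) = 0" by simp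
   qed
   then show "(\<integral>b:1,n. \<integral>a:\<C>. indicator S (bmat a b c D)) = 0" by simp
  qed
  then show "(\<integral>c:n,1. \<integral>b:1,n. \<integral>a:\<C>. indicator S (bmat a b c D)) = 0" by simp
 qed
 finally have "S \<in> null_sets (lmat (Suc n) (Suc n))" using S by auto
 from AE_not_in[OF this] show ?case
  by (rule AE_mp[OF _ AE_I2[OF impI]]) (simp add: S_def)
qed

section \<open>Splitting off one eigenvalue\<close>

text \<open>Its first column (1, u) serves as an eigenvector normalised to first coordinate one: a
  block upper triangular matrix with corner z, conjugated by it, has the eigenvector (1, u) for
  z.\<close>

definition unipotent :: "nat => complex mat => complex mat" where
 "unipotent n u = bmat 1 (0\<^sub>m 1 n) u (1\<^sub>m n)"

lemma unipotent_carrier [simp]: "unipotent n u \<in> cmat (Suc n) (Suc n)"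
 by (simp add: unipotent_def)

text \<open>The eigenvector equation M (1, u) = z (1, u), solved for the first column of M: the
  corner is z - bu and the column below it is (z - D) u. On the quotient by the eigenvector M acts
  as D - ub.\<close>

lemma unipotent_block:
 assumes b: "b \<in> cmat 1 n" and u: "u \<in> cmat n 1" and D: "D \<in> cmat n n"
 shows "unipotent n u * bmat z b (0\<^sub>m n 1) (D + (- 1) \<cdot>\<^sub>m (u * b)) * unipotent n ((- 1) \<cdot>\<^sub>m u)
  = bmat (z - (b * u) $$ (0, 0)) b ((z \<cdot>\<^sub>m 1\<^sub>m n + (- 1) \<cdot>\<^sub>m D) * u) D"
proof -
 let ?N = "D + (- 1) \<cdot>\<^sub>m (u * b)"
 have N: "?N \<in> cmat n n" "u * b \<in> cmat n n" using b u D by auto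
 have 1: "unipotent n u * bmat z b (0\<^sub>m n 1) ?N = bmat z b (z \<cdot>\<^sub>m u) (u * b + ?N)"
 proof -
  have "1 \<cdot>\<^sub>m b + 0\<^sub>m 1 n * ?N = b" using b N by (intro eq_matI) auto
  then show ?thesis unfolding unipotent_def
   using bmat_mult[of "0\<^sub>m 1 n" n u "1\<^sub>m n" b "0\<^sub>m n 1" ?N 1 z] b u N by simp
 qed
 have 2: "u * b + ?N = D" using b u N D by (intro eq_matI) auto
 have 3: "bmat z b (z \<cdot>\<^sub>m u) D * unipotent n ((- 1) \<cdot>\<^sub>m u) =
   bmat (z * 1 + (b * ((- 1) \<cdot>\<^sub>m u)) $$ (0, 0)) (z \<cdot>\<^sub>m 0\<^sub>m 1 n + b * 1\<^sub>m n)
    (1 \<cdot>\<^sub>m (z \<cdot>\<^sub>m u) + D * ((- 1) \<cdot>\<^sub>m u)) ((z \<cdot>\<^sub>m u) * 0\<^sub>m 1 n + D * 1\<^sub>m n)"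
  unfolding unipotent_def by (rule bmat_mult) (use b u D in auto)
 have bu: "b * ((- 1) \<cdot>\<^sub>m u) = (- 1) \<cdot>\<^sub>m (b * u)" "D * ((- 1) \<cdot>\<^sub>m u) = (- 1) \<cdot>\<^sub>m (D * u)"
  using b u D by (auto intro: mult_smult_distrib)
 have 4: "(z \<cdot>\<^sub>m 1\<^sub>m n + (- 1) \<cdot>\<^sub>m D) * u = 1 \<cdot>\<^sub>m (z \<cdot>\<^sub>m u) + (- 1) \<cdot>\<^sub>m (D * u)"
 proof -
  have "(z \<cdot>\<^sub>m 1\<^sub>m n + (- 1) \<cdot>\<^sub>m D) * u = (z \<cdot>\<^sub>m 1\<^sub>m n) * u + ((- 1) \<cdot>\<^sub>m D) * u"
   using u D by (intro add_mult_distrib_mat[of _ n n _ _ 1]) auto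
  also have "(z \<cdot>\<^sub>m 1\<^sub>m n) * u = z \<cdot>\<^sub>m (1\<^sub>m n * u)" using u by (intro mult_smult_assoc_mat) auto
  also have "((- 1) \<cdot>\<^sub>m D) * u = (- 1) \<cdot>\<^sub>m (D * u)" using u D by (intro mult_smult_assoc_mat) auto
  also have "1\<^sub>m n * u = u" using u by simp
  also have "z \<cdot>\<^sub>m u = 1 \<cdot>\<^sub>m (z \<cdot>\<^sub>m u)" by (intro eq_matI) auto
  finally show ?thesis .
 qed
 have 5: "z * 1 + ((- 1) \<cdot>\<^sub>m (b * u)) $$ (0, 0) = z - (b * u) $$ (0, 0)" using b u by simp
 have 6: "z \<cdot>\<^sub>m 0\<^sub>m 1 n + b * 1\<^sub>m n = b" "(z \<cdot>\<^sub>m u) * 0\<^sub>m 1 n + D * 1\<^sub>m n = D"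
  using b u D by (auto intro!: eq_matI)
 show ?thesis unfolding 1 2 3 bu 4 5 6 ..
qed

lemma char_poly_bmat_lower_zero:
 assumes "b \<in> cmat 1 n" "N \<in> cmat n n"
 shows "char_poly (bmat z b (0\<^sub>m n 1) N) = [:- z, 1:] * char_poly N"
proof -
 have "char_poly (Matrix.mat 1 1 (\<lambda>_. z)) = [:- z, 1:]"
  by (simp add: char_poly_def char_poly_matrix_def det_single one_pCons)
 then show ?thesis
  unfolding bmat_def using char_poly_four_block_zeros_col[of "Matrix.mat 1 1 (\<lambda>_. z)" b n N] assms by simp
qed

lemma unipotent_mult_inverse:
 assumes u: "u \<in> cmat n 1"
 shows "unipotent n u * unipotent n ((- 1) \<cdot>\<^sub>m u) = 1\<^sub>m (Suc n)"
  "unipotent n ((- 1) \<cdot>\<^sub>m u) * unipotent n u = 1\<^sub>m (Suc n)"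
proof -
 have I: "bmat 1 (0\<^sub>m 1 n) (0\<^sub>m n 1) (1\<^sub>m n) = 1\<^sub>m (Suc n)"
  by (intro eq_matI) (auto simp: bmat_def One_nat_def)
 have 1: "unipotent n u * unipotent n v = bmat (1 * 1 + (0\<^sub>m 1 n * v) $$ (0, 0)) (1 \<cdot>\<^sub>m 0\<^sub>m 1 n + 0\<^sub>m 1 n * 1\<^sub>m n)
   (1 \<cdot>\<^sub>m u + 1\<^sub>m n * v) (u * 0\<^sub>m 1 n + 1\<^sub>m n * 1\<^sub>m n)"
  if "u \<in> cmat n 1" "v \<in> cmat n 1" for u v
  unfolding unipotent_def by (rule bmat_mult) (use that in auto)
 have 2: "1 \<cdot>\<^sub>m u + 1\<^sub>m n * ((- 1) \<cdot>\<^sub>m u) = 0\<^sub>m n 1" "1 \<cdot>\<^sub>m ((- 1) \<cdot>\<^sub>m u) + 1\<^sub>m n * u = 0\<^sub>m n 1"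
  using u by (auto intro!: eq_matI)
 have u': "(- 1) \<cdot>\<^sub>m u \<in> cmat n 1" using u by simp
 show "unipotent n u * unipotent n ((- 1) \<cdot>\<^sub>m u) = 1\<^sub>m (Suc n)"
  unfolding 1[OF u u'] 2 using u u' by (simp add: I)
 show "unipotent n ((- 1) \<cdot>\<^sub>m u) * unipotent n u = 1\<^sub>m (Suc n)"
  unfolding 1[OF u' u] 2 using u u' by (simp add: I)
qed

text \<open>The second claim is the cancellation of Jacobians: |Q(z)|^2 from passing from the column
  c to u, and the squared derivative of P/Q from passing from the corner to z. For the corner a
  belonging to z, the Wronskian at z is Q(z) (P' - aQ')(z), and P' - aQ' is the derivative of (t -
  z) times the characteristic polynomial of N, which at z is the value of the latter. So Q(z)
  cancels.\<close>

lemma eigenvalue_block_identity: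
 assumes b: "b \<in> cmat 1 n" and u: "u \<in> cmat n 1" and D: "D \<in> cmat n n"
  and Z: "Z = z \<cdot>\<^sub>m 1\<^sub>m n + (- 1) \<cdot>\<^sub>m D" and q: "poly (char_poly D) z ~= 0"
 defines "P \<equiv> char_poly (bmat 0 b (Z * u) D)" and "Q \<equiv> char_poly D" and "N \<equiv> D + (- 1) \<cdot>\<^sub>m (u * b)"
 shows "bmat (poly P z / poly Q z) b (Z * u) D = unipotent n u * bmat z b (0\<^sub>m n 1) N * unipotent n ((- 1) \<cdot>\<^sub>m u)"
  and "(cmod (poly Q z))^2 * (cmod (poly (pderiv P * Q - P * pderiv Q) z / (poly Q z)^2))^2 = (cmod (poly (char_poly N) z))^2"
proof -
 let ?a = "z - (b * u) $$ (0, 0)"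
 let ?M = "bmat ?a b (Z * u) D"
 let ?T = "bmat z b (0\<^sub>m n 1) N"
 have Zc: "Z \<in> cmat n n" "Z * u \<in> cmat n 1" using Z D u by auto
 have N: "N \<in> cmat n n" using b u D by (auto simp: N_def)
 have M: "?M = unipotent n u * ?T * unipotent n ((- 1) \<cdot>\<^sub>m u)"
  unfolding N_def Z using unipotent_block[OF b u D] by simp
 have "similar_mat ?M ?T"
 proof -
  have u': "(- 1) \<cdot>\<^sub>m u \<in> cmat n 1" using u by simp
  have "similar_mat_wit ?M ?T (unipotent n u) (unipotent n ((- 1) \<cdot>\<^sub>m u))"
   by (rule similar_mat_witI[OF unipotent_mult_inverse[OF u] M]) (use D N in auto)
  then show ?thesis by (auto simp: similar_mat_def)
 qed
 then have chi: "char_poly ?M = [:- z, 1:] * char_poly N"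
  using char_poly_similar char_poly_bmat_lower_zero[OF b N] by metis
 have aff: "char_poly ?M = P - Polynomial.smult ?a Q"
  unfolding P_def Q_def by (rule char_poly_bmat_affine[OF b Zc(2) D])
 have qz: "poly Q z ~= 0" using q by (simp add: Q_def)
 have "poly (char_poly ?M) z = 0" by (simp add: chi)
 then have Pz: "poly P z = ?a * poly Q z" by (simp add: aff)
 then have a: "poly P z / poly Q z = ?a" using qz by simp
 then show "bmat (poly P z / poly Q z) b (Z * u) D = unipotent n u * ?T * unipotent n ((- 1) \<cdot>\<^sub>m u)"
  using M by simp
 have "poly (pderiv (char_poly ?M)) z = poly (char_poly N) z"
  unfolding chi pderiv_mult by (simp add: pderiv_pCons)
 then have "poly (pderiv P) z - ?a * poly (pderiv Q) z = poly (char_poly N) z"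
  by (simp add: aff pderiv_diff pderiv_smult)
 moreover have "p' * q - p * q' = q * (p' - x * q')" if "p = x * q" for p p' q q' x :: complex
  using that by (simp add: algebra_simps)
 from this[OF Pz] have "poly (pderiv P * Q - P * pderiv Q) z = poly Q z * (poly (pderiv P) z - ?a * poly (pderiv Q) z)"
  by (simp only: poly_diff poly_mult)
 ultimately have "poly (pderiv P * Q - P * pderiv Q) z = poly Q z * poly (char_poly N) z"
  by (simp only:)
 then show "(cmod (poly Q z))^2 * (cmod (poly (pderiv P * Q - P * pderiv Q) z / (poly Q z)^2))^2 = (cmod (poly (char_poly N) z))^2"
  using qz by (simp add: norm_mult norm_divide norm_power power2_eq_square field_simps)
qed

lemma AE_char_poly_eval_nonzero: "AE D in lmat n n. poly (char_poly D) z ~= 0"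
proof (rule AE_lmat_line[of "1\<^sub>m n"])
 have "(\<lambda>D. poly (char_poly D) z) \<in> bmeas (lmat n n)"
  by (intro measurable_char_poly_eval[OF measurable_idt] borel_measurable_const)
 then have "{D \<in> space (lmat n n). poly (char_poly D) z = 0} \<in> sets (lmat n n)"
  by (rule sets_zero_complex)
 then show "{D \<in> cmat n n. poly (char_poly D) z = 0} \<in> sets (lmat n n)"
  by (simp only: space_lmat)
 fix D :: "complex mat" assume D: "D \<in> cmat n n"
 have "z \<cdot>\<^sub>m 1\<^sub>m n + (- 1) \<cdot>\<^sub>m (D + t \<cdot>\<^sub>m 1\<^sub>m n) = (z - t) \<cdot>\<^sub>m 1\<^sub>m n + (- 1) \<cdot>\<^sub>m D" for t
  using D by (intro eq_matI) auto
 then have "{t. poly (char_poly (D + t \<cdot>\<^sub>m 1\<^sub>m n)) z = 0} = {t. poly (char_poly D) (z - t) = 0}"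
  using D by (simp add: poly_char_poly[of _ n])
 also have "... = (\<lambda>w. z - w) ` {w. poly (char_poly D) w = 0}"
  by (auto intro!: image_eqI[of _ _ "z - _"])
 finally show "countable {t. poly (char_poly (D + t \<cdot>\<^sub>m 1\<^sub>m n)) z = 0}"
  using poly_roots_finite[OF char_poly_nonzero[OF D]] by (simp add: countable_finite)
qed simp

definition triangularized :: "nat => complex mat => complex => complex mat => complex mat => complex mat" where
 "triangularized n u z b N = unipotent n u * bmat z b (0\<^sub>m n 1) N * unipotent n ((- 1) \<cdot>\<^sub>m u)"

lemma measurable_unipotent [measurable (raw)]:
 "f \<in> N \<rightarrow>\<^sub>M lmat n 1 ==> (\<lambda>w. unipotent n (f w)) \<in> N \<rightarrow>\<^sub>M lmat (Suc n) (Suc n)"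
 unfolding unipotent_def
 by (intro measurable_bmat meas_zero meas_one borel_measurable_const)

lemma measurable_triangularized [measurable (raw)]:
 assumes "u \<in> M \<rightarrow>\<^sub>M lmat n 1" "z \<in> bmeas M" "b \<in> M \<rightarrow>\<^sub>M lmat 1 n" "N \<in> M \<rightarrow>\<^sub>M lmat n n"
 shows "(\<lambda>w. triangularized n (u w) (z w) (b w) (N w)) \<in> M \<rightarrow>\<^sub>M lmat (Suc n) (Suc n)"
 unfolding triangularized_def using assms
 by (intro meas_mult[where b = "Suc n"] measurable_unipotent meas_smult borel_measurable_const
   measurable_bmat meas_zero)

text \<open>Three substitutions: the corner is exchanged for an eigenvalue z, the column c for u
  with c = (z - D) u, and D for N = D - ub. Each matrix is counted once for each of its n + 1
  eigenvalues, hence the factor on the left.\<close>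

theorem nn_integral_split_eigenvalue:
 assumes F: "F \<in> bmeas (lmat (Suc n) (Suc n))"
 shows "of_nat (Suc n) * integral\<^sup>N (lmat (Suc n) (Suc n)) F =
  (\<integral>z:\<C>. \<integral>b:1,n. \<integral>u:n,1. \<integral>N:n,n. ennreal ((cmod (poly (char_poly N) z))^2) * F (triangularized n u z b N))"
proof -
 define P where "P = (\<lambda>b c D. char_poly (bmat 0 b c D))"
 define G where "G = (\<lambda>z b c D. ennreal ((cmod (poly (pderiv (P b c D) * char_poly D - P b c D * pderiv (char_poly D)) z
   / (poly (char_poly D) z)^2))^2) * F (bmat (poly (P b c D) z / poly (char_poly D) z) b c D))"
 define H where "H = (\<lambda>z b u N. ennreal ((cmod (poly (char_poly N) z))^2) * F (triangularized n u z b N))"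
 let ?A = "clborel \<Otimes>\<^sub>M (lmat 1 n \<Otimes>\<^sub>M (lmat n 1 \<Otimes>\<^sub>M lmat n n))"
 have pr: "(\<lambda>p. fst p) \<in> bmeas ?A" "(\<lambda>p. fst (snd p)) \<in> ?A \<rightarrow>\<^sub>M lmat 1 n"
  "(\<lambda>p. fst (snd (snd p))) \<in> ?A \<rightarrow>\<^sub>M lmat n 1" "(\<lambda>p. snd (snd (snd p))) \<in> ?A \<rightarrow>\<^sub>M lmat n n"
  by simp_all
 note prb = measurable_bmat[OF borel_measurable_const[of "0 :: complex"] pr(2,3,4)]
 have prP: "(\<lambda>p. poly (P (fst (snd p)) (fst (snd (snd p))) (snd (snd (snd p)))) (fst p)) \<in> bmeas ?A"
  "(\<lambda>p. poly (pderiv (P (fst (snd p)) (fst (snd (snd p))) (snd (snd (snd p))))) (fst p)) \<in> bmeas ?A"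
  unfolding P_def by (rule measurable_char_poly_eval[OF prb pr(1)], rule measurable_pderiv_char_poly_eval[OF prb pr(1)])
 note prQ = measurable_char_poly_eval[OF pr(4,1)] measurable_pderiv_char_poly_eval[OF pr(4,1)]
 have G: "(\<lambda>(z, b, c, D). G z b c D) \<in> bmeas ?A"
  unfolding G_def case_prod_unfold poly_diff poly_mult
  by (intro measurable_times measurable_to_ennreal borel_measurable_power
    measurable_cmod borel_measurable_divide borel_measurable_diff borel_measurable_times prP prQ
    measurable_compose[OF _ F] measurable_bmat pr)
 have H: "(\<lambda>(z, b, u, N). H z b u N) \<in> bmeas ?A"
  unfolding H_def case_prod_unfold
  by (intro measurable_times measurable_to_ennreal borel_measurable_power
    measurable_cmod prQ measurable_compose[OF _ F] measurable_triangularized pr)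
 have Fa: "(\<lambda>a. F (bmat a b c D)) \<in> bmeas borel"
  if "b \<in> cmat 1 n" "c \<in> cmat n 1" "D \<in> cmat n n" for b c D
  using that by (intro measurable_compose[OF _ F] measurable_bmat meas_const measurable_idt)
 let ?I = "\<lambda>D c b. \<integral>a:\<C>. F (bmat a b c D)"
 have I: "(\<lambda>(c, b). ?I D c b) \<in> bmeas (lmat n 1 \<Otimes>\<^sub>M lmat 1 n)" if "D \<in> cmat n n" for D
 proof -
  have "(\<lambda>p. F (bmat (snd p) (snd (fst p)) (fst (fst p)) D)) \<in> bmeas ((lmat n 1 \<Otimes>\<^sub>M lmat 1 n) \<Otimes>\<^sub>M lborel)"
   using that by (intro measurable_compose[OF _ F] measurable_bmat meas_const) simp_all
  then show ?thesis
   unfolding case_prod_unfold by (intro lborel.borel_measurable_nn_integral) (simp only: case_prod_unfold)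
 qed
 have II: "(\<lambda>p. F (bmat (snd p) (snd (fst p)) (snd (fst (fst p))) (fst (fst (fst p))))) \<in>
   bmeas (((lmat n n \<Otimes>\<^sub>M lmat n 1) \<Otimes>\<^sub>M lmat 1 n) \<Otimes>\<^sub>M lborel)"
  by (intro measurable_compose[OF _ F] measurable_bmat) simp_all
 have "of_nat (Suc n) * integral\<^sup>N (lmat (Suc n) (Suc n)) F =
   of_nat (Suc n) * (\<integral>D:n,n. \<integral>c:n,1. \<integral>b:1,n. ?I D c b)"
  by (simp only: nn_integral_bmat_reorder[OF F])
 also have "... = (\<integral>D:n,n. of_nat (Suc n) * (\<integral>c:n,1. \<integral>b:1,n. ?I D c b))"
  using II by (intro nn_integral_cmult[symmetric] lmat.borel_measurable_nn_integral
    lborel.borel_measurable_nn_integral) (simp add: case_prod_unfold)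
 also have "... = (\<integral>D:n,n. \<integral>c:n,1. \<integral>b:1,n. of_nat (Suc n) * ?I D c b)"
 proof (rule nn_integral_cong_mat)
  fix D :: "complex mat" assume D: "D \<in> cmat n n"
  have "of_nat (Suc n) * (\<integral>c:n,1. \<integral>b:1,n. ?I D c b)
    = (\<integral>c:n,1. of_nat (Suc n) * (\<integral>b:1,n. ?I D c b))"
   using I[OF D] by (intro nn_integral_cmult[symmetric] lmat.borel_measurable_nn_integral)
  also have "... = (\<integral>c:n,1. \<integral>b:1,n. of_nat (Suc n) * ?I D c b)"
  proof (rule nn_integral_cong)
   fix c assume "c \<in> space (lmat n 1)"
   then show "of_nat (Suc n) * (\<integral>b:1,n. ?I D c b) = (\<integral>b:1,n. of_nat (Suc n) * ?I D c b)"
    using measurable_compose[OF measurable_Pair1' I[OF D], of c] by (intro nn_integral_cmult[symmetric]) simp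
  qed
  finally show "of_nat (Suc n) * (\<integral>c:n,1. \<integral>b:1,n. ?I D c b)
    = (\<integral>c:n,1. \<integral>b:1,n. of_nat (Suc n) * ?I D c b)" .
 qed
 also have "... = (\<integral>D:n,n. \<integral>c:n,1. \<integral>b:1,n. \<integral>z:\<C>. G z b c D)"
 proof (rule nn_integral_cong_AE, rule AE_mp[OF AE_rsquarefree_char_poly AE_I2[OF impI]])
  fix D assume "D \<in> space (lmat n n)" and rs: "rsquarefree (char_poly D)"
  then have D: "D \<in> cmat n n" by simp
  show "(\<integral>c:n,1. \<integral>b:1,n. of_nat (Suc n) * ?I D c b)
    = (\<integral>c:n,1. \<integral>b:1,n. \<integral>z:\<C>. G z b c D)"
  proof (rule nn_integral_cong_AE, rule AE_mp[OF AE_bmat_no_common_root[OF D rs] AE_I2[OF impI]])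
   fix c assume "c \<in> space (lmat n 1)"
    and ae: "AE b in lmat 1 n. \<forall>a z. poly (char_poly D) z = 0 \<longrightarrow> poly (char_poly (bmat a b c D)) z ~= 0"
   then have c: "c \<in> cmat n 1" by simp
   show "(\<integral>b:1,n. of_nat (Suc n) * ?I D c b) = (\<integral>b:1,n. \<integral>z:\<C>. G z b c D)"
   proof (rule nn_integral_cong_AE, rule AE_mp[OF ae AE_I2[OF impI]])
    fix b assume "b \<in> space (lmat 1 n)"
    and nc: "\<forall>a z. poly (char_poly D) z = 0 \<longrightarrow> poly (char_poly (bmat a b c D)) z ~= 0"
    then have b: "b \<in> cmat 1 n" by simp
    show "of_nat (Suc n) * ?I D c b = (\<integral>z:\<C>. G z b c D)"
    unfolding G_def
    proof (rule nn_integral_rational_substitution[OF _ _ _ _ Fa[OF b c D]])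
    show "degree (P b c D) = Suc n" unfolding P_def
    using degree_monic_char_poly[of "bmat 0 b c D" "Suc n"] D by simp
    show "degree (char_poly D) = n" using degree_monic_char_poly[OF D] by simp
    show "char_poly D ~= 0" by (rule char_poly_nonzero[OF D])
    show "poly (P b c D) z ~= 0" if "poly (char_poly D) z = 0" for z
    using nc that by (simp add: P_def)
    qed
   qed
  qed
 qed
 also have "... = (\<integral>z:\<C>. \<integral>b:1,n. \<integral>c:n,1. \<integral>D:n,n. G z b c D)"
  by (rule nn_integral_reorder_lmat[OF G, symmetric])
 \<comment> \<open>With z and b fixed the two remaining substitutions are a multiplication and a
   translation; their Jacobian turns G into H.\<close>
 also have "... = (\<integral>z:\<C>. \<integral>b:1,n. \<integral>u:n,1. \<integral>N:n,n. H z b u N)"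
 proof (rule nn_integral_cong, rule nn_integral_cong)
  fix z :: complex and b assume "b \<in> space (lmat 1 n)"
  then have b: "b \<in> cmat 1 n" by simp
  have Gcd: "case_prod (G z b) \<in> bmeas (lmat n 1 \<Otimes>\<^sub>M lmat n n)"
   unfolding case_prod_unfold using b
   by (intro measurable_4_compose[OF G] meas_const borel_measurable_const) simp_all
  have "(\<integral>c:n,1. \<integral>D:n,n. G z b c D) = (\<integral>D:n,n. \<integral>c:n,1. G z b c D)"
   by (rule nn_integral_lmat_swap[OF Gcd])
  also have "... = (\<integral>D:n,n. \<integral>u:n,1. H z b u (D + (- 1) \<cdot>\<^sub>m (u * b)))"
  proof (rule nn_integral_cong_AE, rule AE_mp[OF AE_char_poly_eval_nonzero[where n = n and z = z] AE_I2[OF impI]])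
   fix D assume "D \<in> space (lmat n n)" and q: "poly (char_poly D) z ~= 0"
   then have D: "D \<in> cmat n n" by simp
   define Z where "Z = z \<cdot>\<^sub>m 1\<^sub>m n + (- 1) \<cdot>\<^sub>m D"
   have Z: "Z \<in> cmat n n" using D by (simp add: Z_def)
   have dZ: "det Z = poly (char_poly D) z" using D by (simp add: Z_def poly_char_poly)
   have Gc: "(\<lambda>c. G z b c D) \<in> bmeas (lmat n 1)"
    using b D by (intro measurable_4_compose[OF G] meas_const borel_measurable_const
    measurable_idt)
   have GZ: "(\<lambda>u. G z b (Z * u) D) \<in> bmeas (lmat n 1)"
    using b D Z by (intro measurable_4_compose[OF G] meas_mult[where b = n] meas_const borel_measurable_const
    measurable_idt)
   have "(\<integral>c:n,1. G z b c D) = ennreal (cmod (det Z) ^ (2 * 1)) * (\<integral>u:n,1. G z b (Z * u) D)"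
    using Z q dZ by (intro nn_integral_left_mult[symmetric] Gc) simp_all
   also have "... = (\<integral>u:n,1. ennreal (cmod (det Z) ^ (2 * 1)) * G z b (Z * u) D)"
    by (rule nn_integral_cmult[OF GZ, symmetric])
   also have "... = (\<integral>u:n,1. H z b u (D + (- 1) \<cdot>\<^sub>m (u * b)))"
   proof (rule nn_integral_cong_mat)
    fix u :: "complex mat" assume u: "u \<in> cmat n 1"
    note id = eigenvalue_block_identity[OF b u D Z_def q]
    show "ennreal (cmod (det Z) ^ (2 * 1)) * G z b (Z * u) D = H z b u (D + (- 1) \<cdot>\<^sub>m (u * b))"
    unfolding G_def H_def P_def triangularized_def id(1) id(2)[symmetric] dZ
    by (simp only: ennreal_mult mult_1_right mult.assoc zero_le_power2)
   qed
   finally show "(\<integral>c:n,1. G z b c D) = (\<integral>u:n,1. H z b u (D + (- 1) \<cdot>\<^sub>m (u * b)))" .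
  qed
  also have "... = (\<integral>u:n,1. \<integral>D:n,n. H z b u (D + (- 1) \<cdot>\<^sub>m (u * b)))"
  proof (rule nn_integral_lmat_swap)
   show "(\<lambda>(D, u). H z b u (D + (- 1) \<cdot>\<^sub>m (u * b))) \<in> bmeas (lmat n n \<Otimes>\<^sub>M lmat n 1)"
    unfolding case_prod_unfold using b
    by (intro measurable_4_compose[OF H] meas_add meas_smult meas_mult[where b = 1]
    meas_const borel_measurable_const measurable_fst measurable_snd)
  qed
  also have "... = (\<integral>u:n,1. \<integral>N:n,n. H z b u N)"
  proof (rule nn_integral_cong_mat)
   fix u :: "complex mat" assume u: "u \<in> cmat n 1"
   then show "(\<integral>D:n,n. H z b u (D + (- 1) \<cdot>\<^sub>m (u * b))) = (\<integral>N:n,n. H z b u N)"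
    using b by (intro nn_integral_lmat_translate measurable_4_compose[OF H] meas_const borel_measurable_const
    measurable_idt) auto
  qed
  finally show "(\<integral>c:n,1. \<integral>D:n,n. G z b c D) = (\<integral>u:n,1. \<integral>N:n,n. H z b u N)" .
 qed
 finally show ?thesis by (simp only: H_def)
qed

section \<open>Unitary invariance\<close>

definition sqnorm :: "complex mat => real" where
 "sqnorm A = (\<Sum>i<dim_row A. \<Sum>j<dim_col A. (cmod (A $$ (i, j)))^2)"

definition ctrans :: "complex mat => complex mat" where
 "ctrans A = Matrix.mat (dim_col A) (dim_row A) (\<lambda>(i, j). cnj (A $$ (j, i)))"

lemma ctrans_carrier [simp]: "A \<in> cmat m n ==> ctrans A \<in> cmat n m"
 by (auto simp: ctrans_def)

lemma ctrans_index [simp]: "i < dim_col A ==> j < dim_row A ==> ctrans A $$ (i, j) = cnj (A $$ (j, i))"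
 by (simp add: ctrans_def)

lemma dim_ctrans [simp]: "dim_row (ctrans A) = dim_col A" "dim_col (ctrans A) = dim_row A"
 by (simp_all add: ctrans_def)

lemma ctrans_ctrans [simp]: "ctrans (ctrans A) = A"
 by (intro eq_matI) auto

lemma ctrans_mult:
 assumes "A \<in> cmat m n" "B \<in> cmat n k"
 shows "ctrans (A * B) = ctrans B * ctrans A"
 using assms by (intro eq_matI) (auto simp: scalar_prod_def intro!: sum.cong)

lemma det_ctrans:
 assumes "A \<in> cmat n n"
 shows "det (ctrans A) = cnj (det A)"
proof -
 have "det (ctrans A) = det (Matrix.transpose_mat (ctrans A))"
  using assms by (simp add: det_transpose[of _ n])
 also have "... = (\<Sum>p\<in>{p. p permutes {0..<n}}. signof p * (\<Prod>i = 0..<n. Matrix.transpose_mat (ctrans A) $$ (i, p i)))"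
  using assms by (intro det_def') auto
 also have "... = (\<Sum>p\<in>{p. p permutes {0..<n}}. cnj (signof p * (\<Prod>i = 0..<n. A $$ (i, p i))))"
 proof (rule sum.cong)
  fix p assume "p \<in> {p. p permutes {0..<n}}"
  then have p: "p permutes {0..<n}" by simp
  have "(\<Prod>i = 0..<n. Matrix.transpose_mat (ctrans A) $$ (i, p i)) = (\<Prod>i = 0..<n. cnj (A $$ (i, p i)))"
   using assms permutes_in_image[OF p] by (intro prod.cong) auto
  moreover have "cnj (signof p) = (signof p :: complex)" by (cases p rule: sign_cases) simp_all
  ultimately show "signof p * (\<Prod>i = 0..<n. Matrix.transpose_mat (ctrans A) $$ (i, p i)) =
    cnj (signof p * (\<Prod>i = 0..<n. A $$ (i, p i)))" by simp
 qed simp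
 also have "... = cnj (det A)" using det_def'[OF assms] by simp
 finally show ?thesis .
qed

definition unitary_mat :: "nat => complex mat => bool" where
 "unitary_mat n Q \<longleftrightarrow> Q \<in> cmat n n \<and> ctrans Q * Q = 1\<^sub>m n \<and> Q * ctrans Q = 1\<^sub>m n"

lemma unitary_mat_ctrans: "unitary_mat n Q ==> unitary_mat n (ctrans Q)"
 by (auto simp: unitary_mat_def)

lemma cmod_det_unitary: "unitary_mat n Q ==> cmod (det Q) = 1"
proof -
 assume Q: "unitary_mat n Q"
 then have c: "Q \<in> cmat n n" "Q * ctrans Q = 1\<^sub>m n" by (auto simp: unitary_mat_def)
 then have "det Q * cnj (det Q) = 1"
  using det_mult[of Q n "ctrans Q"] det_ctrans[of Q n] by simp
 then have "(cmod (det Q))^2 = 1"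
  by (metis complex_norm_square of_real_eq_1_iff)
 then show ?thesis by (simp add: power2_eq_1_iff) (smt (verit) norm_ge_zero)
qed

lemma sqnorm_trace_left:
 assumes "A \<in> cmat m n"
 shows "complex_of_real (sqnorm A) = (\<Sum>j<n. (ctrans A * A) $$ (j, j))"
proof -
 have "(\<Sum>j<n. (ctrans A * A) $$ (j, j)) = (\<Sum>j<n. \<Sum>i<m. complex_of_real ((cmod (A $$ (i, j)))^2))"
  using assms by (intro sum.cong)
   (auto simp: scalar_prod_def complex_norm_square lessThan_atLeast0 mult.commute simp del: of_real_power intro!: sum.cong)
 also have "... = complex_of_real (sqnorm A)"
  using assms by (subst sum.swap) (simp add: sqnorm_def)
 finally show ?thesis by simp
qed

lemma sqnorm_ctrans: "sqnorm (ctrans A) = sqnorm A"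
 unfolding sqnorm_def by (subst sum.swap) simp

lemma sqnorm_unitary_left:
 assumes Q: "unitary_mat m Q" and A: "A \<in> cmat m n"
 shows "sqnorm (Q * A) = sqnorm A"
proof -
 have c: "Q \<in> cmat m m" "ctrans Q * Q = 1\<^sub>m m" "ctrans Q \<in> cmat m m" "ctrans A \<in> cmat n m"
  using Q A by (auto simp: unitary_mat_def)
 have "ctrans (Q * A) * (Q * A) = ctrans A * ctrans Q * (Q * A)"
  using c A by (simp add: ctrans_mult[of Q m m A n])
 also have "... = ctrans A * (ctrans Q * (Q * A))"
  using c A by (intro assoc_mult_mat[of _ n m _ m _ n]) auto
 also have "ctrans Q * (Q * A) = (ctrans Q * Q) * A"
  using c A by (intro assoc_mult_mat[symmetric, of _ m m _ m _ n]) auto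
 finally have "ctrans (Q * A) * (Q * A) = ctrans A * A" using c A by simp
 then have "complex_of_real (sqnorm (Q * A)) = complex_of_real (sqnorm A)"
  using sqnorm_trace_left[OF A] sqnorm_trace_left[of "Q * A" m n] c A by simp
 then show ?thesis by (simp only: of_real_eq_iff)
qed

lemma sqnorm_unitary_right:
 assumes Q: "unitary_mat n Q" and A: "A \<in> cmat m n"
 shows "sqnorm (A * Q) = sqnorm A"
proof -
 have "sqnorm (A * Q) = sqnorm (ctrans Q * ctrans A)"
  using Q A by (subst sqnorm_ctrans[symmetric]) (simp add: ctrans_mult[of A m n Q n] unitary_mat_def)
 also have "... = sqnorm A"
  using sqnorm_unitary_left[OF unitary_mat_ctrans[OF Q], of "ctrans A" m] A by (simp add: sqnorm_ctrans)
 finally show ?thesis .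
qed

lemma sqnorm_nonneg: "0 \<le> sqnorm A"
 by (simp add: sqnorm_def sum_nonneg)

lemma sqnorm_bmat:
 assumes "b \<in> cmat 1 n" "c \<in> cmat n 1" "D \<in> cmat n n"
 shows "sqnorm (bmat x b c D) = (cmod x)^2 + sqnorm b + sqnorm c + sqnorm D"
proof -
 have "sqnorm (bmat x b c D) = (\<Sum>i<Suc n. \<Sum>j<Suc n. (cmod (bmat x b c D $$ (i, j)))^2)"
  using assms by (simp add: sqnorm_def)
 also have "... = (cmod (bmat x b c D $$ (0, 0)))^2 + (\<Sum>j<n. (cmod (bmat x b c D $$ (0, Suc j)))^2)
   + (\<Sum>i<n. (cmod (bmat x b c D $$ (Suc i, 0)))^2 + (\<Sum>j<n. (cmod (bmat x b c D $$ (Suc i, Suc j)))^2))"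
  by (simp only: sum.lessThan_Suc_shift)
 also have "... = (cmod x)^2 + sqnorm b + sqnorm c + sqnorm D"
  using assms by (simp add: sqnorm_def bmat_def sum.distrib One_nat_def)
 finally show ?thesis .
qed

lemma measurable_sqnorm [measurable (raw)]:
 assumes "f \<in> N \<rightarrow>\<^sub>M lmat m n"
 shows "(\<lambda>w. sqnorm (f w)) \<in> bmeas N"
proof (rule measurable_eqI)
 show "sqnorm (f w) = (\<Sum>i<m. \<Sum>j<n. (cmod (f w $$ (i, j)))^2)" if "w \<in> space N" for w
  using measurable_carrier[OF assms that] by (simp add: sqnorm_def)
 show "(\<lambda>w. \<Sum>i<m. \<Sum>j<n. (cmod (f w $$ (i, j)))^2) \<in> bmeas N"
  using meas_entry[OF _ _ assms]
  by (intro borel_measurable_sum borel_measurable_power measurable_cmod) auto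
qed

text \<open>The Householder reflection mapping the first column of the unipotent matrix of \<open>u\<close> to a
 multiple of the first unit vector; it is Hermitian.\<close>

definition unit_col :: "nat => complex mat" where
 "unit_col n = unit_mat (Suc n) 1 0 0"

definition col_norm :: "complex mat => real" where
 "col_norm u = sqrt (1 + sqnorm u)"

text \<open>A reflection sending the column v = (1, u) of length r to -r e acts along v + r e. With
  this choice of sign the squared length is 2(r^2 + r), which is never zero, so u = 0 is no
  exception.\<close>

definition householder_vec :: "nat => complex mat => complex mat" where
 "householder_vec n u = unipotent n u * unit_col n + complex_of_real (col_norm u) \<cdot>\<^sub>m unit_col n"

definition householder :: "nat => complex mat => complex mat" where
 "householder n u = 1\<^sub>m (Suc n) + (- complex_of_real (2 / sqnorm (householder_vec n u))) \<cdot>\<^sub>m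
   (householder_vec n u * ctrans (householder_vec n u))"

lemma col_norm_ge_1: "1 \<le> col_norm u"
 by (simp add: col_norm_def sqnorm_nonneg)

lemma measurable_col_norm: "f \<in> N \<rightarrow>\<^sub>M lmat m n ==> (\<lambda>w. col_norm (f w)) \<in> bmeas N"
 unfolding col_norm_def
 by (intro measurable_compose[OF _ borel_measurable_sqrt] borel_measurable_add borel_measurable_const measurable_sqnorm)

lemma unit_col_carrier [simp]: "unit_col n \<in> cmat (Suc n) 1"
 by (simp add: unit_col_def)

lemma householder_vec_carrier [simp]: "householder_vec n u \<in> cmat (Suc n) 1"
 by (simp add: householder_vec_def mult_carrier_mat[of _ "Suc n" "Suc n"])

lemma householder_carrier [simp]: "householder n u \<in> cmat (Suc n) (Suc n)"
 unfolding householder_def by (intro add_carrier_mat smult_carrier_mat mult_carrier_mat[of _ _ 1] ctrans_carrier householder_vec_carrier)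

lemma unipotent_unit_col:
 assumes "u \<in> cmat n 1"
 shows "unipotent n u * unit_col n = row_stack (Matrix.mat 1 1 (\<lambda>_. 1)) u"
proof -
 have e: "unit_col n = row_stack (Matrix.mat 1 1 (\<lambda>_. 1)) (0\<^sub>m n 1)"
  by (intro eq_matI) (auto simp: unit_col_def unit_mat_def row_stack_def One_nat_def)
 have s: "1 \<cdot>\<^sub>m Matrix.mat 1 1 (\<lambda>_. 1 :: complex) + 0\<^sub>m 1 n * 0\<^sub>m n 1 = Matrix.mat 1 1 (\<lambda>_. 1)"
  "u * Matrix.mat 1 1 (\<lambda>_. 1) + 1\<^sub>m n * 0\<^sub>m n 1 = u"
  using assms by (auto intro!: eq_matI simp: mat_mult_11)
 show ?thesis unfolding e unipotent_def
  using bmat_mult_row_stack[of "0\<^sub>m 1 n" n u "1\<^sub>m n" "Matrix.mat 1 1 (\<lambda>_. 1)" 1 "0\<^sub>m n 1" 1] assms s by simp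
qed

lemma sqnorm_col:
 assumes "A \<in> cmat m 1"
 shows "ctrans A * A = Matrix.mat 1 1 (\<lambda>_. complex_of_real (sqnorm A))"
 using sqnorm_trace_left[OF assms] assms
 by (intro eq_matI) (auto simp: One_nat_def simp del: index_mult_mat(1))

text \<open>For w = v + r e the inner product <w, v> = r^2 + r is half of <w, w>. Hence subtracting
  2 <w, v> / <w, w> times w from v leaves v - w = -r e.\<close>

lemma householder_props:
 assumes u: "u \<in> cmat n 1"
 defines "Q \<equiv> householder n u" and "r \<equiv> col_norm u"
 shows "ctrans Q = Q" "Q * Q = 1\<^sub>m (Suc n)" "unitary_mat (Suc n) Q"
  "Q * (unipotent n u * unit_col n) = (- complex_of_real r) \<cdot>\<^sub>m unit_col n"
proof -
 define w where "w = householder_vec n u"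
 define v where "v = unipotent n u * unit_col n"
 define e where "e = unit_col n"
 define a where "a = - complex_of_real (2 / sqnorm w)"
 define W where "W = w * ctrans w"
 have car: "w \<in> cmat (Suc n) 1" "v \<in> cmat (Suc n) 1" "e \<in> cmat (Suc n) 1"
  "W \<in> cmat (Suc n) (Suc n)" "ctrans w \<in> cmat 1 (Suc n)" "ctrans v \<in> cmat 1 (Suc n)"
  by (auto simp: w_def v_def e_def W_def mult_carrier_mat[of _ "Suc n" "Suc n"] mult_carrier_mat[of _ "Suc n" 1])
 have Q: "Q = 1\<^sub>m (Suc n) + a \<cdot>\<^sub>m W" by (simp add: Q_def householder_def a_def W_def w_def)
 have w: "w = v + complex_of_real r \<cdot>\<^sub>m e" by (simp add: w_def householder_vec_def v_def r_def e_def)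
 have rpos: "r \<ge> 1" by (simp add: r_def col_norm_ge_1)
 have r2: "r^2 = 1 + sqnorm u" by (simp add: r_def col_norm_def sqnorm_nonneg)
 have vi: "v $$ (i, 0) = (if i = 0 then 1 else u $$ (i - 1, 0))" if "i < Suc n" for i
  using that u unfolding v_def unipotent_unit_col[OF u] by (auto simp: row_stack_def One_nat_def)
 have ei: "e $$ (i, 0) = (if i = 0 then 1 else 0)" if "i < Suc n" for i
  using that by (simp add: e_def unit_col_def unit_mat_def One_nat_def)
 have sq: "sqnorm A = (\<Sum>i<Suc n. (cmod (A $$ (i, 0)))^2)" if "A \<in> cmat (Suc n) 1" for A
  using that by (simp add: sqnorm_def One_nat_def)
 have su: "sqnorm u = (\<Sum>i<n. (cmod (u $$ (i, 0)))^2)"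
  using u by (simp add: sqnorm_def One_nat_def)
 have sv: "sqnorm v = r^2"
  unfolding sq[OF car(2)] r2 su by (subst sum.lessThan_Suc_shift) (simp add: vi)
 have wi: "w $$ (i, 0) = v $$ (i, 0) + complex_of_real r * e $$ (i, 0)" if "i < Suc n" for i
  unfolding w using that car by (simp add: One_nat_def)
 have sw: "sqnorm w = 2 * (r^2 + r)"
 proof -
  have "sqnorm w = (cmod (1 + complex_of_real r))^2 + (\<Sum>i<n. (cmod (u $$ (i, 0)))^2)"
   unfolding sq[OF car(1)] by (subst sum.lessThan_Suc_shift) (simp add: wi vi ei)
  also have "cmod (1 + complex_of_real r) = 1 + r"
   using rpos by (metis norm_of_real of_real_1 of_real_add abs_of_nonneg add_nonneg_nonneg zero_le_one order_trans)
  finally show ?thesis using r2 su by (simp add: power2_eq_square algebra_simps)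
 qed
 have sw0: "sqnorm w ~= 0" using rpos sw by (smt (verit) zero_le_power2)
 have wv: "ctrans w * v = Matrix.mat 1 1 (\<lambda>_. complex_of_real (r^2 + r))"
 proof -
  have "(ctrans w * v) $$ (0, 0) = (\<Sum>i<Suc n. cnj (w $$ (i, 0)) * v $$ (i, 0))"
   using car by (simp add: scalar_prod_def lessThan_atLeast0 One_nat_def)
  also have "... = (1 + complex_of_real r) + (\<Sum>i<n. complex_of_real ((cmod (u $$ (i, 0)))^2))"
   by (subst sum.lessThan_Suc_shift) (simp add: wi vi ei complex_norm_square mult.commute del: of_real_power)
  also have "... = complex_of_real (r^2 + r)" unfolding r2 su by simp
  finally show ?thesis using car by (intro eq_matI) (auto simp: One_nat_def simp del: index_mult_mat(1))
 qed
 have WW: "W * W = complex_of_real (sqnorm w) \<cdot>\<^sub>m W"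
 proof -
  have "W * W = w * (ctrans w * (w * ctrans w))"
   unfolding W_def using car by (intro assoc_mult_mat[of _ "Suc n" 1 _ "Suc n" _ "Suc n"]) auto
  also have "ctrans w * (w * ctrans w) = (ctrans w * w) * ctrans w"
   using car by (intro assoc_mult_mat[symmetric, of _ 1 "Suc n" _ 1 _ "Suc n"]) auto
  also have "... = complex_of_real (sqnorm w) \<cdot>\<^sub>m ctrans w"
   by (simp only: sqnorm_col[OF car(1)] mat_11_mult[OF car(5)])
  also have "w * ... = complex_of_real (sqnorm w) \<cdot>\<^sub>m W"
   unfolding W_def using car by (intro mult_smult_distrib) auto
  finally show ?thesis .
 qed
 have cW: "ctrans W = W" unfolding W_def using car by (simp add: ctrans_mult[of w "Suc n" 1 "ctrans w" "Suc n"])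
 have ca: "cnj a = a" by (simp add: a_def)
 show cQ: "ctrans Q = Q"
 proof (rule eq_matI)
  fix i j assume "i < dim_row Q" "j < dim_col Q"
  then have ij: "i < Suc n" "j < Suc n" using car by (auto simp: Q)
  have "cnj (W $$ (j, i)) = W $$ (i, j)" using ij car arg_cong[OF cW, of "\<lambda>A. A $$ (i, j)"] by simp
  then show "ctrans Q $$ (i, j) = Q $$ (i, j)" using ij car ca by (simp add: Q)
 qed (use car in \<open>auto simp: Q\<close>)
 have "Q * Q = 1\<^sub>m (Suc n) * Q + (a \<cdot>\<^sub>m W) * Q"
 proof -
  have "Q \<in> cmat (Suc n) (Suc n)" using car by (simp add: Q)
  then have "(1\<^sub>m (Suc n) + a \<cdot>\<^sub>m W) * Q = 1\<^sub>m (Suc n) * Q + (a \<cdot>\<^sub>m W) * Q"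
   using car by (intro add_mult_distrib_mat) auto
  then show ?thesis by (simp only: Q[symmetric])
 qed
 also have "(a \<cdot>\<^sub>m W) * Q = a \<cdot>\<^sub>m (W * Q)"
  using car by (intro mult_smult_assoc_mat[of _ "Suc n" "Suc n" _ "Suc n"]) (auto simp: Q)
 also have "W * Q = W + (a * complex_of_real (sqnorm w)) \<cdot>\<^sub>m W"
 proof -
  have "W * Q = W * 1\<^sub>m (Suc n) + W * (a \<cdot>\<^sub>m W)"
   unfolding Q using car by (intro mult_add_distrib_mat) auto
  also have "W * (a \<cdot>\<^sub>m W) = a \<cdot>\<^sub>m (W * W)" using car by (intro mult_smult_distrib) auto
  finally show ?thesis using car unfolding WW by (intro eq_matI) auto
 qed
 also have "a * complex_of_real (sqnorm w) = - 2" using sw0 by (simp add: a_def)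
 finally show QQ: "Q * Q = 1\<^sub>m (Suc n)"
  using car by (simp add: Q) (intro eq_matI, auto simp: algebra_simps)
 show "unitary_mat (Suc n) Q" using QQ cQ car by (simp add: unitary_mat_def Q)
 have "Q * v = 1\<^sub>m (Suc n) * v + (a \<cdot>\<^sub>m W) * v"
  unfolding Q using car by (intro add_mult_distrib_mat[of _ "Suc n" "Suc n" _ _ 1]) auto
 also have "(a \<cdot>\<^sub>m W) * v = a \<cdot>\<^sub>m (W * v)"
  using car by (intro mult_smult_assoc_mat[of _ "Suc n" "Suc n" _ 1]) auto
 also have "W * v = w * (ctrans w * v)"
  unfolding W_def using car by (intro assoc_mult_mat[of _ "Suc n" 1 _ "Suc n" _ 1]) auto
 also have "... = complex_of_real (r^2 + r) \<cdot>\<^sub>m w"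
  unfolding wv using car by (intro mat_mult_11)
 also have "a \<cdot>\<^sub>m (complex_of_real (r\<^sup>2 + r) \<cdot>\<^sub>m w) = (- 1) \<cdot>\<^sub>m w"
 proof -
  have "r^2 + r ~= 0" using sw sw0 by simp
  then have "2 / (2 * (r^2 + r)) * (r^2 + r) = 1" by simp
  then have "complex_of_real (2 / (2 * (r^2 + r))) * complex_of_real (r^2 + r) = 1"
   by (metis of_real_1 of_real_mult)
  then have "a * complex_of_real (r\<^sup>2 + r) = - 1" unfolding a_def sw by simp
  then have "a * (complex_of_real (r\<^sup>2 + r) * x) = - 1 * x" for x by (metis mult.assoc)
  then show ?thesis using car by (intro eq_matI) (auto simp del: of_real_add of_real_power)
 qed
 also have "1\<^sub>m (Suc n) * v + (- 1) \<cdot>\<^sub>m w = (- complex_of_real r) \<cdot>\<^sub>m e"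
 proof -
  have "1\<^sub>m (Suc n) * v = v" using car by simp
  then show ?thesis using car w by (intro eq_matI) auto
 qed
 finally show "Q * (unipotent n u * unit_col n) = (- complex_of_real r) \<cdot>\<^sub>m unit_col n"
  by (simp only: v_def e_def)
qed

lemma mult_unit_col:
 assumes R: "R \<in> cmat (Suc n) (Suc n)" and i: "i < Suc n"
 shows "(R * unit_col n) $$ (i, 0) = R $$ (i, 0)"
proof -
 have "(R * unit_col n) $$ (i, 0) = (\<Sum>k<Suc n. R $$ (i, k) * unit_col n $$ (k, 0))"
  using R i unit_col_carrier[of n] by (auto simp: scalar_prod_def lessThan_atLeast0 One_nat_def intro!: sum.cong)
 also have "... = (\<Sum>k<Suc n. if k = 0 then R $$ (i, 0) else 0)"
  by (intro sum.cong) (auto simp: unit_col_def unit_mat_def One_nat_def)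
 finally show ?thesis by simp
qed

text \<open>The first column of the product is a multiple of the first unit vector, which gives the
  block triangular shape. Both factors have determinants of modulus one, so the diagonal blocks do
  jointly.\<close>

lemma householder_unipotent:
 assumes u: "u \<in> cmat n 1"
 obtains s S where "s \<in> cmat 1 n" "S \<in> cmat n n"
  "householder n u * unipotent n u = bmat (- complex_of_real (col_norm u)) s (0\<^sub>m n 1) S"
  "col_norm u * cmod (det S) = 1"
proof -
 let ?Q = "householder n u" and ?r = "col_norm u"
 let ?R = "?Q * unipotent n u"
 have Rc: "?R \<in> cmat (Suc n) (Suc n)" by (intro mult_carrier_mat[of _ _ "Suc n"]) auto
 obtain x s c S where R: "s \<in> cmat 1 n" "c \<in> cmat n 1" "S \<in> cmat n n" "?R = bmat x s c S"
  by (rule bmat_cases[OF Rc])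
 have "?R * unit_col n = ?Q * (unipotent n u * unit_col n)"
  by (intro assoc_mult_mat[of _ "Suc n" "Suc n" _ "Suc n" _ 1]) auto
 then have eq: "?R * unit_col n = (- complex_of_real ?r) \<cdot>\<^sub>m unit_col n"
  using householder_props(4)[OF u] by simp
 note col = mult_unit_col[OF Rc]
 have "?R $$ (0, 0) = - complex_of_real ?r"
  using col[of 0] unfolding eq by (simp add: unit_col_def unit_mat_def One_nat_def)
 then have x: "x = - complex_of_real ?r" unfolding R(4) by (simp add: bmat_def One_nat_def)
 have "c = 0\<^sub>m n 1"
 proof (rule eq_matI)
  fix i j assume "i < dim_row (0\<^sub>m n 1 :: complex mat)" "j < dim_col (0\<^sub>m n 1 :: complex mat)"
  then have ij: "i < n" "j = 0" by (auto simp: One_nat_def)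
  have "?R $$ (Suc i, 0) = 0" using col[of "Suc i"] ij unfolding eq by (simp add: unit_col_def unit_mat_def One_nat_def)
  then show "c $$ (i, j) = 0\<^sub>m n 1 $$ (i, j)" using ij R unfolding R(4) by (simp add: bmat_def One_nat_def)
 qed (use R in auto)
 then have R': "?R = bmat (- complex_of_real ?r) s (0\<^sub>m n 1) S" using R(4) x by simp
 have "det ?R = det ?Q * det (unipotent n u)"
  by (intro det_mult[of _ "Suc n"]) auto
 also have "det (unipotent n u) = 1" using u by (simp add: unipotent_def det_bmat_upper_zero)
 finally have "cmod (det ?R) = 1"
  using cmod_det_unitary[OF householder_props(3)[OF u]] by simp
 moreover have "cmod (det ?R) = ?r * cmod (det S)"
  unfolding R' using R col_norm_ge_1[of u] by (simp add: det_bmat_lower_zero norm_mult)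
 ultimately show ?thesis using that[OF R(1,3) R'] by simp
qed

section \<open>Reduction to block triangular matrices\<close>

definition upper_integral :: "nat => (complex mat => ennreal) => ennreal" where
 "upper_integral n F = (\<integral>x:\<C>. \<integral>b:1,n. \<integral>B:n,n. F (bmat x b (0\<^sub>m n 1) B))"

lemma nn_integral_lborel_complex_scale:
 fixes r :: complex
 assumes r: "r ~= 0" and F: "F \<in> bmeas borel"
 shows "ennreal ((cmod r)^2) * (\<integral>x:\<C>. F (r * x)) = (\<integral>x:\<C>. F x)"
proof -
 have 0: "(\<lambda>x. F (r * x)) \<in> bmeas borel"
  by (rule measurable_compose[OF _ F]) (intro borel_measurable_times borel_measurable_const measurable_idt)
 have "of_nat (Suc 0) * (\<integral>x:\<C>. F x) = (\<integral>x:\<C>. ennreal ((cmod (poly (pderiv [:0, r:] * 1 - [:0, r:] * pderiv 1) x / (poly 1 x)^2))^2) * F (poly [:0, r:] x / poly 1 x))"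
  by (rule nn_integral_rational_substitution[OF _ _ _ _ F]) (use r in auto)
 also have "... = (\<integral>x:\<C>. ennreal ((cmod r)^2) * F (r * x))"
  by (intro nn_integral_cong) (simp add: pderiv_pCons mult.commute)
 also have "... = ennreal ((cmod r)^2) * (\<integral>x:\<C>. F (r * x))"
  using 0 by (intro nn_integral_cmult) simp
 finally show ?thesis by simp
qed

lemma upper_block_measurable:
 assumes "F \<in> bmeas (lmat (Suc n) (Suc n))"
  "x \<in> bmeas N" "b \<in> N \<rightarrow>\<^sub>M lmat 1 n" "B \<in> N \<rightarrow>\<^sub>M lmat n n"
 shows "(\<lambda>w. F (bmat (x w) (b w) (0\<^sub>m n 1) (B w))) \<in> bmeas N"
 by (rule measurable_compose[OF _ assms(1)]) (intro measurable_bmat meas_zero assms(2-))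

lemma bmat_upper_mult:
 assumes "s \<in> cmat 1 n" "S \<in> cmat n n" "b \<in> cmat 1 n" "B \<in> cmat n n"
 shows "bmat r s (0\<^sub>m n 1) S * bmat x b (0\<^sub>m n 1) B = bmat (r * x) (r \<cdot>\<^sub>m b + s * B) (0\<^sub>m n 1) (S * B)"
proof -
 have "bmat r s (0\<^sub>m n 1) S * bmat x b (0\<^sub>m n 1) B = bmat (r * x + (s * 0\<^sub>m n 1) $$ (0, 0)) (r \<cdot>\<^sub>m b + s * B)
   (x \<cdot>\<^sub>m 0\<^sub>m n 1 + S * 0\<^sub>m n 1) (0\<^sub>m n 1 * b + S * B)"
  by (rule bmat_mult) (use assms in auto)
 moreover have "(s * 0\<^sub>m n 1) $$ (0, 0) = 0" "x \<cdot>\<^sub>m 0\<^sub>m n 1 + S * 0\<^sub>m n 1 = 0\<^sub>m n 1" "0\<^sub>m n 1 * b + S * B = S * B"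
  using assms by (auto intro!: eq_matI)
 ultimately show ?thesis by simp
qed

text \<open>The corner is scaled by r, the row of length n is scaled by r and shifted, and the block
  is multiplied by S from the left. The Jacobians are |r|^2, |r|^(2n) and |det S|^(2n).\<close>

lemma upper_integral_left:
 assumes F: "F \<in> bmeas (lmat (Suc n) (Suc n))"
  and r: "r ~= 0" and s: "s \<in> cmat 1 n" and S: "S \<in> cmat n n" "det S ~= 0"
 shows "ennreal (cmod r ^ (2 * n + 2) * cmod (det S) ^ (2 * n)) *
  upper_integral n (\<lambda>T. F (bmat r s (0\<^sub>m n 1) S * T)) = upper_integral n F"
proof -
 let ?F = "\<lambda>x b B. F (bmat x b (0\<^sub>m n 1) B)"
 let ?kb = "ennreal (cmod r ^ (2 * (1 * n)))" and ?kB = "ennreal (cmod (det S) ^ (2 * n))" and ?kx = "ennreal ((cmod r)^2)"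
 note meas = upper_block_measurable[OF F]
 have inner: "?kB * (?kb * (\<integral>b:1,n. \<integral>B:n,n. ?F (r * x) (r \<cdot>\<^sub>m b + s * B) (S * B)))
   = (\<integral>b:1,n. \<integral>B:n,n. ?F (r * x) b B)" for x
 proof -
  have m1: "(\<lambda>(b, B). ?F (r * x) (r \<cdot>\<^sub>m b + s * B) (S * B)) \<in> bmeas (lmat 1 n \<Otimes>\<^sub>M lmat n n)"
   unfolding case_prod_unfold using s S
   by (intro meas meas_add meas_smult meas_mult[where b = n] borel_measurable_const
    meas_const measurable_fst measurable_snd)
  have m2: "(\<lambda>(b, B). ?F (r * x) b B) \<in> bmeas (lmat 1 n \<Otimes>\<^sub>M lmat n n)"
   unfolding case_prod_unfold by (intro meas borel_measurable_const measurable_fst measurable_snd)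
  have m3: "(\<lambda>(B, b). ?F (r * x) (r \<cdot>\<^sub>m b + s * B) (S * B)) \<in> bmeas (lmat n n \<Otimes>\<^sub>M lmat 1 n)"
   unfolding case_prod_unfold using s S
   by (intro meas meas_add meas_smult meas_mult[where b = n] borel_measurable_const
    meas_const measurable_fst measurable_snd)
  have m4: "(\<lambda>(B, b). ?F (r * x) b B) \<in> bmeas (lmat n n \<Otimes>\<^sub>M lmat 1 n)"
   unfolding case_prod_unfold by (intro meas borel_measurable_const measurable_fst measurable_snd)
  have e1: "(\<integral>b:1,n. \<integral>B:n,n. ?F (r * x) (r \<cdot>\<^sub>m b + s * B) (S * B))
    = (\<integral>B:n,n. \<integral>b:1,n. ?F (r * x) (r \<cdot>\<^sub>m b + s * B) (S * B))"
   by (rule nn_integral_lmat_swap[OF m1])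
  have e2: "?kb * (\<integral>B:n,n. \<integral>b:1,n. ?F (r * x) (r \<cdot>\<^sub>m b + s * B) (S * B))
    = (\<integral>B:n,n. ?kb * (\<integral>b:1,n. ?F (r * x) (r \<cdot>\<^sub>m b + s * B) (S * B)))"
   by (intro nn_integral_cmult[symmetric] lmat.borel_measurable_nn_integral m3)
  have e3: "(\<integral>B:n,n. ?kb * (\<integral>b:1,n. ?F (r * x) (r \<cdot>\<^sub>m b + s * B) (S * B)))
    = (\<integral>B:n,n. \<integral>b:1,n. ?F (r * x) b (S * B))"
  proof (rule nn_integral_cong_mat)
   fix B :: "complex mat" assume B: "B \<in> cmat n n"
   have "s * B \<in> cmat 1 n" "S * B \<in> cmat n n" using s S B by auto
   then show "?kb * (\<integral>b:1,n. ?F (r * x) (r \<cdot>\<^sub>m b + s * B) (S * B)) = (\<integral>b:1,n. ?F (r * x) b (S * B))"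
    by (intro nn_integral_lmat_affine[OF r] meas borel_measurable_const meas_const measurable_idt)
  qed
  have e4: "?kB * (\<integral>B:n,n. \<integral>b:1,n. ?F (r * x) b (S * B)) = (\<integral>B:n,n. \<integral>b:1,n. ?F (r * x) b B)"
   using S by (intro nn_integral_left_mult lmat.borel_measurable_nn_integral m4)
  have e5: "(\<integral>B:n,n. \<integral>b:1,n. ?F (r * x) b B) = (\<integral>b:1,n. \<integral>B:n,n. ?F (r * x) b B)"
   by (rule nn_integral_lmat_swap[OF m4])
  show ?thesis by (simp only: e1 e2 e3 e4 e5)
 qed
 let ?J = "\<lambda>x. \<integral>b:1,n. \<integral>B:n,n. ?F x b B"
 let ?K = "\<lambda>x. \<integral>b:1,n. \<integral>B:n,n. ?F (r * x) (r \<cdot>\<^sub>m b + s * B) (S * B)"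
 have J: "?J \<in> bmeas borel"
 proof -
  have "fst \<circ> fst \<in> ((borel :: complex measure) \<Otimes>\<^sub>M lmat 1 n) \<Otimes>\<^sub>M lmat n n \<rightarrow>\<^sub>M borel" by simp
  then have "(\<lambda>p. ?F (fst (fst p)) (snd (fst p)) (snd p)) \<in> bmeas ((borel \<Otimes>\<^sub>M lmat 1 n) \<Otimes>\<^sub>M lmat n n)"
   by (intro meas) simp_all
  then show ?thesis by (intro lmat.borel_measurable_nn_integral) (simp add: case_prod_unfold)
 qed
 have K: "?K \<in> bmeas borel"
 proof -
  have 1: "(\<lambda>p. fst (fst p)) \<in> ((borel :: complex measure) \<Otimes>\<^sub>M lmat 1 n) \<Otimes>\<^sub>M lmat n n \<rightarrow>\<^sub>M borel"
   and 2: "(\<lambda>p. snd (fst p)) \<in> ((borel :: complex measure) \<Otimes>\<^sub>M lmat 1 n) \<Otimes>\<^sub>M lmat n n \<rightarrow>\<^sub>M lmat 1 n"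
   by simp_all
  have "(\<lambda>p. ?F (r * fst (fst p)) (r \<cdot>\<^sub>m snd (fst p) + s * snd p) (S * snd p)) \<in> bmeas ((borel \<Otimes>\<^sub>M lmat 1 n) \<Otimes>\<^sub>M lmat n n)"
   using s S by (intro meas meas_add meas_smult meas_mult[where b = n] borel_measurable_const
    meas_const measurable_snd borel_measurable_times 1 2)
  then show ?thesis by (intro lmat.borel_measurable_nn_integral) (simp add: case_prod_unfold)
 qed
 have "upper_integral n (\<lambda>T. F (bmat r s (0\<^sub>m n 1) S * T)) = (\<integral>x:\<C>. ?K x)"
  unfolding upper_integral_def
 proof (rule nn_integral_cong, rule nn_integral_cong, rule nn_integral_cong)
  fix x b B assume "b \<in> space (lmat 1 n)" "B \<in> space (lmat n n)"
  then show "F (bmat r s (0\<^sub>m n 1) S * bmat x b (0\<^sub>m n 1) B) = ?F (r * x) (r \<cdot>\<^sub>m b + s * B) (S * B)"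
   using bmat_upper_mult[OF s S(1), of b B r x] by simp
 qed
 moreover have "?kB * (?kb * (\<integral>x:\<C>. ?K x)) = (\<integral>x:\<C>. ?J (r * x))"
 proof -
  have "?kB * (?kb * (\<integral>x:\<C>. ?K x)) = ?kB * (\<integral>x:\<C>. ?kb * ?K x)"
   using K by (subst nn_integral_cmult) simp_all
  also have "... = (\<integral>x:\<C>. ?kB * (?kb * ?K x))"
   using K by (intro nn_integral_cmult[symmetric] measurable_times) simp_all
  also have "... = (\<integral>x:\<C>. ?J (r * x))"
   by (intro nn_integral_cong inner)
  finally show ?thesis .
 qed
 moreover have "?kx * (\<integral>x:\<C>. ?J (r * x)) = (\<integral>x:\<C>. ?J x)"
  by (rule nn_integral_lborel_complex_scale[OF r J])
 moreover have "ennreal (cmod r ^ (2 * n + 2) * cmod (det S) ^ (2 * n)) = ?kx * (?kB * ?kb)"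
  by (simp add: ennreal_mult power_add power2_eq_square ac_simps)
 ultimately show ?thesis
  by (simp only: mult.assoc upper_integral_def)
qed

text \<open>The corner is scaled by r, and the row and the block are multiplied by S from the right:
  |r|^2, |det S|^2 and |det S|^(2n). The factor differs from that of left multiplication, since the
  block triangular group is not unimodular; after a conjugation the difference leaves a power of
  \<open>col_norm u\<close>.\<close>

lemma upper_integral_right:
 assumes F: "F \<in> bmeas (lmat (Suc n) (Suc n))"
  and r: "r ~= 0" and s: "s \<in> cmat 1 n" and S: "S \<in> cmat n n" "det S ~= 0"
 shows "ennreal ((cmod r)^2 * cmod (det S) ^ (2 * n + 2)) *
  upper_integral n (\<lambda>T. F (T * bmat r s (0\<^sub>m n 1) S)) = upper_integral n F"
proof -
 let ?F = "\<lambda>x b B. F (bmat x b (0\<^sub>m n 1) B)"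
 let ?kb = "ennreal (cmod (det S) ^ (2 * 1))" and ?kB = "ennreal (cmod (det S) ^ (2 * n))" and ?kx = "ennreal ((cmod r)^2)"
 note meas = upper_block_measurable[OF F]
 let ?L = "\<lambda>x b. \<integral>B:n,n. ?F x b B"
 let ?M = "\<lambda>x b. \<integral>B:n,n. ?F x b (B * S)"
 have LM: "?kB * ?M x b = ?L x b" if "b \<in> cmat 1 n" for x b
  using that S by (intro nn_integral_right_mult meas borel_measurable_const meas_const measurable_idt)
 have Lm: "(\<lambda>b. ?L x b) \<in> bmeas (lmat 1 n)" for x
 proof -
  have "(\<lambda>p. ?F x (fst p) (snd p)) \<in> bmeas (lmat 1 n \<Otimes>\<^sub>M lmat n n)"
   by (intro meas borel_measurable_const measurable_fst measurable_snd)
  then show ?thesis by (intro lmat.borel_measurable_nn_integral) (simp add: case_prod_unfold)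
 qed
 have Mm: "(\<lambda>p. ?M (fst p * r) (fst p \<cdot>\<^sub>m s + snd p * S)) \<in> bmeas ((borel :: complex measure) \<Otimes>\<^sub>M lmat 1 n)"
 proof -
  have 1: "(\<lambda>p. fst (fst p)) \<in> ((borel :: complex measure) \<Otimes>\<^sub>M lmat 1 n) \<Otimes>\<^sub>M lmat n n \<rightarrow>\<^sub>M borel"
   and 2: "(\<lambda>p. snd (fst p)) \<in> ((borel :: complex measure) \<Otimes>\<^sub>M lmat 1 n) \<Otimes>\<^sub>M lmat n n \<rightarrow>\<^sub>M lmat 1 n"
   by simp_all
  have "(\<lambda>p. ?F (fst (fst p) * r) (fst (fst p) \<cdot>\<^sub>m s + snd (fst p) * S) (snd p * S)) \<in> bmeas ((borel \<Otimes>\<^sub>M lmat 1 n) \<Otimes>\<^sub>M lmat n n)"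
   using s S by (intro meas meas_add meas_smult meas_mult[where b = n] borel_measurable_const
    meas_const measurable_snd borel_measurable_times 1 2)
  then show ?thesis by (intro lmat.borel_measurable_nn_integral) (simp add: case_prod_unfold)
 qed
 have Mmx: "(\<lambda>b. ?M (x * r) (x \<cdot>\<^sub>m s + b * S)) \<in> bmeas (lmat 1 n)" for x
  using measurable_compose[OF measurable_Pair1' Mm, of x] by simp
 let ?J = "\<lambda>x. \<integral>b:1,n. ?L x b"
 let ?K = "\<lambda>x. \<integral>b:1,n. ?M (x * r) (x \<cdot>\<^sub>m s + b * S)"
 have J: "?J \<in> bmeas borel"
 proof -
  have "fst \<circ> fst \<in> ((borel :: complex measure) \<Otimes>\<^sub>M lmat 1 n) \<Otimes>\<^sub>M lmat n n \<rightarrow>\<^sub>M borel" by simp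
  then have "(\<lambda>p. ?F (fst (fst p)) (snd (fst p)) (snd p)) \<in> bmeas ((borel \<Otimes>\<^sub>M lmat 1 n) \<Otimes>\<^sub>M lmat n n)"
   by (intro meas) simp_all
  then show ?thesis by (intro lmat.borel_measurable_nn_integral) (simp add: case_prod_unfold)
 qed
 have K: "?K \<in> bmeas borel"
  using Mm by (intro lmat.borel_measurable_nn_integral) (simp add: case_prod_unfold)
 have KJ: "?kb * (?kB * ?K x) = ?J (r * x)" for x
 proof -
  have "?kB * ?K x = (\<integral>b:1,n. ?kB * ?M (x * r) (x \<cdot>\<^sub>m s + b * S))"
   by (rule nn_integral_cmult[OF Mmx, symmetric])
  also have "... = (\<integral>b:1,n. ?L (x * r) (x \<cdot>\<^sub>m s + b * S))"
   using s S by (intro nn_integral_cong LM) auto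
  finally have 1: "?kB * ?K x = (\<integral>b:1,n. ?L (x * r) (x \<cdot>\<^sub>m s + b * S))" .
  have "?kb * (\<integral>b:1,n. ?L (x * r) (x \<cdot>\<^sub>m s + b * S)) = (\<integral>b:1,n. ?L (x * r) (x \<cdot>\<^sub>m s + b))"
   using s S by (intro nn_integral_right_mult measurable_compose[OF _ Lm] meas_add meas_const
    measurable_idt) auto
  also have "... = (\<integral>b:1,n. ?L (x * r) (b + x \<cdot>\<^sub>m s))"
   using s by (intro nn_integral_cong) (simp add: comm_add_mat[of "x \<cdot>\<^sub>m s" 1 n])
  also have "... = ?J (x * r)"
   using s by (intro nn_integral_lmat_translate Lm) auto
  finally show ?thesis unfolding 1 by (simp only: mult.commute)
 qed
 have "upper_integral n (\<lambda>T. F (T * bmat r s (0\<^sub>m n 1) S)) = (\<integral>x:\<C>. ?K x)"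
  unfolding upper_integral_def
 proof (rule nn_integral_cong, rule nn_integral_cong, rule nn_integral_cong)
  fix x b B assume "b \<in> space (lmat 1 n)" "B \<in> space (lmat n n)"
  then show "F (bmat x b (0\<^sub>m n 1) B * bmat r s (0\<^sub>m n 1) S) = ?F (x * r) (x \<cdot>\<^sub>m s + b * S) (B * S)"
   using bmat_upper_mult[of b n B s S x r] s S by simp
 qed
 moreover have "?kb * (?kB * (\<integral>x:\<C>. ?K x)) = (\<integral>x:\<C>. ?J (r * x))"
 proof -
  have "?kb * (?kB * (\<integral>x:\<C>. ?K x)) = ?kb * (\<integral>x:\<C>. ?kB * ?K x)"
   using K by (subst nn_integral_cmult) simp_all
  also have "... = (\<integral>x:\<C>. ?kb * (?kB * ?K x))"
   using K by (intro nn_integral_cmult[symmetric] measurable_times) simp_all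
  also have "... = (\<integral>x:\<C>. ?J (r * x))"
   by (intro nn_integral_cong KJ)
  finally show ?thesis .
 qed
 moreover have "?kx * (\<integral>x:\<C>. ?J (r * x)) = (\<integral>x:\<C>. ?J x)"
  by (rule nn_integral_lborel_complex_scale[OF r J])
 moreover have "ennreal ((cmod r)^2 * cmod (det S) ^ (2 * n + 2)) = ?kx * (?kb * ?kB)"
  by (simp add: ennreal_mult power_add power2_eq_square ac_simps)
 ultimately show ?thesis
  by (simp only: mult.assoc upper_integral_def)
qed

text \<open>The adjugate formula is total and visibly measurable; singular matrices are sent to 0,
  in agreement with \<open>signed_mat\<close>.\<close>

definition minv :: "complex mat => complex mat" where
 "minv X = inverse (det X) \<cdot>\<^sub>m adj_mat X"

lemma minv_carrier [simp]: "X \<in> cmat n n ==> minv X \<in> cmat n n"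
 by (simp add: minv_def adj_mat(1))

lemma minv_mult:
 assumes "X \<in> cmat n n" "det X ~= 0"
 shows "X * minv X = 1\<^sub>m n" "minv X * X = 1\<^sub>m n"
proof -
 have "X * minv X = inverse (det X) \<cdot>\<^sub>m (X * adj_mat X)"
  unfolding minv_def using assms adj_mat(1)[OF assms(1)] by (intro mult_smult_distrib) auto
 also have "... = 1\<^sub>m n" unfolding adj_mat(2)[OF assms(1)] using assms by (intro eq_matI) auto
 finally show 1: "X * minv X = 1\<^sub>m n" .
 show "minv X * X = 1\<^sub>m n" by (rule mat_mult_left_right_inverse[OF assms(1) minv_carrier[OF assms(1)] 1])
qed

lemma minv_singular:
 assumes "X \<in> cmat n n" "det X = 0"
 shows "minv X = 0\<^sub>m n n"
 using assms adj_mat(1)[OF assms(1)] by (intro eq_matI) (auto simp: minv_def)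

lemma minv_unique:
 assumes X: "X \<in> cmat n n" and Y: "Y \<in> cmat n n" and XY: "X * Y = 1\<^sub>m n"
 shows "minv X = Y" "det X ~= 0" "det Y = inverse (det X)"
proof -
 have "det X * det Y = 1" using det_mult[OF X Y] XY by simp
 then show d: "det X ~= 0" "det Y = inverse (det X)"
  by (auto dest: inverse_unique)
 have "minv X = minv X * (X * Y)" using right_mult_one_mat[OF minv_carrier[OF X]] XY by simp
 also have "... = (minv X * X) * Y" using X Y by (intro assoc_mult_mat[symmetric, of _ n n _ n _ n]) auto
 finally show "minv X = Y" using minv_mult(2)[OF X d(1)] Y by simp
qed

lemma det_minv:
 assumes "X \<in> cmat n n" "det X ~= 0"
 shows "det (minv X) = inverse (det X)"
 using minv_unique(3)[OF assms(1) _ minv_mult(1)[OF assms]] assms by simp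

lemma minv_minv:
 assumes "X \<in> cmat n n" "det X ~= 0"
 shows "minv (minv X) = X"
 using minv_unique(1)[OF _ assms(1) minv_mult(2)[OF assms]] assms by simp

text \<open>When a factor is singular both sides are 0, so the rule holds for all square
  matrices.\<close>

lemma minv_times:
 assumes X: "X \<in> cmat n n" and Y: "Y \<in> cmat n n"
 shows "minv (X * Y) = minv Y * minv X"
proof (cases "det X = 0 \<or> det Y = 0")
 case True
 then have "det (X * Y) = 0" using det_mult[OF X Y] by auto
 moreover have "X * Y \<in> cmat n n" using X Y by simp
 ultimately have "minv (X * Y) = 0\<^sub>m n n" by (simp add: minv_singular)
 moreover have "minv Y * minv X = 0\<^sub>m n n"
 proof (cases "det X = 0")
  case True then show ?thesis using minv_singular[OF X] right_mult_zero_mat[OF minv_carrier[OF Y]] by simp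
 next
  case False then show ?thesis using minv_singular[OF Y] left_mult_zero_mat[OF minv_carrier[OF X]] True by simp
 qed
 ultimately show ?thesis by simp
next
 case False
 have c: "minv X \<in> cmat n n" "minv Y \<in> cmat n n" using X Y by auto
 have "X * Y * (minv Y * minv X) = X * (Y * (minv Y * minv X))"
  by (rule assoc_mult_mat[OF X Y mult_carrier_mat[OF c(2,1)]])
 also have "Y * (minv Y * minv X) = Y * minv Y * minv X"
  by (rule assoc_mult_mat[OF Y c(2,1), symmetric])
 also have "... = minv X" using minv_mult(1)[OF Y] False c by simp
 also have "X * minv X = 1\<^sub>m n" using minv_mult(1)[OF X] False by simp
 finally show ?thesis using mult_carrier_mat[OF X Y] mult_carrier_mat[OF c(2,1)] by (intro minv_unique(1)[where n = n])
qed

lemma minv_unitary: "unitary_mat n Q ==> minv Q = ctrans Q" "unitary_mat n Q ==> det Q ~= 0"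
 by (auto simp: unitary_mat_def intro: minv_unique(1)) (metis ctrans_carrier minv_unique(2))

lemma minv_bmat_upper:
 assumes s: "s \<in> cmat 1 n" and S: "S \<in> cmat n n" "det S ~= 0" and r: "r ~= 0"
 shows "minv (bmat r s (0\<^sub>m n 1) S) = bmat (1 / r) ((- 1 / r) \<cdot>\<^sub>m (s * minv S)) (0\<^sub>m n 1) (minv S)"
proof (rule minv_unique(1)[where n = "Suc n"])
 have sS: "s * minv S \<in> cmat 1 n" using s S by simp
 have "r \<cdot>\<^sub>m ((- 1 / r) \<cdot>\<^sub>m M) + M = 0\<^sub>m 1 n" if "M \<in> cmat 1 n" for M
  using that r by (intro eq_matI) auto
 note this[OF sS]
 then have "bmat r s (0\<^sub>m n 1) S * bmat (1 / r) ((- 1 / r) \<cdot>\<^sub>m (s * minv S)) (0\<^sub>m n 1) (minv S)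
   = bmat 1 (0\<^sub>m 1 n) (0\<^sub>m n 1) (1\<^sub>m n)"
  using sS s S r by (subst bmat_upper_mult) (simp_all add: minv_mult)
 also have "... = 1\<^sub>m (Suc n)" by (intro eq_matI) (auto simp: bmat_def One_nat_def)
 finally show "bmat r s (0\<^sub>m n 1) S * bmat (1 / r) ((- 1 / r) \<cdot>\<^sub>m (s * minv S)) (0\<^sub>m n 1) (minv S) = 1\<^sub>m (Suc n)" .
qed (use S in auto)

lemma meas_delete:
 assumes f: "f \<in> N \<rightarrow>\<^sub>M lmat (Suc m) (Suc n)"
 shows "(\<lambda>w. mat_delete (f w) i j) \<in> N \<rightarrow>\<^sub>M lmat m n"
proof (rule measurable_lmat)
 fix w assume "w \<in> space N"
 then show "mat_delete (f w) i j \<in> cmat m n"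
  using measurable_carrier[OF f] mat_delete_carrier[of "f w" "Suc m" "Suc n" i j] by simp
next
 fix p q assume pq: "p < m" "q < n"
 show "(\<lambda>w. mat_delete (f w) i j $$ (p, q)) \<in> bmeas N"
 proof (rule measurable_eqI)
  show "mat_delete (f w) i j $$ (p, q) = f w $$ (if p < i then p else Suc p, if q < j then q else Suc q)"
   if "w \<in> space N" for w
   using measurable_carrier[OF f that] pq by (simp add: mat_delete_def)
  show "(\<lambda>w. f w $$ (if p < i then p else Suc p, if q < j then q else Suc q)) \<in> bmeas N"
   using pq by (intro meas_entry[OF _ _ f]) auto
 qed
qed

lemma measurable_adj_mat:
 assumes f: "f \<in> N \<rightarrow>\<^sub>M lmat n n"
 shows "(\<lambda>w. adj_mat (f w)) \<in> N \<rightarrow>\<^sub>M lmat n n"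
proof (rule measurable_lmat)
 show "adj_mat (f w) \<in> cmat n n" if "w \<in> space N" for w
  using adj_mat(1)[OF measurable_carrier[OF f that]] .
next
 fix p q assume pq: "p < n" "q < n"
 then obtain m where m: "n = Suc m" by (cases n) auto
 show "(\<lambda>w. adj_mat (f w) $$ (p, q)) \<in> bmeas N"
 proof (rule measurable_eqI)
  show "adj_mat (f w) $$ (p, q) = (- 1) ^ (q + p) * det (mat_delete (f w) q p)" if "w \<in> space N" for w
   using measurable_carrier[OF f that] pq by (simp add: adj_mat_def cofactor_def)
  show "(\<lambda>w. (- 1) ^ (q + p) * det (mat_delete (f w) q p)) \<in> bmeas N"
   using f unfolding m by (intro borel_measurable_times borel_measurable_const meas_det[where n = m] meas_delete)
 qed
qed

lemma measurable_minv:
 assumes "f \<in> N \<rightarrow>\<^sub>M lmat n n"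
 shows "(\<lambda>w. minv (f w)) \<in> N \<rightarrow>\<^sub>M lmat n n"
 unfolding minv_def using assms
 by (intro meas_smult borel_measurable_inverse meas_det measurable_adj_mat)

text \<open>On a block triangular matrix with corner z and block N this is |det (zI - N)|^2. It is a
  function of the whole matrix so that it can be part of an integrand of
  \<open>upper_integral\<close>.\<close>

definition eig_kernel :: "complex mat => real" where
 "eig_kernel T = (cmod (poly (char_poly (mat_delete T 0 0)) (T $$ (0, 0))))^2"

lemma bmat_00 [simp]: "bmat x b c D $$ (0, 0) = x"
 by (simp add: bmat_def four_block_mat_def Let_def One_nat_def)

lemma mat_delete_bmat:
 assumes "b \<in> cmat 1 n" "c \<in> cmat n 1" "D \<in> cmat n n"
 shows "mat_delete (bmat x b c D) 0 0 = D"
 using assms by (intro eq_matI) (auto simp: mat_delete_def bmat_def One_nat_def)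

lemma eig_kernel_bmat:
 assumes "b \<in> cmat 1 n" "c \<in> cmat n 1" "D \<in> cmat n n"
 shows "eig_kernel (bmat x b c D) = (cmod (poly (char_poly D) x))^2"
 using mat_delete_bmat[OF assms] by (simp add: eig_kernel_def)

lemma measurable_eig_kernel:
 assumes "f \<in> N \<rightarrow>\<^sub>M lmat (Suc n) (Suc n)"
 shows "(\<lambda>w. eig_kernel (f w)) \<in> bmeas N"
 unfolding eig_kernel_def
 by (intro borel_measurable_power measurable_cmod measurable_char_poly_eval[where n = n]
   meas_delete meas_entry[OF _ _ assms] assms) auto

lemma upper_integral_cong:
 assumes "\<And>x b B. b \<in> cmat 1 n ==> B \<in> cmat n n ==> F (bmat x b (0\<^sub>m n 1) B) = G (bmat x b (0\<^sub>m n 1) B)"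
 shows "upper_integral n F = upper_integral n G"
 unfolding upper_integral_def by (rule nn_integral_cong, rule nn_integral_cong, rule nn_integral_cong) (use assms in simp)

text \<open>The integrand is (1 + |u|^2)^(-(n + 1)), up to normalisation the Fubini-Study volume
  density of complex projective n-space in the chart u, where (1, u) spans the eigenline.\<close>

definition kappa :: "nat => ennreal" where
 "kappa n = (\<integral>u:n,1. ennreal (1 / col_norm u ^ (2 * n + 2)))"

lemma kappa_mult: "(\<integral>u:n,1. ennreal (1 / col_norm u ^ (2 * n + 2)) * a) = kappa n * a"
 unfolding kappa_def
 by (intro nn_integral_multc measurable_to_ennreal borel_measurable_divide borel_measurable_const
   borel_measurable_power measurable_col_norm[where m = n and n = 1] measurable_idt)

text \<open>Tonelli with u outermost, since the reflection and the triangular factor of the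
  unipotent matrix are functions of u alone.\<close>

lemma nn_integral_move_third:
 assumes H: "(\<lambda>(z, b, u, N). H z b u N) \<in> bmeas
   (clborel \<Otimes>\<^sub>M (lmat p q \<Otimes>\<^sub>M (lmat r s \<Otimes>\<^sub>M lmat t v)))"
 shows "(\<integral>z:\<C>. \<integral>b:p,q. \<integral>u:r,s. \<integral>N:t,v. H z b u N)
  = (\<integral>u:r,s. \<integral>z:\<C>. \<integral>b:p,q. \<integral>N:t,v. H z b u N)"
proof -
 have "(\<integral>b:p,q. \<integral>u:r,s. \<integral>N:t,v. H z b u N)
   = (\<integral>u:r,s. \<integral>b:p,q. \<integral>N:t,v. H z b u N)" for z
 proof (rule nn_integral_lmat_swap)
  have "(\<lambda>w. H z (fst (fst w)) (snd (fst w)) (snd w)) \<in> bmeas ((lmat p q \<Otimes>\<^sub>M lmat r s) \<Otimes>\<^sub>M lmat t v)"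
   by (intro measurable_4_compose[OF H] borel_measurable_const) simp_all
  then show "(\<lambda>(b, u). \<integral>N:t,v. H z b u N) \<in> bmeas (lmat p q \<Otimes>\<^sub>M lmat r s)"
   unfolding case_prod_unfold by (intro lmat.borel_measurable_nn_integral) (simp add: case_prod_unfold)
 qed
 moreover have "(\<integral>z:\<C>. \<integral>u:r,s. \<integral>b:p,q. \<integral>N:t,v. H z b u N)
   = (\<integral>u:r,s. \<integral>z:\<C>. \<integral>b:p,q. \<integral>N:t,v. H z b u N)"
 proof (rule nn_integral_lborel_lmat_swap)
  have "(\<lambda>p. fst (fst (fst p))) \<in> ((clborel \<Otimes>\<^sub>M lmat r s) \<Otimes>\<^sub>M lmat p q) \<Otimes>\<^sub>M lmat t v \<rightarrow>\<^sub>M lborel"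
   by simp
  then have "(\<lambda>w. H (fst (fst (fst w))) (snd (fst w)) (snd (fst (fst w))) (snd w)) \<in> bmeas
    (((clborel \<Otimes>\<^sub>M lmat r s) \<Otimes>\<^sub>M lmat p q) \<Otimes>\<^sub>M lmat t v)"
   by (intro measurable_4_compose[OF H]) simp_all
  then show "(\<lambda>(z, u). \<integral>b:p,q. \<integral>N:t,v. H z b u N) \<in> bmeas (clborel \<Otimes>\<^sub>M lmat r s)"
   unfolding case_prod_unfold by (intro lmat.borel_measurable_nn_integral) (simp add: case_prod_unfold)
 qed
 ultimately show ?thesis by simp
qed

text \<open>A QR factorisation U = QR of the unipotent matrix; its inverse is R^(-1) Q, because the
  reflection Q is its own inverse. Hence U T U^(-1) = Q (R T R^(-1)) Q.\<close>

lemma unipotent_householder: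
 assumes u: "u \<in> cmat n 1"
 defines "Q \<equiv> householder n u"
 obtains s S where "s \<in> cmat 1 n" "S \<in> cmat n n" "det S ~= 0"
  "col_norm u * cmod (det S) = 1"
  "unipotent n u = Q * bmat (- complex_of_real (col_norm u)) s (0\<^sub>m n 1) S"
  "unipotent n ((- 1) \<cdot>\<^sub>m u) = minv (bmat (- complex_of_real (col_norm u)) s (0\<^sub>m n 1) S) * Q"
proof -
 obtain s S where s: "s \<in> cmat 1 n" "S \<in> cmat n n"
  and R: "Q * unipotent n u = bmat (- complex_of_real (col_norm u)) s (0\<^sub>m n 1) S"
  and d: "col_norm u * cmod (det S) = 1"
  unfolding Q_def by (rule householder_unipotent[OF u])
 note Q = householder_props[OF u, folded Q_def]
 have Qc: "Q \<in> cmat (Suc n) (Suc n)" by (simp add: Q_def)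
 have "Q * (Q * unipotent n u) = (Q * Q) * unipotent n u"
  using Qc by (intro assoc_mult_mat[symmetric, of _ "Suc n" "Suc n" _ "Suc n" _ "Suc n"]) auto
 then have 1: "unipotent n u = Q * bmat (- complex_of_real (col_norm u)) s (0\<^sub>m n 1) S"
  unfolding R Q(2) left_mult_one_mat[OF unipotent_carrier] by (rule sym)
 have "unipotent n ((- 1) \<cdot>\<^sub>m u) = minv (unipotent n u)"
  by (rule minv_unique(1)[where n = "Suc n", symmetric]) (use u unipotent_mult_inverse(1)[OF u] in auto)
 also have "... = minv (bmat (- complex_of_real (col_norm u)) s (0\<^sub>m n 1) S) * minv Q"
  unfolding 1 using s(2) by (intro minv_times[OF Qc]) auto
 also have "minv Q = Q" using minv_unitary(1)[OF Q(3)] Q(1) by simp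
 finally show ?thesis using that[OF s _ d 1] d by fastforce
qed

lemma mult_assoc_conj:
 assumes "Q \<in> cmat m m" "R \<in> cmat m m" "T \<in> cmat m m" "R' \<in> cmat m m"
 shows "Q * R * T * (R' * Q) = Q * (R * T * R') * Q" "Q * R * T = Q * (R * T)"
 using assms by (simp_all add: assoc_mult_mat[of _ m m _ m _ m] mult_carrier_mat[of _ m m _ m])

text \<open>The reflection disappears by the invariance of F. What remains is conjugation by R
  within the block triangular matrices, whose Jacobian is a power of \<open>col_norm u\<close>, so
  that the integral over u factors out as \<open>kappa n\<close>.\<close>

theorem nn_integral_conj_invariant:
 assumes F: "F \<in> bmeas (lmat (Suc n) (Suc n))"
  and inv: "\<And>Q X. unitary_mat (Suc n) Q ==> X \<in> cmat (Suc n) (Suc n) ==> F (Q * X * ctrans Q) = F X"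
 shows "of_nat (Suc n) * integral\<^sup>N (lmat (Suc n) (Suc n)) F =
  kappa n * upper_integral n (\<lambda>T. ennreal (eig_kernel T) * F T)"
proof -
 define H where "H T = ennreal (eig_kernel T) * F T" for T
 have Hm: "H \<in> bmeas (lmat (Suc n) (Suc n))"
  unfolding H_def by (intro measurable_times measurable_to_ennreal measurable_eig_kernel[where n = n]
    measurable_idt F)
 have Km: "(\<lambda>(z, b, u, N). ennreal ((cmod (poly (char_poly N) z))^2) * F (triangularized n u z b N)) \<in> bmeas
   (clborel \<Otimes>\<^sub>M (lmat 1 n \<Otimes>\<^sub>M (lmat n 1 \<Otimes>\<^sub>M lmat n n)))"
 proof -
  let ?M = "clborel \<Otimes>\<^sub>M (lmat 1 n \<Otimes>\<^sub>M (lmat n 1 \<Otimes>\<^sub>M lmat n n))"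
  have m: "(\<lambda>p. fst p) \<in> ?M \<rightarrow>\<^sub>M borel" "(\<lambda>p. fst (snd p)) \<in> ?M \<rightarrow>\<^sub>M lmat 1 n"
   "(\<lambda>p. fst (snd (snd p))) \<in> ?M \<rightarrow>\<^sub>M lmat n 1" "(\<lambda>p. snd (snd (snd p))) \<in> ?M \<rightarrow>\<^sub>M lmat n n"
   by simp_all
  show ?thesis unfolding case_prod_unfold
   by (intro measurable_times measurable_to_ennreal borel_measurable_power
    measurable_cmod measurable_char_poly_eval[where n = n]
    measurable_compose[OF _ F] measurable_triangularized m)
 qed
 have "(\<integral>z:\<C>. \<integral>b:1,n. \<integral>N:n,n. ennreal ((cmod (poly (char_poly N) z))^2) * F (triangularized n u z b N)) = ennreal (1 / col_norm u ^ (2 * n + 2)) * upper_integral n H"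
  if "u \<in> space (lmat n 1)" for u
 proof -
  from that have u: "u \<in> cmat n 1" by simp
  define Q where "Q = householder n u"
  define r where "r = - complex_of_real (col_norm u)"
  obtain s S where s: "s \<in> cmat 1 n" and S: "S \<in> cmat n n" "det S ~= 0"
   and d: "col_norm u * cmod (det S) = 1"
   and U: "unipotent n u = Q * bmat r s (0\<^sub>m n 1) S"
    "unipotent n ((- 1) \<cdot>\<^sub>m u) = minv (bmat r s (0\<^sub>m n 1) S) * Q"
   unfolding Q_def r_def by (rule unipotent_householder[OF u])
  note Q = householder_props[OF u, folded Q_def]
  have r0: "r ~= 0" and cr: "cmod r = col_norm u" using col_norm_ge_1[of u] by (auto simp: r_def)
  define s' where "s' = (- 1 / r) \<cdot>\<^sub>m (s * minv S)"
  have s': "s' \<in> cmat 1 n" using s S by (simp add: s'_def)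
  have S': "minv S \<in> cmat n n" "det (minv S) ~= 0" using S by (simp_all add: det_minv)
  let ?R = "bmat r s (0\<^sub>m n 1) S" and ?R' = "bmat (1 / r) s' (0\<^sub>m n 1) (minv S)"
  have R': "minv ?R = ?R'" unfolding s'_def by (rule minv_bmat_upper[OF s S r0])
  have Rc: "?R \<in> cmat (Suc n) (Suc n)" "?R' \<in> cmat (Suc n) (Suc n)" "Q \<in> cmat (Suc n) (Suc n)"
   using S(1) S'(1) by (simp_all add: Q_def)
  \<comment> \<open>Conjugation by R keeps the corner z and replaces N by S N S^(-1), so the
    eigenvalue factor is invariant as well.\<close>
  have main: "ennreal ((cmod (poly (char_poly N) z))^2) * F (triangularized n u z b N)
    = H (?R * bmat z b (0\<^sub>m n 1) N * ?R')" if bN: "b \<in> cmat 1 n" "N \<in> cmat n n" for z b N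
  proof -
   let ?T = "bmat z b (0\<^sub>m n 1) N"
   have Tc: "?T \<in> cmat (Suc n) (Suc n)" using bN(2) by simp
   have RTc: "?R * ?T * ?R' \<in> cmat (Suc n) (Suc n)" using mult_carrier_mat[OF mult_carrier_mat[OF Rc(1) Tc] Rc(2)] .
   have "triangularized n u z b N = Q * (?R * ?T * ?R') * Q"
    unfolding triangularized_def U R' by (rule mult_assoc_conj(1)[OF Rc(3,1) Tc Rc(2)])
   also have "F ... = F (?R * ?T * ?R')" using inv[OF Q(3) RTc] Q(1) by simp
   finally have 1: "F (triangularized n u z b N) = F (?R * ?T * ?R')" .
   have sb: "r \<cdot>\<^sub>m b + s * N \<in> cmat 1 n" and SN: "S * N \<in> cmat n n" using bN s S by auto
   have "?R * ?T * ?R' = bmat (r * z * (1 / r)) ((r * z) \<cdot>\<^sub>m s' + (r \<cdot>\<^sub>m b + s * N) * minv S) (0\<^sub>m n 1) (S * N * minv S)"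
    unfolding bmat_upper_mult[OF s S(1) bN] by (rule bmat_upper_mult[OF sb SN s' S'(1)])
   moreover have "(r * z) \<cdot>\<^sub>m s' + (r \<cdot>\<^sub>m b + s * N) * minv S \<in> cmat 1 n"
    using mult_carrier_mat[OF sb S'(1)] s' by simp
   moreover have "S * N * minv S \<in> cmat n n" using SN S' by simp
   moreover have "char_poly (S * N * minv S) = char_poly N"
   proof (rule char_poly_similar)
    have "similar_mat_wit (S * N * minv S) N S (minv S)"
    by (rule similar_mat_witI[OF minv_mult[OF S] refl mult_carrier_mat[OF SN S'(1)] bN(2) S(1) S'(1)])
    then show "similar_mat (S * N * minv S) N" unfolding similar_mat_def by blast
   qed
   ultimately have "eig_kernel (?R * ?T * ?R') = (cmod (poly (char_poly N) z))^2"
    using r0 by (simp add: eig_kernel_bmat[where n = n])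
   then show ?thesis unfolding H_def 1 by simp
  qed
  have "(\<integral>z:\<C>. \<integral>b:1,n. \<integral>N:n,n. ennreal ((cmod (poly (char_poly N) z))^2) * F (triangularized n u z b N)) = upper_integral n (\<lambda>T. H (?R * T * ?R'))" (is "?lhs = ?I1")
   unfolding upper_integral_def
   by (rule nn_integral_cong, rule nn_integral_cong, rule nn_integral_cong) (simp add: main)
  moreover have "ennreal ((cmod (1 / r))^2 * cmod (det (minv S)) ^ (2 * n + 2)) *
    upper_integral n (\<lambda>T. H (?R * (T * ?R'))) = upper_integral n (\<lambda>T. H (?R * T))" (is "?k1 * _ = ?I2")
  proof (rule upper_integral_right[OF _ _ s' S', where F = "\<lambda>T. H (?R * T)"])
   show "(\<lambda>T. H (?R * T)) \<in> bmeas (lmat (Suc n) (Suc n))"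
    by (intro measurable_compose[OF _ Hm] meas_mult[where b = "Suc n"] meas_const Rc measurable_idt)
  qed (use r0 in simp)
  moreover have "upper_integral n (\<lambda>T. H (?R * T * ?R')) = upper_integral n (\<lambda>T. H (?R * (T * ?R')))"
   by (rule upper_integral_cong, subst assoc_mult_mat[OF Rc(1) _ Rc(2)]) simp_all
  moreover have "ennreal (cmod r ^ (2 * n + 2) * cmod (det S) ^ (2 * n)) * ?I2 = upper_integral n H"
   by (rule upper_integral_left[OF Hm r0 s S])
  ultimately have "upper_integral n H = ennreal (cmod r ^ (2 * n + 2) * cmod (det S) ^ (2 * n)) *
    (ennreal ((cmod (1 / r))^2 * cmod (det (minv S)) ^ (2 * n + 2)) * ?lhs)" by simp
  also have "... = ennreal (cmod r ^ (2 * n + 2) * cmod (det S) ^ (2 * n) *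
    ((cmod (1 / r))^2 * cmod (det (minv S)) ^ (2 * n + 2))) * ?lhs"
   by (simp add: ennreal_mult mult.assoc)
  \<comment> \<open>Here |r| = \<open>col_norm u\<close> and |det S| = 1/|r|. Left multiplication by
    R contributes |r|^2 and right multiplication by its inverse |r|^(2n).\<close>
  also have "cmod r ^ (2 * n + 2) * cmod (det S) ^ (2 * n) *
    ((cmod (1 / r))^2 * cmod (det (minv S)) ^ (2 * n + 2)) = col_norm u ^ (2 * n + 2)"
  proof -
   have "col_norm u ~= 0" using col_norm_ge_1[of u] by auto
   then have S1: "cmod (det S) = 1 / col_norm u" using d by (simp add: nonzero_eq_divide_eq mult.commute)
   have "cmod (det (minv S)) = col_norm u" using S by (simp add: det_minv norm_inverse S1)
   then show ?thesis using r0 cr unfolding S1 by (simp add: norm_divide field_simps power2_eq_square)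
  qed
  finally have "ennreal (1 / col_norm u ^ (2 * n + 2)) * upper_integral n H
    = ennreal (1 / col_norm u ^ (2 * n + 2)) * ennreal (col_norm u ^ (2 * n + 2)) * ?lhs" by (simp add: mult.assoc)
  also have "ennreal (1 / col_norm u ^ (2 * n + 2)) * ennreal (col_norm u ^ (2 * n + 2)) = 1"
   using col_norm_ge_1[of u] by (subst ennreal_mult[symmetric]) auto
  finally show ?thesis by simp
 qed
 then show ?thesis
  unfolding nn_integral_split_eigenvalue[OF F] nn_integral_move_third[OF Km] kappa_mult[symmetric] H_def[symmetric]
  by (intro nn_integral_cong)
qed

text \<open>The counterpart of a QR decomposition. A matrix with first column x (1, u) is a
  unipotent times a block triangular matrix; the substitution c = xu costs |x|^(2n), and the lower
  block is shifted by ub. The reflection in the unipotent factor is removed by invariance, the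
  triangular factor by \<open>upper_integral_left\<close>.\<close>

theorem nn_integral_left_invariant:
 assumes F: "F \<in> bmeas (lmat (Suc n) (Suc n))"
  and inv: "\<And>Q X. unitary_mat (Suc n) Q ==> X \<in> cmat (Suc n) (Suc n) ==> F (Q * X) = F X"
 shows "integral\<^sup>N (lmat (Suc n) (Suc n)) F =
  kappa n * upper_integral n (\<lambda>T. ennreal (cmod (T $$ (0, 0)) ^ (2 * n)) * F T)"
proof -
 define H where "H T = ennreal (cmod (T $$ (0, 0)) ^ (2 * n)) * F T" for T
 have Hm: "H \<in> bmeas (lmat (Suc n) (Suc n))"
  unfolding H_def by (intro measurable_times measurable_to_ennreal borel_measurable_power
    measurable_cmod meas_entry[where m = "Suc n" and n = "Suc n"] measurable_idt F) auto
 let ?M = "clborel \<Otimes>\<^sub>M (lmat 1 n \<Otimes>\<^sub>M (lmat n 1 \<Otimes>\<^sub>M lmat n n))"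
 have m: "(\<lambda>p. fst p) \<in> ?M \<rightarrow>\<^sub>M borel" "(\<lambda>p. fst (snd p)) \<in> ?M \<rightarrow>\<^sub>M lmat 1 n"
  "(\<lambda>p. fst (snd (snd p))) \<in> ?M \<rightarrow>\<^sub>M lmat n 1" "(\<lambda>p. snd (snd (snd p))) \<in> ?M \<rightarrow>\<^sub>M lmat n n"
  by simp_all
 define K where "K z b u N = ennreal (cmod z ^ (2 * n)) * F (unipotent n u * bmat z b (0\<^sub>m n 1) N)" for z b u N
 have Km: "(\<lambda>(z, b, u, N). K z b u N) \<in> bmeas ?M"
  unfolding case_prod_unfold K_def
  by (intro measurable_times measurable_to_ennreal borel_measurable_power
    measurable_cmod measurable_compose[OF _ F] meas_mult[where b = "Suc n"]
    measurable_unipotent measurable_bmat meas_zero m)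
 have Fm: "(\<lambda>(z, b, c, D). F (bmat z b c D)) \<in> bmeas ?M"
  unfolding case_prod_unfold by (intro measurable_compose[OF _ F] measurable_bmat m)
 have "integral\<^sup>N (lmat (Suc n) (Suc n)) F =
   (\<integral>x:\<C>. \<integral>b:1,n. \<integral>c:n,1. \<integral>D:n,n. F (bmat x b c D))"
  by (rule nn_integral_bmat[OF F])
 also have "... = (\<integral>x:\<C>. \<integral>b:1,n. \<integral>u:n,1. \<integral>N:n,n. K x b u N)"
 proof (rule nn_integral_cong_nonzero, rule nn_integral_cong)
  fix x :: complex and b assume x: "x ~= 0" and "b \<in> space (lmat 1 n)"
  then have b: "b \<in> cmat 1 n" by simp
  let ?G = "\<lambda>c. \<integral>D:n,n. F (bmat x b c D)"
  have Gm: "?G \<in> bmeas (lmat n 1)"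
  proof -
   have "(\<lambda>p. F (bmat x b (fst p) (snd p))) \<in> bmeas (lmat n 1 \<Otimes>\<^sub>M lmat n n)"
    using b by (intro measurable_4_compose[OF Fm] borel_measurable_const meas_const) auto
   then show ?thesis by (intro lmat.borel_measurable_nn_integral) (simp add: case_prod_unfold)
  qed
  have "(\<lambda>u. ?G (x \<cdot>\<^sub>m u + 0\<^sub>m n 1)) \<in> bmeas (lmat n 1)"
   by (intro measurable_compose[OF _ Gm] meas_add meas_smult borel_measurable_const
    meas_zero measurable_idt)
  then have "integral\<^sup>N (lmat n 1) ?G = (\<integral>u:n,1. ennreal (cmod x ^ (2 * (n * 1))) * ?G (x \<cdot>\<^sub>m u + 0\<^sub>m n 1))"
   by (simp only: nn_integral_lmat_affine[OF x zero_carrier_mat Gm, symmetric] nn_integral_cmult)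
  also have "... = (\<integral>u:n,1. \<integral>N:n,n. K x b u N)"
  proof (rule nn_integral_cong_mat)
   fix u :: "complex mat" assume u: "u \<in> cmat n 1"
   have xu: "x \<cdot>\<^sub>m u + 0\<^sub>m n 1 = x \<cdot>\<^sub>m u" "x \<cdot>\<^sub>m u \<in> cmat n 1" using u by auto
   have Dm: "(\<lambda>D. F (bmat x b (x \<cdot>\<^sub>m u) D)) \<in> bmeas (lmat n n)"
    using b xu by (intro measurable_compose[OF _ F] measurable_bmat borel_measurable_const meas_const measurable_idt)
   have ub: "u * b \<in> cmat n n" using u b by simp
   have "?G (x \<cdot>\<^sub>m u) = (\<integral>N:n,n. F (bmat x b (x \<cdot>\<^sub>m u) (N + u * b)))"
    by (rule nn_integral_lmat_translate[OF ub Dm, symmetric])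
   also have "... = (\<integral>N:n,n. F (unipotent n u * bmat x b (0\<^sub>m n 1) N))"
   proof (rule nn_integral_cong_mat)
    fix N :: "complex mat" assume N: "N \<in> cmat n n"
    have "unipotent n u * bmat x b (0\<^sub>m n 1) N = bmat (1 * x + (0\<^sub>m 1 n * 0\<^sub>m n 1) $$ (0, 0)) (1 \<cdot>\<^sub>m b + 0\<^sub>m 1 n * N) (x \<cdot>\<^sub>m u + 1\<^sub>m n * 0\<^sub>m n 1) (u * b + 1\<^sub>m n * N)"
    unfolding unipotent_def by (rule bmat_mult) (use b u N in auto)
    also have "1 * x + (0\<^sub>m 1 n * 0\<^sub>m n 1) $$ (0, 0) = x" by simp
    also have "1 \<cdot>\<^sub>m b + 0\<^sub>m 1 n * N = b" using b N by (intro eq_matI) auto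
    also have "x \<cdot>\<^sub>m u + 1\<^sub>m n * 0\<^sub>m n 1 = x \<cdot>\<^sub>m u" using u by (intro eq_matI) auto
    also have "u * b + 1\<^sub>m n * N = N + u * b" using N ub by (subst left_mult_one_mat[OF N]) (rule comm_add_mat)
    finally show "F (bmat x b (x \<cdot>\<^sub>m u) (N + u * b)) = F (unipotent n u * bmat x b (0\<^sub>m n 1) N)" by simp
   qed
   finally have "ennreal (cmod x ^ (2 * (n * 1))) * ?G (x \<cdot>\<^sub>m u + 0\<^sub>m n 1)
    = ennreal (cmod x ^ (2 * n)) * (\<integral>N:n,n. F (unipotent n u * bmat x b (0\<^sub>m n 1) N))"
    unfolding xu(1) by simp
   also have "... = (\<integral>N:n,n. K x b u N)"
    unfolding K_def using u b
    by (intro nn_integral_cmult[symmetric] measurable_compose[OF _ F] meas_mult[where b = "Suc n"]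
    measurable_bmat borel_measurable_const meas_zero meas_const unipotent_carrier measurable_idt)
   finally show "ennreal (cmod x ^ (2 * (n * 1))) * ?G (x \<cdot>\<^sub>m u + 0\<^sub>m n 1) = (\<integral>N:n,n. K x b u N)" .
  qed
  finally show "integral\<^sup>N (lmat n 1) ?G = (\<integral>u:n,1. \<integral>N:n,n. K x b u N)" .
 qed
 also have "... = (\<integral>u:n,1. \<integral>x:\<C>. \<integral>b:1,n. \<integral>N:n,n. K x b u N)"
  by (rule nn_integral_move_third[OF Km])
 also have "... = (\<integral>u:n,1. ennreal (1 / col_norm u ^ (2 * n + 2)) * upper_integral n H)"
 proof (rule nn_integral_cong_mat)
  fix u :: "complex mat" assume u: "u \<in> cmat n 1"
  define Q where "Q = householder n u"
  define r where "r = - complex_of_real (col_norm u)"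
  obtain s S where s: "s \<in> cmat 1 n" and S: "S \<in> cmat n n" "det S ~= 0"
   and d: "col_norm u * cmod (det S) = 1"
   and U: "unipotent n u = Q * bmat r s (0\<^sub>m n 1) S"
   unfolding Q_def r_def by (rule unipotent_householder[OF u])
  note Q = householder_props[OF u, folded Q_def]
  have r0: "r ~= 0" and cr: "cmod r = col_norm u" using col_norm_ge_1[of u] by (auto simp: r_def)
  let ?R = "bmat r s (0\<^sub>m n 1) S"
  have Rc: "?R \<in> cmat (Suc n) (Suc n)" "Q \<in> cmat (Suc n) (Suc n)" using S(1) by (simp_all add: Q_def)
  let ?a = "ennreal (cmod r ^ (2 * n))"
  have main: "?a * K x b u N = H (?R * bmat x b (0\<^sub>m n 1) N)"
   if bN: "b \<in> cmat 1 n" "N \<in> cmat n n" for x b N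
  proof -
   let ?T = "bmat x b (0\<^sub>m n 1) N"
   have Tc: "?T \<in> cmat (Suc n) (Suc n)" using bN(2) by simp
   have "F (unipotent n u * ?T) = F (?R * ?T)"
    unfolding U mult_assoc_conj(2)[OF Rc(2,1) Tc Tc] by (rule inv[OF Q(3) mult_carrier_mat[OF Rc(1) Tc]])
   moreover have "(?R * ?T) $$ (0, 0) = r * x" unfolding bmat_upper_mult[OF s S(1) bN] by simp
   ultimately show ?thesis unfolding K_def H_def
    by (simp add: norm_mult power_mult_distrib ennreal_mult mult.assoc)
  qed
  have Kfm: "(\<lambda>N. K x b u N) \<in> bmeas (lmat n n)" if "b \<in> cmat 1 n" for x b
   using that u by (intro measurable_4_compose[OF Km] borel_measurable_const meas_const measurable_idt)
  have Kfm2: "(\<lambda>b. \<integral>N:n,n. K x b u N) \<in> bmeas (lmat 1 n)" for x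
  proof -
   have "(\<lambda>p. K x (fst p) u (snd p)) \<in> bmeas (lmat 1 n \<Otimes>\<^sub>M lmat n n)"
    using u by (intro measurable_4_compose[OF Km] borel_measurable_const meas_const) auto
   then show ?thesis by (intro lmat.borel_measurable_nn_integral) (simp add: case_prod_unfold)
  qed
  have Kfm3: "(\<lambda>x. \<integral>b:1,n. \<integral>N:n,n. K x b u N) \<in> bmeas lborel"
  proof -
   have "(\<lambda>p. K (fst (fst p)) (snd (fst p)) u (snd p)) \<in> bmeas ((clborel \<Otimes>\<^sub>M lmat 1 n) \<Otimes>\<^sub>M lmat n n)"
    using u by (intro measurable_4_compose[OF Km] meas_const) (simp_all add: measurable_fst'' borel_measurable_subalgebra)
   then show ?thesis by (intro lmat.borel_measurable_nn_integral) (simp add: case_prod_unfold)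
  qed
  let ?I = "\<integral>x:\<C>. \<integral>b:1,n. \<integral>N:n,n. K x b u N"
  have "?a * ?I = (\<integral>x:\<C>. ?a * (\<integral>b:1,n. \<integral>N:n,n. K x b u N))"
   by (rule nn_integral_cmult[OF Kfm3, symmetric])
  also have "... = upper_integral n (\<lambda>T. H (?R * T))"
   unfolding upper_integral_def
  proof (rule nn_integral_cong)
   fix x :: complex
   have "?a * (\<integral>b:1,n. \<integral>N:n,n. K x b u N) = (\<integral>b:1,n. ?a * (\<integral>N:n,n. K x b u N))"
    by (rule nn_integral_cmult[OF Kfm2, symmetric])
   also have "... = (\<integral>b:1,n. \<integral>B:n,n. H (?R * bmat x b (0\<^sub>m n 1) B))"
   proof (rule nn_integral_cong_mat)
    fix b :: "complex mat" assume b: "b \<in> cmat 1 n"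
    show "?a * (\<integral>N:n,n. K x b u N) = (\<integral>B:n,n. H (?R * bmat x b (0\<^sub>m n 1) B))"
    unfolding nn_integral_cmult[OF Kfm[OF b], symmetric] by (rule nn_integral_cong) (simp add: main[OF b])
   qed
   finally show "?a * (\<integral>b:1,n. \<integral>N:n,n. K x b u N) = (\<integral>b:1,n. \<integral>B:n,n. H (?R * bmat x b (0\<^sub>m n 1) B))" .
  qed
  finally have "upper_integral n H = ennreal (cmod r ^ (2 * n + 2) * cmod (det S) ^ (2 * n)) * (?a * ?I)"
   using upper_integral_left[OF Hm r0 s S] by simp
  also have "... = ennreal (cmod r ^ (2 * n + 2) * cmod (det S) ^ (2 * n) * cmod r ^ (2 * n)) * ?I"
   by (simp add: ennreal_mult mult.assoc)
  \<comment> \<open>The corner of R T is r x. The power |r|^(2n) that this produces cancels |det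
    S|^(2n).\<close>
  also have "cmod r ^ (2 * n + 2) * cmod (det S) ^ (2 * n) * cmod r ^ (2 * n) = col_norm u ^ (2 * n + 2)"
  proof -
   have "cmod (det S) ^ (2 * n) * cmod r ^ (2 * n) = 1"
    using d cr by (simp add: power_mult_distrib[symmetric] mult.commute)
   then show ?thesis using cr by (simp add: mult.assoc)
  qed
  finally have "ennreal (1 / col_norm u ^ (2 * n + 2)) * upper_integral n H
    = ennreal (1 / col_norm u ^ (2 * n + 2)) * ennreal (col_norm u ^ (2 * n + 2)) * ?I" by (simp add: mult.assoc)
  also have "ennreal (1 / col_norm u ^ (2 * n + 2)) * ennreal (col_norm u ^ (2 * n + 2)) = 1"
   using col_norm_ge_1[of u] by (subst ennreal_mult[symmetric]) auto
  finally show "?I = ennreal (1 / col_norm u ^ (2 * n + 2)) * upper_integral n H" by simp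
 qed
 finally show ?thesis unfolding kappa_mult H_def .
qed

section \<open>Determinants of projection kernels\<close>

text \<open>Expansion along the last row, then along the last column of each minor. With the
  adjugate in the place of an inverse the formula covers singular D.\<close>

lemma det_border:
 fixes M :: "complex mat"
 assumes M: "M \<in> cmat (Suc n) (Suc n)"
 defines "D \<equiv> mat_delete M n n"
 shows "det M = M $$ (n, n) * det D
  - (\<Sum>j<n. \<Sum>i<n. M $$ (n, j) * adj_mat D $$ (j, i) * M $$ (i, n))"
proof -
 have Dc: "D \<in> cmat n n" using M mat_delete_carrier[of M "Suc n" "Suc n" n n] by (simp add: D_def)
 have minor: "M $$ (n, j) * cofactor M n j = - (\<Sum>i<n. M $$ (n, j) * adj_mat D $$ (j, i) * M $$ (i, n))" if j: "j < n" for j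
 proof -
  obtain p where p: "n = Suc p" using j by (cases n) auto
  let ?E = "mat_delete M n j"
  have E: "?E \<in> cmat n n" using M mat_delete_carrier[of M "Suc n" "Suc n" n j] by simp
  have "det ?E = (\<Sum>i<n. ?E $$ (i, p) * cofactor ?E i p)"
   using laplace_expansion_column[OF E, of p] p by simp
  also have "... = (\<Sum>i<n. M $$ (i, n) * ((- 1) ^ (i + p) * det (mat_delete D i j)))"
  proof (rule sum.cong[OF refl])
   fix i assume "i \<in> {..<n}"
   then have i: "i < n" by simp
   have "mat_delete ?E i p = mat_delete D i j"
    using M i j p by (intro eq_matI) (auto simp: mat_delete_def D_def)
   moreover have "?E $$ (i, p) = M $$ (i, n)" using M i j p by (auto simp: mat_delete_def)
   ultimately show "?E $$ (i, p) * cofactor ?E i p = M $$ (i, n) * ((- 1) ^ (i + p) * det (mat_delete D i j))"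
    by (simp add: cofactor_def)
  qed
  finally have "cofactor M n j = (\<Sum>i<n. (- 1) ^ (n + j) * (M $$ (i, n) * ((- 1) ^ (i + p) * det (mat_delete D i j))))"
   by (simp add: cofactor_def sum_distrib_left)
  also have "... = (\<Sum>i<n. - (adj_mat D $$ (j, i) * M $$ (i, n)))"
  proof (rule sum.cong[OF refl])
   fix i assume "i \<in> {..<n}"
   then have "adj_mat D $$ (j, i) = (- 1) ^ (i + j) * det (mat_delete D i j)"
    using Dc j by (simp add: adj_mat_def cofactor_def)
   moreover have "(- 1 :: complex) ^ (n + j) * (- 1) ^ (i + p) = - ((- 1) ^ (i + j))"
    by (simp add: p power_add[symmetric] minus_one_power_iff)
   ultimately show "(- 1) ^ (n + j) * (M $$ (i, n) * ((- 1) ^ (i + p) * det (mat_delete D i j)))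
    = - (adj_mat D $$ (j, i) * M $$ (i, n))"
    by (metis (no_types, lifting) mult.assoc mult.commute mult_minus_left)
  qed
  finally show ?thesis by (simp add: sum_distrib_left sum_negf mult.assoc)
 qed
 have "det M = (\<Sum>j<Suc n. M $$ (n, j) * cofactor M n j)"
  using laplace_expansion_row[OF M, of n] by simp
 also have "... = (\<Sum>j<n. - (\<Sum>i<n. M $$ (n, j) * adj_mat D $$ (j, i) * M $$ (i, n))) + M $$ (n, n) * cofactor M n n"
  using minor by simp
 also have "cofactor M n n = det D" by (simp add: cofactor_def D_def)
 finally show ?thesis by (simp add: sum_negf)
qed

definition vandermonde :: "nat => (nat => complex) => complex mat" where
 "vandermonde n z = Matrix.mat n n (\<lambda>(i, l). z i ^ l)"

text \<open>As a function of the last node t the determinant is a polynomial of degree at most n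
  that vanishes at the other nodes, and its coefficient of t^n is the determinant of the smaller
  size.\<close>

lemma det_vandermonde: "det (vandermonde n z) = (\<Prod>j<n. \<Prod>i<j. z j - z i)"
proof (induction n)
 case 0
 show ?case by (simp add: vandermonde_def)
next
 case (Suc n)
 define q where "q t = vandermonde (Suc n) (z(n := t))" for t
 have qc: "q t \<in> cmat (Suc n) (Suc n)" for t by (simp add: q_def vandermonde_def)
 define p where "p = (\<Sum>l<Suc n. monom (cofactor (q 0) n l) l)"
 have pq: "poly p t = det (q t)" for t
 proof -
  have "mat_delete (q t) n l = mat_delete (q 0) n l" if "l < Suc n" for l
   using that by (intro eq_matI) (auto simp: mat_delete_def q_def vandermonde_def)
  then show ?thesis
   using laplace_expansion_row[OF qc, of n t]
   by (simp add: p_def poly_sum poly_monom cofactor_def q_def vandermonde_def mult.commute)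
 qed
 have dp: "degree p \<le> n"
  unfolding p_def by (rule degree_sum_le) (auto intro: order_trans[OF degree_monom_le])
 have "mat_delete (q 0) n n = vandermonde n z"
  by (intro eq_matI) (auto simp: mat_delete_def q_def vandermonde_def)
 then have cp: "coeff p n = det (vandermonde n z)"
  by (simp add: p_def coeff_sum cofactor_def)
 have root: "poly p (z i) = 0" if "i < n" for i
  unfolding pq by (rule det_identical_rows[OF qc, of i n]) (use that in \<open>auto simp: q_def vandermonde_def intro!: eq_vecI\<close>)
 have main: "poly p t = det (vandermonde n z) * (\<Prod>i<n. t - z i)" for t
 proof (cases "inj_on z {..<n}")
  case True
  define g where "g = (\<Prod>i<n. [:- z i, 1:])"
  have dg: "degree g = n" "coeff g n = 1"
  proof -
   show "degree g = n" unfolding g_def by (subst degree_prod_eq_sum_degree) auto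
   moreover have "lead_coeff g = 1" unfolding g_def by (simp add: lead_coeff_prod)
   ultimately show "coeff g n = 1" by simp
  qed
  \<comment> \<open>h has degree less than n and vanishes at n distinct nodes.\<close>
  define h where "h = p - Polynomial.smult (coeff p n) g"
  have "h = 0"
  proof (rule ccontr)
   assume h: "h ~= 0"
   have "degree h \<le> n" unfolding h_def using dp dg by (intro degree_diff_le) (auto intro: order_trans[OF degree_smult_le])
   moreover have "coeff h n = 0" by (simp add: h_def dg)
   ultimately have "degree h < n" using h by (metis le_neq_implies_less leading_coeff_0_iff)
   moreover have "z ` {..<n} \<subseteq> {t. poly h t = 0}" by (auto simp: h_def root g_def poly_prod)
   then have "card (z ` {..<n}) \<le> card {t. poly h t = 0}" by (intro card_mono poly_roots_finite[OF h])
   ultimately show False using card_poly_roots_bound[OF h] card_image[OF True] by simp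
  qed
  then have "p = Polynomial.smult (coeff p n) g" by (simp add: h_def)
  then have "poly p t = coeff p n * poly g t" by (metis poly_smult)
  then show ?thesis by (simp add: cp g_def poly_prod)
 next
  case False
  then obtain i j where ij: "i < n" "j < n" "i ~= j" "z i = z j" by (auto simp: inj_on_def)
  have "det (vandermonde n z) = 0"
   by (rule det_identical_rows[of _ n i j]) (use ij in \<open>auto simp: vandermonde_def intro!: eq_vecI\<close>)
  moreover have "det (q t) = 0"
   by (rule det_identical_rows[of _ "Suc n" i j]) (use ij qc in \<open>auto simp: q_def vandermonde_def intro!: eq_vecI\<close>)
  ultimately show ?thesis by (simp add: pq)
 qed
 have "q (z n) = vandermonde (Suc n) z" by (simp add: q_def)
 then have "det (vandermonde (Suc n) z) = det (vandermonde n z) * (\<Prod>i<n. z n - z i)"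
  using main[of "z n"] by (simp add: pq)
 then show ?case using Suc by simp
qed

definition kernel_mat :: "(complex => complex => complex) => nat => (nat => complex) => complex mat" where
 "kernel_mat K r x = Matrix.mat r r (\<lambda>(i, j). K (x i) (x j))"

locale orthonormal =
 fixes n :: nat and \<phi> :: "nat => complex => complex"
 assumes orth: "\<And>i j. i < n ==> j < n ==>
  has_bochner_integral lborel (\<lambda>y. \<phi> i y * cnj (\<phi> j y)) (if i = j then 1 else 0)"
begin

text \<open>The kernel of the orthogonal projection onto the span of the n functions.\<close>

definition K :: "complex => complex => complex" where
 "K x y = (\<Sum>l<n. \<phi> l x * cnj (\<phi> l y))"

text \<open>Columns from index n on are zero, which makes the matrix square for every r. When r is
  at least n, the kernel matrix is \<Phi> times its conjugate transpose.\<close>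

definition \<Phi> :: "nat => (nat => complex) => complex mat" where
 "\<Phi> r x = Matrix.mat r r (\<lambda>(i, l). if l < n then \<phi> l (x i) else 0)"

definition D :: "nat => (nat => complex) => real" where
 "D r x = Re (det (kernel_mat K r x))"

lemma has_bochner_integral_K: "has_bochner_integral lborel (\<lambda>y. K y y) (of_nat n)"
proof -
 have "has_bochner_integral lborel (\<lambda>y. \<Sum>l<n. \<phi> l y * cnj (\<phi> l y)) (\<Sum>l<n. 1)"
  by (intro has_bochner_integral_sum) (use orth in fastforce)
 then show ?thesis by (simp add: K_def)
qed

text \<open>Idempotence of the projection: by orthonormality only the terms with equal indices
  survive.\<close>

lemma has_bochner_integral_K_K: "has_bochner_integral lborel (\<lambda>y. K y v * K u y) (K u v)"
proof -
 have "has_bochner_integral lborel (\<lambda>y. \<Sum>l<n. \<Sum>m<n. (cnj (\<phi> l v) * \<phi> m u) * (\<phi> l y * cnj (\<phi> m y)))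
   (\<Sum>l<n. \<Sum>m<n. (cnj (\<phi> l v) * \<phi> m u) * (if l = m then 1 else 0))"
  by (intro has_bochner_integral_sum has_bochner_integral_mult_right orth) auto
 moreover have "K y v * K u y = (\<Sum>l<n. \<Sum>m<n. (cnj (\<phi> l v) * \<phi> m u) * (\<phi> l y * cnj (\<phi> m y)))" for y
  unfolding K_def sum_product by (intro sum.cong refl) (simp add: ac_simps)
 moreover have "(\<Sum>l<n. \<Sum>m<n. (cnj (\<phi> l v) * \<phi> m u) * (if l = m then 1 else 0)) = K u v"
  by (simp add: K_def mult.commute if_distrib cong: if_cong)
 ultimately show ?thesis by simp
qed

text \<open>Dyson's integration lemma. In the bordered expansion the term K(y, y) integrates to the
  trace n, and each product K(y, v) K(u, y) reproduces K(u, v). The double sum thereby becomes the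
  trace of adj A times A, which is r det A.\<close>

lemma has_bochner_integral_det_kernel:
 "has_bochner_integral lborel (\<lambda>y. det (kernel_mat K (Suc r) (x(r := y))))
   ((of_nat n - of_nat r) * det (kernel_mat K r x))"
proof -
 let ?A = "kernel_mat K r x"
 have A: "?A \<in> cmat r r" by (simp add: kernel_mat_def)
 have "det (kernel_mat K (Suc r) (x(r := y))) = K y y * det ?A
   - (\<Sum>j<r. \<Sum>i<r. adj_mat ?A $$ (j, i) * (K y (x j) * K (x i) y))" for y
 proof -
  have "mat_delete (kernel_mat K (Suc r) (x(r := y))) r r = ?A"
   by (intro eq_matI) (auto simp: mat_delete_def kernel_mat_def)
  then have "det (kernel_mat K (Suc r) (x(r := y))) = K y y * det ?A
   - (\<Sum>j<r. \<Sum>i<r. K y (x j) * adj_mat ?A $$ (j, i) * K (x i) y)"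
   using det_border[of "kernel_mat K (Suc r) (x(r := y))" r] by (simp add: kernel_mat_def)
  then show ?thesis by (simp add: ac_simps)
 qed
 moreover have "has_bochner_integral lborel (\<lambda>y. K y y * det ?A
   - (\<Sum>j<r. \<Sum>i<r. adj_mat ?A $$ (j, i) * (K y (x j) * K (x i) y)))
   (of_nat n * det ?A - (\<Sum>j<r. \<Sum>i<r. adj_mat ?A $$ (j, i) * K (x i) (x j)))"
  by (intro has_bochner_integral_diff has_bochner_integral_sum has_bochner_integral_mult_right has_bochner_integral_mult_left
    has_bochner_integral_K has_bochner_integral_K_K)
 moreover have "(\<Sum>j<r. \<Sum>i<r. adj_mat ?A $$ (j, i) * K (x i) (x j)) = of_nat r * det ?A"
 proof -
  have "(\<Sum>i<r. adj_mat ?A $$ (j, i) * K (x i) (x j)) = det ?A" if j: "j < r" for j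
  proof -
   have "(\<Sum>i<r. adj_mat ?A $$ (j, i) * K (x i) (x j)) = (adj_mat ?A * ?A) $$ (j, j)"
    using j A adj_mat(1)[OF A] by (simp add: scalar_prod_def lessThan_atLeast0 kernel_mat_def)
   then show ?thesis using j by (simp add: adj_mat(3)[OF A])
  qed
  then show ?thesis by simp
 qed
 ultimately show ?thesis by (simp add: left_diff_distrib)
qed

lemma det_kernel_factor:
 assumes "n \<le> r"
 shows "det (kernel_mat K r x) = complex_of_real ((cmod (det (\<Phi> r x)))^2)"
proof -
 have c: "\<Phi> r x \<in> cmat r r" by (simp add: \<Phi>_def)
 have "kernel_mat K r x = \<Phi> r x * ctrans (\<Phi> r x)"
 proof (rule eq_matI)
  fix i j assume "i < dim_row (\<Phi> r x * ctrans (\<Phi> r x))" "j < dim_col (\<Phi> r x * ctrans (\<Phi> r x))"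
  then have ij: "i < r" "j < r" by (auto simp: \<Phi>_def)
  have "(\<Phi> r x * ctrans (\<Phi> r x)) $$ (i, j) = (\<Sum>l<r. if l < n then \<phi> l (x i) * cnj (\<phi> l (x j)) else 0)"
   using ij by (auto simp: scalar_prod_def \<Phi>_def lessThan_atLeast0 intro!: sum.cong)
  also have "... = K (x i) (x j)"
   unfolding K_def using assms by (intro sum.mono_neutral_cong_right) auto
  finally show "kernel_mat K r x $$ (i, j) = (\<Phi> r x * ctrans (\<Phi> r x)) $$ (i, j)"
   using ij by (simp add: kernel_mat_def)
 qed (auto simp: kernel_mat_def \<Phi>_def)
 then show ?thesis
  using det_mult[OF c ctrans_carrier[OF c]] det_ctrans[OF c] by (simp only: complex_norm_square)
qed

lemma det_kernel_zero:
 assumes "n < r"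
 shows "det (kernel_mat K r x) = 0"
proof -
 have c: "\<Phi> r x \<in> cmat r r" by (simp add: \<Phi>_def)
 have "det (\<Phi> r x) = (\<Sum>i<r. \<Phi> r x $$ (i, n) * cofactor (\<Phi> r x) i n)"
  by (rule laplace_expansion_column[OF c assms])
 also have "... = 0" using assms by (simp add: \<Phi>_def)
 finally show ?thesis using det_kernel_factor[of r x] assms by simp
qed

text \<open>Downward induction on r. From n on the determinant is a squared modulus; below n it is,
  up to a positive factor, the integral of the determinant for r + 1 over the last variable.\<close>

lemma det_kernel_real: "det (kernel_mat K r x) = complex_of_real (D r x) \<and> 0 \<le> D r x"
proof (induction "n - r" arbitrary: r x)
 case 0
 then show ?case using det_kernel_factor[of r x] by (simp add: D_def)
next
 case (Suc m)
 then have r: "r < n" and IH: "\<And>x. det (kernel_mat K (Suc r) x) = complex_of_real (D (Suc r) x)"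
   "\<And>x. 0 \<le> D (Suc r) x" by auto
 have "(LINT y|lborel. det (kernel_mat K (Suc r) (x(r := y)))) = of_nat (n - r) * det (kernel_mat K r x)"
  using has_bochner_integral_det_kernel[of r x] r by (simp add: has_bochner_integral_iff of_nat_diff)
 then have eq: "of_nat (n - r) * det (kernel_mat K r x) = complex_of_real (LINT y|lborel. D (Suc r) (x(r := y)))"
  unfolding IH(1) by (simp add: integral_complex_of_real)
 define J where "J = (LINT y|lborel. D (Suc r) (x(r := y))) / real (n - r)"
 have "det (kernel_mat K r x) = complex_of_real J"
  using eq r by (simp add: J_def field_simps)
 moreover have "J \<ge> 0" unfolding J_def by (intro divide_nonneg_nonneg Bochner_Integration.integral_nonneg IH) simp_all
 ultimately show ?case by (simp add: D_def)
qed

lemma nn_integral_D: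
 assumes "r < n"
 shows "(\<integral>y:\<C>. ennreal (D (Suc r) (x(r := y)))) = of_nat (n - r) * ennreal (D r x)"
proof -
 have h: "has_bochner_integral lborel (\<lambda>y. D (Suc r) (x(r := y))) (Re ((of_nat n - of_nat r) * det (kernel_mat K r x)))"
  unfolding D_def by (rule has_bochner_integral_Re[OF has_bochner_integral_det_kernel])
 have "(\<integral>y:\<C>. ennreal (D (Suc r) (x(r := y)))) = ennreal (Re ((of_nat n - of_nat r) * det (kernel_mat K r x)))"
  using h det_kernel_real by (subst nn_integral_eq_integral) (auto simp: has_bochner_integral_iff)
 also have "Re ((of_nat n - of_nat r) * det (kernel_mat K r x)) = real (n - r) * D r x"
  using assms det_kernel_real[of r x] by (simp add: of_nat_diff)
 also have "ennreal (real (n - r) * D r x) = of_nat (n - r) * ennreal (D r x)"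
  using det_kernel_real[of r x] by (simp add: ennreal_mult ennreal_of_nat_eq_real_of_nat)
 finally show ?thesis .
qed

end

section \<open>Multiplicative convolution of weights\<close>

definition haar_weight :: "nat => complex mat => ennreal" where
 "haar_weight n X = ennreal (inverse (cmod (det X) ^ (2 * n)))"

definition haar :: "nat => (complex mat => ennreal) => ennreal" where
 "haar n F = (\<integral>X:n,n. haar_weight n X * F X)"

lemma measurable_haar_weight:
 assumes "f \<in> N \<rightarrow>\<^sub>M lmat n n"
 shows "(\<lambda>w. haar_weight n (f w)) \<in> bmeas N"
 unfolding haar_weight_def using assms
 by (intro measurable_to_ennreal borel_measurable_inverse borel_measurable_power
   measurable_cmod meas_det[where n = n])

lemma haar_weight_times:
 assumes "X \<in> cmat n n" "Y \<in> cmat n n"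
 shows "haar_weight n (X * Y) = haar_weight n X * haar_weight n Y"
 by (simp add: haar_weight_def det_mult[OF assms] norm_mult power_mult_distrib ennreal_mult)

lemma haar_weight_cancel:
 "det X ~= 0 ==> ennreal (cmod (det X) ^ (2 * n)) * haar_weight n X = 1"
 by (simp add: haar_weight_def ennreal_mult[symmetric])

lemma haar_left:
 assumes M: "M \<in> cmat n n" "det M ~= 0" and F: "F \<in> bmeas (lmat n n)"
 shows "haar n (\<lambda>X. F (M * X)) = haar n F"
proof -
 have m: "(\<lambda>X. haar_weight n X * F X) \<in> bmeas (lmat n n)"
  by (intro measurable_times measurable_haar_weight measurable_idt F)
 have m2: "(\<lambda>X. haar_weight n X * F (M * X)) \<in> bmeas (lmat n n)"
  by (intro measurable_times measurable_haar_weight measurable_compose[OF _ F] meas_mult[where b = n]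
    meas_const M measurable_idt)
 have "haar n F = ennreal (cmod (det M) ^ (2 * n)) * (\<integral>X:n,n. haar_weight n (M * X) * F (M * X))"
  unfolding haar_def by (rule nn_integral_left_mult[OF M m, symmetric])
 also have "(\<integral>X:n,n. haar_weight n (M * X) * F (M * X)) = (\<integral>X:n,n. haar_weight n M * (haar_weight n X * F (M * X)))"
  by (rule nn_integral_cong) (simp add: haar_weight_times[OF M(1)] mult.assoc)
 also have "... = haar_weight n M * haar n (\<lambda>X. F (M * X))"
  unfolding haar_def by (rule nn_integral_cmult[OF m2])
 finally show ?thesis using haar_weight_cancel[OF M(2)] by (simp add: mult.assoc[symmetric])
qed

lemma haar_right:
 assumes M: "M \<in> cmat n n" "det M ~= 0" and F: "F \<in> bmeas (lmat n n)"
 shows "haar n (\<lambda>X. F (X * M)) = haar n F"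
proof -
 have m: "(\<lambda>X. haar_weight n X * F X) \<in> bmeas (lmat n n)"
  by (intro measurable_times measurable_haar_weight measurable_idt F)
 have m2: "(\<lambda>X. haar_weight n X * F (X * M)) \<in> bmeas (lmat n n)"
  by (intro measurable_times measurable_haar_weight measurable_compose[OF _ F] meas_mult[where b = n]
    meas_const M measurable_idt)
 have "haar n F = ennreal (cmod (det M) ^ (2 * n)) * (\<integral>X:n,n. haar_weight n (X * M) * F (X * M))"
  unfolding haar_def by (rule nn_integral_right_mult[OF M m, symmetric])
 also have "(\<integral>X:n,n. haar_weight n (X * M) * F (X * M)) = (\<integral>X:n,n. haar_weight n M * (haar_weight n X * F (X * M)))"
  by (rule nn_integral_cong) (simp add: haar_weight_times[OF _ M(1)] ac_simps)
 also have "... = haar_weight n M * haar n (\<lambda>X. F (X * M))"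
  unfolding haar_def by (rule nn_integral_cmult[OF m2])
 finally show ?thesis using haar_weight_cancel[OF M(2)] by (simp add: mult.assoc[symmetric])
qed

lemma haar_swap:
 assumes f: "(\<lambda>p. f (fst p) (snd p)) \<in> bmeas (lmat n n \<Otimes>\<^sub>M lmat n n)"
 shows "haar n (\<lambda>X. haar n (\<lambda>Y. f X Y)) = haar n (\<lambda>Y. haar n (\<lambda>X. f X Y))"
proof -
 have fm: "(\<lambda>Y. f X Y) \<in> bmeas (lmat n n)" "(\<lambda>Y. f Y X) \<in> bmeas (lmat n n)" if "X \<in> cmat n n" for X
  using that by (auto intro!: measurable_compose[OF _ f, where f = "\<lambda>Y. (X, Y)", simplified] measurable_compose[OF _ f, where f = "\<lambda>Y. (Y, X)", simplified]
    measurable_Pair meas_const measurable_idt)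
 have "haar n (\<lambda>X. haar n (\<lambda>Y. f X Y)) = (\<integral>X:n,n. \<integral>Y:n,n. haar_weight n X * (haar_weight n Y * f X Y))"
  unfolding haar_def
  by (rule nn_integral_cong) (intro nn_integral_cmult[symmetric] measurable_times measurable_haar_weight measurable_idt fm, simp)
 also have "... = (\<integral>Y:n,n. \<integral>X:n,n. haar_weight n X * (haar_weight n Y * f X Y))"
 proof (rule nn_integral_lmat_swap)
  show "(\<lambda>(X, Y). haar_weight n X * (haar_weight n Y * f X Y)) \<in> bmeas (lmat n n \<Otimes>\<^sub>M lmat n n)"
   unfolding case_prod_unfold
   by (intro measurable_times measurable_haar_weight measurable_fst measurable_snd f)
 qed
 also have "... = (\<integral>Y:n,n. \<integral>X:n,n. haar_weight n Y * (haar_weight n X * f X Y))"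
  by (simp only: mult.left_commute)
 also have "... = haar n (\<lambda>Y. haar n (\<lambda>X. f X Y))"
  unfolding haar_def
  by (rule nn_integral_cong) (intro nn_integral_cmult measurable_times measurable_haar_weight measurable_idt fm, simp)
 finally show ?thesis .
qed

lemma haar_cong:
 assumes "\<And>X. X \<in> cmat n n ==> det X ~= 0 ==> F X = G X"
 shows "haar n F = haar n G"
 unfolding haar_def
 by (rule nn_integral_cong_det) (use assms in simp)

lemma haar_cmult:
 assumes "F \<in> bmeas (lmat n n)"
 shows "haar n (\<lambda>X. c * F X) = c * haar n F"
 unfolding haar_def mult.left_commute[of _ c]
 by (intro nn_integral_cmult measurable_times measurable_haar_weight measurable_idt assms)

lemma measurable_haar:
 assumes f: "(\<lambda>p. f (fst p) (snd p)) \<in> bmeas (N \<Otimes>\<^sub>M lmat n n)"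
 shows "(\<lambda>w. haar n (f w)) \<in> bmeas N"
 unfolding haar_def
proof (rule lmat.borel_measurable_nn_integral)
 have "(\<lambda>p. haar_weight n (snd p)) \<in> bmeas (N \<Otimes>\<^sub>M lmat n n)"
  by (intro measurable_haar_weight measurable_snd)
 with f show "(\<lambda>(x, y). haar_weight n y * f x y) \<in> bmeas (N \<Otimes>\<^sub>M lmat n n)"
  unfolding case_prod_unfold by (intro measurable_times)
qed

text \<open>A bi-invariant measure is also invariant under inversion: compare
 \<open>\<integral>F(x\<inverse>)dx \<cdot> \<integral>g(y)dy\<close> with \<open>\<integral>F(y)dy \<cdot> \<integral>g(x)dx\<close> by means of the substitutions
 \<open>y \<mapsto> y x\<close>, \<open>x \<mapsto> y\<inverse> x\<close> and \<open>y \<mapsto> x y\<close>.\<close>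

lemma haar_minv:
 assumes F: "F \<in> bmeas (lmat n n)"
 shows "haar n (\<lambda>X. F (minv X)) = haar n F"
proof -
 define B where "B = mat_box n n (\<lambda>_. cball 0 1)"
 have B: "B \<in> sets (lmat n n)" unfolding B_def by (intro sets_mat_box) auto
 \<comment> \<open>The power of the determinant cancels the Haar density, so the Haar integral of g
   is the volume of a polydisc. That is finite and positive and can be divided out at the
   end.\<close>
 define g :: "complex mat => ennreal" where "g X = ennreal (cmod (det X) ^ (2 * n)) * indicator B X" for X
 have g: "g \<in> bmeas (lmat n n)" unfolding g_def
  by (intro measurable_times measurable_to_ennreal borel_measurable_power
    measurable_cmod meas_det[where n = n] measurable_idt
    borel_measurable_indicator B)
 have mi: "(\<lambda>X. F (minv X)) \<in> bmeas (lmat n n)"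
  by (intro measurable_compose[OF _ F] measurable_minv measurable_idt)
 have "haar n g = (\<integral>X:n,n. indicator B X)"
  unfolding haar_def
 proof (rule nn_integral_cong_det)
  fix X :: "complex mat" assume X: "det X ~= 0"
  have "haar_weight n X * g X = (ennreal (cmod (det X) ^ (2 * n)) * haar_weight n X) * indicator B X"
   by (simp only: g_def ac_simps)
  then show "haar_weight n X * g X = indicator B X"
   by (simp only: haar_weight_cancel[OF X] mult_1_left)
 qed
 also have "... = emeasure (lmat n n) B" using B by simp
 also have "... = (\<Prod>p\<in>{..<n} \<times> {..<n}. emeasure lborel (cball (0 :: complex) 1))"
  unfolding B_def by (intro emeasure_mat_box) auto
 finally have gB: "haar n g = (\<Prod>p\<in>{..<n} \<times> {..<n}. emeasure lborel (cball (0 :: complex) 1))" .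
 have "emeasure lborel (cball (0 :: complex) 1) ~= \<infinity>" "emeasure lborel (cball (0 :: complex) 1) ~= 0"
  using emeasure_bounded_finite[of "cball (0 :: complex) 1"] content_cball_pos[of 1 "0 :: complex"]
  by (auto simp: measure_def)
 then have g0: "haar n g ~= 0" "haar n g ~= \<infinity>"
  unfolding gB by (auto simp: ennreal_prod_eq_top power_eq_top_ennreal)
 have mult_r: "haar n H * c = haar n (\<lambda>X. H X * c)" if "H \<in> bmeas (lmat n n)" for H c
  using haar_cmult[OF that, of c] by (simp add: mult.commute)
 note mm = meas_mult[where b = n] measurable_minv[where n = n] measurable_fst measurable_snd measurable_compose[OF _ F] measurable_compose[OF _ g]
  meas_const measurable_idt
 have "haar n (\<lambda>X. F (minv X)) * haar n g = haar n (\<lambda>x. haar n (\<lambda>y. F (minv x) * g y))"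
  unfolding mult_r[OF mi] by (intro haar_cong haar_cmult[symmetric] g)
 also have "... = haar n (\<lambda>x. haar n (\<lambda>y. F (minv x) * g (y * x)))"
 proof (rule haar_cong, rule haar_right[symmetric])
  fix x :: "complex mat" assume "x \<in> cmat n n"
  show "(\<lambda>y. F (minv x) * g y) \<in> bmeas (lmat n n)"
   by (intro measurable_times borel_measurable_const g)
 qed
 also have "... = haar n (\<lambda>y. haar n (\<lambda>x. F (minv x) * g (y * x)))"
  by (rule haar_swap) (intro measurable_times mm)
 also have "... = haar n (\<lambda>y. haar n (\<lambda>x. F (minv x * y) * g x))"
 proof (rule haar_cong)
  fix y :: "complex mat" assume y: "y \<in> cmat n n" "det y ~= 0"
  have "haar n (\<lambda>x. F (minv x) * g (y * x)) = haar n (\<lambda>x. F (minv (minv y * x)) * g (y * (minv y * x)))"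
   by (rule haar_left[symmetric]) (use y in \<open>auto simp: det_minv intro!: measurable_times mm\<close>)
  also have "... = haar n (\<lambda>x. F (minv x * y) * g x)"
  proof (rule haar_cong)
   fix x :: "complex mat" assume x: "x \<in> cmat n n"
   have "minv (minv y * x) = minv x * y" using minv_times[OF minv_carrier[OF y(1)] x] minv_minv[OF y] by simp
   moreover have "y * (minv y * x) = x"
    unfolding assoc_mult_mat[OF y(1) minv_carrier[OF y(1)] x, symmetric] minv_mult(1)[OF y] by (rule left_mult_one_mat[OF x])
   ultimately show "F (minv (minv y * x)) * g (y * (minv y * x)) = F (minv x * y) * g x" by simp
  qed
  finally show "haar n (\<lambda>x. F (minv x) * g (y * x)) = haar n (\<lambda>x. F (minv x * y) * g x)" .
 qed
 also have "... = haar n (\<lambda>x. haar n (\<lambda>y. F (minv x * y) * g x))"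
  by (rule haar_swap) (intro measurable_times mm)
 also have "... = haar n (\<lambda>x. haar n (\<lambda>y. F y * g x))"
 proof (rule haar_cong, rule haar_left)
  fix x :: "complex mat" assume x: "x \<in> cmat n n" "det x ~= 0"
  then show "minv x \<in> cmat n n" "det (minv x) ~= 0" by (simp_all add: det_minv)
  show "(\<lambda>y. F y * g x) \<in> bmeas (lmat n n)"
   by (intro measurable_times borel_measurable_const F)
 qed
 also have "... = haar n (\<lambda>x. haar n F * g x)" by (intro haar_cong mult_r[symmetric] F)
 also have "... = haar n F * haar n g" by (rule haar_cmult[OF g])
 finally show ?thesis using g0 by (metis mult_divide_eq_ennreal infinity_ennreal_def)
qed

text \<open>The density |det X|^(-2n) of the Haar measure enters twice, before and after the
  inversion, hence the exponent 4n.\<close>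

lemma nn_integral_minv:
 assumes F: "F \<in> bmeas (lmat n n)"
 shows "(\<integral>X:n,n. F X) = (\<integral>X:n,n. ennreal (inverse (cmod (det X) ^ (4 * n))) * F (minv X))"
proof -
 let ?G = "\<lambda>X. ennreal (cmod (det X) ^ (2 * n)) * F X"
 have Gm: "?G \<in> bmeas (lmat n n)"
  by (intro measurable_times measurable_to_ennreal borel_measurable_power
    measurable_cmod meas_det[where n = n] measurable_idt F)
 have "(\<integral>X:n,n. F X) = haar n ?G"
  unfolding haar_def
 proof (rule nn_integral_cong_det)
  fix X :: "complex mat" assume X: "det X ~= 0"
  have "haar_weight n X * ?G X = (ennreal (cmod (det X) ^ (2 * n)) * haar_weight n X) * F X"
   by (simp only: ac_simps)
  then show "F X = haar_weight n X * ?G X"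
   by (simp only: haar_weight_cancel[OF X] mult_1_left)
 qed
 also have "... = haar n (\<lambda>X. ?G (minv X))" by (rule haar_minv[OF Gm, symmetric])
 also have "... = (\<integral>X:n,n. ennreal (inverse (cmod (det X) ^ (4 * n))) * F (minv X))"
  unfolding haar_def
 proof (rule nn_integral_cong_det)
  fix X :: "complex mat" assume X: "X \<in> cmat n n" and "det X ~= 0"
  then have "cmod (det (minv X)) ^ (2 * n) = inverse (cmod (det X) ^ (2 * n))"
   by (simp add: det_minv[of X n] norm_inverse power_inverse)
  moreover have "inverse (cmod (det X) ^ (4 * n)) =
    inverse (cmod (det X) ^ (2 * n)) * inverse (cmod (det X) ^ (2 * n))"
   unfolding nonzero_inverse_mult_distrib[symmetric] by (simp add: power_add[symmetric] inverse_mult_distrib[symmetric] del: inverse_mult_distrib)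
  ultimately show "haar_weight n X * ?G (minv X) = ennreal (inverse (cmod (det X) ^ (4 * n))) * F (minv X)"
   by (simp add: haar_weight_def ennreal_mult mult.assoc)
 qed
 finally show ?thesis .
qed

text \<open>The density of a product A = Y X of independent matrices, the left factor Y with density
  W and the right factor X with density V. For given X the left factor is A X^(-1), and the Haar
  weight of X is the Jacobian.\<close>

definition mat_conv :: "nat => (complex mat => ennreal) => (complex mat => ennreal) => complex mat => ennreal" where
 "mat_conv n W V A = haar n (\<lambda>X. W (A * minv X) * V X)"

text \<open>The multiplicative convolution \<open>mat_conv\<close> for n = 1, as a function on the
  plane.\<close>

definition scalar_conv :: "(complex => ennreal) => (complex => ennreal) => complex => ennreal" where
 "scalar_conv w v z = (\<integral>s:\<C>. ennreal (inverse ((cmod s)^2)) * (w (z / s) * v s))"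

definition bi_invariant :: "nat => (complex mat => ennreal) => bool" where
 "bi_invariant n W \<longleftrightarrow> W \<in> bmeas (lmat n n) \<and>
   (\<forall>Q X. unitary_mat n Q \<longrightarrow> X \<in> cmat n n \<longrightarrow> W (Q * X) = W X \<and> W (X * Q) = W X)"

text \<open>Integration over the first row of a block triangular matrix separates the corner from
  the block. Only invertible matrices are tested, since densities of inverses are meaningful there;
  the others form a null set.\<close>

definition reduces :: "nat => (complex mat => ennreal) => (complex => ennreal) => (complex mat => ennreal) => ennreal => bool" where
 "reduces n W w V C \<longleftrightarrow> (\<forall>x B. x ~= 0 \<longrightarrow> B \<in> cmat n n \<longrightarrow> det B ~= 0 \<longrightarrow>
   (\<integral>b:1,n. W (bmat x b (0\<^sub>m n 1) B)) = C * (w x * V B))"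

lemma measurable_mat_conv:
 assumes "W \<in> bmeas (lmat n n)" "V \<in> bmeas (lmat n n)"
 shows "mat_conv n W V \<in> bmeas (lmat n n)"
proof -
 have "(\<lambda>A. haar n ((\<lambda>A X. W (A * minv X) * V X) A)) \<in> bmeas (lmat n n)"
  by (rule measurable_haar) (intro measurable_times measurable_compose[OF _ assms(1)] measurable_compose[OF _ assms(2)]
    meas_mult[where b = n] measurable_minv measurable_fst measurable_snd)
 then show ?thesis by (simp add: mat_conv_def[abs_def])
qed

lemma measurable_scalar_conv:
 assumes [measurable]: "w \<in> bmeas borel" "v \<in> bmeas borel"
 shows "scalar_conv w v \<in> bmeas borel"
 unfolding scalar_conv_def[abs_def] by measurable

text \<open>On the left Q is absorbed by W. On the right the substitution of XQ for X in the Haar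
  integral moves Q onto the integration variable, where V absorbs it.\<close>

lemma bi_invariant_conv:
 assumes W: "bi_invariant n W" and V: "bi_invariant n V"
 shows "bi_invariant n (mat_conv n W V)"
 unfolding bi_invariant_def
proof (intro conjI allI impI)
 have Wm: "W \<in> bmeas (lmat n n)" and Vm: "V \<in> bmeas (lmat n n)"
  using W V by (auto simp: bi_invariant_def)
 show "mat_conv n W V \<in> bmeas (lmat n n)" by (rule measurable_mat_conv[OF Wm Vm])
 fix Q A :: "complex mat" assume Q: "unitary_mat n Q" and A: "A \<in> cmat n n"
 have Qc: "Q \<in> cmat n n" using Q by (simp add: unitary_mat_def)
 show "mat_conv n W V (Q * A) = mat_conv n W V A" unfolding mat_conv_def
 proof (rule haar_cong)
  fix X :: "complex mat" assume X: "X \<in> cmat n n"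
  have "W (Q * (A * minv X)) = W (A * minv X)"
   using W Q mult_carrier_mat[OF A minv_carrier[OF X]] unfolding bi_invariant_def by blast
  then show "W (Q * A * minv X) * V X = W (A * minv X) * V X"
   by (simp only: assoc_mult_mat[OF Qc A minv_carrier[OF X]])
 qed
 have "mat_conv n W V (A * Q) = haar n (\<lambda>X. W ((A * Q) * minv (X * Q)) * V (X * Q))"
  unfolding mat_conv_def
  by (rule haar_right[OF Qc minv_unitary(2)[OF Q], symmetric])
   (intro measurable_times measurable_compose[OF _ Wm] Vm meas_mult[where b = n] measurable_minv
    meas_const mult_carrier_mat[OF A Qc] measurable_idt)
 also have "... = mat_conv n W V A" unfolding mat_conv_def
 proof (rule haar_cong)
  fix X :: "complex mat" assume X: "X \<in> cmat n n"
  have "V (X * Q) = V X" using V Q X unfolding bi_invariant_def by blast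
  moreover have "(A * Q) * minv (X * Q) = A * minv X"
  proof -
   have "(A * Q) * minv (X * Q) = A * (Q * (minv Q * minv X))"
    unfolding minv_times[OF X Qc]
    by (rule assoc_mult_mat[OF A Qc mult_carrier_mat[OF minv_carrier[OF Qc] minv_carrier[OF X]]])
   also have "Q * (minv Q * minv X) = (Q * minv Q) * minv X"
    by (rule assoc_mult_mat[OF Qc minv_carrier[OF Qc] minv_carrier[OF X], symmetric])
   also have "... = minv X"
    unfolding minv_mult(1)[OF Qc minv_unitary(2)[OF Q]] by (rule left_mult_one_mat[OF minv_carrier[OF X]])
   finally show ?thesis .
  qed
  ultimately show "W ((A * Q) * minv (X * Q)) * V (X * Q) = W (A * minv X) * V X" by simp
 qed
 finally show "mat_conv n W V (A * Q) = mat_conv n W V A" .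
qed

lemma nn_integral_reorder_b_s_t_D:
 assumes f: "(\<lambda>(s, b, t, D). f s b t D) \<in> bmeas
   (clborel \<Otimes>\<^sub>M (lmat p q \<Otimes>\<^sub>M (lmat r r' \<Otimes>\<^sub>M lmat t' v)))"
 shows "(\<integral>b:p,q. \<integral>s:\<C>. \<integral>t:r,r'. \<integral>D:t',v. f s b t D)
  = (\<integral>s:\<C>. \<integral>D:t',v. \<integral>t:r,r'. \<integral>b:p,q. f s b t D)"
proof -
 have "(\<lambda>p. fst (fst (fst p))) \<in> ((clborel \<Otimes>\<^sub>M lmat p q) \<Otimes>\<^sub>M lmat r r') \<Otimes>\<^sub>M lmat t' v \<rightarrow>\<^sub>M lborel"
  by simp
 then have 1: "(\<lambda>w. f (fst (fst (fst w))) (snd (fst (fst w))) (snd (fst w)) (snd w)) \<in> bmeas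
   (((clborel \<Otimes>\<^sub>M lmat p q) \<Otimes>\<^sub>M lmat r r') \<Otimes>\<^sub>M lmat t' v)"
  by (intro measurable_4_compose[OF f]) simp_all
 have 2: "(\<lambda>w. f s (fst (fst w)) (snd (fst w)) (snd w)) \<in> bmeas ((lmat p q \<Otimes>\<^sub>M lmat r r') \<Otimes>\<^sub>M lmat t' v)" for s
  by (intro measurable_4_compose[OF f] borel_measurable_const) simp_all
 have 3: "(\<lambda>w. f s (fst w) t (snd w)) \<in> bmeas (lmat p q \<Otimes>\<^sub>M lmat t' v)" if "t \<in> cmat r r'" for s t
  using that by (intro measurable_4_compose[OF f] borel_measurable_const meas_const) simp_all
 have 4: "(\<lambda>w. f s (snd w) (fst (fst w)) (snd (fst w))) \<in> bmeas ((lmat r r' \<Otimes>\<^sub>M lmat t' v) \<Otimes>\<^sub>M lmat p q)" for s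
  by (intro measurable_4_compose[OF f] borel_measurable_const) simp_all
 have "(\<integral>b:p,q. \<integral>s:\<C>. \<integral>t:r,r'. \<integral>D:t',v. f s b t D)
   = (\<integral>s:\<C>. \<integral>b:p,q. \<integral>t:r,r'. \<integral>D:t',v. f s b t D)"
 proof (rule nn_integral_lborel_lmat_swap[symmetric])
  show "(\<lambda>(s, b). \<integral>t:r,r'. \<integral>D:t',v. f s b t D) \<in> bmeas (clborel \<Otimes>\<^sub>M lmat p q)"
   unfolding case_prod_unfold using 1 by (intro lmat.borel_measurable_nn_integral) (simp add: case_prod_unfold)
 qed
 also have "... = (\<integral>s:\<C>. \<integral>t:r,r'. \<integral>b:p,q. \<integral>D:t',v. f s b t D)"
 proof (rule nn_integral_cong, rule nn_integral_lmat_swap)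
  fix s :: complex
  show "(\<lambda>(b, t). \<integral>D:t',v. f s b t D) \<in> bmeas (lmat p q \<Otimes>\<^sub>M lmat r r')"
   unfolding case_prod_unfold using 2 by (intro lmat.borel_measurable_nn_integral) (simp add: case_prod_unfold)
 qed
 also have "... = (\<integral>s:\<C>. \<integral>t:r,r'. \<integral>D:t',v. \<integral>b:p,q. f s b t D)"
 proof (rule nn_integral_cong, rule nn_integral_cong, rule nn_integral_lmat_swap)
  fix s :: complex and t assume "t \<in> space (lmat r r')"
  then show "(\<lambda>(b, D). f s b t D) \<in> bmeas (lmat p q \<Otimes>\<^sub>M lmat t' v)"
   unfolding case_prod_unfold using 3 by simp
 qed
 also have "... = (\<integral>s:\<C>. \<integral>D:t',v. \<integral>t:r,r'. \<integral>b:p,q. f s b t D)"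
 proof (rule nn_integral_cong, rule nn_integral_lmat_swap)
  fix s :: complex
  show "(\<lambda>(t, D). \<integral>b:p,q. f s b t D) \<in> bmeas (lmat r r' \<Otimes>\<^sub>M lmat t' v)"
   unfolding case_prod_unfold using 4 by (intro lmat.borel_measurable_nn_integral) (simp add: case_prod_unfold)
 qed
 finally show ?thesis .
qed

lemma nn_integral_row_affine:
 assumes M: "M \<in> cmat n n" "det M ~= 0" and c: "c \<in> cmat 1 n"
  and G: "G \<in> bmeas (lmat 1 n)"
 shows "(\<integral>b:1,n. G (b * minv M + c)) = ennreal ((cmod (det M))^2) * integral\<^sup>N (lmat 1 n) G"
proof -
 have 1: "(\<lambda>b. G (b + c)) \<in> bmeas (lmat 1 n)"
  by (intro measurable_compose[OF _ G] meas_add meas_const c measurable_idt)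
 have "ennreal (cmod (det (minv M)) ^ (2 * 1)) * (\<integral>b:1,n. G (b * minv M + c)) = integral\<^sup>N (lmat 1 n) G"
  using nn_integral_right_mult[OF _ _ 1, of "minv M"] M nn_integral_lmat_translate[OF c G] by (simp add: det_minv)
 then have "ennreal ((cmod (det M))^2) * integral\<^sup>N (lmat 1 n) G =
   (ennreal ((cmod (det M))^2) * ennreal (cmod (det (minv M)) ^ (2 * 1))) * (\<integral>b:1,n. G (b * minv M + c))"
  by (simp only: mult.assoc)
 also have "ennreal ((cmod (det M))^2) * ennreal (cmod (det (minv M)) ^ (2 * 1)) = 1"
  using M by (subst ennreal_mult[symmetric]) (simp_all add: det_minv[of M n] norm_inverse power_mult_distrib[symmetric])
 finally show ?thesis by simp
qed

text \<open>As a function of X the integrand of the convolution is left invariant: W is invariant on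
  its right, V on its left, and the Haar weight has |det Q| = 1. This admits
  \<open>nn_integral_left_invariant\<close>.\<close>

lemma mat_conv_left_invariant:
 assumes W: "bi_invariant n W" and V: "bi_invariant n V" and Q: "unitary_mat n Q"
  and A: "A \<in> cmat n n" and X: "X \<in> cmat n n"
 shows "haar_weight n (Q * X) * (W (A * minv (Q * X)) * V (Q * X)) = haar_weight n X * (W (A * minv X) * V X)"
proof -
 have Qc: "Q \<in> cmat n n" and Q': "unitary_mat n (ctrans Q)" using Q unitary_mat_ctrans by (auto simp: unitary_mat_def)
 have "haar_weight n Q = 1" using cmod_det_unitary[OF Q] by (simp add: haar_weight_def)
 moreover have "A * minv (Q * X) = (A * minv X) * ctrans Q"
  unfolding minv_times[OF Qc X] minv_unitary(1)[OF Q]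
  by (rule assoc_mult_mat[OF A minv_carrier[OF X] ctrans_carrier[OF Qc], symmetric])
 moreover have "W ((A * minv X) * ctrans Q) = W (A * minv X)"
  using W Q' mult_carrier_mat[OF A minv_carrier[OF X]] unfolding bi_invariant_def by blast
 moreover have "V (Q * X) = V X" using V Q X unfolding bi_invariant_def by blast
 ultimately show ?thesis by (simp add: haar_weight_times[OF Qc X])
qed

text \<open>By left invariance the convolution variable may be taken block triangular, with corner
  s, row t and block D. The quotient of block triangular matrices has corner x/s and block B D^(-1).
  Integration over b uses the first reduction and integration over t the second, and what is left is
  a convolution in the corner and one in the block.\<close>

theorem reduces_conv:
 assumes W1: "bi_invariant (Suc n) W1" and W2: "bi_invariant (Suc n) W2"
  and r1: "reduces n W1 w1 V1 C1" and r2: "reduces n W2 w2 V2 C2"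
  and w: "w1 \<in> bmeas borel" "w2 \<in> bmeas borel"
  and V: "V1 \<in> bmeas (lmat n n)" "V2 \<in> bmeas (lmat n n)"
 shows "reduces n (mat_conv (Suc n) W1 W2) (scalar_conv w1 w2) (mat_conv n V1 V2) (kappa n * C1 * C2)"
 unfolding reduces_def
proof (intro allI impI)
 fix x :: complex and B :: "complex mat" assume x: "x ~= 0" and B: "B \<in> cmat n n" "det B ~= 0"
 have Wm: "W1 \<in> bmeas (lmat (Suc n) (Suc n))" "W2 \<in> bmeas (lmat (Suc n) (Suc n))"
  using W1 W2 by (auto simp: bi_invariant_def)
 define T where "T b = bmat x b (0\<^sub>m n 1) B" for b
 have Tc: "T b \<in> cmat (Suc n) (Suc n)" for b using B by (simp add: T_def)
 have Tm: "(\<lambda>w. T (b w)) \<in> N \<rightarrow>\<^sub>M lmat (Suc n) (Suc n)" if "b \<in> N \<rightarrow>\<^sub>M lmat 1 n" for b and N :: "complex mat measure"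
  unfolding T_def by (intro measurable_bmat borel_measurable_const that meas_zero meas_const B)
 define F where "F b X = haar_weight (Suc n) X * (W1 (T b * minv X) * W2 X)" for b X
 have Fm: "(\<lambda>w. F (b w) (X w)) \<in> bmeas N"
  if "b \<in> N \<rightarrow>\<^sub>M lmat 1 n" "X \<in> N \<rightarrow>\<^sub>M lmat (Suc n) (Suc n)" for b X and N :: "complex mat measure"
  unfolding F_def by (intro measurable_times measurable_haar_weight measurable_compose[OF _ Wm(1)] measurable_compose[OF _ Wm(2)]
    meas_mult[where b = "Suc n"] measurable_minv Tm that)
 define f where "f s b t D = ennreal (cmod s ^ (2 * n)) * F b (bmat s t (0\<^sub>m n 1) D)" for s b t D
 let ?M = "clborel \<Otimes>\<^sub>M (lmat 1 n \<Otimes>\<^sub>M (lmat 1 n \<Otimes>\<^sub>M lmat n n))"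
 have m: "(\<lambda>p. fst p) \<in> ?M \<rightarrow>\<^sub>M borel" "(\<lambda>p. fst (snd p)) \<in> ?M \<rightarrow>\<^sub>M lmat 1 n"
  "(\<lambda>p. fst (snd (snd p))) \<in> ?M \<rightarrow>\<^sub>M lmat 1 n" "(\<lambda>p. snd (snd (snd p))) \<in> ?M \<rightarrow>\<^sub>M lmat n n"
  by simp_all
 have fm: "(\<lambda>(s, b, t, D). f s b t D) \<in> bmeas ?M"
 proof -
  have "(\<lambda>p. F (fst (snd p)) (bmat (fst p) (fst (snd (snd p))) (0\<^sub>m n 1) (snd (snd (snd p))))) \<in> bmeas ?M"
   unfolding F_def by (intro measurable_times measurable_haar_weight measurable_compose[OF _ Wm(1)] measurable_compose[OF _ Wm(2)]
    meas_mult[where b = "Suc n"] measurable_minv measurable_bmat meas_zero m)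
    (unfold T_def, intro measurable_bmat borel_measurable_const m meas_zero meas_const B)
  moreover have "(\<lambda>p. ennreal (cmod (fst p) ^ (2 * n))) \<in> bmeas ?M"
   by (intro measurable_to_ennreal borel_measurable_power measurable_cmod m)
  ultimately show ?thesis unfolding case_prod_unfold f_def by (intro measurable_times)
 qed
 have conv: "mat_conv (Suc n) W1 W2 (T b) = kappa n * (\<integral>s:\<C>. \<integral>t:1,n. \<integral>D:n,n. f s b t D)"
  if "b \<in> cmat 1 n" for b
 proof -
  have "mat_conv (Suc n) W1 W2 (T b) = integral\<^sup>N (lmat (Suc n) (Suc n)) (F b)"
   by (simp add: mat_conv_def haar_def F_def[abs_def])
  also have "... = kappa n * upper_integral n (\<lambda>S. ennreal (cmod (S $$ (0, 0)) ^ (2 * n)) * F b S)"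
  proof (rule nn_integral_left_invariant)
   show "F b \<in> bmeas (lmat (Suc n) (Suc n))"
    using that by (intro Fm meas_const measurable_idt)
  qed (simp only: F_def mat_conv_left_invariant[OF W1 W2 _ Tc])
  finally show ?thesis by (simp add: upper_integral_def f_def)
 qed
 have bint: "(\<integral>b:1,n. f s b t D) = W2 (bmat s t (0\<^sub>m n 1) D) *
   (ennreal (inverse ((cmod s)^2)) * haar_weight n D * (C1 * (w1 (x / s) * V1 (B * minv D))))"
  if s: "s ~= 0" and D: "D \<in> cmat n n" "det D ~= 0" and t: "t \<in> cmat 1 n" for s t D
 proof -
  let ?S = "bmat s t (0\<^sub>m n 1) D"
  let ?c = "x \<cdot>\<^sub>m ((- 1 / s) \<cdot>\<^sub>m (t * minv D))"
  have Dc: "minv D \<in> cmat n n" using D by simp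
  have c1: "(- 1 / s) \<cdot>\<^sub>m (t * minv D) \<in> cmat 1 n" by (rule smult_carrier_mat[OF mult_carrier_mat[OF t Dc]])
  have c: "?c \<in> cmat 1 n" by (rule smult_carrier_mat[OF c1])
  have BD: "B * minv D \<in> cmat n n" "det (B * minv D) ~= 0"
   using B D Dc by (simp_all add: det_mult[of _ n] det_minv)
  define G where "G b = W1 (bmat (x / s) b (0\<^sub>m n 1) (B * minv D))" for b
  have Gm: "G \<in> bmeas (lmat 1 n)"
   unfolding G_def by (intro measurable_compose[OF _ Wm(1)] measurable_bmat borel_measurable_const meas_zero
    meas_const BD measurable_idt)
  have "T b * minv ?S = bmat (x / s) (b * minv D + ?c) (0\<^sub>m n 1) (B * minv D)" if b: "b \<in> cmat 1 n" for b
  proof -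
   have "T b * minv ?S = bmat (x * (1 / s)) (?c + b * minv D) (0\<^sub>m n 1) (B * minv D)"
    unfolding T_def minv_bmat_upper[OF t D s] by (rule bmat_upper_mult[OF b B(1) c1 Dc])
   also have "?c + b * minv D = b * minv D + ?c" by (rule comm_add_mat[OF c mult_carrier_mat[OF b Dc]])
   finally show ?thesis by simp
  qed
  then have "(\<integral>b:1,n. f s b t D) =
    (\<integral>b:1,n. (ennreal (cmod s ^ (2 * n)) * haar_weight (Suc n) ?S * W2 ?S) * G (b * minv D + ?c))"
   by (intro nn_integral_cong) (simp add: f_def F_def G_def ac_simps)
  also have "... = (ennreal (cmod s ^ (2 * n)) * haar_weight (Suc n) ?S * W2 ?S) * (\<integral>b:1,n. G (b * minv D + ?c))"
   by (intro nn_integral_cmult measurable_compose[OF _ Gm] meas_add meas_mult[where b = n] meas_const c Dc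
    measurable_idt)
  also have "(\<integral>b:1,n. G (b * minv D + ?c)) = ennreal ((cmod (det D))^2) * (C1 * (w1 (x / s) * V1 (B * minv D)))"
   unfolding nn_integral_row_affine[OF D c Gm] using r1 x s BD unfolding reduces_def by (simp add: G_def[abs_def])
  also have "(ennreal (cmod s ^ (2 * n)) * haar_weight (Suc n) ?S * W2 ?S) * (ennreal ((cmod (det D))^2) * (C1 * (w1 (x / s) * V1 (B * minv D))))
   = W2 ?S * ((ennreal (cmod s ^ (2 * n)) * haar_weight (Suc n) ?S * ennreal ((cmod (det D))^2)) * (C1 * (w1 (x / s) * V1 (B * minv D))))"
   by (simp only: ac_simps)
  \<comment> \<open>|s|^(2n) comes from the restriction to triangular matrices and |det D|^2 from
    the substitution in the row b. Together with the Haar weight for size n + 1 they leave exactly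
    the Haar weights of the corner and of the block.\<close>
  also have "ennreal (cmod s ^ (2 * n)) * haar_weight (Suc n) ?S * ennreal ((cmod (det D))^2)
    = ennreal (inverse ((cmod s)^2)) * haar_weight n D"
  proof -
   have "cmod s ^ (2 * n) * inverse (cmod s ^ (2 * n + 2)) = inverse ((cmod s)^2)"
    "inverse (cmod (det D) ^ (2 * n + 2)) * (cmod (det D))^2 = inverse (cmod (det D) ^ (2 * n))"
    using s D by (simp_all add: power_add field_simps power2_eq_square)
   then have "cmod s ^ (2 * n) * inverse ((cmod s * cmod (det D)) ^ (2 * n + 2)) * (cmod (det D))^2
    = inverse ((cmod s)^2) * inverse (cmod (det D) ^ (2 * n))"
    by (simp only: power_mult_distrib inverse_mult_distrib) (metis (no_types, lifting) mult.assoc)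
   moreover have "det ?S = s * det D" by (rule det_bmat_lower_zero[OF t D(1)])
   ultimately show ?thesis
    by (simp add: haar_weight_def ennreal_mult[symmetric] norm_mult)
  qed
  finally show ?thesis .
 qed
 have V1m: "(\<lambda>D. V1 (B * minv D)) \<in> bmeas (lmat n n)"
  by (intro measurable_compose[OF _ V(1)] meas_mult[where b = n] measurable_minv meas_const B measurable_idt)
 have tint: "(\<integral>t:1,n. \<integral>b:1,n. f s b t D) =
   (C1 * C2 * (ennreal (inverse ((cmod s)^2)) * (w1 (x / s) * w2 s))) * (haar_weight n D * (V1 (B * minv D) * V2 D))"
  if s: "s ~= 0" and D: "D \<in> cmat n n" "det D ~= 0" for s D
 proof -
  have "(\<integral>t:1,n. \<integral>b:1,n. f s b t D) =
    (\<integral>t:1,n. W2 (bmat s t (0\<^sub>m n 1) D) * (ennreal (inverse ((cmod s)^2)) * haar_weight n D * (C1 * (w1 (x / s) * V1 (B * minv D)))))"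
   by (rule nn_integral_cong, rule bint[OF s D]) simp
  also have "... = (\<integral>t:1,n. W2 (bmat s t (0\<^sub>m n 1) D)) * (ennreal (inverse ((cmod s)^2)) * haar_weight n D * (C1 * (w1 (x / s) * V1 (B * minv D))))"
   by (intro nn_integral_multc measurable_compose[OF _ Wm(2)] measurable_bmat borel_measurable_const meas_zero
    meas_const D measurable_idt)
  also have "(\<integral>t:1,n. W2 (bmat s t (0\<^sub>m n 1) D)) = C2 * (w2 s * V2 D)"
   using r2 s D unfolding reduces_def by simp
  finally show ?thesis by (simp only: ac_simps)
 qed
 have "(\<integral>b:1,n. mat_conv (Suc n) W1 W2 (T b)) =
   (\<integral>b:1,n. kappa n * (\<integral>s:\<C>. \<integral>t:1,n. \<integral>D:n,n. f s b t D))"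
  by (rule nn_integral_cong) (simp add: conv)
 also have "... = kappa n * (\<integral>b:1,n. \<integral>s:\<C>. \<integral>t:1,n. \<integral>D:n,n. f s b t D)"
 proof (rule nn_integral_cmult)
  have "(\<lambda>p. snd (fst (fst p))) \<in> ((lmat 1 n \<Otimes>\<^sub>M clborel) \<Otimes>\<^sub>M lmat 1 n) \<Otimes>\<^sub>M lmat n n \<rightarrow>\<^sub>M lborel"
   by simp
  then have "(\<lambda>p. f (snd (fst (fst p))) (fst (fst (fst p))) (snd (fst p)) (snd p)) \<in> bmeas (((lmat 1 n \<Otimes>\<^sub>M clborel) \<Otimes>\<^sub>M lmat 1 n) \<Otimes>\<^sub>M lmat n n)"
   by (intro measurable_4_compose[OF fm]) simp_all
  then show "(\<lambda>b. \<integral>s:\<C>. \<integral>t:1,n. \<integral>D:n,n. f s b t D) \<in> bmeas (lmat 1 n)"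
   by (intro lborel.borel_measurable_nn_integral lmat.borel_measurable_nn_integral) (simp add: case_prod_unfold)
 qed
 also have "(\<integral>b:1,n. \<integral>s:\<C>. \<integral>t:1,n. \<integral>D:n,n. f s b t D)
   = (\<integral>s:\<C>. \<integral>D:n,n. \<integral>t:1,n. \<integral>b:1,n. f s b t D)"
  by (rule nn_integral_reorder_b_s_t_D[OF fm])
 also have "... = (\<integral>s:\<C>. (C1 * C2 * (ennreal (inverse ((cmod s)^2)) * (w1 (x / s) * w2 s))) * mat_conv n V1 V2 B)"
 proof (rule nn_integral_cong_nonzero)
  fix s :: complex assume s: "s ~= 0"
  have "(\<integral>D:n,n. \<integral>t:1,n. \<integral>b:1,n. f s b t D)
    = (\<integral>D:n,n. (C1 * C2 * (ennreal (inverse ((cmod s)^2)) * (w1 (x / s) * w2 s))) * (haar_weight n D * (V1 (B * minv D) * V2 D)))"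
   by (rule nn_integral_cong_det) (simp add: tint[OF s])
  also have "... = (C1 * C2 * (ennreal (inverse ((cmod s)^2)) * (w1 (x / s) * w2 s))) * mat_conv n V1 V2 B"
   unfolding mat_conv_def haar_def
   by (intro nn_integral_cmult measurable_times measurable_haar_weight V1m V(2) measurable_idt)
  finally show "(\<integral>D:n,n. \<integral>t:1,n. \<integral>b:1,n. f s b t D)
    = (C1 * C2 * (ennreal (inverse ((cmod s)^2)) * (w1 (x / s) * w2 s))) * mat_conv n V1 V2 B" .
 qed
 also have "... = (\<integral>s:\<C>. (C1 * C2 * mat_conv n V1 V2 B) * (ennreal (inverse ((cmod s)^2)) * (w1 (x / s) * w2 s)))"
  by (simp only: ac_simps)
 also have "... = (C1 * C2 * mat_conv n V1 V2 B) * scalar_conv w1 w2 x"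
  unfolding scalar_conv_def
 proof (rule nn_integral_cmult)
  have "(\<lambda>s. x / s) \<in> bmeas borel" by simp
  from measurable_compose[OF this w(1)] w(2)
  show "(\<lambda>s. ennreal (inverse ((cmod s)^2)) * (w1 (x / s) * w2 s)) \<in> bmeas lborel"
   by (intro measurable_times) simp_all
 qed
 finally show "(\<integral>b:1,n. mat_conv (Suc n) W1 W2 (bmat x b (0\<^sub>m n 1) B)) = kappa n * C1 * C2 * (scalar_conv w1 w2 x * mat_conv n V1 V2 B)"
  by (simp add: T_def ac_simps)
qed

text \<open>For \<open>e = - 1\<close> this is the density of the inverse of a matrix with weight
\<open>exp (- sqnorm X) |det X|\<^sup>2\<^sup>m\<close>; the number \<open>m\<close> counts the eigenvalues already split off.\<close>

definition gauss_weight :: "int => nat => nat => complex mat => ennreal" where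
 "gauss_weight e m n X = (if e = 1 then ennreal (exp (- sqnorm X))
   else ennreal (exp (- sqnorm (minv X)) * inverse (cmod (det X) ^ (2 * m + 4 * n))))"

text \<open>For e = -1 this is the image of the weight exp(-|y|^2) |y|^(2(N - 1)) under inversion,
  the additional 4 being the Jacobian |x|^(-4). N is the size of the original matrix, that is m + n
  at every stage.\<close>

definition scalar_weight :: "int => nat => complex => ennreal" where
 "scalar_weight e N x = (if e = 1 then ennreal (exp (- (cmod x)\<^sup>2))
   else ennreal (exp (- (inverse (cmod x))\<^sup>2) * inverse (cmod x ^ (2 * (N - 1) + 4))))"

lemma measurable_scalar_weight [measurable]: "scalar_weight e N \<in> bmeas borel"
 unfolding scalar_weight_def[abs_def] by measurable

lemma measurable_exp_sqnorm:
 "f \<in> N \<rightarrow>\<^sub>M lmat a b ==> (\<lambda>w. exp (- sqnorm (f w))) \<in> bmeas N"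
 by (intro measurable_compose[OF _ borel_measurable_exp] borel_measurable_uminus measurable_sqnorm)

lemma bi_invariant_gauss_weight: "bi_invariant n (gauss_weight e m n)"
 unfolding bi_invariant_def
proof (intro conjI allI impI)
 show "gauss_weight e m n \<in> bmeas (lmat n n)"
 proof (cases "e = 1")
  case True
  have "(\<lambda>X. ennreal (exp (- sqnorm X))) \<in> bmeas (lmat n n)"
   by (intro measurable_to_ennreal measurable_exp_sqnorm[where a = n and b = n] measurable_idt)
  then show ?thesis using True by (simp add: gauss_weight_def[abs_def])
 next
  case False
  have "(\<lambda>X. ennreal (exp (- sqnorm (minv X)) * inverse (cmod (det X) ^ (2 * m + 4 * n)))) \<in> bmeas (lmat n n)"
   by (intro measurable_to_ennreal borel_measurable_times borel_measurable_inverse borel_measurable_power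
    measurable_cmod meas_det[where n = n] measurable_minv
    measurable_exp_sqnorm[where a = n and b = n] measurable_idt)
  then show ?thesis using False by (simp add: gauss_weight_def[abs_def])
 qed
next
 fix Q X :: "complex mat" assume Q: "unitary_mat n Q" and X: "X \<in> cmat n n"
 have Qc: "Q \<in> cmat n n" and Q': "unitary_mat n (ctrans Q)" using Q unitary_mat_ctrans by (auto simp: unitary_mat_def)
 have d: "cmod (det (Q * X)) = cmod (det X)" "cmod (det (X * Q)) = cmod (det X)"
  using cmod_det_unitary[OF Q] by (simp_all add: det_mult[OF Qc X] det_mult[OF X Qc] norm_mult)
 show "gauss_weight e m n (Q * X) = gauss_weight e m n X"
  unfolding gauss_weight_def d minv_times[OF Qc X] minv_unitary(1)[OF Q] sqnorm_unitary_left[OF Q X]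
   sqnorm_unitary_right[OF Q' minv_carrier[OF X]] ..
 show "gauss_weight e m n (X * Q) = gauss_weight e m n X"
  unfolding gauss_weight_def d minv_times[OF X Qc] minv_unitary(1)[OF Q] sqnorm_unitary_right[OF Q X]
   sqnorm_unitary_left[OF Q' minv_carrier[OF X]] ..
qed

lemma sqnorm_zero [simp]: "sqnorm (0\<^sub>m a b) = 0"
 by (simp add: sqnorm_def)

text \<open>For e = 1 the squared norm is additive over the blocks. For e = -1 the first row of the
  inverse is -(1/x) b B^(-1), and rescaling it to a fixed Gaussian costs |x|^(2n) |det B|^2. This
  turns the exponent 2m + 4(n + 1) of det B into 2(m + 1) + 4n, which is why m increases by
  one.\<close>

lemma reduces_gauss_weight:
 "reduces n (gauss_weight e m (Suc n)) (scalar_weight e (m + Suc n)) (gauss_weight e (Suc m) n)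
   (\<integral>b:1,n. ennreal (exp (- sqnorm b)))"
 unfolding reduces_def
proof (intro allI impI)
 fix x :: complex and B :: "complex mat" assume x: "x ~= 0" and B: "B \<in> cmat n n" "det B ~= 0"
 let ?\<gamma> = "\<integral>b:1,n. ennreal (exp (- sqnorm b))"
 have em: "(\<lambda>b. ennreal (exp (- sqnorm b))) \<in> bmeas (lmat 1 n)"
  by (intro measurable_to_ennreal measurable_exp_sqnorm[where a = 1 and b = n] measurable_idt)
 show "(\<integral>b:1,n. gauss_weight e m (Suc n) (bmat x b (0\<^sub>m n 1) B))
   = ?\<gamma> * (scalar_weight e (m + Suc n) x * gauss_weight e (Suc m) n B)"
 proof (cases "e = 1")
  case True
  have "(\<integral>b:1,n. gauss_weight e m (Suc n) (bmat x b (0\<^sub>m n 1) B))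
    = (\<integral>b:1,n. ennreal (exp (- sqnorm b)) * (scalar_weight e (m + Suc n) x * gauss_weight e (Suc m) n B))"
  proof (rule nn_integral_cong_mat)
   fix b :: "complex mat" assume b: "b \<in> cmat 1 n"
   show "gauss_weight e m (Suc n) (bmat x b (0\<^sub>m n 1) B)
    = ennreal (exp (- sqnorm b)) * (scalar_weight e (m + Suc n) x * gauss_weight e (Suc m) n B)"
    using True sqnorm_bmat[OF b zero_carrier_mat B(1), of x]
    by (simp add: gauss_weight_def scalar_weight_def ennreal_mult[symmetric] exp_add[symmetric])
  qed
  also have "... = ?\<gamma> * (scalar_weight e (m + Suc n) x * gauss_weight e (Suc m) n B)"
   by (rule nn_integral_multc[OF em])
  finally show ?thesis .
 next
  case False
  let ?M = "minv B"
  have Mc: "?M \<in> cmat n n" using B by simp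
  define G where "G b = ennreal (exp (- sqnorm ((- 1 / x) \<cdot>\<^sub>m b + 0\<^sub>m 1 n)))" for b
  have Gm: "G \<in> bmeas (lmat 1 n)"
   unfolding G_def by (intro measurable_compose[OF _ em] meas_add meas_smult borel_measurable_const
    meas_zero measurable_idt)
  have Gint: "integral\<^sup>N (lmat 1 n) G = ennreal (cmod x ^ (2 * n)) * ?\<gamma>"
  proof -
   have "ennreal (cmod (- 1 / x) ^ (2 * (1 * n))) * integral\<^sup>N (lmat 1 n) G = ?\<gamma>"
    unfolding G_def by (rule nn_integral_lmat_affine[OF _ zero_carrier_mat em]) (use x in simp)
   then have "ennreal (cmod x ^ (2 * n)) * ?\<gamma> = (ennreal (cmod x ^ (2 * n)) * ennreal (cmod (- 1 / x) ^ (2 * (1 * n)))) * integral\<^sup>N (lmat 1 n) G"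
    by (simp only: mult.assoc)
   also have "ennreal (cmod x ^ (2 * n)) * ennreal (cmod (- 1 / x) ^ (2 * (1 * n))) = 1"
    using x by (subst ennreal_mult[symmetric]) (simp_all add: norm_divide power_mult_distrib[symmetric])
   finally show ?thesis by simp
  qed
  let ?c = "ennreal (exp (- (inverse (cmod x))\<^sup>2) * exp (- sqnorm ?M) * inverse ((cmod x * cmod (det B)) ^ (2 * m + 4 * Suc n)))"
  have "(\<integral>b:1,n. gauss_weight e m (Suc n) (bmat x b (0\<^sub>m n 1) B))
    = (\<integral>b:1,n. ?c * G (b * ?M + 0\<^sub>m 1 n))"
  proof (rule nn_integral_cong_mat)
   fix b :: "complex mat" assume b: "b \<in> cmat 1 n"
   have bM: "b * ?M \<in> cmat 1 n" by (rule mult_carrier_mat[OF b Mc])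
   have sb: "(- 1 / x) \<cdot>\<^sub>m (b * ?M) \<in> cmat 1 n" by (rule smult_carrier_mat[OF bM])
   have "sqnorm (minv (bmat x b (0\<^sub>m n 1) B)) = (inverse (cmod x))\<^sup>2 + sqnorm ((- 1 / x) \<cdot>\<^sub>m (b * ?M)) + sqnorm ?M"
    unfolding minv_bmat_upper[OF b B x] using sqnorm_bmat[OF sb zero_carrier_mat Mc, of "1 / x"]
    by (simp add: norm_divide inverse_eq_divide)
   moreover have "G (b * ?M + 0\<^sub>m 1 n) = ennreal (exp (- sqnorm ((- 1 / x) \<cdot>\<^sub>m (b * ?M))))"
    unfolding G_def right_add_zero_mat[OF bM] right_add_zero_mat[OF sb] ..
   ultimately show "gauss_weight e m (Suc n) (bmat x b (0\<^sub>m n 1) B) = ?c * G (b * ?M + 0\<^sub>m 1 n)"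
    using False by (simp add: gauss_weight_def det_bmat_lower_zero[OF b B(1)] norm_mult ennreal_mult[symmetric]
    exp_minus exp_add exp_diff power_mult_distrib algebra_simps divide_inverse)
  qed
  also have "... = ?c * (\<integral>b:1,n. G (b * ?M + 0\<^sub>m 1 n))"
   by (intro nn_integral_cmult measurable_compose[OF _ Gm] meas_add meas_mult[where b = n] meas_const Mc
    meas_zero measurable_idt)
  also have "... = (?c * ennreal ((cmod (det B))^2) * ennreal (cmod x ^ (2 * n))) * ?\<gamma>"
   unfolding nn_integral_row_affine[OF B zero_carrier_mat Gm] Gint by (simp only: mult.assoc)
  also have "?c * ennreal ((cmod (det B))^2) * ennreal (cmod x ^ (2 * n)) = scalar_weight e (m + Suc n) x * gauss_weight e (Suc m) n B"
  proof -
   \<comment> \<open>The exponent of the corner: 2m + 4(n + 1) - 2n = 2(m + n) + 4.\<close>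
   have f1: "inverse (cmod x ^ (2 * m + 4 * Suc n)) * cmod x ^ (2 * n) = inverse (cmod x ^ (2 * (m + Suc n - 1) + 4))"
   proof -
    have "cmod x ^ (2 * m + 4 * Suc n) = cmod x ^ (2 * (m + Suc n - 1) + 4) * cmod x ^ (2 * n)"
    by (simp add: power_add[symmetric] algebra_simps)
    then show ?thesis using x by (simp del: power_Suc)
   qed
   have f2: "inverse (cmod (det B) ^ (2 * m + 4 * Suc n)) * (cmod (det B))^2 = inverse (cmod (det B) ^ (2 * Suc m + 4 * n))"
   proof -
    have "cmod (det B) ^ (2 * m + 4 * Suc n) = cmod (det B) ^ (2 * Suc m + 4 * n) * (cmod (det B))^2"
    proof -
    have "2 * m + 4 * Suc n = (2 * Suc m + 4 * n) + 2" by simp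
    then show ?thesis by (simp only: power_add)
    qed
    then show ?thesis using B by (simp del: power_Suc mult_Suc_right)
   qed
   have gen: "E * S * (a * b) * q * p = (E * (a * p)) * (S * (b * q))" for E S a b q p :: real
    by (simp only: ac_simps)
   have "exp (- (inverse (cmod x))\<^sup>2) * exp (- sqnorm ?M) * inverse ((cmod x * cmod (det B)) ^ (2 * m + 4 * Suc n))
    * (cmod (det B))^2 * cmod x ^ (2 * n)
    = (exp (- (inverse (cmod x))\<^sup>2) * inverse (cmod x ^ (2 * (m + Suc n - 1) + 4))) * (exp (- sqnorm ?M) * inverse (cmod (det B) ^ (2 * Suc m + 4 * n)))"
    unfolding power_mult_distrib inverse_mult_distrib gen f1 f2 ..
   then show ?thesis using False unfolding gauss_weight_def scalar_weight_def by (simp only: if_False ennreal_mult[symmetric]) (simp add: ennreal_mult[symmetric])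
  qed
  finally show ?thesis by (simp only: mult.commute)
 qed
qed

section \<open>The joint density of the eigenvalues\<close>

text \<open>The argument k stands for k + 1 factors: the neutral element of convolution would be a
  point mass, not a function, so the recursion starts from one factor. The same holds for
  \<open>eig_weight\<close>.\<close>

fun mat_weight :: "(nat => int) => nat => nat => nat => complex mat => ennreal" where
 "mat_weight \<epsilon> m n 0 = gauss_weight (\<epsilon> 0) m n"
| "mat_weight \<epsilon> m n (Suc k) = mat_conv n (mat_weight \<epsilon> m n k) (gauss_weight (\<epsilon> (Suc k)) m n)"

fun eig_weight :: "(nat => int) => nat => nat => complex => ennreal" where
 "eig_weight \<epsilon> N 0 = scalar_weight (\<epsilon> 0) N"
| "eig_weight \<epsilon> N (Suc k) = scalar_conv (eig_weight \<epsilon> N k) (scalar_weight (\<epsilon> (Suc k)) N)"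

lemma bi_invariant_mat_weight: "bi_invariant n (mat_weight \<epsilon> m n k)"
 by (induction k) (auto intro: bi_invariant_conv bi_invariant_gauss_weight)

lemma measurable_mat_weight: "mat_weight \<epsilon> m n k \<in> bmeas (lmat n n)"
 using bi_invariant_mat_weight unfolding bi_invariant_def by blast

lemma measurable_eig_weight [measurable]: "eig_weight \<epsilon> N k \<in> bmeas borel"
 by (induction k) (auto intro: measurable_scalar_conv measurable_scalar_weight)

lemma reduces_mat_weight:
 "\<exists>C. reduces n (mat_weight \<epsilon> m (Suc n) k) (eig_weight \<epsilon> (m + Suc n) k) (mat_weight \<epsilon> (Suc m) n k) C"
proof (induction k)
 case 0
 show ?case unfolding mat_weight.simps(1) eig_weight.simps(1) using reduces_gauss_weight by blast
next
 case (Suc k)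
 then obtain C where C: "reduces n (mat_weight \<epsilon> m (Suc n) k) (eig_weight \<epsilon> (m + Suc n) k) (mat_weight \<epsilon> (Suc m) n k) C" ..
 have "gauss_weight e (Suc m) n \<in> bmeas (lmat n n)" for e
  using bi_invariant_gauss_weight unfolding bi_invariant_def by blast
 from reduces_conv[OF bi_invariant_mat_weight bi_invariant_gauss_weight C reduces_gauss_weight measurable_eig_weight
   measurable_scalar_weight measurable_mat_weight this]
 show ?case unfolding mat_weight.simps(2) eig_weight.simps(2) by blast
qed

definition dist_weight :: "complex => complex multiset => ennreal" where
 "dist_weight z S = (\<Prod>l\<in>#S. ennreal ((cmod (z - l))^2))"

definition ginibre_density :: "(complex => ennreal) => nat => (nat => complex) => ennreal" where
 "ginibre_density w n z = (\<Prod>l<n. w (z l)) * (\<Prod>j<n. \<Prod>i<j. ennreal ((cmod (z i - z j))^2))"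

lemma dist_weight_map: "dist_weight z (mset (map x [0..<n])) = (\<Prod>i<n. ennreal ((cmod (z - x i))^2))"
 by (induction n) (simp_all add: dist_weight_def lessThan_Suc)

lemma char_poly_dist_weight:
 assumes "N \<in> cmat n n"
 shows "ennreal ((cmod (poly (char_poly N) z))^2) = dist_weight z (eigenvalues N)"
proof -
 have "coeff (char_poly N) (degree (char_poly N)) = 1"
  using degree_monic_char_poly[OF assms] by simp
 then have "char_poly N = (\<Prod>x\<in>#proots (char_poly N). [:- x, 1:])"
  using complex_poly_decompose_multiset[of "char_poly N"] by simp
 then have "ennreal ((cmod (poly (char_poly N) z))^2) = ennreal ((cmod (poly (\<Prod>x\<in>#eigenvalues N. [:- x, 1:]) z))^2)"
  by (simp add: eigenvalues_def)
 moreover have "ennreal ((cmod (poly (\<Prod>x\<in>#S. [:- x, 1:]) z))^2) = dist_weight z S" for S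
 proof (induction S)
  case (add x S)
  have "poly (\<Prod>x\<in>#add_mset x S. [:- x, 1:]) z = (z - x) * poly (\<Prod>x\<in>#S. [:- x, 1:]) z"
   by (simp add: left_diff_distrib)
  then have "ennreal ((cmod (poly (\<Prod>x\<in>#add_mset x S. [:- x, 1:]) z))^2)
    = ennreal ((cmod (z - x))^2) * ennreal ((cmod (poly (\<Prod>x\<in>#S. [:- x, 1:]) z))^2)"
   by (simp only: norm_mult power_mult_distrib ennreal_mult zero_le_power2)
  also have "... = dist_weight z (add_mset x S)" unfolding add by (simp add: dist_weight_def)
  finally show ?case .
 qed (simp add: dist_weight_def)
 ultimately show ?thesis by simp
qed

lemma mset_map_upd: "mset (map (x(n := z)) [0..<Suc n]) = add_mset z (mset (map x [0..<n]))"
 by simp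

lemma lebesgue_pow_Suc: "lpow (Suc n) = (\<Pi>\<^sub>M i\<in>insert n {..<n}. lborel)"
 by (simp add: lessThan_Suc)

lemma measurable_lebesgue_pow_upd:
 assumes "x \<in> N \<rightarrow>\<^sub>M lpow n" "z \<in> bmeas N"
 shows "(\<lambda>w. (x w)(n := z w)) \<in> N \<rightarrow>\<^sub>M lpow (Suc n)"
proof -
 have "(\<lambda>w. (x w, z w)) \<in> N \<rightarrow>\<^sub>M (lpow n \<Otimes>\<^sub>M lborel)"
  using assms by (intro measurable_Pair) simp_all
 from measurable_compose[OF this measurable_add_dim] show ?thesis
  by (simp add: lebesgue_pow_Suc)
qed

lemma measurable_lebesgue_pow_component: "i < n ==> (\<lambda>x. x i) \<in> bmeas (lpow n)"
 using measurable_component_singleton[of i "{..<n}" "\<lambda>_. clborel"] by simp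

lemma measurable_ginibre_density:
 assumes "w \<in> bmeas borel"
 shows "ginibre_density w n \<in> bmeas (lpow n)"
 unfolding ginibre_density_def[abs_def]
 by (intro measurable_times borel_measurable_prod_ennreal measurable_compose[OF _ assms]
   measurable_to_ennreal borel_measurable_power measurable_cmod
   borel_measurable_diff measurable_lebesgue_pow_component) auto

lemma ginibre_density_Suc:
 "ginibre_density w (Suc n) (x(n := z)) = w z * (dist_weight z (mset (map x [0..<n])) * ginibre_density w n x)"
proof -
 let ?e = "\<lambda>a b. ennreal ((cmod (a - b))^2)"
 have 1: "(\<Prod>l<n. w ((x(n := z)) l)) = (\<Prod>l<n. w (x l))" by (intro prod.cong) auto
 have 2: "(\<Prod>j<n. \<Prod>i<j. ?e ((x(n := z)) i) ((x(n := z)) j)) = (\<Prod>j<n. \<Prod>i<j. ?e (x i) (x j))" by (intro prod.cong) auto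
 have 3: "(\<Prod>i<n. ?e ((x(n := z)) i) ((x(n := z)) n)) = (\<Prod>i<n. ?e (x i) z)" by (intro prod.cong) auto
 have "ginibre_density w (Suc n) (x(n := z)) = ((\<Prod>l<n. w (x l)) * w z) * ((\<Prod>j<n. \<Prod>i<j. ?e (x i) (x j)) * (\<Prod>i<n. ?e (x i) z))"
  unfolding ginibre_density_def prod.lessThan_Suc 1 2 3 by simp
 then show ?thesis unfolding dist_weight_map by (simp add: ginibre_density_def norm_minus_commute ac_simps)
qed

lemma measurable_mset_dist_weight:
 assumes f: "measurable_mset f"
 shows "measurable_mset (\<lambda>S. f (add_mset z S) * dist_weight z S)"
 unfolding measurable_mset_def
proof
 fix n
 have "(\<lambda>x. f (mset (map (x(n := z)) [0..<Suc n]))) \<in> bmeas (lpow n)"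
  by (rule measurable_compose[OF measurable_lebesgue_pow_upd, of "\<lambda>x. x" _ _ "\<lambda>_. z"])
   (use f in \<open>auto simp: measurable_mset_def simp del: upt_Suc\<close>)
 moreover have "(\<lambda>x. \<Prod>i<n. ennreal ((cmod (z - x i))^2)) \<in> bmeas (lpow n)"
  by (intro borel_measurable_prod_ennreal measurable_to_ennreal borel_measurable_power
    measurable_cmod borel_measurable_diff borel_measurable_const measurable_lebesgue_pow_component) auto
 ultimately show "(\<lambda>x. f (add_mset z (mset (map x [0..<n]))) * dist_weight z (mset (map x [0..<n]))) \<in> bmeas (lpow n)"
  unfolding dist_weight_map mset_map_upd by (intro measurable_times)
qed

lemma nn_integral_lebesgue_pow_Suc:
 assumes "h \<in> bmeas (lpow (Suc n))"
 shows "(\<integral>z:\<C>^(Suc n). h z) = (\<integral>y:\<C>. \<integral>x:\<C>^n. h (x(n := y)))"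
 using lborel_prod.product_nn_integral_insert_rev[of "{..<n}" n h] assms by (simp add: lebesgue_pow_Suc)

lemma eigenvalues_conj:
 assumes Q: "unitary_mat n Q" and X: "X \<in> cmat n n"
 shows "eigenvalues (Q * X * ctrans Q) = eigenvalues X"
proof -
 have Q': "Q \<in> cmat n n" "ctrans Q \<in> cmat n n" "Q * ctrans Q = 1\<^sub>m n" "ctrans Q * Q = 1\<^sub>m n"
  using Q by (auto simp: unitary_mat_def)
 have "similar_mat_wit (Q * X * ctrans Q) X Q (ctrans Q)"
  by (rule similar_mat_witI[OF Q'(3,4) refl mult_carrier_mat[OF mult_carrier_mat[OF Q'(1) X] Q'(2)] X Q'(1,2)])
 then show ?thesis unfolding eigenvalues_def by (metis char_poly_similar similar_mat_def)
qed

text \<open>Induction over the size for all m at once. After an eigenvalue z is split off,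
  integration over b leaves the scalar weight at z times the matrix weight for m + 1. The factor
  |det (zI - B)|^2 depends on the spectrum of B only and is moved into the symmetric functional. One
  constant serves all f, so that it can later be found from a single f.\<close>

theorem nn_integral_eigenvalues:
 "\<exists>C. \<forall>f. measurable_mset f \<longrightarrow>
   (\<integral>A:n,n. mat_weight \<epsilon> m n k A * f (eigenvalues A)) =
   C * (\<integral>z:\<C>^n. f (mset (map z [0..<n])) * ginibre_density (eig_weight \<epsilon> (m + n) k) n z)"
proof (induction n arbitrary: m)
 case 0
 show ?case
 proof (intro exI allI impI)
  fix f assume f: "measurable_mset f"
  have m: "(\<lambda>A. mat_weight \<epsilon> m 0 k A * f (eigenvalues A)) \<in> bmeas (lmat 0 0)"
   by (intro measurable_times measurable_mat_weight measurable_mset_eigenvalues[OF f, where n = 0] measurable_idt)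
  have "eigenvalues (0\<^sub>m 0 0) = {#}" using eigenvalue_vector[of "0\<^sub>m 0 0" 0] by simp
  moreover have "ginibre_density v 0 z = 1" for v z by (simp add: ginibre_density_def)
  ultimately show "(\<integral>A:0,0. mat_weight \<epsilon> m 0 k A * f (eigenvalues A)) =
    mat_weight \<epsilon> m 0 k (0\<^sub>m 0 0) * (\<integral>z:\<C>^0. f (mset (map z [0..<0])) * ginibre_density (eig_weight \<epsilon> (m + 0) k) 0 z)"
   unfolding nn_integral_lmat_0[OF m disjI1[OF refl]] by (simp add: PiM_empty nn_integral_count_space_finite)
 qed
next
 case (Suc n)
 let ?W = "mat_weight \<epsilon> m (Suc n) k" and ?V = "mat_weight \<epsilon> (Suc m) n k" and ?w = "eig_weight \<epsilon> (m + Suc n) k"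
 obtain C where C: "reduces n ?W ?w ?V C" using reduces_mat_weight by blast
 from Suc.IH[of "Suc m"] obtain C' where C': "\<And>f. measurable_mset f ==>
   (\<integral>A:n,n. ?V A * f (eigenvalues A)) =
   C' * (\<integral>z:\<C>^n. f (mset (map z [0..<n])) * ginibre_density ?w n z)" by auto
 show ?case
 proof (intro exI allI impI)
  fix f assume f: "measurable_mset f"
  define F where "F X = ?W X * f (eigenvalues X)" for X
  have Fm: "F \<in> bmeas (lmat (Suc n) (Suc n))"
   unfolding F_def[abs_def] by (intro measurable_times measurable_mat_weight measurable_mset_eigenvalues[OF f, where n = "Suc n"] measurable_idt)
  have Finv: "F (Q * X * ctrans Q) = F X" if Q: "unitary_mat (Suc n) Q" and X: "X \<in> cmat (Suc n) (Suc n)" for Q X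
  proof -
   have Qc: "Q \<in> cmat (Suc n) (Suc n)" using Q by (simp add: unitary_mat_def)
   have "?W (Q * X * ctrans Q) = ?W (Q * X)" "?W (Q * X) = ?W X"
    using bi_invariant_mat_weight[of "Suc n" \<epsilon> m k] Q X unitary_mat_ctrans[OF Q] mult_carrier_mat[OF Qc X]
    unfolding bi_invariant_def by blast+
   then show ?thesis by (simp add: F_def eigenvalues_conj[OF Q X])
  qed
  \<comment> \<open>The functional for the remaining block: f with z put back into the spectrum,
    times the interaction of z with the other eigenvalues.\<close>
  define g where "g z S = f (add_mset z S) * dist_weight z S" for z S
  have gm: "measurable_mset (g z)" for z unfolding g_def by (rule measurable_mset_dist_weight[OF f])
  define h where "h z = f (mset (map z [0..<Suc n])) * ginibre_density ?w (Suc n) z" for z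
  have hm: "h \<in> bmeas (lpow (Suc n))"
   unfolding h_def by (intro measurable_times measurable_ginibre_density measurable_eig_weight f[unfolded measurable_mset_def, rule_format])
  have hz: "h (x(n := z)) = ?w z * (g z (mset (map x [0..<n])) * ginibre_density ?w n x)" for x z
   unfolding h_def mset_map_upd ginibre_density_Suc g_def by (simp only: ac_simps)
  have hm2: "(\<lambda>p. h ((snd p)(n := fst p))) \<in> bmeas (lborel \<Otimes>\<^sub>M lpow n)"
   by (intro measurable_compose[OF measurable_lebesgue_pow_upd hm]) simp_all
  have gdm: "(\<lambda>x. g z (mset (map x [0..<n])) * ginibre_density ?w n x) \<in> bmeas (lpow n)" for z
   using gm[of z] by (intro measurable_times measurable_ginibre_density measurable_eig_weight) (simp add: measurable_mset_def)
  interpret sf: sigma_finite_measure "lpow n" by (rule lborel_prod.sigma_finite) simp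
  have "upper_integral n (\<lambda>T. ennreal (eig_kernel T) * F T) =
    (\<integral>z:\<C>. \<integral>b:1,n. \<integral>B:n,n. ?W (bmat z b (0\<^sub>m n 1) B) * g z (eigenvalues B))"
   unfolding upper_integral_def
  proof (rule nn_integral_cong, rule nn_integral_cong, rule nn_integral_cong)
   fix z :: complex and b B assume "b \<in> space (lmat 1 n)" "B \<in> space (lmat n n)"
   then have b: "b \<in> cmat 1 n" and B: "B \<in> cmat n n" by simp_all
   have "eigenvalues (bmat z b (0\<^sub>m n 1) B) = add_mset z (eigenvalues B)"
    unfolding eigenvalues_def char_poly_bmat_lower_zero[OF b B]
    using char_poly_nonzero[OF B] by (subst proots_mult) auto
   then show "ennreal (eig_kernel (bmat z b (0\<^sub>m n 1) B)) * F (bmat z b (0\<^sub>m n 1) B) = ?W (bmat z b (0\<^sub>m n 1) B) * g z (eigenvalues B)"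
    unfolding eig_kernel_bmat[OF b zero_carrier_mat B] char_poly_dist_weight[OF B] F_def g_def by (simp only: ac_simps)
  qed
  also have "... = (\<integral>z:\<C>. (C * C') * (\<integral>x:\<C>^n. h (x(n := z))))"
  proof (rule nn_integral_cong_nonzero)
   fix z :: complex assume z: "z ~= 0"
   have gB: "(\<lambda>B. g z (eigenvalues B)) \<in> bmeas (lmat n n)"
    by (intro measurable_mset_eigenvalues[OF gm, where n = n] measurable_idt)
   have "(\<integral>b:1,n. \<integral>B:n,n. ?W (bmat z b (0\<^sub>m n 1) B) * g z (eigenvalues B))
    = (\<integral>B:n,n. \<integral>b:1,n. ?W (bmat z b (0\<^sub>m n 1) B) * g z (eigenvalues B))"
   proof (rule nn_integral_lmat_swap)
    show "(\<lambda>(b, B). ?W (bmat z b (0\<^sub>m n 1) B) * g z (eigenvalues B)) \<in> bmeas (lmat 1 n \<Otimes>\<^sub>M lmat n n)"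
    unfolding case_prod_unfold
    by (intro measurable_times measurable_compose[OF _ measurable_mat_weight] measurable_compose[OF _ gB]
    measurable_bmat borel_measurable_const meas_zero measurable_fst measurable_snd)
   qed
   also have "... = (\<integral>B:n,n. (C * ?w z) * (?V B * g z (eigenvalues B)))"
   proof (rule nn_integral_cong_det)
    fix B :: "complex mat" assume B: "B \<in> cmat n n" and d: "det B ~= 0"
    have "(\<integral>b:1,n. ?W (bmat z b (0\<^sub>m n 1) B) * g z (eigenvalues B))
    = (\<integral>b:1,n. ?W (bmat z b (0\<^sub>m n 1) B)) * g z (eigenvalues B)"
    by (intro nn_integral_multc measurable_compose[OF _ measurable_mat_weight] measurable_bmat borel_measurable_const
    meas_zero meas_const B measurable_idt)
    also have "(\<integral>b:1,n. ?W (bmat z b (0\<^sub>m n 1) B)) = C * (?w z * ?V B)"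
    using C z B d unfolding reduces_def by blast
    finally show "(\<integral>b:1,n. ?W (bmat z b (0\<^sub>m n 1) B) * g z (eigenvalues B)) = (C * ?w z) * (?V B * g z (eigenvalues B))"
    by (simp only: ac_simps)
   qed
   also have "... = (C * ?w z) * (\<integral>B:n,n. ?V B * g z (eigenvalues B))"
    by (intro nn_integral_cmult measurable_times measurable_mat_weight gB)
   also have "... = (C * C') * (?w z * (\<integral>x:\<C>^n. g z (mset (map x [0..<n])) * ginibre_density ?w n x))"
    unfolding C'[OF gm] by (simp only: ac_simps)
   also have "?w z * (\<integral>x:\<C>^n. g z (mset (map x [0..<n])) * ginibre_density ?w n x) = (\<integral>x:\<C>^n. h (x(n := z)))"
    unfolding hz by (rule nn_integral_cmult[OF gdm, symmetric])
   finally show "(\<integral>b:1,n. \<integral>B:n,n. ?W (bmat z b (0\<^sub>m n 1) B) * g z (eigenvalues B))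
    = (C * C') * (\<integral>x:\<C>^n. h (x(n := z)))" .
  qed
  also have "... = (C * C') * (\<integral>z:\<C>^(Suc n). h z)"
   unfolding nn_integral_lebesgue_pow_Suc[OF hm]
   using hm2 by (intro nn_integral_cmult sf.borel_measurable_nn_integral) (simp add: case_prod_unfold)
  finally have U: "upper_integral n (\<lambda>T. ennreal (eig_kernel T) * F T) = (C * C') * (\<integral>z:\<C>^(Suc n). h z)" .
  \<comment> \<open>Undoes the counting of each matrix once for every eigenvalue.\<close>
  have "ennreal (1 / real (Suc n)) * of_nat (Suc n) = 1"
   unfolding ennreal_of_nat_eq_real_of_nat by (subst ennreal_mult[symmetric]) auto
  then have "(\<integral>A:(Suc n),(Suc n). F A) = ennreal (1 / real (Suc n)) * (of_nat (Suc n) * (\<integral>A:(Suc n),(Suc n). F A))"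
   by (metis mult.assoc mult_1)
  also have "of_nat (Suc n) * (\<integral>A:(Suc n),(Suc n). F A) = kappa n * ((C * C') * (\<integral>z:\<C>^(Suc n). h z))"
   unfolding U[symmetric] by (rule nn_integral_conj_invariant[OF Fm Finv])
  also have "ennreal (1 / real (Suc n)) * (kappa n * ((C * C') * (\<integral>z:\<C>^(Suc n). h z)))
    = (ennreal (1 / real (Suc n)) * kappa n * C * C') * (\<integral>z:\<C>^(Suc n). h z)"
   by (simp only: ac_simps)
  finally show "(\<integral>A:(Suc n),(Suc n). ?W A * f (eigenvalues A)) =
    (ennreal (1 / real (Suc n)) * kappa n * C * C') *
    (\<integral>z:\<C>^(Suc n). f (mset (map z [0..<Suc n])) * ginibre_density ?w (Suc n) z)"
   unfolding F_def h_def .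
 qed
qed

section \<open>Random orderings and factorial moments\<close>

definition perm_vec :: "nat => (nat => nat) => (nat => complex) => nat => complex" where
 "perm_vec n \<sigma> z = (\<lambda>i\<in>{..<n}. z (\<sigma> i))"

lemma measurable_perm_vec:
 assumes \<sigma>: "\<sigma> permutes {..<n}"
 shows "perm_vec n \<sigma> \<in> lpow n \<rightarrow>\<^sub>M lpow n"
 unfolding perm_vec_def[abs_def]
proof (rule measurable_restrict)
 fix i assume "i \<in> {..<n}"
 then have "\<sigma> i \<in> {..<n}" using permutes_in_image[OF \<sigma>] by blast
 then show "(\<lambda>x. x (\<sigma> i)) \<in> lpow n \<rightarrow>\<^sub>M lborel" by (rule measurable_component_singleton)
qed

lemma distr_perm_vec:
 assumes \<sigma>: "\<sigma> permutes {..<n}"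
 shows "distr (lpow n) (lpow n) (perm_vec n \<sigma>) = lpow n"
proof (rule lborel_prod.PiM_eqI)
 fix A :: "nat => complex set" assume A: "\<And>i. i \<in> {..<n} ==> A i \<in> sets lborel"
 note \<sigma>' = permutes_inv[OF \<sigma>]
 have pinv: "inv_into UNIV \<sigma> i \<in> {..<n} \<longleftrightarrow> i \<in> {..<n}" "\<sigma> i \<in> {..<n} \<longleftrightarrow> i \<in> {..<n}" for i
  using permutes_in_image[OF \<sigma>'] permutes_in_image[OF \<sigma>] by blast+
 have "perm_vec n \<sigma> -` (\<Pi>\<^sub>E i\<in>{..<n}. A i) \<inter> space (lpow n) = (\<Pi>\<^sub>E i\<in>{..<n}. A (inv_into UNIV \<sigma> i))"
 proof (intro equalityI subsetI)
  fix z assume z: "z \<in> perm_vec n \<sigma> -` (\<Pi>\<^sub>E i\<in>{..<n}. A i) \<inter> space (lpow n)"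
  show "z \<in> (\<Pi>\<^sub>E i\<in>{..<n}. A (inv_into UNIV \<sigma> i))"
  proof (rule PiE_I)
   fix i assume "i \<in> {..<n}"
   then have "inv_into UNIV \<sigma> i \<in> {..<n}" using pinv by blast
   then have "perm_vec n \<sigma> z (inv_into UNIV \<sigma> i) \<in> A (inv_into UNIV \<sigma> i)" using z by auto
   then show "z i \<in> A (inv_into UNIV \<sigma> i)"
    using \<open>inv_into UNIV \<sigma> i \<in> {..<n}\<close> permutes_inverses(1)[OF \<sigma>] by (simp add: perm_vec_def)
  qed (use z in \<open>auto simp: space_PiM PiE_def extensional_def\<close>)
 next
  fix z assume z: "z \<in> (\<Pi>\<^sub>E i\<in>{..<n}. A (inv_into UNIV \<sigma> i))"
  have "z (\<sigma> i) \<in> A i" if "i \<in> {..<n}" for i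
   using PiE_mem[OF z, of "\<sigma> i"] pinv(2)[of i] that permutes_inverses(2)[OF \<sigma>] by simp
  moreover have "z \<in> space (lpow n)" using z by (auto simp: space_PiM PiE_def)
  ultimately show "z \<in> perm_vec n \<sigma> -` (\<Pi>\<^sub>E i\<in>{..<n}. A i) \<inter> space (lpow n)"
   by (auto simp: perm_vec_def)
 qed
 moreover have A': "A (inv_into UNIV \<sigma> i) \<in> sets lborel" if "i \<in> {..<n}" for i using A pinv(1) that by blast
 ultimately have "emeasure (distr (lpow n) (lpow n) (perm_vec n \<sigma>)) (\<Pi>\<^sub>E i\<in>{..<n}. A i)
   = emeasure (lpow n) (\<Pi>\<^sub>E i\<in>{..<n}. A (inv_into UNIV \<sigma> i))"
  using A by (subst emeasure_distr[OF measurable_perm_vec[OF \<sigma>]]) (auto intro!: sets_PiM_I_finite)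
 also have "... = (\<Prod>i\<in>{..<n}. emeasure lborel (A (inv_into UNIV \<sigma> i)))"
  using A' by (intro lborel_prod.emeasure_PiM) auto
 also have "... = (\<Prod>i\<in>{..<n}. emeasure lborel (A i))"
  by (rule prod.permute[OF \<sigma>', unfolded comp_def, symmetric])
 finally show "emeasure (distr (lpow n) (lpow n) (perm_vec n \<sigma>)) (\<Pi>\<^sub>E i\<in>{..<n}. A i)
  = (\<Prod>i\<in>{..<n}. emeasure lborel (A i))" .
qed simp_all

lemma nn_integral_perm_vec:
 assumes \<sigma>: "\<sigma> permutes {..<n}" and g: "g \<in> bmeas (lpow n)"
 shows "(\<integral>z:\<C>^n. g (perm_vec n \<sigma> z)) = (\<integral>z:\<C>^n. g z)"
proof -
 have "(\<integral>z:\<C>^n. g z) = (\<integral>\<^sup>+z. g z \<partial>distr (lpow n) (lpow n) (perm_vec n \<sigma>))"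
  by (simp only: distr_perm_vec[OF \<sigma>])
 also have "... = (\<integral>z:\<C>^n. g (perm_vec n \<sigma> z))"
  by (subst nn_integral_distr[OF measurable_perm_vec[OF \<sigma>]]) (simp_all add: g)
 finally show ?thesis by simp
qed

text \<open>Double counting of pairs of a list and a permutation of positions. A fixed permutation
  permutes the lists among themselves; for a fixed list, which is a rearrangement of zs, the sum
  over permutations is the one for zs with a shifted index. Repeated points are covered.\<close>

lemma permutations_double_count:
 fixes h :: "'a list => nat"
 defines "P n \<equiv> {\<sigma>. \<sigma> permutes {..<n :: nat}}"
 shows "(\<Sum>xs\<in>permutations_of_multiset (mset zs). h xs) * fact (length zs) =
  card (permutations_of_multiset (mset zs)) * (\<Sum>\<sigma>\<in>P (length zs). h (permute_list \<sigma> zs))"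
proof -
 let ?L = "permutations_of_multiset (mset zs)" and ?n = "length zs"
 have len: "length xs = ?n" if "xs \<in> ?L" for xs
  using that by (metis permutations_of_multisetD size_mset)
 have 1: "(\<Sum>xs\<in>?L. h (permute_list \<sigma> xs)) = (\<Sum>xs\<in>?L. h xs)" if "\<sigma> \<in> P ?n" for \<sigma>
 proof -
  have \<sigma>: "\<sigma> permutes {..<?n}" using that by (simp add: P_def)
  have L: "permute_list \<tau> xs \<in> ?L" if "xs \<in> ?L" "\<tau> permutes {..<?n}" for \<tau> xs
   using that len[OF that(1)] by (simp add: permutations_of_multiset_def)
  have comp: "permute_list \<tau> (permute_list \<rho> xs) = xs" if "xs \<in> ?L" "\<tau> permutes {..<?n}" "\<rho> \<circ> \<tau> = id" for \<tau> \<rho> xs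
   using permute_list_compose[of \<tau> xs \<rho>] that len[OF that(1)] by simp
  show ?thesis
   by (rule sum.reindex_bij_witness[where i = "permute_list (inv_into UNIV \<sigma>)" and j = "permute_list \<sigma>"])
    (use \<sigma> permutes_inv[OF \<sigma>] permutes_inv_o[OF \<sigma>] in \<open>auto intro!: L comp\<close>)
 qed
 have 2: "(\<Sum>\<sigma>\<in>P ?n. h (permute_list \<sigma> xs)) = (\<Sum>\<sigma>\<in>P ?n. h (permute_list \<sigma> zs))" if "xs \<in> ?L" for xs
 proof -
  have "mset xs = mset zs" using that by (rule permutations_of_multisetD)
  then obtain \<tau> where \<tau>: "\<tau> permutes {..<?n}" "permute_list \<tau> zs = xs" by (rule mset_eq_permutation)
  have "(\<Sum>\<sigma>\<in>P ?n. h (permute_list \<sigma> xs)) = (\<Sum>\<sigma>\<in>P ?n. h (permute_list (\<tau> \<circ> \<sigma>) zs))"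
   by (rule sum.cong) (auto simp: P_def permute_list_compose \<tau>(2))
  also have "... = (\<Sum>\<sigma>\<in>P ?n. h (permute_list \<sigma> zs))"
   by (rule sum.reindex_bij_witness[where i = "\<lambda>\<sigma>. inv_into UNIV \<tau> \<circ> \<sigma>" and j = "\<lambda>\<sigma>. \<tau> \<circ> \<sigma>"])
    (use \<tau>(1) permutes_inv[OF \<tau>(1)] permutes_inv_o[OF \<tau>(1)] in \<open>auto simp: P_def o_assoc intro: permutes_compose\<close>)
  finally show ?thesis .
 qed
 have "(\<Sum>xs\<in>?L. h xs) * fact ?n = (\<Sum>\<sigma>\<in>P ?n. \<Sum>xs\<in>?L. h (permute_list \<sigma> xs))"
  using 1 by (simp add: P_def card_permutations[OF refl])
 also have "... = (\<Sum>xs\<in>?L. \<Sum>\<sigma>\<in>P ?n. h (permute_list \<sigma> xs))" by (rule sum.swap)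
 also have "... = card ?L * (\<Sum>\<sigma>\<in>P ?n. h (permute_list \<sigma> zs))" using 2 by simp
 finally show ?thesis .
qed

text \<open>The uniform choice among the different lists becomes an average over all n!
  rearrangements of one enumeration, which can be integrated against a symmetric density term by
  term.\<close>

lemma emeasure_uniform_ordering:
 "emeasure (uniform_ordering (mset (map z [0..<n]))) B =
   ennreal (1 / fact n) * (\<Sum>\<sigma> | \<sigma> permutes {..<n}. indicator B (perm_vec n \<sigma> z))"
proof -
 let ?zs = "map z [0..<n]"
 let ?L = "permutations_of_multiset (mset ?zs)"
 let ?v = "\<lambda>xs. \<lambda>i\<in>{..<n}. xs ! i :: complex"
 define h :: "complex list => nat" where "h xs = (if ?v xs \<in> B then 1 else 0)" for xs
 have fin: "finite ?L" "?L ~= {}" by auto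
 have v: "?v (permute_list \<sigma> ?zs) = perm_vec n \<sigma> z" if "\<sigma> permutes {..<n}" for \<sigma>
 proof
  fix i show "?v (permute_list \<sigma> ?zs) i = perm_vec n \<sigma> z i"
   using permutes_in_image[OF that, of i] by (auto simp: perm_vec_def permute_list_def)
 qed
 have "(\<Sum>xs\<in>?L. h xs) = card (?L \<inter> ?v -` B)"
  using fin(1) by (simp add: h_def sum.If_cases Int_def vimage_def)
 moreover have "(\<Sum>\<sigma> | \<sigma> permutes {..<n}. h (permute_list \<sigma> ?zs)) = (\<Sum>\<sigma> | \<sigma> permutes {..<n}. indicator B (perm_vec n \<sigma> z))"
  by (rule sum.cong) (auto simp: h_def v indicator_def)
 ultimately have eq: "card (?L \<inter> ?v -` B) * fact n = card ?L * (\<Sum>\<sigma> | \<sigma> permutes {..<n}. indicator B (perm_vec n \<sigma> z))"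
  using permutations_double_count[of h ?zs] by simp
 define I :: nat where "I = (\<Sum>\<sigma> | \<sigma> permutes {..<n}. indicator B (perm_vec n \<sigma> z))"
 have "real (card (?L \<inter> ?v -` B)) * fact n = real (card ?L) * real I"
  using arg_cong[OF eq, of real] unfolding I_def[symmetric] by simp
 moreover have "real (card ?L) ~= 0" using fin by simp
 ultimately have r: "real (card (?L \<inter> ?v -` B)) / real (card ?L) = 1 / fact n * real I"
  by (simp add: field_simps)
 have "emeasure (uniform_ordering (mset ?zs)) B = ennreal (measure (pmf_of_set ?L) (?v -` B))"
  by (simp add: uniform_ordering_def measure_pmf.emeasure_eq_measure measure_map_pmf del: mset_map)
 also have "measure (pmf_of_set ?L) (?v -` B) = 1 / fact n * real I"
  using measure_pmf_of_set[OF fin(2,1)] r by simp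
 also have "ennreal (1 / fact n * real I) = ennreal (1 / fact n) * of_nat I"
  unfolding ennreal_of_nat_eq_real_of_nat by (rule ennreal_mult) simp_all
 also have "(of_nat I :: ennreal) = (\<Sum>\<sigma> | \<sigma> permutes {..<n}. indicator B (perm_vec n \<sigma> z))"
  unfolding I_def of_nat_sum by (rule sum.cong) (auto simp: indicator_def)
 finally show ?thesis .
qed

section \<open>Tuples of distinct points\<close>

definition inj_tuples :: "nat => nat => (nat => nat) set" where
 "inj_tuples r n = {t \<in> {..<r} \<rightarrow>\<^sub>E {..<n}. inj_on t {..<r}}"

lemma finite_inj_tuples [simp]: "finite (inj_tuples r n)"
 unfolding inj_tuples_def by (rule finite_subset[OF _ finite_PiE[of "{..<r}" "\<lambda>_. {..<n}"]]) auto

text \<open>The enumeration chosen in \<open>tuple_count\<close> is a rearrangement of xs.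
  Relabelling the positions by the permutation is a bijection between the injective tuples, so any
  enumeration gives the same count.\<close>

lemma tuple_count_mset:
 "tuple_count r (mset xs) B = card {t \<in> inj_tuples r (length xs). (\<lambda>i\<in>{..<r}. xs ! t i) \<in> B}"
proof -
 define ys where "ys = (SOME ys. mset ys = mset xs)"
 have "mset ys = mset xs" unfolding ys_def by (rule someI[of _ xs]) simp
 then obtain p where p: "p permutes {..<length xs}" "permute_list p xs = ys" by (rule mset_eq_permutation)
 note p' = permutes_inv[OF p(1)]
 have pin: "p i < length xs \<longleftrightarrow> i < length xs" "inv_into UNIV p i < length xs \<longleftrightarrow> i < length xs" for i
  using permutes_in_image[OF p(1), of i] permutes_in_image[OF p', of i] by auto
 have pp: "p (inv_into UNIV p i) = i" "inv_into UNIV p (p i) = i" for i using permutes_inverses[OF p(1)] by auto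
 let ?n = "length xs"
 have "bij_betw (\<lambda>t. \<lambda>i\<in>{..<r}. p (t i)) {t \<in> inj_tuples r ?n. (\<lambda>i\<in>{..<r}. ys ! t i) \<in> B} {t \<in> inj_tuples r ?n. (\<lambda>i\<in>{..<r}. xs ! t i) \<in> B}"
 proof (rule bij_betw_byWitness[where f' = "\<lambda>t. \<lambda>i\<in>{..<r}. inv_into UNIV p (t i)"])
  have ysi: "(\<lambda>i\<in>{..<r}. ys ! t i) = (\<lambda>i\<in>{..<r}. xs ! p (t i))" if "t \<in> inj_tuples r ?n" for t
   using that p(2) by (auto simp: inj_tuples_def permute_list_def fun_eq_iff PiE_iff)
  show "(\<lambda>t. \<lambda>i\<in>{..<r}. p (t i)) ` {t \<in> inj_tuples r ?n. (\<lambda>i\<in>{..<r}. ys ! t i) \<in> B} \<subseteq> {t \<in> inj_tuples r ?n. (\<lambda>i\<in>{..<r}. xs ! t i) \<in> B}"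
  proof safe
   fix t assume t: "t \<in> inj_tuples r ?n" and B: "(\<lambda>i\<in>{..<r}. ys ! t i) \<in> B"
   have "inj_on (\<lambda>i\<in>{..<r}. p (t i)) {..<r}"
    using t by (auto simp: inj_tuples_def inj_on_def dest: arg_cong[of "p _" "p _" "inv_into UNIV p"] simp: pp)
   then show "(\<lambda>i\<in>{..<r}. p (t i)) \<in> inj_tuples r ?n" using t pin by (auto simp: inj_tuples_def PiE_iff)
   have "(\<lambda>i\<in>{..<r}. xs ! (\<lambda>i\<in>{..<r}. p (t i)) i) = (\<lambda>i\<in>{..<r}. xs ! p (t i))" by (auto simp: fun_eq_iff)
   then show "(\<lambda>i\<in>{..<r}. xs ! (\<lambda>i\<in>{..<r}. p (t i)) i) \<in> B" using B ysi[OF t] by metis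
  qed
  show "(\<lambda>t. \<lambda>i\<in>{..<r}. inv_into UNIV p (t i)) ` {t \<in> inj_tuples r ?n. (\<lambda>i\<in>{..<r}. xs ! t i) \<in> B} \<subseteq> {t \<in> inj_tuples r ?n. (\<lambda>i\<in>{..<r}. ys ! t i) \<in> B}"
  proof safe
   fix t assume t: "t \<in> inj_tuples r ?n" and B: "(\<lambda>i\<in>{..<r}. xs ! t i) \<in> B"
   have "inj_on (\<lambda>i\<in>{..<r}. inv_into UNIV p (t i)) {..<r}"
    using t by (auto simp: inj_tuples_def inj_on_def dest: arg_cong[of "inv_into UNIV p _" "inv_into UNIV p _" p] simp: pp)
   then show t': "(\<lambda>i\<in>{..<r}. inv_into UNIV p (t i)) \<in> inj_tuples r ?n" using t pin by (auto simp: inj_tuples_def PiE_iff)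
   have "(\<lambda>i\<in>{..<r}. xs ! p ((\<lambda>i\<in>{..<r}. inv_into UNIV p (t i)) i)) = (\<lambda>i\<in>{..<r}. xs ! t i)" by (auto simp: fun_eq_iff pp)
   then show "(\<lambda>i\<in>{..<r}. ys ! (\<lambda>i\<in>{..<r}. inv_into UNIV p (t i)) i) \<in> B" using B ysi[OF t'] by metis
  qed
 qed (auto simp: pp inj_tuples_def PiE_iff extensional_def fun_eq_iff)
 from bij_betw_same_card[OF this] show ?thesis
  by (simp add: tuple_count_def Let_def ys_def[symmetric] inj_tuples_def conj_ac)
qed

lemma of_nat_tuple_count:
 "of_nat (tuple_count r (mset (map z [0..<n])) B) = (\<Sum>t\<in>inj_tuples r n. indicator B (\<lambda>i\<in>{..<r}. z (t i)) :: ennreal)"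
proof -
 have "(\<lambda>i\<in>{..<r}. map z [0..<n] ! t i) = (\<lambda>i\<in>{..<r}. z (t i))" if "t \<in> inj_tuples r n" for t
  using that by (auto simp: inj_tuples_def PiE_iff fun_eq_iff)
 then have "{t \<in> inj_tuples r n. (\<lambda>i\<in>{..<r}. map z [0..<n] ! t i) \<in> B} = {t \<in> inj_tuples r n. (\<lambda>i\<in>{..<r}. z (t i)) \<in> B}"
  by auto
 then show ?thesis
  unfolding tuple_count_mset length_map length_upt by (simp add: indicator_def sum.If_cases Int_def)
qed

lemma card_inj_tuples:
 assumes "r \<le> n"
 shows "card (inj_tuples r n) * fact (n - r) = fact n"
proof -
 let ?L = "{xs. length xs = r \<and> distinct xs \<and> set xs \<subseteq> {..<n}}"
 have "bij_betw (\<lambda>t. map t [0..<r]) (inj_tuples r n) ?L"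
 proof (rule bij_betw_byWitness[where f' = "\<lambda>xs. \<lambda>i\<in>{..<r}. xs ! i"])
  show "\<forall>t\<in>inj_tuples r n. (\<lambda>i\<in>{..<r}. map t [0..<r] ! i) = t"
   by (auto simp: inj_tuples_def fun_eq_iff PiE_iff extensional_def)
  show "\<forall>xs\<in>?L. map (\<lambda>i\<in>{..<r}. xs ! i) [0..<r] = xs" by (auto intro!: nth_equalityI)
  show "(\<lambda>t. map t [0..<r]) ` inj_tuples r n \<subseteq> ?L"
   by (auto simp: inj_tuples_def distinct_map PiE_iff lessThan_atLeast0)
  show "(\<lambda>xs. \<lambda>i\<in>{..<r}. xs ! i) ` ?L \<subseteq> inj_tuples r n"
   by (auto simp: inj_tuples_def inj_on_def nth_eq_iff_index_eq subset_iff set_conv_nth split: if_splits)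
 qed
 then have "card (inj_tuples r n) = card ?L" by (rule bij_betw_same_card)
 also have "... = \<Prod>{n - r + 1..n}" using assms by (subst card_lists_distinct_length_eq) simp_all
 also have "... = fact n div fact (n - r)" by (rule fact_div_fact[symmetric]) simp
 finally show ?thesis by (simp add: dvd_div_mult_self fact_dvd)
qed

lemma inj_tuples_empty: "n < r ==> inj_tuples r n = {}"
proof (rule equals0I)
 fix t assume "n < r" "t \<in> inj_tuples r n"
 then have "inj_on t {..<r}" "t ` {..<r} \<subseteq> {..<n}" by (auto simp: inj_tuples_def)
 from card_inj_on_le[OF this] show False using \<open>n < r\<close> by simp
qed

text \<open>With a symmetric joint density, the coordinates selected by a tuple can then be moved to
  the first r places.\<close>

lemma inj_tuple_extend:
 assumes "t \<in> inj_tuples r n"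
 obtains \<sigma> where "\<sigma> permutes {..<n}" "\<And>i. i < r ==> \<sigma> i = t i"
proof -
 have t: "inj_on t {..<r}" "t ` {..<r} \<subseteq> {..<n}" using assms by (auto simp: inj_tuples_def)
 have rn: "r \<le> n" using card_inj_on_le[OF t] by simp
 have "card ({..<n} - {..<r}) = card ({..<n} - t ` {..<r})"
  using t rn by (simp add: card_Diff_subset card_image)
 then obtain h where h: "bij_betw h ({..<n} - {..<r}) ({..<n} - t ` {..<r})"
  using finite_same_card_bij[of "{..<n} - {..<r}" "{..<n} - t ` {..<r}"] by auto
 define \<sigma> where "\<sigma> i = (if i < r then t i else if i < n then h i else i)" for i
 have "bij_betw \<sigma> {..<r} (t ` {..<r})"
  using inj_on_imp_bij_betw[OF t(1)] by (rule bij_betw_cong[THEN iffD1, rotated]) (simp add: \<sigma>_def)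
 moreover have "bij_betw \<sigma> ({..<n} - {..<r}) ({..<n} - t ` {..<r})"
  using h by (rule bij_betw_cong[THEN iffD1, rotated]) (simp add: \<sigma>_def)
 ultimately have "bij_betw \<sigma> ({..<r} \<union> ({..<n} - {..<r})) (t ` {..<r} \<union> ({..<n} - t ` {..<r}))"
  by (rule bij_betw_combine) auto
 moreover have "{..<r} \<union> ({..<n} - {..<r}) = {..<n}" "t ` {..<r} \<union> ({..<n} - t ` {..<r}) = {..<n}"
  using rn t by auto
 ultimately have "\<sigma> permutes {..<n}" by (intro bij_imp_permutes) (use rn in \<open>auto simp: \<sigma>_def\<close>)
 then show ?thesis using that by (simp add: \<sigma>_def)
qed

section \<open>The law of the random matrix\<close>

lemma signed_mat_minv:
 assumes X: "X \<in> cmat n n"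
 shows "signed_mat e X = (if e = 1 then X else minv X)"
proof (cases "mat_inverse X")
 case None
 have "det X = 0"
  using mat_inverse(1)[OF X None, of "()"] det_non_zero_imp_unit[OF X, of "()"] by blast
 then show ?thesis using None minv_singular[OF X] X by (simp add: signed_mat_def)
next
 case (Some Y)
 then have "X * Y = 1\<^sub>m n" "Y \<in> cmat n n" using mat_inverse(2)[OF X Some] by auto
 then show ?thesis using Some minv_unique(1)[OF X] by (simp add: signed_mat_def)
qed

text \<open>The product with an arbitrary right end R in place of the identity. The induction over
  the factors moves the last one into R.\<close>

definition signed_mult :: "(nat => int) => nat => (nat => complex mat) => complex mat => complex mat" where
 "signed_mult \<epsilon> k X R = foldr (\<lambda>j Y. signed_mat (\<epsilon> j) (X j) * Y) [0..<k] R"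

lemma signed_mult_Suc: "signed_mult \<epsilon> (Suc k) X R = signed_mult \<epsilon> k X (signed_mat (\<epsilon> k) (X k) * R)"
 by (simp add: signed_mult_def)

lemma signed_mult_cong: "(\<And>j. j < k ==> X j = Y j) ==> signed_mult \<epsilon> k X R = signed_mult \<epsilon> k Y R"
 unfolding signed_mult_def by (intro foldr_cong) auto

lemma measurable_signed_mat:
 assumes "f \<in> N \<rightarrow>\<^sub>M lmat n n"
 shows "(\<lambda>w. signed_mat e (f w)) \<in> N \<rightarrow>\<^sub>M lmat n n"
proof (rule measurable_eqI)
 show "signed_mat e (f w) = (if e = 1 then f w else minv (f w))" if "w \<in> space N" for w
  by (rule signed_mat_minv[OF measurable_carrier[OF assms that]])
 show "(\<lambda>w. if e = 1 then f w else minv (f w)) \<in> N \<rightarrow>\<^sub>M lmat n n"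
  using assms measurable_minv[OF assms] by (cases "e = 1") simp_all
qed

lemma measurable_signed_mult:
 assumes "\<And>j. j < k ==> (\<lambda>w. X w j) \<in> N \<rightarrow>\<^sub>M lmat n n" "R \<in> N \<rightarrow>\<^sub>M lmat n n"
 shows "(\<lambda>w. signed_mult \<epsilon> k (X w) (R w)) \<in> N \<rightarrow>\<^sub>M lmat n n"
 using assms
proof (induction k arbitrary: R)
 case 0
 then show ?case by (simp add: signed_mult_def)
next
 case (Suc k)
 show ?case unfolding signed_mult_Suc
  using Suc.prems by (intro Suc.IH meas_mult[where b = n] measurable_signed_mat) auto
qed

definition gauss_mat :: "nat => complex mat measure" where
 "gauss_mat n = density (lmat n n) (\<lambda>X. ennreal (exp (- sqnorm X)) * ennreal ((1 / pi) ^ (n * n)))"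

lemma sets_gauss_mat [simp, measurable_cong]: "sets (gauss_mat n) = sets (lmat n n)"
 by (simp add: gauss_mat_def)

lemma space_gauss_mat [simp]: "space (gauss_mat n) = cmat n n"
 by (simp add: gauss_mat_def)

lemma measurable_ennreal_exp_sqnorm: "(\<lambda>X. ennreal (exp (- sqnorm X))) \<in> bmeas (lmat n n)"
 by (intro measurable_to_ennreal measurable_exp_sqnorm[where a = n and b = n] measurable_idt)

lemma nn_integral_gauss_mat:
 assumes F: "F \<in> bmeas (lmat n n)"
 shows "(\<integral>\<^sup>+X. F X \<partial>gauss_mat n) = ennreal ((1 / pi) ^ (n * n)) * (\<integral>X:n,n. ennreal (exp (- sqnorm X)) * F X)"
proof -
 have "(\<integral>\<^sup>+X. F X \<partial>gauss_mat n) = (\<integral>X:n,n. ennreal ((1 / pi) ^ (n * n)) * (ennreal (exp (- sqnorm X)) * F X))"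
  unfolding gauss_mat_def
  by (subst nn_integral_density) (auto intro!: F measurable_times measurable_ennreal_exp_sqnorm nn_integral_cong simp: ac_simps)
 also have "... = ennreal ((1 / pi) ^ (n * n)) * (\<integral>X:n,n. ennreal (exp (- sqnorm X)) * F X)"
  by (intro nn_integral_cmult measurable_times measurable_ennreal_exp_sqnorm F)
 finally show ?thesis .
qed

text \<open>The density of a single factor with its sign. For an inverse the Jacobian |det X|^(-4n)
  gives \<open>gauss_weight\<close> with m = 0: no eigenvalue has been split off.\<close>

lemma nn_integral_signed_gauss_mat:
 assumes H: "H \<in> bmeas (lmat n n)" and e: "e \<in> {1, - 1}"
 shows "(\<integral>\<^sup>+X. H (signed_mat e X) \<partial>gauss_mat n) = ennreal ((1 / pi) ^ (n * n)) * (\<integral>X:n,n. gauss_weight e 0 n X * H X)"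
proof -
 have Hm: "(\<lambda>X. H (signed_mat e X)) \<in> bmeas (lmat n n)"
  by (intro measurable_compose[OF _ H] measurable_signed_mat measurable_idt)
 have "(\<integral>X:n,n. ennreal (exp (- sqnorm X)) * H (signed_mat e X)) = (\<integral>X:n,n. gauss_weight e 0 n X * H X)"
 proof (cases "e = 1")
  case True
  then show ?thesis by (simp add: gauss_weight_def signed_mat_def)
 next
  case False
  have m: "(\<lambda>X. ennreal (exp (- sqnorm X)) * H (signed_mat e X)) \<in> bmeas (lmat n n)"
   by (intro measurable_times measurable_ennreal_exp_sqnorm Hm)
  show ?thesis unfolding nn_integral_minv[OF m]
  proof (rule nn_integral_cong_det)
   fix X :: "complex mat" assume X: "X \<in> cmat n n" and d: "det X ~= 0"
   have "signed_mat e (minv X) = X" using signed_mat_minv[OF minv_carrier[OF X]] False minv_minv[OF X d] by simp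
   then show "ennreal (inverse (cmod (det X) ^ (4 * n))) * (ennreal (exp (- sqnorm (minv X))) * H (signed_mat e (minv X))) = gauss_weight e 0 n X * H X"
    using False by (simp add: gauss_weight_def ennreal_mult ac_simps)
  qed
 qed
 then show ?thesis unfolding nn_integral_gauss_mat[OF Hm] by simp
qed

text \<open>For fixed Y the product A Y becomes the new inner variable; the Jacobian |det Y|^(-2n)
  is the Haar weight of Y in the convolution.\<close>

lemma nn_integral_mat_conv:
 assumes W: "W \<in> bmeas (lmat n n)" and V: "V \<in> bmeas (lmat n n)"
  and G: "G \<in> bmeas (lmat n n)" and R: "R \<in> cmat n n"
 shows "(\<integral>Y:n,n. V Y * (\<integral>A:n,n. W A * G (A * (Y * R)))) =
  (\<integral>A:n,n. mat_conv n W V A * G (A * R))"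
proof -
 note mm = measurable_times measurable_haar_weight measurable_compose[OF _ W] measurable_compose[OF _ V] measurable_compose[OF _ G]
  meas_mult[where b = n] measurable_minv[where n = n] meas_const[OF R] measurable_fst measurable_snd
 have "(\<integral>Y:n,n. V Y * (\<integral>A:n,n. W A * G (A * (Y * R))))
  = (\<integral>Y:n,n. \<integral>A:n,n. (haar_weight n Y * (W (A * minv Y) * V Y)) * G (A * R))"
 proof (rule nn_integral_cong_det)
  fix Y :: "complex mat" assume Y: "Y \<in> cmat n n" and d: "det Y ~= 0"
  have Fm: "(\<lambda>A. W (A * minv Y) * G (A * R)) \<in> bmeas (lmat n n)"
   by (intro mm meas_const minv_carrier Y measurable_idt)
  have "(\<integral>A:n,n. W A * G (A * (Y * R))) = (\<integral>A:n,n. W (A * Y * minv Y) * G (A * Y * R))"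
  proof (rule nn_integral_cong_mat)
   fix A :: "complex mat" assume A: "A \<in> cmat n n"
   have "A * Y * minv Y = A"
    unfolding assoc_mult_mat[OF A Y minv_carrier[OF Y]] minv_mult(1)[OF Y d] by (rule right_mult_one_mat[OF A])
   then show "W A * G (A * (Y * R)) = W (A * Y * minv Y) * G (A * Y * R)"
    by (simp only: assoc_mult_mat[OF A Y R])
  qed
  also have "... = (ennreal (cmod (det Y) ^ (2 * n)) * haar_weight n Y) * (\<integral>A:n,n. W (A * Y * minv Y) * G (A * Y * R))"
   unfolding haar_weight_cancel[OF d] by simp
  also have "... = haar_weight n Y * (\<integral>A:n,n. W (A * minv Y) * G (A * R))"
   unfolding nn_integral_right_mult[OF Y d Fm, symmetric] by (simp only: ac_simps)
  finally have "V Y * (\<integral>A:n,n. W A * G (A * (Y * R))) = (haar_weight n Y * V Y) * (\<integral>A:n,n. W (A * minv Y) * G (A * R))"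
   by (simp only: ac_simps)
  also have "... = (\<integral>A:n,n. (haar_weight n Y * V Y) * (W (A * minv Y) * G (A * R)))"
   by (rule nn_integral_cmult[OF Fm, symmetric])
  finally show "V Y * (\<integral>A:n,n. W A * G (A * (Y * R))) = (\<integral>A:n,n. (haar_weight n Y * (W (A * minv Y) * V Y)) * G (A * R))"
   by (simp only: ac_simps)
 qed
 also have "... = (\<integral>A:n,n. \<integral>Y:n,n. (haar_weight n Y * (W (A * minv Y) * V Y)) * G (A * R))"
  by (rule nn_integral_lmat_swap) (unfold case_prod_unfold, intro mm)
 also have "... = (\<integral>A:n,n. mat_conv n W V A * G (A * R))"
 proof (rule nn_integral_cong_mat)
  fix A :: "complex mat" assume A: "A \<in> cmat n n"
  show "(\<integral>Y:n,n. (haar_weight n Y * (W (A * minv Y) * V Y)) * G (A * R)) = mat_conv n W V A * G (A * R)"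
   unfolding mat_conv_def haar_def by (intro nn_integral_multc mm V meas_const A measurable_idt)
 qed
 finally show ?thesis .
qed

lemma sigma_finite_gauss_mat: "sigma_finite_measure (gauss_mat n)"
proof -
 have "sigma_finite_measure (density (lmat n n) (\<lambda>X. ennreal (exp (- sqnorm X) * (1 / pi) ^ (n * n))))"
  by (subst lmat.sigma_finite_iff_density_finite')
   (auto intro!: measurable_to_ennreal borel_measurable_times measurable_exp_sqnorm[where a = n and b = n] measurable_idt)
 then show ?thesis by (simp add: gauss_mat_def ennreal_mult)
qed

text \<open>Induction over the number of factors with the integral over the last one outermost. The
  inner integral is the induction hypothesis with the last factor put into R, and
  \<open>nn_integral_mat_conv\<close> adds one convolution.\<close>

theorem nn_integral_signed_mult:
 assumes \<epsilon>: "\<And>j. j < Suc k ==> \<epsilon> j \<in> {1, - 1}"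
  and G: "G \<in> bmeas (lmat n n)" and R: "R \<in> cmat n n"
 shows "(\<integral>\<^sup>+X. G (signed_mult \<epsilon> (Suc k) X R) \<partial>(\<Pi>\<^sub>M j\<in>{..<Suc k}. gauss_mat n)) =
  ennreal ((1 / pi) ^ (n * n)) ^ Suc k * (\<integral>A:n,n. mat_weight \<epsilon> 0 n k A * G (A * R))"
 using assms
proof (induction k arbitrary: R)
 case 0
 interpret product_sigma_finite "\<lambda>_ :: nat. gauss_mat n" by (simp add: product_sigma_finite_def sigma_finite_gauss_mat)
 have GR: "(\<lambda>A. G (A * R)) \<in> bmeas (lmat n n)"
  by (intro measurable_compose[OF _ 0(2)] meas_mult[where b = n] meas_const[OF 0(3)] measurable_idt)
 have "(\<integral>\<^sup>+X. G (signed_mult \<epsilon> (Suc 0) X R) \<partial>(\<Pi>\<^sub>M j\<in>{..<Suc 0}. gauss_mat n)) = (\<integral>\<^sup>+X. G (signed_mat (\<epsilon> 0) (X 0) * R) \<partial>(\<Pi>\<^sub>M j\<in>{0 :: nat}. gauss_mat n))"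
  by (simp add: signed_mult_def lessThan_Suc)
 also have "... = (\<integral>\<^sup>+X. G (signed_mat (\<epsilon> 0) X * R) \<partial>gauss_mat n)"
 proof (rule product_nn_integral_singleton)
  have "(\<lambda>X. G (signed_mat (\<epsilon> 0) X * R)) \<in> bmeas (lmat n n)"
   by (intro measurable_compose[OF measurable_signed_mat GR] measurable_idt)
  then show "(\<lambda>X. G (signed_mat (\<epsilon> 0) X * R)) \<in> bmeas (gauss_mat n)"
   using measurable_cong_sets[OF sets_gauss_mat refl] by blast
 qed
 also have "... = ennreal ((1 / pi) ^ (n * n)) * (\<integral>X:n,n. gauss_weight (\<epsilon> 0) 0 n X * G (X * R))"
  by (rule nn_integral_signed_gauss_mat[OF GR]) (use 0 in simp)
 finally show ?case by simp
next
 case (Suc k)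
 interpret product_sigma_finite "\<lambda>_ :: nat. gauss_mat n" by (simp add: product_sigma_finite_def sigma_finite_gauss_mat)
 let ?c = "ennreal ((1 / pi) ^ (n * n))" and ?K = "Suc k"
 let ?W = "mat_weight \<epsilon> 0 n k"
 let ?H = "\<lambda>Y. \<integral>A:n,n. ?W A * G (A * (Y * R))"
 have ins: "{..<Suc ?K} = insert ?K {..<?K}" by auto
 have comp: "(\<lambda>X. X j) \<in> (\<Pi>\<^sub>M j\<in>insert ?K {..<?K}. gauss_mat n) \<rightarrow>\<^sub>M lmat n n" if "j \<in> insert ?K {..<?K}" for j
  using measurable_component_singleton[OF that, of "\<lambda>_. gauss_mat n"] measurable_cong_sets[OF refl sets_gauss_mat] by blast
 have Pm: "(\<lambda>X. G (signed_mult \<epsilon> (Suc ?K) X R)) \<in> bmeas (\<Pi>\<^sub>M j\<in>insert ?K {..<?K}. gauss_mat n)"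
  by (intro measurable_compose[OF _ Suc.prems(2)] measurable_signed_mult meas_const[OF Suc.prems(3)] comp) auto
 have Hm: "?H \<in> bmeas (lmat n n)"
 proof (rule lmat.borel_measurable_nn_integral)
  show "(\<lambda>(Y, A). ?W A * G (A * (Y * R))) \<in> bmeas (lmat n n \<Otimes>\<^sub>M lmat n n)"
   unfolding case_prod_unfold
   by (intro measurable_times measurable_compose[OF _ measurable_mat_weight] measurable_compose[OF _ Suc.prems(2)]
    meas_mult[where b = n] meas_const[OF Suc.prems(3)] measurable_fst measurable_snd)
 qed
 have Hs: "(\<lambda>Y. ?H (signed_mat (\<epsilon> ?K) Y)) \<in> bmeas (gauss_mat n)"
  using measurable_compose[OF measurable_signed_mat[OF measurable_idt] Hm] measurable_cong_sets[OF sets_gauss_mat refl] by blast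
 have "(\<integral>\<^sup>+X. G (signed_mult \<epsilon> (Suc ?K) X R) \<partial>(\<Pi>\<^sub>M j\<in>{..<Suc ?K}. gauss_mat n)) =
   (\<integral>\<^sup>+Y. \<integral>\<^sup>+X. G (signed_mult \<epsilon> (Suc ?K) (X(?K := Y)) R) \<partial>(\<Pi>\<^sub>M j\<in>{..<?K}. gauss_mat n) \<partial>gauss_mat n)"
  unfolding ins by (rule product_nn_integral_insert_rev[OF _ _ Pm]) auto
 also have "... = (\<integral>\<^sup>+Y. ?c ^ ?K * ?H (signed_mat (\<epsilon> ?K) Y) \<partial>gauss_mat n)"
 proof (rule nn_integral_cong)
  fix Y assume "Y \<in> space (gauss_mat n)"
  then have Y: "Y \<in> cmat n n" by simp
  have sY: "signed_mat (\<epsilon> ?K) Y * R \<in> cmat n n"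
   unfolding signed_mat_minv[OF Y]
   using mult_carrier_mat[OF minv_carrier[OF Y] Suc.prems(3)] mult_carrier_mat[OF Y Suc.prems(3)] by simp
  have "signed_mult \<epsilon> (Suc ?K) (X(?K := Y)) R = signed_mult \<epsilon> ?K X (signed_mat (\<epsilon> ?K) Y * R)" for X
   unfolding signed_mult_Suc[of \<epsilon> ?K] fun_upd_same by (rule signed_mult_cong) simp
  then show "(\<integral>\<^sup>+X. G (signed_mult \<epsilon> (Suc ?K) (X(?K := Y)) R) \<partial>(\<Pi>\<^sub>M j\<in>{..<?K}. gauss_mat n)) = ?c ^ ?K * ?H (signed_mat (\<epsilon> ?K) Y)"
   using Suc.IH[OF _ Suc.prems(2) sY] Suc.prems(1) by simp
 qed
 also have "... = ?c ^ ?K * (\<integral>\<^sup>+Y. ?H (signed_mat (\<epsilon> ?K) Y) \<partial>gauss_mat n)"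
  by (rule nn_integral_cmult[OF Hs])
 also have "(\<integral>\<^sup>+Y. ?H (signed_mat (\<epsilon> ?K) Y) \<partial>gauss_mat n) = ?c * (\<integral>Y:n,n. gauss_weight (\<epsilon> ?K) 0 n Y * ?H Y)"
  by (rule nn_integral_signed_gauss_mat[OF Hm]) (use Suc.prems(1)[of ?K] in simp)
 also have "(\<integral>Y:n,n. gauss_weight (\<epsilon> ?K) 0 n Y * ?H Y) = (\<integral>A:n,n. mat_weight \<epsilon> 0 n ?K A * G (A * R))"
  unfolding mat_weight.simps(2)
  by (rule nn_integral_mat_conv[OF measurable_mat_weight _ Suc.prems(2,3)]) (use bi_invariant_gauss_weight in \<open>auto simp: bi_invariant_def\<close>)
 finally show ?case by (simp only: power_Suc ac_simps)
qed

lemma density_lebesgue_PiM: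
 fixes g :: "complex => ennreal"
 assumes I: "finite I" and g: "g \<in> bmeas borel" and sf: "sigma_finite_measure (density lborel g)"
 shows "(\<Pi>\<^sub>M i\<in>I. density lborel g) = density (\<Pi>\<^sub>M i\<in>I. lborel) (\<lambda>x. \<Prod>i\<in>I. g (x i))"
proof -
 interpret d: product_sigma_finite "\<lambda>_ :: 'a. density lborel g" using sf by (simp add: product_sigma_finite_def)
 have pm: "(\<lambda>x. \<Prod>i\<in>I. g (x i)) \<in> bmeas (\<Pi>\<^sub>M i\<in>I. lborel)"
  using g by (intro borel_measurable_prod_ennreal measurable_compose[OF measurable_component_singleton]) auto
 have "density (\<Pi>\<^sub>M i\<in>I. lborel) (\<lambda>x. \<Prod>i\<in>I. g (x i)) = (\<Pi>\<^sub>M i\<in>I. density lborel g)"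
 proof (rule d.PiM_eqI[OF I])
  show "sets (density (\<Pi>\<^sub>M i\<in>I. lborel) (\<lambda>x. \<Prod>i\<in>I. g (x i))) = sets (\<Pi>\<^sub>M i\<in>I. density lborel g)"
   by (simp cong: sets_PiM_cong)
  fix A assume A: "\<And>i. i \<in> I ==> A i \<in> sets (density lborel g)"
  then have A': "A i \<in> sets borel" if "i \<in> I" for i using that by simp
  have "emeasure (density (\<Pi>\<^sub>M i\<in>I. lborel) (\<lambda>x. \<Prod>i\<in>I. g (x i))) (Pi\<^sub>E I A)
    = (\<integral>\<^sup>+x. (\<Prod>i\<in>I. g (x i)) * indicator (Pi\<^sub>E I A) x \<partial>(\<Pi>\<^sub>M i\<in>I. lborel))"
   using I A' by (intro emeasure_density pm sets_PiM_I_finite) auto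
  also have "... = (\<integral>\<^sup>+x. (\<Prod>i\<in>I. g (x i) * indicator (A i) (x i)) \<partial>(\<Pi>\<^sub>M i\<in>I. lborel))"
  proof (rule nn_integral_cong)
   fix x assume "x \<in> space (\<Pi>\<^sub>M i\<in>I. clborel)"
   then have "x \<in> extensional I" by (auto simp: space_PiM PiE_def)
   then have "indicator (Pi\<^sub>E I A) x = (\<Prod>i\<in>I. indicator (A i) (x i) :: ennreal)"
    using I by (auto simp: indicator_def PiE_def Pi_def prod_zero_iff intro!: prod.neutral)
   then show "(\<Prod>i\<in>I. g (x i)) * indicator (Pi\<^sub>E I A) x = (\<Prod>i\<in>I. g (x i) * indicator (A i) (x i))"
    by (simp add: prod.distrib)
  qed
  also have "... = (\<Prod>i\<in>I. \<integral>x:\<C>. g x * indicator (A i) x)"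
   using I g A' by (intro lborel_prod.product_nn_integral_prod) auto
  also have "... = (\<Prod>i\<in>I. emeasure (density lborel g) (A i))"
   using g A' by (intro prod.cong refl) (simp add: emeasure_density)
  finally show "emeasure (density (\<Pi>\<^sub>M i\<in>I. lborel) (\<lambda>x. \<Prod>i\<in>I. g (x i))) (Pi\<^sub>E I A) = (\<Prod>i\<in>I. emeasure (density lborel g) (A i))" .
 qed
 then show ?thesis by simp
qed

section \<open>Law of the Gaussian matrices\<close>

definition entry_block :: "nat => nat => (nat \<times> nat \<times> nat) set" where
 "entry_block n j = {j} \<times> {..<n} \<times> {..<n}"

definition block_mat :: "nat => nat => (nat \<times> nat \<times> nat => complex) => complex mat" where
 "block_mat n j y = Matrix.mat n n (\<lambda>p. y (j, p))"

lemma entry_block_image: "entry_block n j = Pair j ` ({..<n} \<times> {..<n})"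
 by (auto simp: entry_block_def)

lemma measurable_block_mat: "block_mat n j \<in> (\<Pi>\<^sub>M i\<in>entry_block n j. borel) \<rightarrow>\<^sub>M lmat n n"
proof (rule measurable_lmat)
 fix a b assume ab: "a < n" "b < n"
 have "(\<lambda>y. y (j, a, b)) \<in> (\<Pi>\<^sub>M i\<in>entry_block n j. borel :: complex measure) \<rightarrow>\<^sub>M borel"
  by (rule measurable_component_singleton) (use ab in \<open>auto simp: entry_block_def\<close>)
 then show "(\<lambda>y. block_mat n j y $$ (a, b)) \<in> bmeas (\<Pi>\<^sub>M i\<in>entry_block n j. borel)"
  using ab by (simp add: block_mat_def)
qed (simp add: block_mat_def)

lemma sets_PiM_lborel: "sets (\<Pi>\<^sub>M i\<in>I. clborel) = sets (\<Pi>\<^sub>M i\<in>I. borel)"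
 by (intro sets_PiM_cong) simp_all

lemma distr_block_mat: "distr (\<Pi>\<^sub>M i\<in>entry_block n j. lborel) (lmat n n) (block_mat n j) = lmat n n"
proof (rule lmat_eqI)
 let ?N = "{..<n} \<times> {..<n}"
 fix E :: "nat \<times> nat => complex set" assume E: "\<And>p. E p \<in> sets borel"
 have m: "block_mat n j \<in> (\<Pi>\<^sub>M i\<in>entry_block n j. lborel) \<rightarrow>\<^sub>M lmat n n"
  using measurable_block_mat measurable_cong_sets[OF sets_PiM_lborel refl] by blast
 have "block_mat n j y \<in> mat_box n n E \<longleftrightarrow> (\<forall>a<n. \<forall>b<n. y (j, a, b) \<in> E (a, b))" for y
  by (simp add: block_mat_def mat_box_def)
 moreover have "(\<forall>i\<in>entry_block n j. y i \<in> E (snd i)) \<longleftrightarrow> (\<forall>a<n. \<forall>b<n. y (j, a, b) \<in> E (a, b))" for y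
  by (auto simp: entry_block_def)
 ultimately have iff: "block_mat n j y \<in> mat_box n n E \<longleftrightarrow> (\<forall>i\<in>entry_block n j. y i \<in> E (snd i))" for y
  by (simp only:)
 have "block_mat n j -` mat_box n n E \<inter> space (\<Pi>\<^sub>M i\<in>entry_block n j. lborel) = (\<Pi>\<^sub>E i\<in>entry_block n j. E (snd i))"
 proof (intro equalityI subsetI)
  fix y assume "y \<in> block_mat n j -` mat_box n n E \<inter> space (\<Pi>\<^sub>M i\<in>entry_block n j. lborel)"
  then show "y \<in> (\<Pi>\<^sub>E i\<in>entry_block n j. E (snd i))"
   by (simp add: vimage_def iff space_PiM PiE_iff)
 next
  fix y assume "y \<in> (\<Pi>\<^sub>E i\<in>entry_block n j. E (snd i))"
  then show "y \<in> block_mat n j -` mat_box n n E \<inter> space (\<Pi>\<^sub>M i\<in>entry_block n j. lborel)"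
   by (simp add: vimage_def iff space_PiM PiE_iff)
 qed
 then have "emeasure (distr (\<Pi>\<^sub>M i\<in>entry_block n j. lborel) (lmat n n) (block_mat n j)) (mat_box n n E)
   = emeasure (\<Pi>\<^sub>M i\<in>entry_block n j. lborel) (\<Pi>\<^sub>E i\<in>entry_block n j. E (snd i))"
  using E by (subst emeasure_distr[OF m sets_mat_box]) auto
 also have "... = (\<Prod>i\<in>entry_block n j. emeasure lborel (E (snd i)))"
  using E by (intro lborel_prod.emeasure_PiM) (auto simp: entry_block_def)
 also have "... = (\<Prod>p\<in>?N. emeasure lborel (E p))"
  unfolding entry_block_image by (subst prod.reindex) (auto simp: inj_on_def)
 finally show "emeasure (distr (\<Pi>\<^sub>M i\<in>entry_block n j. lborel) (lmat n n) (block_mat n j)) (mat_box n n E)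
   = (\<Prod>p\<in>?N. emeasure lborel (E p))" .
qed simp

lemma prod_gauss_density:
 "(\<Prod>i\<in>entry_block n j. ennreal (exp (- (cmod (y i))\<^sup>2) / pi)) =
   ennreal (exp (- sqnorm (block_mat n j y))) * ennreal ((1 / pi) ^ (n * n))"
proof -
 let ?N = "{..<n} \<times> {..<n}"
 have "(\<Prod>i\<in>entry_block n j. ennreal (exp (- (cmod (y i))\<^sup>2) / pi)) = (\<Prod>p\<in>?N. ennreal (exp (- (cmod (y (j, p)))\<^sup>2) / pi))"
  unfolding entry_block_image by (subst prod.reindex) (auto simp: inj_on_def)
 also have "... = ennreal (\<Prod>p\<in>?N. exp (- (cmod (y (j, p)))\<^sup>2) * (1 / pi))"
  by (subst prod_ennreal) auto
 also have "(\<Prod>p\<in>?N. exp (- (cmod (y (j, p)))\<^sup>2) * (1 / pi)) = exp (\<Sum>p\<in>?N. - (cmod (y (j, p)))\<^sup>2) * (1 / pi) ^ (n * n)"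
  unfolding prod.distrib by (simp add: exp_sum card_cartesian_product)
 also have "(\<Sum>p\<in>?N. - (cmod (y (j, p)))\<^sup>2) = - sqnorm (block_mat n j y)"
  by (simp add: sqnorm_def block_mat_def sum_negf sum.cartesian_product')
 finally show ?thesis by (simp add: ennreal_mult)
qed

context
 fixes M :: "'w measure" and n k :: nat and A :: "nat => 'w => complex mat"
 assumes ind: "independent_gaussian_matrices M n k A" and n: "1 \<le> n"
begin

interpretation prob_space M
 using ind by (simp add: independent_gaussian_matrices_def)

abbreviation (input) entry :: "nat \<times> nat \<times> nat => 'w => complex" where
 "entry \<equiv> \<lambda>(j, a, b) w. A j w $$ (a, b)"

lemma entry_distributed:
 "i \<in> {..<k} \<times> {..<n} \<times> {..<n} ==> distributed M lborel (entry i) (\<lambda>z. ennreal (exp (- (cmod z)\<^sup>2) / pi))"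
 using ind by (auto simp: independent_gaussian_matrices_def std_complex_gaussian_def)

lemma measurable_entry: "i \<in> {..<k} \<times> {..<n} \<times> {..<n} ==> entry i \<in> M \<rightarrow>\<^sub>M borel"
 using distributed_measurable[OF entry_distributed] measurable_cong_sets[OF refl sets_lborel] by blast

lemma gaussian_mat_carrier: "j < k ==> w \<in> space M ==> A j w \<in> cmat n n"
 using ind by (auto simp: independent_gaussian_matrices_def)

lemma measurable_gaussian_mat: "j < k ==> A j \<in> M \<rightarrow>\<^sub>M lmat n n"
proof (rule measurable_lmat)
 fix a b assume "j < k" "a < n" "b < n"
 then show "(\<lambda>w. A j w $$ (a, b)) \<in> bmeas M" using measurable_entry[of "(j, a, b)"] by simp
qed (rule gaussian_mat_carrier)

lemma measurable_signed_product: "(\<lambda>w. signed_product n k \<epsilon> (\<lambda>j. A j w)) \<in> M \<rightarrow>\<^sub>M lmat n n"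
proof -
 have "(\<lambda>w. signed_mult \<epsilon> k (\<lambda>j. A j w) (1\<^sub>m n)) \<in> M \<rightarrow>\<^sub>M lmat n n"
  by (rule measurable_signed_mult) (auto intro: measurable_gaussian_mat meas_one)
 then show ?thesis by (simp add: signed_mult_def signed_product_def)
qed

lemma block_mat_entry:
 "j < k ==> w \<in> space M ==> block_mat n j (\<lambda>i\<in>entry_block n j. entry i w) = A j w"
proof (rule eq_matI)
 assume "j < k" "w \<in> space M"
 then have c: "A j w \<in> cmat n n" by (rule gaussian_mat_carrier)
 then show "dim_row (block_mat n j (\<lambda>i\<in>entry_block n j. entry i w)) = dim_row (A j w)"
  "dim_col (block_mat n j (\<lambda>i\<in>entry_block n j. entry i w)) = dim_col (A j w)" by (auto simp: block_mat_def)
 fix a b assume "a < dim_row (A j w)" "b < dim_col (A j w)"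
 then show "block_mat n j (\<lambda>i\<in>entry_block n j. entry i w) $$ (a, b) = A j w $$ (a, b)"
  using c by (auto simp: block_mat_def entry_block_def)
qed

text \<open>Independent entries have the product of their Gaussian densities as joint density, and
  the exponents add up to the squared norm of the matrix.\<close>

lemma distr_gaussian_mat:
 assumes j: "j < k"
 shows "distr M (lmat n n) (\<lambda>w. block_mat n j (\<lambda>i\<in>entry_block n j. entry i w)) = gauss_mat n"
proof -
 let ?K = "entry_block n j" and ?g = "\<lambda>z. ennreal (exp (- (cmod z)\<^sup>2) / pi)"
 have sub: "?K \<subseteq> {..<k} \<times> {..<n} \<times> {..<n}" using j by (auto simp: entry_block_def)
 have "(j, 0, 0) \<in> ?K" using n by (simp add: entry_block_def)
 then have ne: "?K ~= {}" by blast
 have em: "entry i \<in> M \<rightarrow>\<^sub>M borel" if "i \<in> ?K" for i using measurable_entry sub that by blast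
 have "indep_vars (\<lambda>_. borel) entry ({..<k} \<times> {..<n} \<times> {..<n})"
  using ind by (simp add: independent_gaussian_matrices_def)
 then have "indep_vars (\<lambda>_. borel) entry ?K" using sub by (rule indep_vars_subset)
 then have 1: "distr M (\<Pi>\<^sub>M i\<in>?K. borel) (\<lambda>w. \<lambda>i\<in>?K. entry i w) = (\<Pi>\<^sub>M i\<in>?K. distr M borel (entry i))"
  using indep_vars_iff_distr_eq_PiM'[OF ne, of entry "\<lambda>_. borel"] em by blast
 have dl: "distr M borel (entry i) = density lborel ?g" if "i \<in> ?K" for i
 proof -
  have "distr M borel (entry i) = distr M lborel (entry i)" by (rule distr_cong) auto
  also have "... = density lborel ?g" using distributed_distr_eq_density[OF entry_distributed] sub that by blast
  finally show ?thesis .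
 qed
 then have "(\<Pi>\<^sub>M i\<in>?K. distr M borel (entry i)) = (\<Pi>\<^sub>M i\<in>?K. density lborel ?g)" by (rule PiM_cong[OF refl])
 also have "... = density (\<Pi>\<^sub>M i\<in>?K. lborel) (\<lambda>x. \<Prod>i\<in>?K. ?g (x i))"
 proof (rule density_lebesgue_PiM)
  obtain i where i: "i \<in> ?K" using ne by blast
  have "prob_space (distr M borel (entry i))" using em[OF i] by (rule prob_space_distr)
  then show "sigma_finite_measure (density lborel ?g)"
   unfolding dl[OF i] by (rule prob_space_imp_sigma_finite)
 qed (auto simp: entry_block_def)
 finally have 2: "(\<Pi>\<^sub>M i\<in>?K. distr M borel (entry i)) = density (\<Pi>\<^sub>M i\<in>?K. lborel) (\<lambda>x. \<Prod>i\<in>?K. ?g (x i))" .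
 have rm: "(\<lambda>w. \<lambda>i\<in>?K. entry i w) \<in> M \<rightarrow>\<^sub>M (\<Pi>\<^sub>M i\<in>?K. borel)" by (rule measurable_restrict) (rule em)
 have bm: "block_mat n j \<in> (\<Pi>\<^sub>M i\<in>?K. lborel) \<rightarrow>\<^sub>M lmat n n"
  using measurable_block_mat measurable_cong_sets[OF sets_PiM_lborel refl] by blast
 let ?d = "\<lambda>X. ennreal (exp (- sqnorm X)) * ennreal ((1 / pi) ^ (n * n))"
 have dm: "?d \<in> bmeas (lmat n n)"
  by (intro measurable_times measurable_ennreal_exp_sqnorm borel_measurable_const)
 have "distr M (lmat n n) (\<lambda>w. block_mat n j (\<lambda>i\<in>?K. entry i w)) =
   distr (distr M (\<Pi>\<^sub>M i\<in>?K. borel) (\<lambda>w. \<lambda>i\<in>?K. entry i w)) (lmat n n) (block_mat n j)"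
  by (subst distr_distr[OF measurable_block_mat rm]) (simp add: comp_def)
 also have "... = distr (density (\<Pi>\<^sub>M i\<in>?K. lborel) (\<lambda>x. ?d (block_mat n j x))) (lmat n n) (block_mat n j)"
  unfolding 1 2 prod_gauss_density ..
 also have "... = density (distr (\<Pi>\<^sub>M i\<in>?K. lborel) (lmat n n) (block_mat n j)) ?d"
  by (rule density_distr[symmetric]) (use dm bm in auto)
 also have "... = gauss_mat n" unfolding distr_block_mat gauss_mat_def ..
 finally show ?thesis .
qed

text \<open>Joint independence of all entries passes to the disjoint blocks of entries that make up
  the matrices, so their joint law is a product measure.\<close>

lemma nn_integral_gaussian_mats:
 assumes k: "1 \<le> k" and \<Psi>: "\<Psi> \<in> bmeas (\<Pi>\<^sub>M j\<in>{..<k}. lmat n n)"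
 shows "(\<integral>\<^sup>+w. \<Psi> (\<lambda>j\<in>{..<k}. A j w) \<partial>M) = (\<integral>\<^sup>+X. \<Psi> X \<partial>(\<Pi>\<^sub>M j\<in>{..<k}. gauss_mat n))"
proof -
 let ?B = "\<lambda>j w. block_mat n j (\<lambda>i\<in>entry_block n j. entry i w)"
 have "indep_vars (\<lambda>_. borel) entry ({..<k} \<times> {..<n} \<times> {..<n})"
  using ind by (simp add: independent_gaussian_matrices_def)
 then have "indep_vars (\<lambda>j. \<Pi>\<^sub>M i\<in>entry_block n j. borel) (\<lambda>j w. \<lambda>i\<in>entry_block n j. entry i w) {..<k}"
  by (rule indep_vars_restrict) (auto simp: entry_block_def disjoint_family_on_def)
 then have iv: "indep_vars (\<lambda>_. lmat n n) ?B {..<k}"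
  by (rule indep_vars_compose2) (rule measurable_block_mat)
 then have Bm: "?B j \<in> M \<rightarrow>\<^sub>M lmat n n" if "j \<in> {..<k}" for j using that by (auto simp: indep_vars_def)
 have "{..<k} ~= {}" using k by (auto simp: lessThan_empty_iff)
 from indep_vars_iff_distr_eq_PiM'[OF this, of ?B "\<lambda>_. lmat n n"] iv Bm
 have "distr M (\<Pi>\<^sub>M j\<in>{..<k}. lmat n n) (\<lambda>w. \<lambda>j\<in>{..<k}. ?B j w) = (\<Pi>\<^sub>M j\<in>{..<k}. distr M (lmat n n) (?B j))" by blast
 also have "... = (\<Pi>\<^sub>M j\<in>{..<k}. gauss_mat n)" by (rule PiM_cong[OF refl]) (simp add: distr_gaussian_mat)
 finally have law: "distr M (\<Pi>\<^sub>M j\<in>{..<k}. lmat n n) (\<lambda>w. \<lambda>j\<in>{..<k}. ?B j w) = (\<Pi>\<^sub>M j\<in>{..<k}. gauss_mat n)" .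
 have "(\<lambda>w. \<lambda>j\<in>{..<k}. ?B j w) \<in> M \<rightarrow>\<^sub>M (\<Pi>\<^sub>M j\<in>{..<k}. lmat n n)" by (rule measurable_restrict) (rule Bm)
 from nn_integral_distr[OF this, of \<Psi>] \<Psi> law
 have "(\<integral>\<^sup>+X. \<Psi> X \<partial>(\<Pi>\<^sub>M j\<in>{..<k}. gauss_mat n)) = (\<integral>\<^sup>+w. \<Psi> (\<lambda>j\<in>{..<k}. ?B j w) \<partial>M)" by simp
 also have "... = (\<integral>\<^sup>+w. \<Psi> (\<lambda>j\<in>{..<k}. A j w) \<partial>M)"
 proof (rule nn_integral_cong)
  fix w assume w: "w \<in> space M"
  have "(\<lambda>j\<in>{..<k}. ?B j w) = (\<lambda>j\<in>{..<k}. A j w)" by (rule restrict_ext) (simp only: block_mat_entry[OF _ w] lessThan_iff)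
  then show "\<Psi> (\<lambda>j\<in>{..<k}. ?B j w) = \<Psi> (\<lambda>j\<in>{..<k}. A j w)" by (simp only:)
 qed
 finally show ?thesis by simp
qed

theorem nn_integral_signed_product:
 assumes k: "k = Suc l" and \<epsilon>: "\<And>j. j < k ==> \<epsilon> j \<in> {1, - 1}" and G: "G \<in> bmeas (lmat n n)"
 shows "(\<integral>\<^sup>+w. G (signed_product n k \<epsilon> (\<lambda>j. A j w)) \<partial>M) =
  ennreal ((1 / pi) ^ (n * n)) ^ k * (\<integral>X:n,n. mat_weight \<epsilon> 0 n l X * G X)"
proof -
 define \<Psi> where "\<Psi> X = G (signed_mult \<epsilon> k X (1\<^sub>m n))" for X
 have \<Psi>: "\<Psi> \<in> bmeas (\<Pi>\<^sub>M j\<in>{..<k}. lmat n n)"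
  unfolding \<Psi>_def
  by (intro measurable_compose[OF _ G] measurable_signed_mult meas_one measurable_component_singleton) simp
 have "(\<integral>\<^sup>+w. G (signed_product n k \<epsilon> (\<lambda>j. A j w)) \<partial>M) = (\<integral>\<^sup>+w. \<Psi> (\<lambda>j\<in>{..<k}. A j w) \<partial>M)"
 proof (rule nn_integral_cong)
  fix w
  have "signed_mult \<epsilon> k (\<lambda>j\<in>{..<k}. A j w) (1\<^sub>m n) = signed_mult \<epsilon> k (\<lambda>j. A j w) (1\<^sub>m n)"
   by (rule signed_mult_cong) simp
  then show "G (signed_product n k \<epsilon> (\<lambda>j. A j w)) = \<Psi> (\<lambda>j\<in>{..<k}. A j w)"
   by (simp add: \<Psi>_def signed_product_def signed_mult_def)
 qed
 also have "... = (\<integral>\<^sup>+X. \<Psi> X \<partial>(\<Pi>\<^sub>M j\<in>{..<k}. gauss_mat n))" by (rule nn_integral_gaussian_mats[OF _ \<Psi>]) (simp add: k)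
 also have "... = ennreal ((1 / pi) ^ (n * n)) ^ k * (\<integral>X:n,n. mat_weight \<epsilon> 0 n l X * G (X * 1\<^sub>m n))"
  unfolding \<Psi>_def k by (rule nn_integral_signed_mult) (use \<epsilon> k G in auto)
 also have "(\<integral>X:n,n. mat_weight \<epsilon> 0 n l X * G (X * 1\<^sub>m n)) = (\<integral>X:n,n. mat_weight \<epsilon> 0 n l X * G X)"
  by (rule nn_integral_cong) (simp add: right_mult_one_mat)
 finally show ?thesis .
qed

end

section \<open>The scalar weight\<close>

definition factor_weight :: "int => nat => complex => ennreal" where
 "factor_weight e n y = ennreal (exp (- (cmod y)\<^sup>2) * cmod y powi ((1 - e) * (int n - 1)))"

lemma measurable_powi [measurable]: "(\<lambda>y :: complex. y powi e) \<in> bmeas borel"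
 unfolding power_int_def by measurable

lemma measurable_cmod_powi [measurable]: "(\<lambda>y :: complex. cmod y powi e) \<in> bmeas borel"
 unfolding power_int_def by measurable

lemma measurable_factor_weight [measurable]: "factor_weight e n \<in> bmeas borel"
 unfolding factor_weight_def[abs_def] by measurable

text \<open>\<open>nn_integral_minv\<close> for matrices of size 1, whose exponent 4n is 4.\<close>

lemma nn_integral_complex_inverse:
 assumes F: "F \<in> bmeas borel"
 shows "(\<integral>x:\<C>. F x) = (\<integral>\<^sup>+x. ennreal (inverse (cmod x ^ 4)) * F (inverse x) \<partial>clborel)"
proof -
 define G where "G X = F (X $$ (0, 0))" for X
 have entry: "(\<lambda>X. X $$ (0, 0)) \<in> bmeas (lmat 1 1)"
  by (rule meas_entry[OF _ _ measurable_idt]) auto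
 have Gm: "G \<in> bmeas (lmat 1 1)"
  unfolding G_def by (rule measurable_compose[OF entry F])
 let ?H = "\<lambda>X. ennreal (inverse (cmod (det X) ^ (4 * 1))) * G (minv X)"
 have Hm: "?H \<in> bmeas (lmat 1 1)"
  by (intro measurable_times measurable_to_ennreal borel_measurable_inverse
    borel_measurable_power measurable_cmod meas_det[where n = 1]
    measurable_compose[OF _ Gm] measurable_minv measurable_idt)
 have "(\<integral>x:\<C>. F x) = integral\<^sup>N (lmat 1 1) G"
  unfolding nn_integral_lmat_11[OF Gm] by (simp add: G_def One_nat_def)
 also have "... = integral\<^sup>N (lmat 1 1) ?H" by (rule nn_integral_minv[OF Gm])
 also have "... = (\<integral>x:\<C>. ?H (Matrix.mat 1 1 (\<lambda>_. x)))" by (rule nn_integral_lmat_11[OF Hm])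
 also have "... = (\<integral>x:\<C>. ennreal (inverse (cmod x ^ 4)) * F (inverse x))"
 proof (rule nn_integral_cong_nonzero)
  fix x :: complex assume x: "x ~= 0"
  have "minv (Matrix.mat 1 1 (\<lambda>_. x)) = Matrix.mat 1 1 (\<lambda>_. inverse x)"
   by (rule minv_unique(1)[where n = 1]) (use x in \<open>auto intro!: eq_matI simp: scalar_prod_def One_nat_def\<close>)
  moreover have "det (Matrix.mat 1 1 (\<lambda>_. x)) = x" by (subst det_single) (auto simp: One_nat_def)
  ultimately show "?H (Matrix.mat 1 1 (\<lambda>_. x)) = ennreal (inverse (cmod x ^ 4)) * F (inverse x)"
   by (simp add: G_def One_nat_def)
 qed
 finally show ?thesis .
qed

text \<open>For e = -1 the exponent (1 - e)(n - 1) is 2(n - 1), and inversion adds the Jacobian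
  |x|^(-4); the sum is the exponent in \<open>scalar_weight\<close>.\<close>

lemma nn_integral_factor_weight:
 assumes H: "H \<in> bmeas borel" and e: "e \<in> {1, - 1}" and n: "1 \<le> n"
 shows "(\<integral>y:\<C>. factor_weight e n y * H (y powi e)) = (\<integral>y:\<C>. scalar_weight e n y * H y)"
proof (cases "e = 1")
 case True
 then show ?thesis by (simp add: factor_weight_def scalar_weight_def)
next
 case False
 then have e: "e = - 1" using e by simp
 have [measurable]: "H \<in> bmeas borel" by (rule H)
 have Hm: "(\<lambda>y. factor_weight e n y * H (y powi e)) \<in> bmeas borel" by measurable
 show ?thesis unfolding nn_integral_complex_inverse[OF Hm]
 proof (rule nn_integral_cong_nonzero)
  fix x :: complex assume x: "x ~= 0"
  have "(1 - e) * (int n - 1) = int (2 * (n - 1))" using e n by (simp add: of_nat_diff)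
  then have "factor_weight e n (inverse x) = ennreal (exp (- (inverse (cmod x))\<^sup>2) * inverse (cmod x) ^ (2 * (n - 1)))"
   by (simp only: factor_weight_def norm_inverse power_int_of_nat)
  moreover have "inverse x powi e = x" using e x by (simp add: power_int_minus)
  moreover have "inverse (cmod x ^ (2 * (n - 1) + 4)) = inverse (cmod x ^ 4) * inverse (cmod x) ^ (2 * (n - 1))"
   by (simp add: power_add power_inverse)
  ultimately show "ennreal (inverse (cmod x ^ 4)) * (factor_weight e n (inverse x) * H (inverse x powi e)) = scalar_weight e n x * H x"
   using False by (simp add: scalar_weight_def ennreal_mult ac_simps)
 qed
qed

lemma nn_integral_scalar_conv:
 assumes [measurable]: "w \<in> bmeas borel" "v \<in> bmeas borel" "F \<in> bmeas borel"
 shows "(\<integral>y:\<C>. v y * (\<integral>z:\<C>. w z * F (z * y))) = (\<integral>z:\<C>. scalar_conv w v z * F z)"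
proof -
 have "(\<integral>y:\<C>. v y * (\<integral>z:\<C>. w z * F (z * y)))
   = (\<integral>y:\<C>. \<integral>z:\<C>. (ennreal (inverse ((cmod y)^2)) * (w (z / y) * v y)) * F z)"
 proof (rule nn_integral_cong_nonzero)
  fix y :: complex assume y: "y ~= 0"
  define G where "G z = w (z / y) * F z" for z
  have Gm: "G \<in> bmeas borel" unfolding G_def by measurable
  have c: "ennreal (inverse ((cmod y)^2)) * ennreal ((cmod y)^2) = 1" using y by (subst ennreal_mult[symmetric]) auto
  have "(\<integral>z:\<C>. w z * F (z * y)) = (\<integral>z:\<C>. G (y * z))"
   using y by (intro nn_integral_cong) (simp add: G_def mult.commute)
  also have "... = ennreal (inverse ((cmod y)^2)) * (\<integral>z:\<C>. G z)"
   unfolding nn_integral_lborel_complex_scale[OF y Gm, symmetric] mult.assoc[symmetric] c by simp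
  finally have "v y * (\<integral>z:\<C>. w z * F (z * y)) = (ennreal (inverse ((cmod y)^2)) * v y) * (\<integral>z:\<C>. G z)"
   by (simp only: ac_simps)
  also have "... = (\<integral>z:\<C>. (ennreal (inverse ((cmod y)^2)) * v y) * G z)"
   using Gm by (intro nn_integral_cmult[symmetric]) simp
  finally show "v y * (\<integral>z:\<C>. w z * F (z * y)) = (\<integral>z:\<C>. (ennreal (inverse ((cmod y)^2)) * (w (z / y) * v y)) * F z)"
   by (simp only: G_def ac_simps)
 qed
 also have "... = (\<integral>z:\<C>. \<integral>y:\<C>. (ennreal (inverse ((cmod y)^2)) * (w (z / y) * v y)) * F z)"
  by (rule lborel_pair.Fubini') measurable
 also have "... = (\<integral>z:\<C>. scalar_conv w v z * F z)"
  unfolding scalar_conv_def by (intro nn_integral_cong nn_integral_multc) measurable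
 finally show ?thesis .
qed

text \<open>Identifies the recursive convolution of scalar weights with the push-forward in
  \<open>product_weight\<close>. As for the matrices, the last variable is kept outermost and each
  step adds one convolution.\<close>

theorem nn_integral_eig_weight:
 assumes "\<And>j. j < Suc k ==> \<epsilon> j \<in> {1, - 1}" "1 \<le> n" "F \<in> bmeas borel"
 shows "(\<integral>x:\<C>^(Suc k). (\<Prod>j<Suc k. factor_weight (\<epsilon> j) n (x j)) * F (\<Prod>j<Suc k. x j powi \<epsilon> j))
  = (\<integral>z:\<C>. eig_weight \<epsilon> n k z * F z)"
 using assms
proof (induction k arbitrary: F)
 case 0
 have [measurable]: "F \<in> bmeas borel" by (rule 0(3))
 have "(\<integral>x:\<C>^(Suc 0). (\<Prod>j<Suc 0. factor_weight (\<epsilon> j) n (x j)) * F (\<Prod>j<Suc 0. x j powi \<epsilon> j))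
   = (\<integral>\<^sup>+x. factor_weight (\<epsilon> 0) n (x 0) * F (x 0 powi \<epsilon> 0) \<partial>(\<Pi>\<^sub>M i\<in>{0 :: nat}. lborel))"
  by (simp add: lessThan_Suc)
 also have "... = (\<integral>y:\<C>. factor_weight (\<epsilon> 0) n y * F (y powi \<epsilon> 0))"
  by (rule lborel_prod.product_nn_integral_singleton[of "\<lambda>y. factor_weight (\<epsilon> 0) n y * F (y powi \<epsilon> 0)"]) simp
 finally show ?case using nn_integral_factor_weight[OF 0(3), of "\<epsilon> 0" n] 0 by simp
next
 case (Suc k)
 have Fm [measurable]: "F \<in> bmeas borel" by (rule Suc.prems(3))
 let ?K = "Suc k"
 define h where "h x = (\<Prod>j<Suc ?K. factor_weight (\<epsilon> j) n (x j)) * F (\<Prod>j<Suc ?K. x j powi \<epsilon> j)" for x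
 have comp: "(\<lambda>x. x j) \<in> lpow (Suc ?K) \<rightarrow>\<^sub>M borel" if "j < Suc ?K" for j
  by (rule measurable_lebesgue_pow_component[OF that])
 have hm: "h \<in> bmeas (lpow (Suc ?K))"
  unfolding h_def by (intro measurable_times borel_measurable_prod_ennreal measurable_compose[OF _ measurable_factor_weight]
    measurable_compose[OF _ Fm] borel_measurable_prod measurable_compose[OF _ measurable_powi] comp) auto
 have hu: "h (x(?K := y)) = factor_weight (\<epsilon> ?K) n y * ((\<Prod>j<?K. factor_weight (\<epsilon> j) n (x j)) * F ((\<Prod>j<?K. x j powi \<epsilon> j) * y powi \<epsilon> ?K))" for x y
 proof -
  have "(\<Prod>j<?K. factor_weight (\<epsilon> j) n ((x(?K := y)) j)) = (\<Prod>j<?K. factor_weight (\<epsilon> j) n (x j))"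
   "(\<Prod>j<?K. (x(?K := y)) j powi \<epsilon> j) = (\<Prod>j<?K. x j powi \<epsilon> j)" by (intro prod.cong; simp)+
  then show ?thesis unfolding h_def prod.lessThan_Suc[of _ ?K] by (simp only: fun_upd_same ac_simps)
 qed
 let ?H = "\<lambda>y. \<integral>z:\<C>. eig_weight \<epsilon> n k z * F (z * y)"
 have Hm: "?H \<in> bmeas borel" by measurable
 have "(\<integral>x:\<C>^(Suc ?K). h x) = (\<integral>y:\<C>. \<integral>x:\<C>^?K. h (x(?K := y)))"
  by (rule nn_integral_lebesgue_pow_Suc[OF hm])
 also have "... = (\<integral>y:\<C>. factor_weight (\<epsilon> ?K) n y * ?H (y powi \<epsilon> ?K))"
 proof (rule nn_integral_cong)
  fix y :: complex
  have Fy: "(\<lambda>z. F (z * y powi \<epsilon> ?K)) \<in> bmeas borel" by measurable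
  have m: "(\<lambda>x. (\<Prod>j<?K. factor_weight (\<epsilon> j) n (x j)) * F ((\<Prod>j<?K. x j powi \<epsilon> j) * y powi \<epsilon> ?K)) \<in> bmeas (lpow ?K)"
   by (intro measurable_times borel_measurable_prod_ennreal measurable_compose[OF _ measurable_factor_weight]
    measurable_compose[OF _ Fy] borel_measurable_prod measurable_compose[OF _ measurable_powi] measurable_lebesgue_pow_component) auto
  show "(\<integral>x:\<C>^?K. h (x(?K := y))) = factor_weight (\<epsilon> ?K) n y * ?H (y powi \<epsilon> ?K)"
   unfolding hu nn_integral_cmult[OF m] using Suc.IH[OF _ Suc.prems(2) Fy] Suc.prems(1) by simp
 qed
 also have "... = (\<integral>y:\<C>. scalar_weight (\<epsilon> ?K) n y * ?H y)"
  by (rule nn_integral_factor_weight[OF Hm]) (use Suc.prems in auto)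
 also have "... = (\<integral>z:\<C>. eig_weight \<epsilon> n ?K z * F z)"
  unfolding eig_weight.simps(2) by (rule nn_integral_scalar_conv) simp_all
 finally show ?case unfolding h_def .
qed

section \<open>Moments and rotation invariance of the scalar weight\<close>

lemma nn_integral_gauss_complex_finite: "(\<integral>\<^sup>+z. ennreal (exp (- (cmod z)\<^sup>2)) \<partial>clborel) < \<infinity>"
proof -
 let ?g = "\<lambda>x :: real. ennreal (exp (- x\<^sup>2))"
 have fin: "(\<integral>\<^sup>+x. ?g x \<partial>lborel) < \<infinity>"
 proof -
  \<comment> \<open>Standard deviation 1 / sqrt 2 gives the density exp(-x^2) / sqrt pi.\<close>
  interpret prob_space "density lborel (normal_density 0 (1 / sqrt 2))" by (rule prob_space_normal_density) simp
  have "(\<integral>\<^sup>+x. ennreal (normal_density 0 (1 / sqrt 2) x) \<partial>lborel) = 1"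
   using emeasure_space_1 by (simp add: emeasure_density)
  moreover have "normal_density 0 (1 / sqrt 2) x = exp (- x\<^sup>2) / sqrt pi" for x
   by (simp add: normal_density_def power_divide)
  ultimately have *: "(\<integral>\<^sup>+x. ennreal (exp (- x\<^sup>2) / sqrt pi) \<partial>lborel) = 1" by simp
  have "(\<integral>\<^sup>+x. ?g x \<partial>lborel) = (\<integral>\<^sup>+x. ennreal (sqrt pi) * ennreal (exp (- x\<^sup>2) / sqrt pi) \<partial>lborel)"
   by (intro nn_integral_cong) (simp add: ennreal_mult[symmetric])
  also have "... = ennreal (sqrt pi) * 1" unfolding *[symmetric] by (intro nn_integral_cmult) measurable
  finally show ?thesis by simp
 qed
 have "(\<integral>\<^sup>+z. ennreal (exp (- (cmod z)\<^sup>2)) \<partial>clborel) =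
   (\<integral>\<^sup>+z. (\<Prod>b\<in>Basis. ?g (inner z b)) \<partial>clborel)"
  by (intro nn_integral_cong) (simp add: Basis_complex_def cmod_power2 inner_complex_def ennreal_mult[symmetric] exp_add[symmetric])
 also have "... = (\<Prod>b\<in>(Basis :: complex set). \<integral>\<^sup>+x. ?g x \<partial>lborel)"
  by (intro nn_integral_lborel_prod) auto
 also have "... < \<infinity>" using fin by (simp add: Basis_complex_def ennreal_mult_less_top)
 finally show ?thesis .
qed

text \<open>The squared norm of the monomial z^i with respect to the weight w.\<close>

definition moment :: "nat => (complex => ennreal) => ennreal" where
 "moment i w = (\<integral>z:\<C>. w z * ennreal (cmod z ^ (2 * i)))"

lemma power_le_exp: "0 \<le> (t :: real) ==> t ^ i \<le> fact i * exp t"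
proof -
 assume t: "0 \<le> t"
 have "(\<Sum>n\<in>{i}. t ^ n /\<^sub>R fact n) \<le> (\<Sum>n. t ^ n /\<^sub>R fact n)"
  by (rule sum_le_suminf) (use t summable_exp_generic[of t] in auto)
 then show ?thesis by (simp add: exp_def field_simps)
qed

text \<open>With t = |z|^2 / 2 the bound t^i \<le> i! e^t leaves the Gaussian exp(-|z|^2 / 2), which
  is integrable by scaling.\<close>

lemma gauss_moment_finite: "(\<integral>\<^sup>+z. ennreal (exp (- (cmod z)\<^sup>2) * cmod z ^ (2 * i)) \<partial>clborel) < \<infinity>"
proof -
 define E :: "complex => ennreal" where "E z = ennreal (exp (- (cmod z)\<^sup>2))" for z
 have Em [measurable]: "E \<in> bmeas borel" unfolding E_def by measurable
 let ?r = "complex_of_real (1 / sqrt 2)"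
 have le: "ennreal (exp (- (cmod z)\<^sup>2) * cmod z ^ (2 * i)) \<le> ennreal (fact i * 2 ^ i) * E (?r * z)" for z :: complex
 proof -
  let ?t = "(cmod z)^2 / 2"
  have t: "(cmod (?r * z))^2 = ?t" by (simp add: norm_mult norm_divide power_divide power_mult_distrib)
  have "cmod z ^ (2 * i) = 2 ^ i * ?t ^ i" by (simp add: power_mult power_divide)
  also have "... \<le> 2 ^ i * (fact i * exp ?t)" by (intro mult_left_mono power_le_exp) auto
  finally have "exp (- (cmod z)\<^sup>2) * cmod z ^ (2 * i) \<le> exp (- (cmod z)\<^sup>2) * (2 ^ i * (fact i * exp ?t))"
   by (intro mult_left_mono) auto
  also have "... = fact i * 2 ^ i * (exp (- (cmod z)\<^sup>2) * exp ?t)" by simp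
  also have "exp (- (cmod z)\<^sup>2) * exp ?t = exp (- ?t)" by (simp add: exp_add[symmetric])
  finally have "exp (- (cmod z)\<^sup>2) * cmod z ^ (2 * i) \<le> fact i * 2 ^ i * exp (- ?t)" .
  then show ?thesis unfolding E_def t by (subst ennreal_mult[symmetric]) (auto intro!: ennreal_leI)
 qed
 have "(\<integral>\<^sup>+z. ennreal (exp (- (cmod z)\<^sup>2) * cmod z ^ (2 * i)) \<partial>clborel) \<le> (\<integral>z:\<C>. ennreal (fact i * 2 ^ i) * E (?r * z))"
  by (intro nn_integral_mono le)
 also have "... = ennreal (fact i * 2 ^ i) * (\<integral>z:\<C>. E (?r * z))"
  by (intro nn_integral_cmult) measurable
 also have "... < \<infinity>"
 proof -
  have "ennreal ((cmod ?r)^2) * (\<integral>z:\<C>. E (?r * z)) = (\<integral>z:\<C>. E z)"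
   by (rule nn_integral_lborel_complex_scale[OF _ Em]) simp
  also have "... < \<infinity>" using nn_integral_gauss_complex_finite unfolding E_def .
  finally have "(\<integral>z:\<C>. E (?r * z)) < \<infinity>"
   by (auto simp: ennreal_mult_less_top norm_divide less_top[symmetric] ennreal_mult_eq_top_iff)
  then show ?thesis by (simp add: ennreal_mult_less_top)
 qed
 finally show ?thesis .
qed

text \<open>For e = -1 the moment carries |y|^(-2i), which the factor |y|^(2(n - 1)) of the weight
  compensates exactly as long as i is at most n - 1. These are the n monomials that the kernel
  uses.\<close>

lemma moment_scalar_weight_finite:
 assumes "i < n" "e \<in> {1, - 1}"
 shows "moment i (scalar_weight e n) < \<infinity>"
proof -
 have m: "(\<lambda>y :: complex. ennreal (cmod y ^ (2 * i))) \<in> bmeas borel" by measurable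
 have "moment i (scalar_weight e n) = (\<integral>y:\<C>. factor_weight e n y * ennreal (cmod (y powi e) ^ (2 * i)))"
  unfolding moment_def using assms by (intro nn_integral_factor_weight[OF m, symmetric]) auto
 also have "... = (\<integral>y:\<C>. ennreal (exp (- (cmod y)\<^sup>2) * cmod y ^ (2 * (if e = 1 then i else n - 1 - i))))"
 proof (rule nn_integral_cong_nonzero)
  fix y :: complex assume y: "y ~= 0"
  show "factor_weight e n y * ennreal (cmod (y powi e) ^ (2 * i)) = ennreal (exp (- (cmod y)\<^sup>2) * cmod y ^ (2 * (if e = 1 then i else n - 1 - i)))"
  proof (cases "e = 1")
   case True
   then show ?thesis by (simp add: factor_weight_def ennreal_mult)
  next
   case False
   then have e: "e = - 1" using assms by simp
   have "(1 - e) * (int n - 1) = int (2 * (n - 1))" using e assms by (simp add: of_nat_diff)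
   then have "factor_weight e n y = ennreal (exp (- (cmod y)\<^sup>2) * cmod y ^ (2 * (n - 1)))"
    by (simp only: factor_weight_def power_int_of_nat)
   moreover have "cmod (y powi e) ^ (2 * i) = inverse (cmod y ^ (2 * i))"
    using e by (simp add: power_int_minus norm_inverse power_inverse)
   moreover have "cmod y ^ (2 * (n - 1)) = cmod y ^ (2 * (n - 1 - i)) * cmod y ^ (2 * i)"
    using assms by (simp add: power_add[symmetric] algebra_simps flip: distrib_left)
   ultimately show ?thesis using y False by (simp add: ennreal_mult[symmetric])
  qed
 qed
 also have "... < \<infinity>" by (rule gauss_moment_finite)
 finally show ?thesis .
qed

text \<open>The convolution is the weight of a product, and |zy|^(2i) factors, so moments
  multiply.\<close>

lemma moment_scalar_conv:
 assumes [measurable]: "w \<in> bmeas borel" "v \<in> bmeas borel"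
 shows "moment i (scalar_conv w v) = moment i w * moment i v"
proof -
 have "moment i (scalar_conv w v) = (\<integral>y:\<C>. v y * (\<integral>z:\<C>. w z * ennreal (cmod (z * y) ^ (2 * i))))"
  unfolding moment_def by (rule nn_integral_scalar_conv[symmetric]) measurable
 also have "... = (\<integral>y:\<C>. moment i w * (v y * ennreal (cmod y ^ (2 * i))))"
 proof (rule nn_integral_cong)
  fix y :: complex
  have "(\<integral>z:\<C>. w z * ennreal (cmod (z * y) ^ (2 * i))) = (\<integral>z:\<C>. (w z * ennreal (cmod z ^ (2 * i))) * ennreal (cmod y ^ (2 * i)))"
   by (intro nn_integral_cong) (simp add: norm_mult power_mult_distrib ennreal_mult mult.assoc)
  also have "... = moment i w * ennreal (cmod y ^ (2 * i))" unfolding moment_def by (intro nn_integral_multc) measurable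
  finally show "v y * (\<integral>z:\<C>. w z * ennreal (cmod (z * y) ^ (2 * i))) = moment i w * (v y * ennreal (cmod y ^ (2 * i)))"
   by (simp only: ac_simps)
 qed
 also have "... = moment i w * moment i v" unfolding moment_def by (intro nn_integral_cmult) measurable
 finally show ?thesis .
qed

lemma moment_eig_weight_finite:
 assumes "i < n" "\<And>j. j < Suc k ==> \<epsilon> j \<in> {1, - 1}"
 shows "moment i (eig_weight \<epsilon> n k) < \<infinity>"
 using assms(2)
proof (induction k)
 case 0
 then show ?case using moment_scalar_weight_finite[OF assms(1)] by simp
next
 case (Suc k)
 then show ?case using moment_scalar_weight_finite[OF assms(1), of "\<epsilon> (Suc k)"]
  by (simp add: moment_scalar_conv measurable_scalar_weight measurable_eig_weight ennreal_mult_less_top)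
qed

lemma moment_scalar_weight_pos: "moment i (scalar_weight e n) ~= 0"
proof
 have pos: "scalar_weight e n z * ennreal (cmod z ^ (2 * i)) ~= 0" if "z ~= 0" for z
 proof -
  have "0 < cmod z ^ (2 * i)" "0 < inverse (cmod z ^ (2 * (n - 1) + 4))" using that by simp_all
  then show ?thesis by (auto simp: scalar_weight_def ennreal_eq_0_iff mult_le_0_iff not_le)
 qed
 assume "moment i (scalar_weight e n) = 0"
 then have "AE z in clborel. scalar_weight e n z * ennreal (cmod z ^ (2 * i)) = 0"
  unfolding moment_def by (subst (asm) nn_integral_0_iff_AE) measurable
 then have "AE z in clborel. False"
  using AE_lborel_singleton[of "0 :: complex"] by eventually_elim (use pos in blast)
 then show False by (simp add: eventually_False ae_filter_eq_bot_iff)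
qed

lemma moment_eig_weight_pos: "moment i (eig_weight \<epsilon> n k) ~= 0"
 by (induction k)
  (simp_all add: moment_scalar_weight_pos moment_scalar_conv measurable_scalar_weight measurable_eig_weight)

lemma eig_weight_rotate: "cmod c = 1 ==> eig_weight \<epsilon> n k (c * z) = eig_weight \<epsilon> n k z"
proof (induction k arbitrary: z)
 case 0
 then show ?case by (simp add: scalar_weight_def norm_mult)
next
 case (Suc k)
 then show ?case by (simp add: scalar_conv_def flip: times_divide_eq_right)
qed

lemma distr_lborel_rotate:
 fixes c :: complex
 assumes c: "cmod c = 1"
 shows "distr lborel borel (\<lambda>z. c * z) = lborel"
proof (rule measure_eqI)
 fix E :: "complex set" assume "E \<in> sets (distr lborel borel (\<lambda>z. c * z))"
 then have E: "E \<in> sets borel" by simp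
 have c0: "c ~= 0" using c by auto
 have m: "(\<lambda>z. c * z) \<in> bmeas lborel" by simp
 have "emeasure (distr lborel borel (\<lambda>z. c * z)) E = (\<integral>\<^sup>+z. indicator E z \<partial>distr lborel borel (\<lambda>z. c * z))"
  using E by simp
 also have "... = (\<integral>z:\<C>. indicator E (c * z))" using E by (intro nn_integral_distr m) simp
 also have "... = emeasure lborel E"
  using nn_integral_lborel_complex_scale[OF c0, of "indicator E"] E c by simp
 finally show "emeasure (distr lborel borel (\<lambda>z. c * z)) E = emeasure lborel E" .
qed simp

section \<open>Orthonormal monomials for the scalar weight\<close>

context
 fixes \<epsilon> :: "nat => int" and n k :: nat
 assumes \<epsilon>: "\<And>j. j < Suc k ==> \<epsilon> j \<in> {1, - 1}" and n: "1 \<le> n"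
begin

text \<open>The extended weight may be infinite on a null set; \<open>enn2real\<close> replaces
  these values by 0.\<close>

definition real_weight :: "complex => real" where
 "real_weight z = enn2real (eig_weight \<epsilon> n k z)"

definition real_moment :: "nat => real" where
 "real_moment i = enn2real (moment i (eig_weight \<epsilon> n k))"

definition ortho_fun :: "nat => complex => complex" where
 "ortho_fun i z = complex_of_real (sqrt (real_weight z / real_moment i)) * z ^ i"

lemma measurable_real_weight [measurable]: "real_weight \<in> bmeas borel"
 unfolding real_weight_def[abs_def] by measurable

lemma measurable_ortho_fun: "ortho_fun i \<in> bmeas borel"
 unfolding ortho_fun_def[abs_def] by measurable

lemma real_weight_nonneg [simp]: "0 \<le> real_weight z"
 by (simp add: real_weight_def)

lemma real_weight_rotate: "cmod c = 1 ==> real_weight (c * z) = real_weight z"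
 by (simp add: real_weight_def eig_weight_rotate)

lemma AE_real_weight: "AE z in lborel. ennreal (real_weight z) = eig_weight \<epsilon> n k z"
proof -
 have "moment 0 (eig_weight \<epsilon> n k) < \<infinity>" using n \<epsilon> by (intro moment_eig_weight_finite) auto
 then have "(\<integral>z:\<C>. eig_weight \<epsilon> n k z) ~= \<infinity>" by (simp add: moment_def less_top)
 then have "AE z in lborel. eig_weight \<epsilon> n k z ~= \<infinity>" by (intro nn_integral_PInf_AE) simp_all
 then show ?thesis by eventually_elim (simp add: real_weight_def less_top)
qed

lemma real_moment_pos: "i < n ==> 0 < real_moment i"
 using moment_eig_weight_finite[of i n k \<epsilon>] moment_eig_weight_pos[of i \<epsilon> n k] \<epsilon>
 by (simp add: real_moment_def enn2real_positive_iff less_top zero_less_iff_neq_zero)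

lemma has_bochner_integral_moment:
 assumes i: "i < n"
 shows "has_bochner_integral lborel (\<lambda>z. real_weight z * cmod z ^ (2 * i)) (real_moment i)"
proof (rule has_bochner_integral_nn_integral)
 have "(\<integral>z:\<C>. ennreal (real_weight z * cmod z ^ (2 * i))) = moment i (eig_weight \<epsilon> n k)"
  unfolding moment_def
  by (rule nn_integral_cong_AE, rule AE_mp[OF AE_real_weight AE_I2]) (simp add: ennreal_mult)
 also have "... = ennreal (real_moment i)"
  using moment_eig_weight_finite[of i n k \<epsilon>] i \<epsilon> by (simp add: real_moment_def less_top)
 finally show "(\<integral>z:\<C>. ennreal (real_weight z * cmod z ^ (2 * i))) = ennreal (real_moment i)" .
qed (auto simp: real_moment_def)

lemma ortho_fun_mult:
 "ortho_fun i y * cnj (ortho_fun j y) =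
  complex_of_real (real_weight y) * (y ^ i * cnj y ^ j) * complex_of_real (1 / (sqrt (real_moment i) * sqrt (real_moment j)))"
proof -
 have "sqrt (real_weight y / real_moment i) * sqrt (real_weight y / real_moment j) = real_weight y * (1 / (sqrt (real_moment i) * sqrt (real_moment j)))"
  by (simp add: real_sqrt_divide)
 then have "complex_of_real (sqrt (real_weight y / real_moment i)) * complex_of_real (sqrt (real_weight y / real_moment j))
   = complex_of_real (real_weight y) * complex_of_real (1 / (sqrt (real_moment i) * sqrt (real_moment j)))"
  by (simp only: of_real_mult[symmetric])
 moreover have "ortho_fun i y * cnj (ortho_fun j y) =
   (complex_of_real (sqrt (real_weight y / real_moment i)) * complex_of_real (sqrt (real_weight y / real_moment j))) * (y ^ i * cnj y ^ j)"
  by (simp add: ortho_fun_def)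
 ultimately show ?thesis by (simp only: ac_simps)
qed

text \<open>For equal indices the integral is a normalised moment. For different indices a rotation
  leaves the weight and the measure alone and multiplies the integrand by a phase, which a suitable
  angle makes -1.\<close>

lemma orthonormal_ortho_fun: "orthonormal n ortho_fun"
proof
 fix i j assume i: "i < n" and j: "j < n"
 show "has_bochner_integral lborel (\<lambda>y. ortho_fun i y * cnj (ortho_fun j y)) (if i = j then 1 else 0)"
 proof (cases "i = j")
  case True
  have "has_bochner_integral lborel (\<lambda>y. complex_of_real (1 / real_moment i * (real_weight y * cmod y ^ (2 * i)))) (complex_of_real (1 / real_moment i * real_moment i))"
   by (intro has_bochner_integral_of_real has_bochner_integral_mult_right has_bochner_integral_moment[OF i])
  moreover have "complex_of_real (1 / real_moment i * real_moment i) = 1" using real_moment_pos[OF i] by simp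
  moreover have "ortho_fun i y * cnj (ortho_fun i y) = complex_of_real (1 / real_moment i * (real_weight y * cmod y ^ (2 * i)))" for y
  proof -
   have "y ^ i * cnj y ^ i = complex_of_real (cmod y ^ (2 * i))"
    by (simp add: power_mult_distrib[symmetric] complex_norm_square[symmetric] power_mult)
   moreover have "sqrt (real_moment i) * sqrt (real_moment i) = real_moment i" using real_moment_pos[OF i] by simp
   ultimately show ?thesis unfolding ortho_fun_mult by simp
  qed
  ultimately show ?thesis using True by simp
 next
  case False
  define f where "f y = complex_of_real (real_weight y) * (y ^ i * cnj y ^ j)" for y
  have fm [measurable]: "f \<in> bmeas borel"
  proof -
   have [measurable]: "cnj \<in> bmeas borel" by (intro borel_measurable_continuous_onI continuous_intros)
   show ?thesis unfolding f_def by measurable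
  qed
  have fi: "integrable lborel f"
  proof (rule Bochner_Integration.integrable_bound)
   show "integrable lborel (\<lambda>z. real_weight z * cmod z ^ (2 * i) + real_weight z * cmod z ^ (2 * j))"
    using has_bochner_integral_moment[OF i] has_bochner_integral_moment[OF j] by (auto simp: has_bochner_integral_iff)
   show "AE z in lborel. norm (f z) \<le> norm (real_weight z * cmod z ^ (2 * i) + real_weight z * cmod z ^ (2 * j))"
   proof (rule AE_I2)
    fix z :: complex
    \<comment> \<open>The mixed moment is bounded by the two moments of orders i and j, which are
      finite; this gives integrability.\<close>
    have "2 * (cmod z ^ i * cmod z ^ j) \<le> (cmod z ^ i)^2 + (cmod z ^ j)^2" using sum_squares_bound[of "cmod z ^ i" "cmod z ^ j"] by simp
    moreover have "0 \<le> cmod z ^ i * cmod z ^ j" by simp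
    moreover have "(cmod z ^ m)^2 = cmod z ^ (2 * m)" for m by (simp add: power_mult[symmetric] mult.commute)
    ultimately have "cmod z ^ i * cmod z ^ j \<le> cmod z ^ (2 * i) + cmod z ^ (2 * j)"
    by (simp only:)
    from mult_left_mono[OF this real_weight_nonneg[of z]]
    have "real_weight z * (cmod z ^ i * cmod z ^ j) \<le> real_weight z * cmod z ^ (2 * i) + real_weight z * cmod z ^ (2 * j)"
    by (simp add: distrib_left)
    then show "norm (f z) \<le> norm (real_weight z * cmod z ^ (2 * i) + real_weight z * cmod z ^ (2 * j))"
    by (simp add: f_def norm_mult norm_power)
   qed
  qed simp
  \<comment> \<open>The angle pi/(i - j) makes the phase picked up by z^i times the conjugate of z^j
    equal to -1, so the integral is its own negative.\<close>
  define c where "c = cis (pi / (real i - real j))"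
  have c1: "cmod c = 1" by (simp add: c_def)
  have rot: "real_weight (z * c) = real_weight z" for z
   using real_weight_rotate[OF c1, of z] by (simp only: mult.commute)
  have cc: "c ^ i * cnj c ^ j = - 1"
  proof -
   have "c ^ i * cnj c ^ j = cis (real i * (pi / (real i - real j))) * cis (- (real j * (pi / (real i - real j))))"
    unfolding c_def cis_cnj Complex.DeMoivre by simp
   also have "... = cis ((real i - real j) * (pi / (real i - real j)))" by (simp add: cis_mult algebra_simps diff_divide_distrib)
   also have "... = - 1" using False by simp
   finally show ?thesis .
  qed
  have "integral\<^sup>L lborel f = integral\<^sup>L (distr lborel borel (\<lambda>z. c * z)) f" by (simp only: distr_lborel_rotate[OF c1])
  also have "... = (LINT z|lborel. f (c * z))" by (intro integral_distr) simp_all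
  also have "... = (LINT z|lborel. (c ^ i * cnj c ^ j) * f z)"
   by (intro Bochner_Integration.integral_cong refl) (simp add: f_def real_weight_rotate[OF c1] rot power_mult_distrib ac_simps)
  also have "... = - integral\<^sup>L lborel f" unfolding cc by simp
  finally have "integral\<^sup>L lborel f = 0" by (simp add: equal_neg_zero)
  then have "has_bochner_integral lborel f 0" using fi by (simp add: has_bochner_integral_iff)
  from has_bochner_integral_mult_left[OF this, of "complex_of_real (1 / (sqrt (real_moment i) * sqrt (real_moment j)))"]
  show ?thesis unfolding ortho_fun_mult f_def using False by simp
 qed
qed

interpretation ortho: orthonormal n ortho_fun by (rule orthonormal_ortho_fun)

definition norm_const :: real where
 "norm_const = (\<Prod>l<n. 1 / real_moment l)"

lemma norm_const_pos: "0 < norm_const"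
 unfolding norm_const_def using real_moment_pos by (intro prod_pos) auto

text \<open>The matrix of function values is a Vandermonde matrix with rows scaled by the square
  roots of the weight and columns by those of the inverse moments. The determinant of the kernel is
  the squared modulus of its determinant.\<close>

lemma D_eq_ginibre:
 "ortho.D n z = norm_const * (\<Prod>l<n. real_weight (z l)) * (\<Prod>j<n. \<Prod>i<j. (cmod (z i - z j))^2)"
proof -
 let ?s = "\<lambda>i. complex_of_real (sqrt (real_weight (z i)))" and ?a = "\<lambda>l. complex_of_real (sqrt (1 / real_moment l))"
 have c: "ortho.\<Phi> n z \<in> cmat n n" "vandermonde n z \<in> cmat n n" by (simp_all add: ortho.\<Phi>_def vandermonde_def)
 have "det (ortho.\<Phi> n z) = (\<Prod>i<n. ?s i) * (\<Prod>l<n. ?a l) * det (vandermonde n z)"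
  unfolding det_def'[OF c(1)] det_def'[OF c(2)] sum_distrib_left
 proof (rule sum.cong[OF refl])
  fix p assume "p \<in> {p. p permutes {0..<n}}"
  then have p: "p permutes {0..<n}" by simp
  have "(\<Prod>i = 0..<n. ortho.\<Phi> n z $$ (i, p i)) = (\<Prod>i = 0..<n. ?s i * ?a (p i) * vandermonde n z $$ (i, p i))"
  proof (rule prod.cong[OF refl])
   fix i assume i: "i \<in> {0..<n}"
   then have pi: "p i \<in> {0..<n}" using permutes_in_image[OF p] by blast
   have "sqrt (real_weight (z i) / real_moment (p i)) = sqrt (real_weight (z i)) * sqrt (1 / real_moment (p i))"
    by (simp add: real_sqrt_divide)
   then show "ortho.\<Phi> n z $$ (i, p i) = ?s i * ?a (p i) * vandermonde n z $$ (i, p i)"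
    using i pi by (simp add: ortho.\<Phi>_def vandermonde_def ortho_fun_def)
  qed
  also have "... = (\<Prod>i<n. ?s i) * (\<Prod>l<n. ?a l) * (\<Prod>i = 0..<n. vandermonde n z $$ (i, p i))"
   using prod.permute[OF p, of ?a] by (simp add: prod.distrib lessThan_atLeast0 comp_def)
  finally show "signof p * (\<Prod>i = 0..<n. ortho.\<Phi> n z $$ (i, p i)) =
    (\<Prod>i<n. ?s i) * (\<Prod>l<n. ?a l) * (signof p * (\<Prod>i = 0..<n. vandermonde n z $$ (i, p i)))"
   by (simp only: ac_simps)
 qed
 then have "(cmod (det (ortho.\<Phi> n z)))^2 =
   (\<Prod>i<n. (cmod (?s i))^2) * (\<Prod>l<n. (cmod (?a l))^2) * (\<Prod>j<n. \<Prod>i<j. (cmod (z j - z i))^2)"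
  by (simp add: det_vandermonde norm_mult power_mult_distrib prod_norm[symmetric] prod_power_distrib)
 also have "(\<Prod>i<n. (cmod (?s i))^2) = (\<Prod>l<n. real_weight (z l))" by (intro prod.cong refl) simp
 also have "(\<Prod>l<n. (cmod (?a l))^2) = norm_const"
  unfolding norm_const_def using real_moment_pos by (intro prod.cong refl) (simp add: less_imp_le)
 also have "(\<Prod>j<n. \<Prod>i<j. (cmod (z j - z i))^2) = (\<Prod>j<n. \<Prod>i<j. (cmod (z i - z j))^2)"
  by (simp only: norm_minus_commute)
 finally have sq: "(cmod (det (ortho.\<Phi> n z)))^2 =
   (\<Prod>l<n. real_weight (z l)) * norm_const * (\<Prod>j<n. \<Prod>i<j. (cmod (z i - z j))^2)" .
 have "ortho.D n z = (cmod (det (ortho.\<Phi> n z)))^2"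
  using ortho.det_kernel_factor[of n z] by (simp add: ortho.D_def)
 then show ?thesis unfolding sq by (simp only: ac_simps)
qed

end

section \<open>Correlation functions and the main theorem\<close>

context orthonormal
begin

lemma measurable_kernel:
 assumes \<phi>: "\<And>l. \<phi> l \<in> bmeas borel"
 shows "case_prod K \<in> bmeas (borel \<Otimes>\<^sub>M borel)"
proof -
 have [measurable]: "\<phi> l \<in> bmeas borel" for l by (rule \<phi>)
 have [measurable]: "cnj \<in> bmeas borel" by (intro borel_measurable_continuous_onI continuous_intros)
 show ?thesis unfolding K_def case_prod_unfold by measurable
qed

lemma measurable_D:
 assumes \<phi>: "\<And>l. \<phi> l \<in> bmeas borel"
 shows "D r \<in> bmeas (lpow r)"
proof -
 have "kernel_mat K r \<in> lpow r \<rightarrow>\<^sub>M lmat r r"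
 proof (rule measurable_lmat)
  fix i j assume ij: "i < r" "j < r"
  have "(\<lambda>x. (x i, x j)) \<in> lpow r \<rightarrow>\<^sub>M borel \<Otimes>\<^sub>M borel"
   using ij by (intro measurable_Pair measurable_lebesgue_pow_component)
  from measurable_compose[OF this measurable_kernel[OF \<phi>]]
  show "(\<lambda>x. kernel_mat K r x $$ (i, j)) \<in> bmeas (lpow r)"
   using ij by (simp add: kernel_mat_def)
 qed (simp add: kernel_mat_def)
 then have "(\<lambda>x. det (kernel_mat K r x)) \<in> bmeas (lpow r)"
  by (rule meas_det)
 then show ?thesis unfolding D_def[abs_def] by (rule measurable_compose[OF _ borel_measurable_Re])
qed

text \<open>A rearrangement of the points permutes the rows of \<Phi>, which changes its determinant
  by a sign only.\<close>

lemma D_perm_vec: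
 assumes \<sigma>: "\<sigma> permutes {..<n}"
 shows "D n (perm_vec n \<sigma> z) = D n z"
proof -
 have c: "\<Phi> n z \<in> cmat n n" by (simp add: \<Phi>_def)
 have \<sigma>': "\<sigma> permutes {0..<n}" using \<sigma> by (simp add: lessThan_atLeast0)
 have "\<Phi> n (perm_vec n \<sigma> z) = Matrix.mat n n (\<lambda>(i, j). \<Phi> n z $$ (\<sigma> i, j))"
 proof (rule eq_matI)
  fix i j assume "i < dim_row (Matrix.mat n n (\<lambda>(i, j). \<Phi> n z $$ (\<sigma> i, j)))" "j < dim_col (Matrix.mat n n (\<lambda>(i, j). \<Phi> n z $$ (\<sigma> i, j)))"
  then have ij: "i < n" "j < n" by auto
  then have "\<sigma> i < n" using permutes_in_image[OF \<sigma>, of i] by simp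
  then show "\<Phi> n (perm_vec n \<sigma> z) $$ (i, j) = Matrix.mat n n (\<lambda>(i, j). \<Phi> n z $$ (\<sigma> i, j)) $$ (i, j)"
   using ij by (simp add: \<Phi>_def perm_vec_def)
 qed (auto simp: \<Phi>_def)
 then have "det (\<Phi> n (perm_vec n \<sigma> z)) = signof \<sigma> * det (\<Phi> n z)"
  by (simp only: det_permute_rows[OF c \<sigma>'])
 then have "cmod (det (\<Phi> n (perm_vec n \<sigma> z))) = cmod (det (\<Phi> n z))"
  by (simp add: norm_mult sign_def)
 then show ?thesis using det_kernel_factor[of n] by (simp add: D_def)
qed

text \<open>The variables are integrated out from the last one down to r. Passing from s + 1 to s
  variables contributes n - s, and these factors multiply to (n - r)!.\<close>

lemma nn_integral_D_marginal:
 assumes \<phi>: "\<And>l. \<phi> l \<in> bmeas borel" and r: "r \<le> n" and B: "B \<in> sets (lpow r)"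
 shows "(\<integral>z:\<C>^n. indicator B (restrict z {..<r}) * ennreal (D n z)) =
  fact (n - r) * (\<integral>\<^sup>+x\<in>B. ennreal (D r x) \<partial>lpow r)"
proof -
 have mr: "(\<lambda>z. restrict z {..<r}) \<in> lpow s \<rightarrow>\<^sub>M lpow r" if "r \<le> s" for s
  using that by (intro measurable_restrict_subset) auto
 have Dm: "(\<lambda>z. ennreal (D s z)) \<in> bmeas (lpow s)" for s
  using measurable_D[OF \<phi>] by (rule measurable_compose) simp
 have "r + d \<le> n ==> (\<integral>z:\<C>^(r + d). indicator B (restrict z {..<r}) * ennreal (D (r + d) z)) =
  of_nat (\<Prod>i<d. n - r - i) * (\<integral>\<^sup>+x\<in>B. ennreal (D r x) \<partial>lpow r)" for d
 proof (induction d)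
  case 0
  have "(\<integral>z:\<C>^r. indicator B (restrict z {..<r}) * ennreal (D r z)) = (\<integral>\<^sup>+x\<in>B. ennreal (D r x) \<partial>lpow r)"
   by (rule nn_integral_cong) (auto simp: space_PiM PiE_def extensional_restrict mult.commute)
  then show ?case unfolding add_0_right by (simp only: lessThan_0 prod.empty of_nat_1 mult_1)
 next
  case (Suc d)
  let ?s = "r + d"
  have s: "?s < n" using Suc.prems by simp
  define h where "h z = indicator B (restrict z {..<r}) * ennreal (D (Suc ?s) z)" for z
  have hm: "h \<in> bmeas (lpow (Suc ?s))"
   unfolding h_def by (intro measurable_times Dm measurable_compose[OF mr] borel_measurable_indicator B) simp
  have restr: "restrict (x(?s := y)) {..<r} = restrict x {..<r}" for x :: "nat => complex" and y
   by (auto simp: fun_eq_iff)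
  have ym: "(\<lambda>y. ennreal (D (Suc ?s) (x(?s := y)))) \<in> bmeas lborel" if "x \<in> space (lpow ?s)" for x
   by (rule measurable_compose[OF measurable_lebesgue_pow_upd Dm]) (use that in simp_all)
  have "(\<integral>z:\<C>^(Suc ?s). h z) = (\<integral>x:\<C>^?s. \<integral>y:\<C>. h (x(?s := y)))"
   using lborel_prod.product_nn_integral_insert[of "{..<?s}" ?s h] hm by (simp add: lebesgue_pow_Suc)
  also have "... = (\<integral>x:\<C>^?s. of_nat (n - ?s) * (indicator B (restrict x {..<r}) * ennreal (D ?s x)))"
  proof (rule nn_integral_cong)
   fix x assume x: "x \<in> space (lpow ?s)"
   have "(\<integral>y:\<C>. h (x(?s := y))) = indicator B (restrict x {..<r}) * (\<integral>y:\<C>. ennreal (D (Suc ?s) (x(?s := y))))"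
    unfolding h_def restr by (rule nn_integral_cmult[OF ym[OF x]])
   then show "(\<integral>y:\<C>. h (x(?s := y))) = of_nat (n - ?s) * (indicator B (restrict x {..<r}) * ennreal (D ?s x))"
    unfolding nn_integral_D[OF s] by (simp only: ac_simps)
  qed
  also have "... = of_nat (n - ?s) * (\<integral>x:\<C>^?s. indicator B (restrict x {..<r}) * ennreal (D ?s x))"
   by (intro nn_integral_cmult measurable_times Dm measurable_compose[OF mr] borel_measurable_indicator B) simp
  also have "... = of_nat (\<Prod>i<Suc d. n - r - i) * (\<integral>\<^sup>+x\<in>B. ennreal (D r x) \<partial>lpow r)"
  proof -
   have "?s \<le> n" using Suc.prems by simp
   from Suc.IH[OF this] show ?thesis
    by (simp only: prod.lessThan_Suc of_nat_mult diff_diff_left ac_simps)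
  qed
  finally show ?case unfolding h_def add_Suc_right .
 qed
 from this[of "n - r"] have "(\<integral>z:\<C>^n. indicator B (restrict z {..<r}) * ennreal (D n z)) =
  of_nat (\<Prod>i<n - r. n - r - i) * (\<integral>\<^sup>+x\<in>B. ennreal (D r x) \<partial>lpow r)" using r by simp
 also have "(of_nat (\<Prod>i<n - r. n - r - i) :: ennreal) = fact (n - r)"
  by (simp only: fact_prod_rev lessThan_atLeast0)
 finally show ?thesis .
qed

end

lemma AE_lebesgue_pow_component:
 assumes P: "AE z in lborel. P z" and i: "i < n"
 shows "AE x in lpow n. P (x i :: complex)"
proof -
 obtain N where N: "{z. \<not> P z} \<subseteq> N" "N \<in> sets lborel" "emeasure lborel N = 0"
  using P by (auto elim: AE_E)
 let ?E = "\<Pi>\<^sub>E l\<in>{..<n}. if l = i then N else UNIV"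
 have E: "?E \<in> sets (lpow n)" using N(2) by (intro sets_PiM_I_finite) auto
 have "emeasure (lpow n) ?E = (\<Prod>l\<in>{..<n}. emeasure lborel (if l = i then N else UNIV))"
  using N(2) by (intro lborel_prod.emeasure_PiM) auto
 also have "... = 0" using i N(3) by (intro prod_zero bexI[of _ i]) auto
 finally have "emeasure (lpow n) ?E = 0" .
 moreover have "{x \<in> space (lpow n). \<not> P (x i)} \<subseteq> ?E"
  using N(1) by (auto simp: space_PiM PiE_iff extensional_def split: if_splits)
 ultimately show ?thesis using E by (intro AE_I[of _ _ ?E])
qed

lemma distr_product_weight:
 assumes "\<And>j. j < Suc k ==> \<epsilon> j \<in> {1, - 1}" "1 \<le> n"
 shows "distr (density (lpow (Suc k)) (\<lambda>x. ennreal (exp (- (\<Sum>j<Suc k. (cmod (x j))\<^sup>2)) *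
   (\<Prod>j<Suc k. cmod (x j) powi ((1 - \<epsilon> j) * (int n - 1)))))) borel (\<lambda>x. \<Prod>j<Suc k. x j powi \<epsilon> j)
  = density lborel (eig_weight \<epsilon> n k)"
proof -
 let ?g = "\<lambda>x. \<Prod>j<Suc k. factor_weight (\<epsilon> j) n (x j)" and ?h = "\<lambda>x. \<Prod>j<Suc k. x j powi \<epsilon> j"
 have "ennreal (exp (- (\<Sum>j<Suc k. (cmod (x j))\<^sup>2)) * (\<Prod>j<Suc k. cmod (x j) powi ((1 - \<epsilon> j) * (int n - 1)))) = ?g x" for x :: "nat => complex"
  unfolding factor_weight_def
  by (subst prod_ennreal) (simp_all only: prod.distrib exp_sum finite_lessThan sum_negf[symmetric], simp)
 moreover have "distr (density (lpow (Suc k)) ?g) borel ?h = density lborel (eig_weight \<epsilon> n k)"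
 proof (rule measure_eqI)
  have gm: "?g \<in> bmeas (lpow (Suc k))"
   by (intro borel_measurable_prod_ennreal measurable_compose[OF _ measurable_factor_weight] measurable_lebesgue_pow_component) simp
  have hm: "?h \<in> bmeas (lpow (Suc k))"
   by (intro borel_measurable_prod measurable_compose[OF _ measurable_powi] measurable_lebesgue_pow_component) simp
  fix E assume "E \<in> sets (distr (density (lpow (Suc k)) ?g) borel ?h)"
  then have E: "E \<in> sets borel" by simp
  have hE: "?h -` E \<inter> space (lpow (Suc k)) \<in> sets (lpow (Suc k))" by (rule measurable_sets[OF hm E])
  have "emeasure (distr (density (lpow (Suc k)) ?g) borel ?h) E = emeasure (density (lpow (Suc k)) ?g) (?h -` E \<inter> space (lpow (Suc k)))"
   using hm E by (subst emeasure_distr) simp_all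
  also have "... = (\<integral>x:\<C>^(Suc k). ?g x * indicator (?h -` E \<inter> space (lpow (Suc k))) x)"
   by (rule emeasure_density[OF gm hE])
  also have "... = (\<integral>x:\<C>^(Suc k). ?g x * indicator E (?h x))"
   by (rule nn_integral_cong) (simp add: indicator_def)
  also have "... = (\<integral>z:\<C>. eig_weight \<epsilon> n k z * indicator E z)"
   by (rule nn_integral_eig_weight[OF assms]) (use E in auto)
  also have "... = emeasure (density lborel (eig_weight \<epsilon> n k)) E"
   using E by (intro emeasure_density[symmetric]) simp_all
  finally show "emeasure (distr (density (lpow (Suc k)) ?g) borel ?h) E = emeasure (density lborel (eig_weight \<epsilon> n k)) E" .
 qed simp
 ultimately show ?thesis by simp
qed

lemma size_filter_mset_map: "size (filter_mset P (mset (map v [0..<n]))) = (\<Sum>i<n. if P (v i) then 1 else 0)"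
 by (induction n) auto

lemma measurable_select: "t \<in> inj_tuples r n ==> (\<lambda>z. \<lambda>i\<in>{..<r}. z (t i)) \<in> lpow n \<rightarrow>\<^sub>M lpow r"
 by (intro measurable_restrict measurable_component_singleton) (auto simp: inj_tuples_def)

lemma measurable_mset_tuple_count:
 assumes "B \<in> sets (lpow r)"
 shows "measurable_mset (\<lambda>S. of_nat (tuple_count r S B))"
 unfolding measurable_mset_def of_nat_tuple_count
 by (intro allI borel_measurable_sum measurable_compose[OF measurable_select] borel_measurable_indicator assms)

lemma measurable_mset_uniform_ordering:
 assumes "\<And>n. n = m ==> B \<in> sets (lpow n)"
 shows "(\<lambda>x. emeasure (uniform_ordering (mset (map x [0..<m]))) B) \<in> bmeas (lpow m)"
 unfolding emeasure_uniform_ordering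
 by (intro measurable_times borel_measurable_const borel_measurable_sum
   measurable_compose[OF measurable_perm_vec] borel_measurable_indicator assms) auto

theorem theorem1:
 fixes M :: "'w measure" and A :: "nat => 'w => complex mat"
  and \<epsilon> :: "nat => int" and k n :: nat
 assumes "1 \<le> k" and "1 \<le> n"
  and "independent_gaussian_matrices M n k A"
  and "\<And>j. j < k ==> \<epsilon> j \<in> {1, -1}"
 shows "determinantal M (\<lambda>w. eigenvalues (signed_product n k \<epsilon> (\<lambda>j. A j w))) \<and>
  (\<exists>\<omega>. product_weight n k \<epsilon> \<omega>) \<and>
  (\<forall>\<omega>. product_weight n k \<epsilon> \<omega> \<longrightarrow>
   (\<exists>c>0. points_have_density M n (\<lambda>w. eigenvalues (signed_product n k \<epsilon> (\<lambda>j. A j w)))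
    (\<lambda>z. c * (\<Prod>l<n. \<omega> (z l)) * (\<Prod>j<n. \<Prod>i<j. (cmod (z i - z j))^2))))"
proof -
 obtain l where k: "k = Suc l" using assms(1) by (cases k) auto
 note ind = assms(3) and n = assms(2)
 have \<epsilon>: "\<epsilon> j \<in> {1, - 1}" if "j < Suc l" for j using assms(4) that k by simp
 interpret prob_space M using ind by (simp add: independent_gaussian_matrices_def)
 define P where "P w = signed_product n k \<epsilon> (\<lambda>j. A j w)" for w
 define Z where "Z w = eigenvalues (P w)" for w
 let ?W = "eig_weight \<epsilon> n l" and ?\<phi> = "ortho_fun \<epsilon> n l" and ?rw = "real_weight \<epsilon> n l"
 have Pm: "P \<in> M \<rightarrow>\<^sub>M lmat n n" unfolding P_def[abs_def] by (rule measurable_signed_product[OF ind n])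
 have Pc: "P w \<in> cmat n n" if "w \<in> space M" for w by (rule measurable_carrier[OF Pm that])
 define v where "v w = eigenvalue_vector n (P w)" for w
 have vm: "v \<in> M \<rightarrow>\<^sub>M lpow n" unfolding v_def[abs_def] by (rule measurable_eigenvalue_vector[OF Pm])
 have Zv: "Z w = mset (map (v w) [0..<n])" if "w \<in> space M" for w
  unfolding Z_def v_def by (rule eigenvalue_vector[OF Pc[OF that]])
 interpret orthonormal n ?\<phi> by (rule orthonormal_ortho_fun[where \<epsilon> = \<epsilon> and k = l, OF \<epsilon> n])
 have AErw: "AE z in lborel. ennreal (?rw z) = ?W z" by (rule AE_real_weight[OF \<epsilon> n])
 have rw0: "0 \<le> ?rw z" for z by (rule real_weight_nonneg[OF \<epsilon> n])
 have rwm: "?rw \<in> bmeas borel" by (rule measurable_real_weight[where \<epsilon> = \<epsilon> and k = l, OF \<epsilon> n])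
 have \<phi>m: "?\<phi> i \<in> bmeas borel" for i
  by (rule measurable_ortho_fun[where \<epsilon> = \<epsilon> and k = l, OF \<epsilon> n])
 have Dm: "(\<lambda>z. ennreal (D r z)) \<in> bmeas (lpow r)" for r
  by (rule measurable_compose[OF measurable_D[OF \<phi>m] measurable_ennreal])
 define N where "N = norm_const \<epsilon> n l"
 have N: "0 < N" unfolding N_def by (rule norm_const_pos[where \<epsilon> = \<epsilon> and k = l, OF \<epsilon> n])
 have D_eq: "D n z = N * (\<Prod>i<n. ?rw (z i)) * (\<Prod>j<n. \<Prod>i<j. (cmod (z i - z j))^2)" for z
  unfolding N_def by (rule D_eq_ginibre[OF \<epsilon> n])
 \<comment> \<open>Only almost everywhere, since infinite values of \<open>?W\<close> were replaced
   by 0 in \<open>?rw\<close>.\<close>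
 have gd: "AE z in lpow n. ginibre_density ?W n z = ennreal (1 / N) * ennreal (D n z)"
 proof -
  have "AE z in lpow n. \<forall>i\<in>{..<n}. ennreal (?rw (z i)) = ?W (z i)"
   by (rule AE_finite_allI) (auto intro: AE_lebesgue_pow_component[OF AErw])
  then show ?thesis
  proof (rule AE_mp[OF _ AE_I2[OF impI]])
   fix z assume z: "\<forall>i\<in>{..<n}. ennreal (?rw (z i)) = ?W (z i)"
   have "ginibre_density ?W n z = (\<Prod>i<n. ennreal (?rw (z i))) * (\<Prod>j<n. \<Prod>i<j. ennreal ((cmod (z i - z j))^2))"
    unfolding ginibre_density_def using z by simp
   also have "... = ennreal ((\<Prod>i<n. ?rw (z i)) * (\<Prod>j<n. \<Prod>i<j. (cmod (z i - z j))^2))"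
    by (simp add: prod_ennreal prod_nonneg rw0 ennreal_mult)
   also have "(\<Prod>i<n. ?rw (z i)) * (\<Prod>j<n. \<Prod>i<j. (cmod (z i - z j))^2) = 1 / N * D n z"
    using D_eq[of z] N by (simp add: field_simps)
   also have "ennreal (1 / N * D n z) = ennreal (1 / N) * ennreal (D n z)"
    using N det_kernel_real by (intro ennreal_mult) auto
   finally show "ginibre_density ?W n z = ennreal (1 / N) * ennreal (D n z)" .
  qed
 qed
 obtain C0 where C0: "\<And>f. measurable_mset f ==> (\<integral>X:n,n. mat_weight \<epsilon> 0 n l X * f (eigenvalues X)) =
   C0 * (\<integral>z:\<C>^n. f (mset (map z [0..<n])) * ginibre_density ?W n z)"
  using nn_integral_eigenvalues[where \<epsilon> = \<epsilon> and m = 0 and n = n and k = l] by auto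
 define C where "C = ennreal ((1 / pi) ^ (n * n)) ^ k * C0 * ennreal (1 / N)"
 have Ef: "(\<integral>\<^sup>+w. f (Z w) \<partial>M) = C * (\<integral>z:\<C>^n. f (mset (map z [0..<n])) * ennreal (D n z))"
  if f: "measurable_mset f" for f
 proof -
  have fm: "(\<lambda>z. f (mset (map z [0..<n]))) \<in> bmeas (lpow n)"
   by (rule f[unfolded measurable_mset_def, rule_format])
  have "(\<integral>\<^sup>+w. f (Z w) \<partial>M) = ennreal ((1 / pi) ^ (n * n)) ^ k * (\<integral>X:n,n. mat_weight \<epsilon> 0 n l X * f (eigenvalues X))"
   unfolding Z_def P_def using \<epsilon>
   by (intro nn_integral_signed_product[OF ind n k] measurable_mset_eigenvalues[OF f, where n = n] measurable_idt) (auto simp: k)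
  also have "(\<integral>X:n,n. mat_weight \<epsilon> 0 n l X * f (eigenvalues X)) =
    C0 * (\<integral>z:\<C>^n. ennreal (1 / N) * (f (mset (map z [0..<n])) * ennreal (D n z)))"
   unfolding C0[OF f]
   by (intro arg_cong[where f = "\<lambda>x. C0 * x"] nn_integral_cong_AE, rule AE_mp[OF gd AE_I2[OF impI]]) (simp only: ac_simps)
  also have "(\<integral>z:\<C>^n. ennreal (1 / N) * (f (mset (map z [0..<n])) * ennreal (D n z))) =
    ennreal (1 / N) * (\<integral>z:\<C>^n. f (mset (map z [0..<n])) * ennreal (D n z))"
   by (intro nn_integral_cmult measurable_times fm Dm)
  finally show ?thesis by (simp only: C_def mult.assoc)
 qed
 have Dint: "(\<integral>z:\<C>^n. indicator B (restrict z {..<r}) * ennreal (D n z)) =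
   fact (n - r) * (\<integral>\<^sup>+x\<in>B. ennreal (D r x) \<partial>lpow r)" if "r \<le> n" "B \<in> sets (lpow r)" for r B
  by (rule nn_integral_D_marginal[OF \<phi>m that])
 \<comment> \<open>The total mass determines the constant: for f = 1 the left side is one, and the
   marginal formula with r = 0 gives n! for the integral of \<open>D n\<close>.\<close>
 have C: "C * fact n = 1"
 proof -
  have "1 = (\<integral>\<^sup>+w. 1 \<partial>M)" by (simp add: emeasure_space_1)
  also have "... = C * (\<integral>z:\<C>^n. 1 * ennreal (D n z))"
   by (rule Ef[of "\<lambda>_. 1"]) (simp add: measurable_mset_def)
  also have "(\<integral>z:\<C>^n. 1 * ennreal (D n z)) = (\<integral>z:\<C>^n. indicator (space (lpow 0)) (restrict z {..<0}) * ennreal (D n z))"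
   by (rule nn_integral_cong) (simp add: space_PiM restrict_def)
  also have "... = fact (n - 0) * (\<integral>\<^sup>+x\<in>space (lpow 0). ennreal (D 0 x) \<partial>lpow 0)"
   by (rule Dint) auto
  also have "(\<integral>\<^sup>+x\<in>space (lpow 0). ennreal (D 0 x) \<partial>lpow 0) = 1"
   by (simp add: PiM_empty nn_integral_count_space_finite D_def kernel_mat_def)
  finally show ?thesis by simp
 qed
 have perm: "(\<integral>z:\<C>^n. h (perm_vec n \<sigma> z) * ennreal (D n z)) = (\<integral>z:\<C>^n. h z * ennreal (D n z))"
  if "\<sigma> permutes {..<n}" "h \<in> bmeas (lpow n)" for h \<sigma>
  using nn_integral_perm_vec[OF that(1), of "\<lambda>z. h z * ennreal (D n z)"] that(2) Dm
  by (simp add: D_perm_vec[OF that(1)])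
 have "determinantal M Z"
  unfolding determinantal_def
 proof (intro conjI exI allI impI ballI)
  show "finite_point_process M Z"
   unfolding finite_point_process_def
  proof (intro conjI ballI)
   fix E :: "complex set" assume E: "E \<in> sets borel"
   show "(\<lambda>w. real (size (filter_mset (\<lambda>z. z \<in> E) (Z w)))) \<in> bmeas M"
   proof (rule measurable_eqI)
    show "real (size (filter_mset (\<lambda>z. z \<in> E) (Z w))) = (\<Sum>i<n. indicator E (v w i))" if "w \<in> space M" for w
    unfolding Zv[OF that] size_filter_mset_map of_nat_sum by (intro sum.cong refl) (simp add: indicator_def)
    show "(\<lambda>w. \<Sum>i<n. indicator E (v w i) :: real) \<in> bmeas M"
    using E by (intro borel_measurable_sum measurable_compose[OF vm] measurable_compose[OF measurable_lebesgue_pow_component] borel_measurable_indicator) auto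
   qed
  qed unfold_locales
  show "case_prod K \<in> bmeas (borel \<Otimes>\<^sub>M borel)" by (rule measurable_kernel[OF \<phi>m])
  fix r :: nat
  show "correlation_function M Z r (D r)"
   unfolding correlation_function_def
  proof (intro conjI ballI)
   show "D r \<in> bmeas (lpow r)" by (rule measurable_D[OF \<phi>m])
   show "0 \<le> D r x" for x using det_kernel_real by blast
   fix B assume B: "B \<in> sets (lpow r)"
   have im: "(\<lambda>z. indicator B (\<lambda>i\<in>{..<r}. z (t i)) :: ennreal) \<in> bmeas (lpow n)" if "t \<in> inj_tuples r n" for t
    by (rule measurable_compose[OF measurable_select[OF that] borel_measurable_indicator[OF B]])
   have "(\<integral>\<^sup>+w. of_nat (tuple_count r (Z w) B) \<partial>M) =
    C * (\<integral>z:\<C>^n. of_nat (tuple_count r (mset (map z [0..<n])) B) * ennreal (D n z))"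
    by (rule Ef[OF measurable_mset_tuple_count[OF B]])
   also have "(\<integral>z:\<C>^n. of_nat (tuple_count r (mset (map z [0..<n])) B) * ennreal (D n z))
    = (\<Sum>t\<in>inj_tuples r n. \<integral>z:\<C>^n. indicator B (\<lambda>i\<in>{..<r}. z (t i)) * ennreal (D n z))"
    unfolding of_nat_tuple_count sum_distrib_right by (intro nn_integral_sum measurable_times im Dm)
   finally have eq: "(\<integral>\<^sup>+w. of_nat (tuple_count r (Z w) B) \<partial>M) =
    C * (\<Sum>t\<in>inj_tuples r n. \<integral>z:\<C>^n. indicator B (\<lambda>i\<in>{..<r}. z (t i)) * ennreal (D n z))" .
   show "(\<integral>\<^sup>+w. of_nat (tuple_count r (Z w) B) \<partial>M) = (\<integral>\<^sup>+x\<in>B. ennreal (D r x) \<partial>lpow r)"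
   proof (cases "r \<le> n")
    case True
    \<comment> \<open>A permutation extending t moves the selected coordinates to the first r
      places, and by symmetry of \<open>D n\<close> every tuple contributes the same marginal
      integral.\<close>
    have "(\<integral>z:\<C>^n. indicator B (\<lambda>i\<in>{..<r}. z (t i)) * ennreal (D n z)) = fact (n - r) * (\<integral>\<^sup>+x\<in>B. ennreal (D r x) \<partial>lpow r)"
    if t: "t \<in> inj_tuples r n" for t
    proof -
    obtain \<sigma> where \<sigma>: "\<sigma> permutes {..<n}" "\<forall>i<r. \<sigma> i = t i" using inj_tuple_extend[OF t] by metis
    have "restrict (perm_vec n \<sigma> z) {..<r} = (\<lambda>i\<in>{..<r}. z (t i))" for z
    using True \<sigma>(2) by (auto simp: perm_vec_def fun_eq_iff)
    note restr = this
    have m: "(\<lambda>z. indicator B (restrict z {..<r}) :: ennreal) \<in> bmeas (lpow n)"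
    using True by (intro measurable_compose[OF measurable_restrict_subset borel_measurable_indicator[OF B]]) auto
    show ?thesis using perm[OF \<sigma>(1) m] unfolding restr Dint[OF True B] .
    qed
    then have "(\<integral>\<^sup>+w. of_nat (tuple_count r (Z w) B) \<partial>M) =
    (C * of_nat (card (inj_tuples r n) * fact (n - r))) * (\<integral>\<^sup>+x\<in>B. ennreal (D r x) \<partial>lpow r)"
    unfolding eq by (simp add: mult.assoc)
    then show ?thesis unfolding card_inj_tuples[OF True] by (simp add: C)
   next
    case False
    \<comment> \<open>For r > n both sides vanish: there are no injective tuples, and a kernel of
      rank at most n has determinant zero.\<close>
    then have "D r x = 0" for x using det_kernel_zero[of r x] by (simp add: D_def)
    then show ?thesis unfolding eq using False by (simp add: inj_tuples_empty)
   qed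
  qed
  show "complex_of_real (D r x) = det (Matrix.mat r r (\<lambda>(i, j). K (x i) (x j)))" if "x \<in> space (lpow r)" for x
   using det_kernel_real[of r x] by (simp add: kernel_mat_def)
 qed
 \<comment> \<open>The push-forward fixes a weight up to a null set only, so every admissible
   \<omega> is compared with \<open>?W\<close> through the densities.\<close>
 moreover have "product_weight n k \<epsilon> \<omega> \<longleftrightarrow> \<omega> \<in> bmeas borel \<and> (\<forall>z. 0 \<le> \<omega> z) \<and> density lborel ?W = density lborel (\<lambda>z. ennreal (\<omega> z))" for \<omega>
  using distr_product_weight[where \<epsilon> = \<epsilon> and k = l, OF \<epsilon> n]
  unfolding product_weight_def pushforward_weight_def k by (simp only:)
 note pw = this
 have "product_weight n k \<epsilon> ?rw"
  unfolding pw
 proof (intro conjI allI)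
  show "density lborel ?W = density lborel (\<lambda>z. ennreal (?rw z))"
  proof (rule density_cong)
   show "?W \<in> bmeas lborel" using measurable_eig_weight[of \<epsilon> n l] by simp
   show "(\<lambda>z. ennreal (?rw z)) \<in> bmeas lborel" using rwm by simp
   show "AE z in lborel. ?W z = ennreal (?rw z)"
    using AErw by eventually_elim simp
  qed
 qed (auto simp: rwm rw0)
 moreover have "\<exists>c>0. points_have_density M n Z (\<lambda>z. c * (\<Prod>l<n. \<omega> (z l)) * (\<Prod>j<n. \<Prod>i<j. (cmod (z i - z j))^2))"
  if \<omega>: "product_weight n k \<epsilon> \<omega>" for \<omega>
 proof (intro exI conjI)
  have \<omega>m: "\<omega> \<in> bmeas borel" and \<omega>0: "0 \<le> \<omega> z" and \<omega>d: "density lborel ?W = density lborel (\<lambda>z. ennreal (\<omega> z))" for z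
   using \<omega> unfolding pw by auto
  \<comment> \<open>N is the product of the inverse moments, which makes \<open>D n\<close> the
    determinant of the kernel, and n! is the total mass of \<open>D n\<close>.\<close>
  let ?c = "N / fact n"
  let ?p = "\<lambda>z. ?c * (\<Prod>l<n. \<omega> (z l)) * (\<Prod>j<n. \<Prod>i<j. (cmod (z i - z j))^2)"
  show "0 < ?c" using N by simp
  \<comment> \<open>Uniqueness of densities with respect to a sigma-finite measure.\<close>
  have "AE z in lborel. ?W z = ennreal (\<omega> z)"
   using sigma_finite_measure.density_unique[OF lborel.sigma_finite_measure_axioms _ _ \<omega>d] \<omega>m by simp
  then have "AE z in lborel. \<omega> z = ?rw z"
   using AErw by eventually_elim (metis \<omega>0 ennreal_inj rw0)
  then have "AE z in lpow n. \<omega> (z i) = ?rw (z i)" if "i < n" for i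
   using that by (rule AE_lebesgue_pow_component)
  then have "AE z in lpow n. \<forall>i\<in>{..<n}. \<omega> (z i) = ?rw (z i)" by (intro AE_finite_allI) auto
  then have pD: "AE z in lpow n. ennreal (?p z) = C * ennreal (D n z)"
  proof (rule AE_mp[OF _ AE_I2[OF impI]])
   fix z assume "\<forall>i\<in>{..<n}. \<omega> (z i) = ?rw (z i)"
   then have "?p z = 1 / fact n * D n z" using D_eq[of z] by (simp add: field_simps)
   moreover have "ennreal (1 / fact n * D n z) = ennreal (1 / fact n) * ennreal (D n z)"
    using det_kernel_real by (intro ennreal_mult) auto
   moreover have "ennreal (1 / fact n) = C"
   proof -
    have "ennreal (1 / fact n) * fact n = 1"
    proof -
    have "(fact n :: ennreal) = ennreal (fact n)" by (metis ennreal_of_nat_eq_real_of_nat of_nat_fact)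
    then show ?thesis by (simp add: ennreal_mult[symmetric])
    qed
    then show ?thesis by (metis C mult.assoc mult.commute mult_1)
   qed
   ultimately show "ennreal (?p z) = C * ennreal (D n z)" by simp
  qed
  show "points_have_density M n Z ?p"
   unfolding points_have_density_def
  proof (intro conjI allI ballI)
   show "AE w in M. size (Z w) = n" by (rule AE_I2) (simp add: Zv del: mset_map)
   show "?p \<in> bmeas (lpow n)"
    by (intro borel_measurable_times borel_measurable_const borel_measurable_prod measurable_compose[OF _ \<omega>m] borel_measurable_power
    measurable_cmod borel_measurable_diff measurable_lebesgue_pow_component) auto
   show "0 \<le> ?p z" for z using N \<omega>0 by (intro mult_nonneg_nonneg prod_nonneg) auto
   fix B assume B: "B \<in> sets (lpow n)"
   \<comment> \<open>B is known to be measurable as a set of vectors of length n only, so the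
     functional is set to 0 at other sizes; the spectrum always has size n.\<close>
   define f where "f S = (if size S = n then emeasure (uniform_ordering S) B else 0)" for S
   have f: "measurable_mset f"
    unfolding measurable_mset_def
   proof
    fix m show "(\<lambda>x. f (mset (map x [0..<m]))) \<in> bmeas (lpow m)"
    using measurable_mset_uniform_ordering[of m B] B by (cases "m = n") (simp_all add: f_def del: mset_map)
   qed
   have fZ: "emeasure (uniform_ordering (Z w)) B = f (Z w)" if "w \<in> space M" for w
    by (simp add: f_def Zv[OF that] del: mset_map)
   show "(\<lambda>w. emeasure (uniform_ordering (Z w)) B) \<in> bmeas M"
    by (rule measurable_eqI[OF fZ]) (simp_all add: Z_def measurable_mset_eigenvalues[OF f Pm])
   let ?P = "{\<sigma>. \<sigma> permutes {..<n}}"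
   have im: "(\<lambda>z. indicator B (perm_vec n \<sigma> z) :: ennreal) \<in> bmeas (lpow n)" if "\<sigma> \<in> ?P" for \<sigma>
    using that by (intro measurable_compose[OF measurable_perm_vec borel_measurable_indicator[OF B]]) simp
   have "(\<integral>\<^sup>+w. emeasure (uniform_ordering (Z w)) B \<partial>M) = (\<integral>\<^sup>+w. f (Z w) \<partial>M)" by (rule nn_integral_cong[OF fZ])
   also have "... = C * (\<integral>z:\<C>^n. f (mset (map z [0..<n])) * ennreal (D n z))" by (rule Ef[OF f])
   also have "(\<integral>z:\<C>^n. f (mset (map z [0..<n])) * ennreal (D n z)) =
    (\<integral>z:\<C>^n. ennreal (1 / fact n) * (\<Sum>\<sigma>\<in>?P. indicator B (perm_vec n \<sigma> z) * ennreal (D n z)))"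
    by (rule nn_integral_cong) (simp add: f_def emeasure_uniform_ordering sum_distrib_right mult.assoc del: mset_map)
   also have "... = ennreal (1 / fact n) * (\<integral>z:\<C>^n. (\<Sum>\<sigma>\<in>?P. indicator B (perm_vec n \<sigma> z) * ennreal (D n z)))"
    by (intro nn_integral_cmult borel_measurable_sum measurable_times im Dm)
   also have "(\<integral>z:\<C>^n. (\<Sum>\<sigma>\<in>?P. indicator B (perm_vec n \<sigma> z) * ennreal (D n z)))
    = (\<Sum>\<sigma>\<in>?P. \<integral>z:\<C>^n. indicator B (perm_vec n \<sigma> z) * ennreal (D n z))"
    by (intro nn_integral_sum measurable_times im Dm)
   also have "... = (\<Sum>\<sigma>\<in>?P. \<integral>z:\<C>^n. indicator B z * ennreal (D n z))"
    using B by (intro sum.cong refl perm) auto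
   also have "... = of_nat (fact n) * (\<integral>z:\<C>^n. indicator B z * ennreal (D n z))"
    by (simp add: card_permutations[OF refl])
   also have "ennreal (1 / fact n) * ... = (\<integral>z:\<C>^n. indicator B z * ennreal (D n z))"
   proof -
    have "ennreal (1 / fact n) * of_nat (fact n) = 1"
    unfolding ennreal_of_nat_eq_real_of_nat by (subst ennreal_mult[symmetric]) simp_all
    then show ?thesis by (simp only: mult.assoc[symmetric] mult_1)
   qed
   also have "C * (\<integral>z:\<C>^n. indicator B z * ennreal (D n z)) = (\<integral>z:\<C>^n. C * (indicator B z * ennreal (D n z)))"
    using B by (intro nn_integral_cmult[symmetric] measurable_times Dm) simp
   also have "... = (\<integral>\<^sup>+z\<in>B. ennreal (?p z) \<partial>lpow n)"
    by (rule nn_integral_cong_AE, rule AE_mp[OF pD AE_I2[OF impI]]) (simp only: ac_simps)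
   finally show "(\<integral>\<^sup>+w. emeasure (uniform_ordering (Z w)) B \<partial>M) = (\<integral>\<^sup>+z\<in>B. ennreal (?p z) \<partial>lpow n)" .
  qed
 qed
 ultimately show ?thesis unfolding Z_def P_def by blast
qed

end
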